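(* Let $\{\mathcal{C}_a\}_{a>0}$ be the family of spherical minimal catenoids in the Poincar\'e ball model $\mathbb{B}^3$ of hyperbolic $3$-space described in the context. There exists a constant $a_c\approx 0.49577$ such that the following statements are true: (1) $\mathcal{C}_a$ is an unstable minimal surface with Morse index one if $0<a<a_c$; (2) $\mathcal{C}_a$ is a globally stable minimal surface if $a\geq a_c$.
   Context: **Ambient space.** $\mathbb{B}^3=\{(u,v,w)\in\mathbb{R}^3: u^2+v^2+w^2<1\}$ with the hyperbolic metric $ds^2=4(du^2+dv^2+dw^2)/(1-r^2)^2$, $r^2=u^2+v^2+w^2$. **Spherical catenoids.** For $a>0$ and $s\in\mathbb{R}$ put $$x(a,s)=\sqrt{2}\,\sinh(2a)\int_0^s\frac{\sqrt{\cosh(2a)\cosh(2t)-1}}{\cosh^2(2a)\cosh^2(2t)-1}\,dt,\qquad y(a,s)=a+\int_0^s\frac{\cosh(2a)\sinh(2t)}{\sqrt{\cosh^2(2a)\cosh^2(2t)-1}}\,dt,$$ $$u(a,s)=\frac{\sinh x\cosh y}{1+\cosh x\cosh y},\qquad v(a,s)=\frac{\sinh y}{1+\cosh x\cosh y}\qquad (x=x(a,s),\ y=y(a,s)).$$ The curve $s\mapsto (u(a,s),v(a,s))$ in the half disk $\mathbb{B}^2_+=\{(u,v): u^2+v^2<1, v\ge 0\}$ is the catenary $\sigma_a$ (parametrized by hyperbolic arc length; $a$ is its hyperbolic distance to the origin). The catenoid $\mathcal{C}_a\subset\mathbb{B}^3$ is the surface of revolution obtained by rotating $\sigma_a$ about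 the $u$-axis: $$\mathcal{C}_a=\{(u(a,s),\,v(a,s)\cos\theta,\,v(a,s)\sin\theta): s\in\mathbb{R},\ \theta\in[0,2\pi]\}.$$ It is a complete minimal surface in $\mathbb{B}^3$. **Stability.** For a minimal surface $\Sigma$ in a Riemannian $3$-manifold $M^3$ with unit normal $e_3$ and second fundamental form $A$, the Jacobi operator is $\mathcal{L}=\Delta_\Sigma+(|A|^2+\mathrm{Ric}(e_3))$. For a compact connected subdomain $\Omega\subset\Sigma$, $\lambda_1(\Omega)=\inf\{-\int_\Omega f\mathcal{L}f : f\in C_0^\infty(\Omega),\ \int_\Omega f^2=1\}$. For complete $\Sigma$, $\lambda_1(\Sigma)=\lim_{n\to\infty}\lambda_1(\Omega_n)$ for any exhaustion $\Omega_1\subset\Omega_2\subset\cdots$ of $\Sigma$ by such subdomains (independent of the exhaustion). $\Sigma$ is globally stable if $\lambda_1(\Sigma)>0$, and unstable if $\lambda_1(\Sigma)<0$. **Morse index.** The Morse index of a compact connected subdomain $\Omega$ is the number of negative eigenvalues, with multiplicity, of the Jacobi operator $\mathcal{L}$ (that is, of the associated quadratic form $-\int_\Omega f\mathcal{L}f$) on smooth normal sections vanishing on $\partial\Omega$. The Morse index of $\Sigma$ is the supremum of the Morse indices of its compact subdomains.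
   Formalization: At a = a_c the first eigenvalue of the whole catenoid is exactly 0, so "globally stable" (λ1 > 0) fails there; it is proved for a > a_c, while for a ≥ a_c it is proved that λ1 ≥ 0 and every compact subdomain has λ1 > 0. *)

theory Defs
  imports "HOL-Analysis.Analysis"
begin

section \<open>Smooth functions on Euclidean space\<close>

definition pd :: "'n::finite \<Rightarrow> (real^'n \<Rightarrow> 'b::real_normed_vector) \<Rightarrow> real^'n \<Rightarrow> 'b" where
  "pd i f p = vector_derivative (\<lambda>t. f (p + t *\<^sub>R axis i 1)) (at 0)"

primrec Ck :: "nat \<Rightarrow> (real^'n::finite \<Rightarrow> 'b::real_normed_vector) \<Rightarrow> bool" where
  "Ck 0 f \<longleftrightarrow> continuous_on UNIV f"
| "Ck (Suc k) f \<longleftrightarrow> f differentiable_on UNIV \<and> (\<forall>i. Ck k (pd i f))"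

definition smooth :: "(real^'n::finite \<Rightarrow> 'b::real_normed_vector) \<Rightarrow> bool" where
  "smooth f \<longleftrightarrow> (\<forall>k. Ck k f)"


section \<open>Riemannian metrics in coordinates\<close>

text \<open>A metric is given by its coefficient matrix \<open>G p\<close> at each point \<open>p\<close>.\<close>

definition riem_inner :: "(real^'n \<Rightarrow> real^'n^'n) \<Rightarrow> real^'n::finite \<Rightarrow> real^'n \<Rightarrow> real^'n \<Rightarrow> real" where
  "riem_inner G p v w = v \<bullet> (G p *v w)"

text \<open>\<open>christoffel G p i j k\<close> is the symbol with upper index \<open>i\<close> and lower indices \<open>j\<close>, \<open>k\<close>.\<close>

definition christoffel ::
    "(real^'n \<Rightarrow> real^'n^'n) \<Rightarrow> real^'n::finite \<Rightarrow> 'n \<Rightarrow> 'n \<Rightarrow> 'n \<Rightarrow> real" where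
  "christoffel G p i j k = (\<Sum>l\<in>UNIV. matrix_inv (G p) $ i $ l *
     (pd j (\<lambda>q. G q $ k $ l) p + pd k (\<lambda>q. G q $ j $ l) p - pd l (\<lambda>q. G q $ j $ k) p)) / 2"

text \<open>The sign convention makes the Ricci curvature of round spheres positive.\<close>

definition ricci :: "(real^'n \<Rightarrow> real^'n^'n) \<Rightarrow> real^'n::finite \<Rightarrow> real^'n^'n" where
  "ricci G p = (\<chi> j k. \<Sum>i\<in>UNIV.
      pd i (\<lambda>q. christoffel G q i j k) p - pd j (\<lambda>q. christoffel G q i i k) p
      + (\<Sum>m\<in>UNIV. christoffel G p i i m * christoffel G p m j k
                 - christoffel G p i j m * christoffel G p m i k))"

definition hyp_metric :: "real^3 \<Rightarrow> real^3^3" where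
  "hyp_metric p = (4 / (1 - (norm p)\<^sup>2)\<^sup>2) *\<^sub>R mat 1"


section \<open>Parametrized surfaces in a Riemannian three-manifold\<close>

text \<open>
  A surface is the image \<open>X ` D\<close> of a smooth immersion \<open>X\<close> of the whole plane.  In
  the intended use \<open>X\<close> is a covering of the embedded surface \<open>X ` D = range X\<close>, and \<open>D\<close> is
  a fundamental domain: \<open>X\<close> is injective on \<open>D\<close> up to a null set.  Then a function
  \<open>f\<close> on the surface is smooth iff \<open>f \<circ> X\<close> is, local operators act on \<open>f \<circ> X\<close>,
  and integrals over the surface are integrals over \<open>D\<close>.
\<close>

definition first_form :: "(real^3 \<Rightarrow> real^3^3) \<Rightarrow> (real^2 \<Rightarrow> real^3) \<Rightarrow> real^2 \<Rightarrow> real^2^2" where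
  "first_form G X q = (\<chi> i j. riem_inner G (X q) (pd i X q) (pd j X q))"

text \<open>The choice of the sign of the normal is arbitrary at each point; everything below in
  which it occurs is quadratic in the normal or asserts a vanishing.\<close>

definition unit_normal :: "(real^3 \<Rightarrow> real^3^3) \<Rightarrow> (real^2 \<Rightarrow> real^3) \<Rightarrow> real^2 \<Rightarrow> real^3" where
  "unit_normal G X q = (SOME n. riem_inner G (X q) n n = 1 \<and>
                               (\<forall>i. riem_inner G (X q) n (pd i X q) = 0))"

definition second_form :: "(real^3 \<Rightarrow> real^3^3) \<Rightarrow> (real^2 \<Rightarrow> real^3) \<Rightarrow> real^2 \<Rightarrow> real^2^2" where
  "second_form G X q = (\<chi> i j. riem_inner G (X q)
     (pd i (pd j X) q + (\<chi> k. \<Sum>l\<in>UNIV. \<Sum>m\<in>UNIV.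
         christoffel G (X q) k l m * pd i X q $ l * pd j X q $ m))
     (unit_normal G X q))"

definition mean_curvature :: "(real^3 \<Rightarrow> real^3^3) \<Rightarrow> (real^2 \<Rightarrow> real^3) \<Rightarrow> real^2 \<Rightarrow> real" where
  "mean_curvature G X q =
     (\<Sum>i\<in>UNIV. \<Sum>j\<in>UNIV. matrix_inv (first_form G X q) $ i $ j * second_form G X q $ i $ j)"

definition norm_second_form_sq :: "(real^3 \<Rightarrow> real^3^3) \<Rightarrow> (real^2 \<Rightarrow> real^3) \<Rightarrow> real^2 \<Rightarrow> real" where
  "norm_second_form_sq G X q = (let h = matrix_inv (first_form G X q); A = second_form G X q in
     (\<Sum>i\<in>UNIV. \<Sum>j\<in>UNIV. \<Sum>k\<in>UNIV. \<Sum>l\<in>UNIV. h $ i $ k * h $ j $ l * A $ i $ j * A $ k $ l))"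

definition minimal_surface :: "(real^3) set \<Rightarrow> (real^3 \<Rightarrow> real^3^3) \<Rightarrow> (real^2 \<Rightarrow> real^3) \<Rightarrow> bool" where
  "minimal_surface M G X \<longleftrightarrow> smooth X \<and> range X \<subseteq> M \<and>
     (\<forall>q. inj (\<lambda>w::real^2. \<Sum>i\<in>UNIV. w $ i *\<^sub>R pd i X q)) \<and>
     (\<forall>q. mean_curvature G X q = 0)"

definition area_density :: "(real^3 \<Rightarrow> real^3^3) \<Rightarrow> (real^2 \<Rightarrow> real^3) \<Rightarrow> real^2 \<Rightarrow> real" where
  "area_density G X q = sqrt (det (first_form G X q))"

definition laplace_beltrami ::
    "(real^3 \<Rightarrow> real^3^3) \<Rightarrow> (real^2 \<Rightarrow> real^3) \<Rightarrow> (real^2 \<Rightarrow> real) \<Rightarrow> real^2 \<Rightarrow> real" where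
  "laplace_beltrami G X \<phi> q = (\<Sum>i\<in>UNIV. pd i (\<lambda>r. area_density G X r *
      (\<Sum>j\<in>UNIV. matrix_inv (first_form G X r) $ i $ j * pd j \<phi> r)) q) / area_density G X q"

definition jacobi_op ::
    "(real^3 \<Rightarrow> real^3^3) \<Rightarrow> (real^2 \<Rightarrow> real^3) \<Rightarrow> (real^2 \<Rightarrow> real) \<Rightarrow> real^2 \<Rightarrow> real" where
  "jacobi_op G X \<phi> q = laplace_beltrami G X \<phi> q +
     (norm_second_form_sq G X q +
      unit_normal G X q \<bullet> (ricci G (X q) *v unit_normal G X q)) * \<phi> q"

definition surface_integral ::
    "(real^3 \<Rightarrow> real^3^3) \<Rightarrow> (real^2 \<Rightarrow> real^3) \<Rightarrow> (real^2) set \<Rightarrow> (real^3) set \<Rightarrow> (real^2 \<Rightarrow> real) \<Rightarrow> real"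
  where
  "surface_integral G X D \<Omega> \<phi> = (LINT q:{q \<in> D. X q \<in> \<Omega>}|lborel. \<phi> q * area_density G X q)"


section \<open>Subdomains, stability and Morse index\<close>

definition compact_subdomain :: "(real^3) set \<Rightarrow> (real^3) set \<Rightarrow> bool" where
  "compact_subdomain \<Sigma> \<Omega> \<longleftrightarrow> \<Omega> \<subseteq> \<Sigma> \<and> compact \<Omega> \<and> connected \<Omega> \<and> \<Omega> \<noteq> {} \<and>
     \<Omega> \<subseteq> closure (top_of_set \<Sigma> interior_of \<Omega>)"

definition test_functions :: "(real^2 \<Rightarrow> real^3) \<Rightarrow> (real^2) set \<Rightarrow> (real^3) set \<Rightarrow> (real^3 \<Rightarrow> real) set" where
  "test_functions X D \<Omega> = {f. smooth (f \<circ> X) \<and>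
     closure {p \<in> X ` D. f p \<noteq> 0} \<subseteq> top_of_set (X ` D) interior_of \<Omega>}"

definition lambda1 ::
    "(real^3 \<Rightarrow> real^3^3) \<Rightarrow> (real^2 \<Rightarrow> real^3) \<Rightarrow> (real^2) set \<Rightarrow> (real^3) set \<Rightarrow> ereal" where
  "lambda1 G X D \<Omega> =
     (INF f \<in> {f \<in> test_functions X D \<Omega>. surface_integral G X D \<Omega> (\<lambda>q. (f (X q))\<^sup>2) = 1}.
        ereal (- surface_integral G X D \<Omega> (\<lambda>q. f (X q) * jacobi_op G X (f \<circ> X) q)))"

text \<open>As usual for exhaustions, each member lies in the interior of the next one, so that every
  compact subset of the surface is eventually covered.\<close>

definition exhaustion :: "(real^3) set \<Rightarrow> (nat \<Rightarrow> (real^3) set) \<Rightarrow> bool" where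
  "exhaustion \<Sigma> \<Omega> \<longleftrightarrow> (\<forall>n. compact_subdomain \<Sigma> (\<Omega> n) \<and>
     \<Omega> n \<subseteq> top_of_set \<Sigma> interior_of \<Omega> (Suc n)) \<and> (\<Union>n. \<Omega> n) = \<Sigma>"

definition has_lambda1 ::
    "(real^3 \<Rightarrow> real^3^3) \<Rightarrow> (real^2 \<Rightarrow> real^3) \<Rightarrow> (real^2) set \<Rightarrow> ereal \<Rightarrow> bool" where
  "has_lambda1 G X D l \<longleftrightarrow> (\<exists>\<Omega>. exhaustion (X ` D) \<Omega>) \<and>
     (\<forall>\<Omega>. exhaustion (X ` D) \<Omega> \<longrightarrow> (\<lambda>n. lambda1 G X D (\<Omega> n)) \<longlonglongrightarrow> l)"

definition globally_stable ::
    "(real^3 \<Rightarrow> real^3^3) \<Rightarrow> (real^2 \<Rightarrow> real^3) \<Rightarrow> (real^2) set \<Rightarrow> bool" where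
  "globally_stable G X D \<longleftrightarrow> (\<exists>l>0. has_lambda1 G X D l)"

definition unstable ::
    "(real^3 \<Rightarrow> real^3^3) \<Rightarrow> (real^2 \<Rightarrow> real^3) \<Rightarrow> (real^2) set \<Rightarrow> bool" where
  "unstable G X D \<longleftrightarrow> (\<exists>l<0. has_lambda1 G X D l)"

text \<open>Stability of every compact subdomain.  This is what remains of global stability,
  \<open>\<lambda>\<^sub>1 > 0\<close>, when the bottom of the spectrum of the whole surface is zero and is attained by a square
  integrable positive Jacobi field, as happens for the critical catenoid.\<close>

definition stable_on_compacts ::
    "(real^3 \<Rightarrow> real^3^3) \<Rightarrow> (real^2 \<Rightarrow> real^3) \<Rightarrow> (real^2) set \<Rightarrow> bool" where
  "stable_on_compacts G X D \<longleftrightarrow> (\<exists>l\<ge>0. has_lambda1 G X D l) \<and>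
     (\<forall>\<Omega>. compact_subdomain (X ` D) \<Omega> \<longrightarrow> 0 < lambda1 G X D \<Omega>)"

text \<open>Functions on \<open>\<Omega>\<close>, smooth up to the boundary and vanishing there, are represented by
  their extension by zero, so that equality on \<open>\<Omega>\<close> is equality of functions.\<close>

definition dirichlet_functions ::
    "(real^2 \<Rightarrow> real^3) \<Rightarrow> (real^2) set \<Rightarrow> (real^3) set \<Rightarrow> (real^3 \<Rightarrow> real) set" where
  "dirichlet_functions X D \<Omega> = {f. (\<forall>p. p \<notin> \<Omega> \<longrightarrow> f p = 0) \<and>
     (\<forall>p \<in> top_of_set (X ` D) frontier_of \<Omega>. f p = 0) \<and>
     (\<exists>g. smooth (g \<circ> X) \<and> (\<forall>p\<in>\<Omega>. f p = g p))}"

text \<open>The sign is that of the quadratic form \<open>-\<integral> f L f\<close>: \<open>l\<close> is an eigenvalue if \<open>L f = -l f\<close>.\<close>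

definition eigenspace ::
    "(real^3 \<Rightarrow> real^3^3) \<Rightarrow> (real^2 \<Rightarrow> real^3) \<Rightarrow> (real^2) set \<Rightarrow> (real^3) set \<Rightarrow> real \<Rightarrow> (real^3 \<Rightarrow> real) set"
  where
  "eigenspace G X D \<Omega> l = {f \<in> dirichlet_functions X D \<Omega>.
     \<forall>q. X q \<in> top_of_set (X ` D) interior_of \<Omega> \<longrightarrow> jacobi_op G X (f \<circ> X) q = - l * f (X q)}"

text \<open>The dimension of the eigenspace; it is \<open>0\<close> iff \<open>l\<close> is not an eigenvalue.\<close>

definition multiplicity ::
    "(real^3 \<Rightarrow> real^3^3) \<Rightarrow> (real^2 \<Rightarrow> real^3) \<Rightarrow> (real^2) set \<Rightarrow> (real^3) set \<Rightarrow> real \<Rightarrow> enat" where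
  "multiplicity G X D \<Omega> l = (SUP k \<in> {k. \<exists>f :: nat \<Rightarrow> real^3 \<Rightarrow> real.
     (\<forall>i<k. f i \<in> eigenspace G X D \<Omega> l) \<and>
     (\<forall>c. (\<forall>p. (\<Sum>i<k. c i * f i p) = 0) \<longrightarrow> (\<forall>i<k. c i = 0))}. enat k)"

definition subdomain_index ::
    "(real^3 \<Rightarrow> real^3^3) \<Rightarrow> (real^2 \<Rightarrow> real^3) \<Rightarrow> (real^2) set \<Rightarrow> (real^3) set \<Rightarrow> enat" where
  "subdomain_index G X D \<Omega> =
     (SUP S \<in> {S. finite S \<and> S \<subseteq> {..<0}}. \<Sum>l\<in>S. multiplicity G X D \<Omega> l)"

definition morse_index ::
    "(real^3 \<Rightarrow> real^3^3) \<Rightarrow> (real^2 \<Rightarrow> real^3) \<Rightarrow> (real^2) set \<Rightarrow> enat" where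
  "morse_index G X D = (SUP \<Omega> \<in> {\<Omega>. compact_subdomain (X ` D) \<Omega>}. subdomain_index G X D \<Omega>)"


section \<open>Spherical catenoids\<close>

definition cat_x :: "real \<Rightarrow> real \<Rightarrow> real" where
  "cat_x a s = sqrt 2 * sinh (2 * a) * (LBINT t=0..s.
     sqrt (cosh (2 * a) * cosh (2 * t) - 1) / ((cosh (2 * a))\<^sup>2 * (cosh (2 * t))\<^sup>2 - 1))"

definition cat_y :: "real \<Rightarrow> real \<Rightarrow> real" where
  "cat_y a s = a + (LBINT t=0..s.
     cosh (2 * a) * sinh (2 * t) / sqrt ((cosh (2 * a))\<^sup>2 * (cosh (2 * t))\<^sup>2 - 1))"

definition cat_u :: "real \<Rightarrow> real \<Rightarrow> real" where
  "cat_u a s = sinh (cat_x a s) * cosh (cat_y a s) / (1 + cosh (cat_x a s) * cosh (cat_y a s))"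

definition cat_v :: "real \<Rightarrow> real \<Rightarrow> real" where
  "cat_v a s = sinh (cat_y a s) / (1 + cosh (cat_x a s) * cosh (cat_y a s))"

text \<open>The coordinates of the parameter are the arc length \<open>s\<close> and the angle \<open>\<theta>\<close>.\<close>

definition cat_param :: "real \<Rightarrow> real^2 \<Rightarrow> real^3" where
  "cat_param a q =
     vector [cat_u a (q $ 1), cat_v a (q $ 1) * cos (q $ 2), cat_v a (q $ 1) * sin (q $ 2)]"

definition cat_strip :: "(real^2) set" where
  "cat_strip = {q. 0 \<le> q $ 2 \<and> q $ 2 \<le> 2 * pi}"

definition catenoid :: "real \<Rightarrow> (real^3) set" where
  "catenoid a = {vector [cat_u a s, cat_v a s * cos \<theta>, cat_v a s * sin \<theta>] | s \<theta>.
                   0 \<le> \<theta> \<and> \<theta> \<le> 2 * pi}"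

lemma catenoid_eq_image: "catenoid a = cat_param a ` cat_strip"
proof (intro equalityI subsetI)
  fix p assume "p \<in> catenoid a"
  then obtain s \<theta> where p: "p = vector [cat_u a s, cat_v a s * cos \<theta>, cat_v a s * sin \<theta>]"
    and th: "0 \<le> \<theta>" "\<theta> \<le> 2 * pi"
    unfolding catenoid_def by blast
  have "p = cat_param a (vector [s, \<theta>])" "(vector [s, \<theta>] :: real^2) \<in> cat_strip"
    using p th by (simp_all add: cat_param_def cat_strip_def)
  then show "p \<in> cat_param a ` cat_strip" by blast
next
  fix p assume "p \<in> cat_param a ` cat_strip"
  then show "p \<in> catenoid a"
    unfolding catenoid_def cat_param_def cat_strip_def by blast
qed

abbreviation catenoid_minimal :: "real \<Rightarrow> bool" where
  "catenoid_minimal a \<equiv> minimal_surface (ball 0 1) hyp_metric (cat_param a)"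

abbreviation catenoid_unstable :: "real \<Rightarrow> bool" where
  "catenoid_unstable a \<equiv> unstable hyp_metric (cat_param a) cat_strip"

abbreviation catenoid_index :: "real \<Rightarrow> enat" where
  "catenoid_index a \<equiv> morse_index hyp_metric (cat_param a) cat_strip"

abbreviation catenoid_globally_stable :: "real \<Rightarrow> bool" where
  "catenoid_globally_stable a \<equiv> globally_stable hyp_metric (cat_param a) cat_strip"

abbreviation catenoid_stable_on_compacts :: "real \<Rightarrow> bool" where
  "catenoid_stable_on_compacts a \<equiv> stable_on_compacts hyp_metric (cat_param a) cat_strip"

end

theory Submission
  imports Defs
begin

text \<open>In arc length and angle the Jacobi operator of the catenoid separates into Fourier modes.  The modes
  of positive frequency are nonnegative, because \<open>1 / sinh y\<close> is a positive supersolution.  The radial mode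
  is governed by the even radial Jacobi field: it is positive, and the surface stable, iff
  \<open>\<integral>\<^sub>0\<^sup>1 r\<^sup>2 / sqrt (r^4 - 2 \<gamma> r\<^sup>2 + 1) dr \<le> sqrt ((1 - \<gamma>) / 2)\<close> with \<open>\<gamma> = 1 / cosh (2 a)\<close>.
  The difference of the two sides is strictly monotone in \<open>a\<close>, and a numerical enclosure locates its
  zero.  If the even field changes sign, so does the even solution with a slightly negative eigenvalue,
  which gives an annulus with a negative eigenvalue.  There is never a second one: the odd radial Jacobi
  field is positive for \<open>s > 0\<close>, so the quadratic form is nonnegative on functions whose mean over the
  neck \<open>s = 0\<close> vanishes.\<close>

section \<open>Smooth functions on open sets\<close>

text \<open>The integral criterion arises by writing the even field as
  \<open>exp (- (2 * s))\<close> plus \<open>rho1\<close> times a bracket that decreases to a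
  constant for s \<ge> 0: as \<open>rho1\<close> grows exponentially, the sign of that constant
  decides. A zero of the even field alone would only give an eigenvalue 0, whereas index and
  instability ask for a negative one; hence the perturbed field. Conversely, positivity of the field
  gives a positive \<open>lambda1\<close> on each compact piece; a bound independent of the piece
  needs the field to control its own weighted mass, and this holds only under strict inequality. In
  the case of equality the field decays like \<open>exp (- (2 * s))\<close> and is square
  integrable, so only compact subdomains have a positive bound. The lower bounds come from Riccati
  functions rather than from spectral theory, and the index bound from the fact that two independent
  negative eigenfunctions of one subdomain cannot coexist. The obstacle there is that the subdomain
  is arbitrary, so integration by parts up to its boundary is out of reach.\<close>

primrec Ck_on :: "(real^'n::finite) set \<Rightarrow> nat \<Rightarrow> (real^'n \<Rightarrow> 'b::real_normed_vector) \<Rightarrow> bool" where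
  "Ck_on U 0 f \<longleftrightarrow> continuous_on U f"
| "Ck_on U (Suc k) f \<longleftrightarrow> f differentiable_on U \<and> (\<forall>i. Ck_on U k (pd i f))"

text \<open>Local smoothness serves to glue: a truncated eigenfunction is given by one formula on an
  open set and by zero on another. Since \<open>pd\<close> is the two-sided ambient derivative, the
  notion is meant for open \<open>U\<close>.\<close>

definition smooth_on :: "(real^'n::finite) set \<Rightarrow> (real^'n \<Rightarrow> 'b::real_normed_vector) \<Rightarrow> bool" where
  "smooth_on U f \<longleftrightarrow> (\<forall>k. Ck_on U k f)"

lemma Ck_on_UNIV: "Ck_on UNIV k f = Ck k f"
  by (induction k arbitrary: f) auto

lemma smooth_on_UNIV: "smooth_on UNIV f = smooth f"
  by (simp add: smooth_on_def smooth_def Ck_on_UNIV)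

lemma pd_eq:
  fixes f :: "real^'n::finite \<Rightarrow> 'b::real_normed_vector"
  assumes "(f has_derivative f') (at p)"
  shows "pd i f p = f' (axis i 1)"
proof -
  have "((\<lambda>t. p + t *\<^sub>R axis i (1::real)) has_derivative (\<lambda>t. t *\<^sub>R axis i 1)) (at (0::real))"
    by (auto intro!: derivative_eq_intros)
  moreover have "(f has_derivative f') (at (p + (0::real) *\<^sub>R axis i 1))"
    using assms by simp
  ultimately have "((\<lambda>t. f (p + t *\<^sub>R axis i (1::real))) has_derivative (\<lambda>t. f' (t *\<^sub>R axis i 1))) (at (0::real))"
    by (rule has_derivative_compose)
  moreover have "linear f'" using assms by (rule has_derivative_linear)
  ultimately have "((\<lambda>t. f (p + t *\<^sub>R axis i (1::real))) has_vector_derivative f' (axis i 1)) (at (0::real))"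
    by (simp add: has_vector_derivative_def linear_scale)
  then show ?thesis unfolding pd_def by (rule vector_derivative_at)
qed

lemma pd_cong_open:
  fixes f g :: "real^'n::finite \<Rightarrow> 'b::real_normed_vector"
  assumes "open U" "p \<in> U" and eq: "\<And>x. x \<in> U \<Longrightarrow> f x = g x"
  shows "pd i f p = pd i g p"
proof -
  have "open ((\<lambda>t. p + t *\<^sub>R axis i (1::real)) -` U)"
    by (intro open_vimage assms continuous_intros)
  then have "eventually (\<lambda>t. t \<in> (\<lambda>t. p + t *\<^sub>R axis i (1::real)) -` U) (nhds 0)"
    using assms(2) by (intro eventually_nhds_in_open) auto
  then have ev: "eventually (\<lambda>t. f (p + t *\<^sub>R axis i (1::real)) = g (p + t *\<^sub>R axis i (1::real))) (nhds 0)"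
    by (rule eventually_mono) (auto intro: eq)
  then show ?thesis unfolding pd_def
    by (intro vector_derivative_cong_eq) (auto simp: eventually_nhds_x_imp_x)
qed

lemma differentiable_cong_open:
  assumes "open U" "p \<in> U" and eq: "\<And>x. x \<in> U \<Longrightarrow> f x = g x" and "f differentiable (at p)"
  shows "g differentiable (at p)"
  using assms by (metis has_derivative_transform_within_open differentiable_def)

lemma differentiable_on_open:
  "open U \<Longrightarrow> f differentiable_on U \<longleftrightarrow> (\<forall>x\<in>U. f differentiable (at x))"
  by (rule differentiable_on_eq_differentiable_at)

lemma Ck_on_cong:
  assumes "open U" and "\<And>x. x \<in> U \<Longrightarrow> f x = g x" and "Ck_on U k f"
  shows "Ck_on U k g"
  using assms(2,3)
proof (induction k arbitrary: f g)
  case 0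
  then show ?case using continuous_on_cong[of U U f g] by simp
next
  case (Suc k)
  have "g differentiable_on U"
    using Suc.prems assms(1) by (auto simp: differentiable_on_open intro: differentiable_cong_open[of U _ f g])
  moreover have "Ck_on U k (pd i g)" for i
    using Suc.prems by (intro Suc.IH[of "pd i f" "pd i g"]) (auto intro: pd_cong_open[OF assms(1)])
  ultimately show ?case by simp
qed

lemma Ck_on_Suc_D: "Ck_on U (Suc k) f \<Longrightarrow> Ck_on U k f"
proof (induction k arbitrary: f)
  case 0
  then show ?case by (simp add: differentiable_imp_continuous_on)
next
  case (Suc k)
  then show ?case by (metis Ck_on.simps(2))
qed

lemma Ck_on_subset: "V \<subseteq> U \<Longrightarrow> Ck_on U k f \<Longrightarrow> Ck_on V k f"
  by (induction k arbitrary: f) (auto intro: continuous_on_subset differentiable_on_subset)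

lemma Ck_on_Un:
  assumes "open U" "open V" "Ck_on U k f" "Ck_on V k f"
  shows "Ck_on (U \<union> V) k f"
  using assms(3,4)
proof (induction k arbitrary: f)
  case 0
  then show ?case using assms by (simp add: continuous_on_open_Un)
next
  case (Suc k)
  then show ?case using assms by (auto simp: differentiable_on_open open_Un)
qed

lemma Ck_on_const:
  fixes U :: "(real^'n::finite) set"
  shows "Ck_on U k (\<lambda>x. c)"
proof (induction k arbitrary: c)
  case (Suc k)
  have "pd i (\<lambda>x::real^'n. c) = (\<lambda>x. 0)" for i :: 'n by (auto simp: pd_def)
  then show ?case using Suc by simp
qed simp

lemma Ck_onD: "Ck_on U (Suc k) f \<Longrightarrow> open U \<Longrightarrow> x \<in> U \<Longrightarrow> f differentiable (at x)"
  by (auto simp: differentiable_on_open)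

lemma pd_add:
  assumes "f differentiable (at x)" "g differentiable (at x)"
  shows "pd i (\<lambda>x. f x + g x) x = pd i f x + pd i g x"
proof -
  obtain f' g' where *: "(f has_derivative f') (at x)" "(g has_derivative g') (at x)"
    using assms unfolding differentiable_def by blast
  show ?thesis unfolding pd_eq[OF has_derivative_add[OF *]] pd_eq[OF *(1)] pd_eq[OF *(2)] ..
qed

lemma pd_mult:
  fixes f g :: "real^'n::finite \<Rightarrow> real"
  assumes "f differentiable (at x)" "g differentiable (at x)"
  shows "pd i (\<lambda>x. f x * g x) x = pd i f x * g x + f x * pd i g x"
proof -
  obtain f' g' where *: "(f has_derivative f') (at x)" "(g has_derivative g') (at x)"
    using assms unfolding differentiable_def by blast
  show ?thesis unfolding pd_eq[OF has_derivative_mult[OF *]] pd_eq[OF *(1)] pd_eq[OF *(2)] by simp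
qed

lemma has_derivative_chain1:
  fixes f :: "'a::real_normed_vector \<Rightarrow> real"
  assumes "(h has_real_derivative d) (at (f x))" "(f has_derivative f') (at x)"
  shows "((\<lambda>x. h (f x)) has_derivative (\<lambda>v. d * f' v)) (at x)"
  using has_derivative_compose[OF assms(2) assms(1)[unfolded has_field_derivative_def]] by simp

lemma pd_chain:
  fixes f :: "real^'n::finite \<Rightarrow> real"
  assumes "(h has_real_derivative d) (at (f x))" "f differentiable (at x)"
  shows "pd i (\<lambda>x. h (f x)) x = d * pd i f x"
proof -
  obtain f' where *: "(f has_derivative f') (at x)"
    using assms unfolding differentiable_def by blast
  show ?thesis unfolding pd_eq[OF has_derivative_chain1[of h d f x, OF assms(1) *]] pd_eq[OF *] ..
qed

lemma differentiable_chain: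
  fixes f :: "real^'n::finite \<Rightarrow> real"
  assumes "(h has_real_derivative d) (at (f x))" "f differentiable (at x)"
  shows "(\<lambda>x. h (f x)) differentiable (at x)"
  using assms(2) unfolding differentiable_def
  by (blast intro: has_derivative_chain1[of h d f x, OF assms(1)])

lemma Ck_on_add:
  assumes "open U" "Ck_on U k f" "Ck_on U k g"
  shows "Ck_on U k (\<lambda>x. f x + g x)"
  using assms(2,3)
proof (induction k arbitrary: f g)
  case 0
  then show ?case by (simp add: continuous_on_add)
next
  case (Suc k)
  have d: "f differentiable (at x)" "g differentiable (at x)" if "x \<in> U" for x
    using that Suc.prems assms(1) by (auto simp: differentiable_on_open)
  have p: "Ck_on U k (pd i f)" "Ck_on U k (pd i g)" for i using Suc.prems by simp_all
  have "Ck_on U k (pd i (\<lambda>x. f x + g x))" for i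
    by (rule Ck_on_cong[OF assms(1) _ Suc.IH[OF p[of i]]]) (simp add: pd_add d)
  then show ?case using Suc.prems by (simp add: differentiable_on_add)
qed

lemma Ck_on_mult:
  fixes f g :: "real^'n::finite \<Rightarrow> real"
  assumes "open U" "Ck_on U k f" "Ck_on U k g"
  shows "Ck_on U k (\<lambda>x. f x * g x)"
  using assms(2,3)
proof (induction k arbitrary: f g)
  case 0
  then show ?case by (simp add: continuous_on_mult)
next
  case (Suc k)
  have d: "f differentiable (at x)" "g differentiable (at x)" if "x \<in> U" for x
    using that Suc.prems assms(1) by (auto simp: differentiable_on_open)
  have p: "Ck_on U k (pd i f)" "Ck_on U k (pd i g)" for i using Suc.prems by simp_all
  have q: "Ck_on U k f" "Ck_on U k g" using Suc.prems[THEN Ck_on_Suc_D] by auto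
  have "Ck_on U k (pd i (\<lambda>x. f x * g x))" for i
    by (rule Ck_on_cong[OF assms(1) _ Ck_on_add[OF assms(1) Suc.IH[OF p(1)[of i] q(2)] Suc.IH[OF q(1) p(2)[of i]]]])
       (simp add: pd_mult d)
  then show ?case using Suc.prems by (auto intro!: derivative_intros)
qed

lemma Ck_on_minus:
  fixes f :: "real^'n::finite \<Rightarrow> real"
  assumes "open U" "Ck_on U k f" shows "Ck_on U k (\<lambda>x. - f x)"
  using Ck_on_mult[OF assms(1) Ck_on_const[of _ _ "-1"] assms(2)] by simp

text \<open>The outer function comes with all its derivatives as a sequence \<open>H\<close>. The
  chain rule then sends \<open>H n\<close> to \<open>H (Suc n)\<close> times a derivative of the
  inner function, and the induction never forms a higher chain rule.\<close>

lemma Ck_on_chain: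
  fixes f :: "real^'n::finite \<Rightarrow> real" and H :: "nat \<Rightarrow> real \<Rightarrow> real"
  assumes "open U" "\<And>n x. (H n has_real_derivative H (Suc n) x) (at x)" "Ck_on U k f"
  shows "Ck_on U k (\<lambda>x. H n (f x))"
  using assms(3)
proof (induction k arbitrary: n)
  case 0
  have "continuous_on UNIV (H n)" using assms(2) by (meson DERIV_continuous_on has_field_derivative_at_within)
  then show ?case using 0 by (auto intro: continuous_on_compose2)
next
  case (Suc k)
  have d: "f differentiable (at x)" if "x \<in> U" for x
    using that Suc.prems assms(1) by (auto simp: differentiable_on_open)
  have p: "Ck_on U k (pd i f)" for i using Suc.prems by simp_all
  have q: "Ck_on U k f" using Suc.prems by (rule Ck_on_Suc_D)
  have "Ck_on U k (pd i (\<lambda>x. H n (f x)))" for i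
    by (rule Ck_on_cong[OF assms(1) _ Ck_on_mult[OF assms(1) Suc.IH[OF q, of "Suc n"] p[of i]]])
       (simp add: pd_chain[OF assms(2)] d)
  moreover have "(\<lambda>x. H n (f x)) differentiable_on U"
    using d by (auto simp: differentiable_on_open[OF assms(1)] intro: differentiable_chain[OF assms(2)])
  ultimately show ?case by simp
qed

text \<open>The derivative of 1/f is built from 1/f and f' by products, so order
  \<open>Suc k\<close> follows from order \<open>k\<close>. The square root is treated in the same
  way through the reciprocal of its own value.\<close>

lemma Ck_on_inverse:
  fixes f :: "real^'n::finite \<Rightarrow> real"
  assumes "open U" "\<And>x. x \<in> U \<Longrightarrow> f x \<noteq> 0" "Ck_on U k f"
  shows "Ck_on U k (\<lambda>x. inverse (f x))"
  using assms(3)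
proof (induction k)
  case 0
  then show ?case using assms(2) by (auto intro: continuous_on_inverse)
next
  case (Suc k)
  have d: "f differentiable (at x)" if "x \<in> U" for x
    using that Suc.prems assms(1) by (auto simp: differentiable_on_open)
  have D: "(inverse has_real_derivative - (inverse (f x) * inverse (f x))) (at (f x))" if "x \<in> U" for x
    using DERIV_inverse[OF assms(2)[OF that]] by (simp add: power2_eq_square numeral_2_eq_2)
  have p: "Ck_on U k (pd i f)" for i using Suc.prems by simp_all
  have IH: "Ck_on U k (\<lambda>x. inverse (f x))" by (rule Suc.IH[OF Ck_on_Suc_D[OF Suc.prems]])
  have "Ck_on U k (pd i (\<lambda>x. inverse (f x)))" for i
    by (rule Ck_on_cong[OF assms(1) _
          Ck_on_mult[OF assms(1) Ck_on_minus[OF assms(1) Ck_on_mult[OF assms(1) IH IH]] p[of i]]])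
       (simp add: pd_chain[OF D] d)
  moreover have "(\<lambda>x. inverse (f x)) differentiable_on U"
    using d by (auto simp: differentiable_on_open[OF assms(1)] intro: differentiable_chain[OF D])
  ultimately show ?case by simp
qed

lemma Ck_on_sqrt:
  fixes f :: "real^'n::finite \<Rightarrow> real"
  assumes "open U" "\<And>x. x \<in> U \<Longrightarrow> f x > 0" "Ck_on U k f"
  shows "Ck_on U k (\<lambda>x. sqrt (f x))"
  using assms(3)
proof (induction k)
  case 0
  then show ?case by (auto intro: continuous_on_real_sqrt)
next
  case (Suc k)
  have d: "f differentiable (at x)" if "x \<in> U" for x
    using that Suc.prems assms(1) by (auto simp: differentiable_on_open)
  have D: "(sqrt has_real_derivative inverse (sqrt (f x)) * (1/2)) (at (f x))" if "x \<in> U" for x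
    using DERIV_real_sqrt[OF assms(2)[OF that]] by simp
  have p: "Ck_on U k (pd i f)" for i using Suc.prems by simp_all
  have "Ck_on U k (\<lambda>x. sqrt (f x))" by (rule Suc.IH[OF Ck_on_Suc_D[OF Suc.prems]])
  then have IH: "Ck_on U k (\<lambda>x. inverse (sqrt (f x)))"
    by (rule Ck_on_inverse[OF assms(1), rotated]) (use assms(2) in force)
  have "Ck_on U k (pd i (\<lambda>x. sqrt (f x)))" for i
    by (rule Ck_on_cong[OF assms(1) _
          Ck_on_mult[OF assms(1) Ck_on_mult[OF assms(1) IH Ck_on_const[of _ _ "1/2"]] p[of i]]])
       (simp add: pd_chain[OF D] d)
  moreover have "(\<lambda>x. sqrt (f x)) differentiable_on U"
    using d by (auto simp: differentiable_on_open[OF assms(1)] intro: differentiable_chain[OF D])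
  ultimately show ?case by simp
qed

lemma has_derivative_nth: "((\<lambda>q::real^'n::finite. q $ i) has_derivative (\<lambda>h. h $ i)) (at x)"
  by (rule bounded_linear_imp_has_derivative) (rule bounded_linear_vec_nth)

lemma pd_nth: "pd j (\<lambda>q::real^'n::finite. q $ i) x = (if i = j then 1 else 0)"
  by (simp add: pd_eq[OF has_derivative_nth] axis_def)

lemma differentiable_nth: "(\<lambda>q::real^'n::finite. q $ i) differentiable (at x)"
  using has_derivative_nth differentiable_def by blast

lemma Ck_on_nth: "open U \<Longrightarrow> Ck_on U k (\<lambda>q::real^'n::finite. q $ i)"
proof (cases k)
  case (Suc m)
  assume "open U"
  have "pd j (\<lambda>q::real^'n::finite. q $ i) = (\<lambda>x. if i = j then 1 else 0)" for j
    by (auto simp: pd_nth)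
  then show ?thesis
    using \<open>open U\<close> by (auto simp: Suc differentiable_on_open differentiable_nth Ck_on_const)
qed (auto intro!: continuous_intros)

section \<open>Closure properties of smooth functions\<close>

named_theorems smooth_intros

lemma smooth_on_Suc_D: "f differentiable_on U \<Longrightarrow> (\<And>i. Ck_on U k (pd i f)) \<Longrightarrow> Ck_on U k f"
  using Ck_on_Suc_D[of U k f] by simp

lemma smooth_on_const [smooth_intros]: "smooth_on U (\<lambda>x. c)"
  by (simp add: smooth_on_def Ck_on_const)
lemma smooth_on_add [smooth_intros]: "open U \<Longrightarrow> smooth_on U f \<Longrightarrow> smooth_on U g \<Longrightarrow> smooth_on U (\<lambda>x. f x + g x)"
  by (simp add: smooth_on_def Ck_on_add)
lemma smooth_on_mult [smooth_intros]:
  "open U \<Longrightarrow> smooth_on U f \<Longrightarrow> smooth_on U g \<Longrightarrow> smooth_on U (\<lambda>x. f x * g x :: real)"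
  by (simp add: smooth_on_def Ck_on_mult)
lemma smooth_on_minus [smooth_intros]: "open U \<Longrightarrow> smooth_on U f \<Longrightarrow> smooth_on U (\<lambda>x. - f x :: real)"
  by (simp add: smooth_on_def Ck_on_minus)
lemma smooth_on_diff [smooth_intros]:
  "open U \<Longrightarrow> smooth_on U f \<Longrightarrow> smooth_on U g \<Longrightarrow> smooth_on U (\<lambda>x. f x - g x :: real)"
  using smooth_on_add[of U f "\<lambda>x. - g x"] by (simp add: smooth_on_minus)
lemma smooth_on_inverse [smooth_intros]:
  "open U \<Longrightarrow> (\<And>x. x \<in> U \<Longrightarrow> f x \<noteq> 0) \<Longrightarrow> smooth_on U f \<Longrightarrow> smooth_on U (\<lambda>x. inverse (f x) :: real)"
  by (simp add: smooth_on_def Ck_on_inverse)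
lemma smooth_on_divide [smooth_intros]:
  "open U \<Longrightarrow> (\<And>x. x \<in> U \<Longrightarrow> g x \<noteq> 0) \<Longrightarrow> smooth_on U f \<Longrightarrow> smooth_on U g \<Longrightarrow> smooth_on U (\<lambda>x. f x / g x :: real)"
  unfolding divide_inverse by (intro smooth_intros) auto
lemma smooth_on_sqrt [smooth_intros]:
  "open U \<Longrightarrow> (\<And>x. x \<in> U \<Longrightarrow> f x > 0) \<Longrightarrow> smooth_on U f \<Longrightarrow> smooth_on U (\<lambda>x. sqrt (f x))"
  by (simp add: smooth_on_def Ck_on_sqrt)
lemma smooth_on_power [smooth_intros]:
  "open U \<Longrightarrow> smooth_on U f \<Longrightarrow> smooth_on U (\<lambda>x. f x ^ n :: real)"
proof (induction n)
  case 0
  then show ?case using smooth_on_const[of U "1::real"] by simp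
next
  case (Suc n)
  then show ?case using smooth_on_mult[of U f "\<lambda>x. f x ^ n"] by simp
qed
lemma smooth_on_nth [smooth_intros]: "open U \<Longrightarrow> smooth_on U (\<lambda>q. q $ i)"
  by (simp add: smooth_on_def Ck_on_nth)
lemma smooth_on_chain:
  "open U \<Longrightarrow> (\<And>n x. (H n has_real_derivative H (Suc n) x) (at x)) \<Longrightarrow> smooth_on U f
    \<Longrightarrow> smooth_on U (\<lambda>x. H n (f x))"
  by (simp add: smooth_on_def Ck_on_chain)

lemma smooth_on_exp [smooth_intros]: "open U \<Longrightarrow> smooth_on U f \<Longrightarrow> smooth_on U (\<lambda>x. exp (f x :: real))"
  by (rule smooth_on_chain[of U "\<lambda>n. exp"]) (auto intro!: derivative_eq_intros)

lemma smooth_on_sin [smooth_intros]: assumes "open U" "smooth_on U f" shows "smooth_on U (\<lambda>x. sin (f x :: real))"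
proof -
  \<comment> \<open>The derivatives of sine form a single sequence when written as phase shifts by
    multiples of pi / 2.\<close>
  have "sin (x + (1 + real n) * pi / 2) = cos (x + real n * pi / 2)" for x n
  proof -
    have "x + (1 + real n) * pi / 2 = (x + real n * pi / 2) + pi / 2" by (simp add: field_simps)
    then show ?thesis by (simp only: sin_add) simp
  qed
  then have "smooth_on U (\<lambda>x. sin (f x + real 0 * pi / 2))"
    by (intro smooth_on_chain[OF assms(1), of "\<lambda>n x. sin (x + real n * pi / 2)"] assms(2))
       (auto intro!: derivative_eq_intros)
  then show ?thesis by simp
qed

lemma smooth_on_cos [smooth_intros]: assumes "open U" "smooth_on U f" shows "smooth_on U (\<lambda>x. cos (f x :: real))"
proof -
  have "smooth_on U (\<lambda>x. sin (pi / 2 - f x))" using assms by (intro smooth_intros)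
  then show ?thesis by (simp add: sin_diff)
qed

lemma smooth_on_cosh [smooth_intros]: assumes "open U" "smooth_on U f" shows "smooth_on U (\<lambda>x. cosh (f x :: real))"
  unfolding cosh_field_def using assms by (intro smooth_on_divide smooth_on_add smooth_on_exp smooth_on_minus smooth_on_const) auto
lemma smooth_on_sinh [smooth_intros]: assumes "open U" "smooth_on U f" shows "smooth_on U (\<lambda>x. sinh (f x :: real))"
  unfolding sinh_field_def using assms by (intro smooth_on_divide smooth_on_diff smooth_on_exp smooth_on_minus smooth_on_const) auto

lemma smooth_on_cong:
  "open U \<Longrightarrow> (\<And>x. x \<in> U \<Longrightarrow> f x = g x) \<Longrightarrow> smooth_on U f \<Longrightarrow> smooth_on U g"
  unfolding smooth_on_def by (blast intro: Ck_on_cong)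
lemma smooth_on_Un: "open U \<Longrightarrow> open V \<Longrightarrow> smooth_on U f \<Longrightarrow> smooth_on V f \<Longrightarrow> smooth_on (U \<union> V) f"
  by (simp add: smooth_on_def Ck_on_Un)
lemma smooth_on_subset: "V \<subseteq> U \<Longrightarrow> smooth_on U f \<Longrightarrow> smooth_on V f"
  unfolding smooth_on_def by (blast intro: Ck_on_subset)

lemma smooth_on_pd: "smooth_on U f \<Longrightarrow> smooth_on U (pd i f)"
  unfolding smooth_on_def by (metis Ck_on.simps(2))
lemma smooth_on_differentiable: "smooth_on U f \<Longrightarrow> open U \<Longrightarrow> x \<in> U \<Longrightarrow> f differentiable (at x)"
  unfolding smooth_on_def by (metis Ck_onD)
lemma smooth_on_continuous: "smooth_on U f \<Longrightarrow> continuous_on U f"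
  unfolding smooth_on_def by (metis Ck_on.simps(1))
lemma smooth_on_if_pd:
  "f differentiable_on U \<Longrightarrow> (\<And>i. smooth_on U (pd i f)) \<Longrightarrow> smooth_on U f"
  by (simp add: smooth_on_def smooth_on_Suc_D)

lemma pd_fun_of_nth:
  assumes "(h has_real_derivative d) (at (q $ i))"
  shows "pd j (\<lambda>q::real^'n::finite. h (q $ i)) q = (if i = j then d else 0)"
  by (simp add: pd_chain[OF assms differentiable_nth] pd_nth)

text \<open>Meant for functions known only as integrals, such as \<open>cat_x\<close>: the first
  derivative is explicit, and smoothness is inherited from it.\<close>

lemma smooth_fun_of_nth_if_deriv:
  assumes "\<And>x. (h has_real_derivative h' x) (at x)" "smooth (\<lambda>q::real^'n::finite. h' (q $ i))"
  shows "smooth (\<lambda>q::real^'n::finite. h (q $ i))"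
  unfolding smooth_on_UNIV[symmetric]
proof (rule smooth_on_if_pd)
  show "(\<lambda>q::real^'n. h (q $ i)) differentiable_on UNIV"
    by (auto simp: differentiable_on_open intro: differentiable_chain[OF assms(1) differentiable_nth])
  show "smooth_on UNIV (pd j (\<lambda>q::real^'n. h (q $ i)))" for j
  proof -
    have "pd j (\<lambda>q::real^'n. h (q $ i)) = (\<lambda>q. if i = j then h' (q $ i) else 0)"
      by (rule ext) (simp add: pd_fun_of_nth[OF assms(1)])
    then show ?thesis using assms(2) smooth_on_const[of UNIV "0::real"]
      by (cases "i = j") (simp_all add: smooth_on_UNIV)
  qed
qed

section \<open>Vector-valued maps, componentwise\<close>

lemma has_derivative_vecI:
  fixes f :: "'a::real_normed_vector \<Rightarrow> real^'m::finite"
  assumes "\<And>j. ((\<lambda>x. f x $ j) has_derivative (\<lambda>h. f' h $ j)) (at x)"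
  shows "(f has_derivative f') (at x)"
  unfolding has_derivative_componentwise_within[of f]
proof
  fix b :: "real^'m" assume "b \<in> Basis"
  then obtain j where "b = axis j 1" by (auto simp: Basis_vec_def)
  then show "((\<lambda>x. f x \<bullet> b) has_derivative (\<lambda>h. f' h \<bullet> b)) (at x)"
    using assms[of j] by (simp add: inner_axis)
qed

lemma differentiable_vecI:
  fixes f :: "'a::real_normed_vector \<Rightarrow> real^'m::finite"
  assumes "\<And>j. (\<lambda>x. f x $ j) differentiable (at x)"
  shows "f differentiable (at x)"
proof -
  obtain D where D: "\<And>j. ((\<lambda>x. f x $ j) has_derivative D j) (at x)"
    using assms unfolding differentiable_def by metis
  have "(f has_derivative (\<lambda>h. \<chi> j. D j h)) (at x)"
    by (rule has_derivative_vecI) (simp add: D)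
  then show ?thesis unfolding differentiable_def by blast
qed

lemma pd_vec_nth:
  fixes f :: "real^'n::finite \<Rightarrow> real^'m::finite"
  assumes "f differentiable (at x)"
  shows "pd i f x $ j = pd i (\<lambda>x. f x $ j) x"
proof -
  obtain f' where f': "(f has_derivative f') (at x)" using assms unfolding differentiable_def by blast
  have "((\<lambda>x. f x $ j) has_derivative (\<lambda>h. f' h $ j)) (at x)"
    by (rule bounded_linear.has_derivative[OF bounded_linear_vec_nth f'])
  then show ?thesis unfolding pd_eq[OF f'] by (simp only: pd_eq[where f="\<lambda>x. f x $ j"])
qed

lemma Ck_on_vecI:
  fixes f :: "real^'n::finite \<Rightarrow> real^'m::finite"
  assumes "open U" "\<And>j. Ck_on U k (\<lambda>x. f x $ j)"
  shows "Ck_on U k f"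
  using assms(2)
proof (induction k arbitrary: f)
  case 0
  then have "continuous_on U (\<lambda>x. \<chi> j. f x $ j)" by (intro continuous_on_vec_lambda) simp
  then show ?case by simp
next
  case (Suc k)
  have d: "f differentiable (at x)" if "x \<in> U" for x
    using that Suc.prems assms(1) by (intro differentiable_vecI) (auto simp: differentiable_on_open)
  have "Ck_on U k (\<lambda>x. pd i f x $ j)" for i j
    by (rule Ck_on_cong[OF assms(1), of "pd i (\<lambda>x. f x $ j)"])
       (use Suc.prems in \<open>auto simp: pd_vec_nth[OF d]\<close>)
  then show ?case using d Suc.IH by (auto simp: differentiable_on_open[OF assms(1)])
qed

lemma smooth_vecI:
  fixes f :: "real^'n::finite \<Rightarrow> real^'m::finite"
  shows "(\<And>j. smooth (\<lambda>x. f x $ j)) \<Longrightarrow> smooth f"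
  unfolding smooth_on_UNIV[symmetric] smooth_on_def by (blast intro: Ck_on_vecI)

section \<open>Smooth functions flat at the origin\<close>

definition flat_fun :: "real poly \<Rightarrow> real \<Rightarrow> real" where
  "flat_fun p x = (if 0 < x then poly p (1 / x) * exp (- (1 / x)) else 0)"

lemma poly_div_exp_tendsto_0: "((\<lambda>y::real. poly p y / exp y) \<longlongrightarrow> 0) at_top"
proof -
  have "((\<lambda>y. \<Sum>i\<le>degree p. coeff p i * (y ^ i / exp y)) \<longlongrightarrow> (\<Sum>i\<le>degree p. coeff p i * 0)) at_top"
    by (intro tendsto_intros tendsto_power_div_exp_0)
  then show ?thesis by (simp add: poly_altdef sum_divide_distrib)
qed

text \<open>In the variable y = 1/x the derivative of p(y) exp(-y) is y^2 (p - p')(y) exp(-y), so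
  the family indexed by polynomials is closed under differentiation. This is why a polynomial is
  carried along instead of exp(-1/x) alone.\<close>

lemma DERIV_flat_fun:
  "(flat_fun p has_real_derivative flat_fun ([:0, 0, 1:] * (p - pderiv p)) x) (at x)"
proof -
  consider "x < 0" | "x > 0" | "x = 0" by linarith
  then show ?thesis
  proof cases
    case 1
    have "flat_fun ([:0, 0, 1:] * (p - pderiv p)) x = 0" using 1 by (simp add: flat_fun_def)
    moreover have "(flat_fun p has_real_derivative 0) (at x)"
      by (rule has_field_derivative_transform_within_open[where f="\<lambda>x. 0" and S="{..<0}"])
         (use 1 in \<open>auto simp: flat_fun_def\<close>)
    ultimately show ?thesis by simp
  next
    case 2
    have "((\<lambda>x. poly p (1 / x) * exp (- (1 / x))) has_real_derivative
        poly (pderiv p) (1 / x) * (- 1 / (x * x)) * exp (- (1 / x)) + exp (- (1 / x)) * (1 / (x * x)) * poly p (1 / x)) (at x)"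
      using 2 by (auto intro!: derivative_eq_intros DERIV_chain2[OF poly_DERIV])
    moreover have "poly (pderiv p) (1 / x) * (- 1 / (x * x)) * exp (- (1 / x)) + exp (- (1 / x)) * (1 / (x * x)) * poly p (1 / x)
       = flat_fun ([:0, 0, 1:] * (p - pderiv p)) x"
      using 2 by (simp add: flat_fun_def field_simps)
    ultimately have "((\<lambda>x. poly p (1 / x) * exp (- (1 / x))) has_real_derivative
        flat_fun ([:0, 0, 1:] * (p - pderiv p)) x) (at x)" by simp
    then show ?thesis
      by (rule has_field_derivative_transform_within_open[where S="{0<..}"])
         (use 2 in \<open>auto simp: flat_fun_def\<close>)
  next
    case 3
    have "((\<lambda>h. flat_fun p h / h) \<longlongrightarrow> 0) (at 0)"
    proof (rule filterlim_split_at_real)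
      show "((\<lambda>h. flat_fun p h / h) \<longlongrightarrow> 0) (at_left 0)"
        by (rule Lim_transform_eventually[OF tendsto_const])
           (auto simp: flat_fun_def eventually_at_left_field intro!: exI[of _ "-1"])
      \<comment> \<open>With y = 1/h the difference quotient at 0 from the right is y p(y) exp(-y),
        which tends to 0 as y grows.\<close>
      have "((\<lambda>h. poly ([:0, 1:] * p) (inverse h) / exp (inverse h)) \<longlongrightarrow> 0) (at_right (0::real))"
        by (rule filterlim_compose[OF poly_div_exp_tendsto_0 filterlim_inverse_at_top_right])
      then show "((\<lambda>h. flat_fun p h / h) \<longlongrightarrow> 0) (at_right 0)"
        by (rule Lim_transform_eventually)
           (auto simp: flat_fun_def eventually_at_right_field divide_simps exp_minus intro!: exI[of _ 1])
    qed
    then show ?thesis using 3 by (simp add: flat_fun_def[of _ 0] DERIV_def)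
  qed
qed

lemma smooth_on_flat_fun [smooth_intros]:
  assumes "open U" "smooth_on U f"
  shows "smooth_on U (\<lambda>x. flat_fun p (f x))"
proof -
  let ?Q = "\<lambda>p. [:0, 0, 1:] * (p - pderiv p) :: real poly"
  have "smooth_on U (\<lambda>x. flat_fun ((?Q ^^ 0) p) (f x))"
    by (rule smooth_on_chain[OF assms(1), of "\<lambda>n. flat_fun ((?Q ^^ n) p)"])
       (use DERIV_flat_fun assms(2) in auto)
  then show ?thesis by simp
qed

section \<open>Curvature of hyperbolic space\<close>

lemma matrix_inv_eqI:
  fixes A B :: "real^'n::finite^'n"
  assumes "A ** B = mat 1" "B ** A = mat 1"
  shows "matrix_inv A = B"
proof -
  have "A ** matrix_inv A = mat 1 \<and> matrix_inv A ** A = mat 1"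
    unfolding matrix_inv_def by (rule someI[of _ B]) (use assms in simp)
  then have "matrix_inv A = matrix_inv A ** (A ** B)" "matrix_inv A ** A = mat 1" using assms by simp_all
  then show ?thesis by (simp add: matrix_mul_assoc)
qed

definition conf_factor :: "real^3 \<Rightarrow> real" where
  "conf_factor p = 4 / (1 - (norm p)\<^sup>2)\<^sup>2"

text \<open>The gradient of the logarithm of 2 / (1 - r^2), the square root of the conformal factor.
  The Christoffel symbols of a conformally flat metric are linear in it.\<close>

definition tau :: "3 \<Rightarrow> real^3 \<Rightarrow> real" where
  "tau j p = 2 * p $ j / (1 - (norm p)\<^sup>2)"

lemma hyp_metric_nth: "hyp_metric p $ k $ l = conf_factor p * (if k = l then 1 else 0)"
  by (simp add: hyp_metric_def conf_factor_def mat_def)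

lemma hyp_inner: "riem_inner hyp_metric p v w = conf_factor p * (v \<bullet> w)"
  by (simp add: riem_inner_def hyp_metric_def conf_factor_def scaleR_matrix_vector_assoc[symmetric])

lemma norm_less_1_sq: "norm p < 1 \<Longrightarrow> 1 - (norm p)\<^sup>2 > (0::real)"
  by (simp add: abs_square_less_1)

lemma conf_factor_pos: "norm p < 1 \<Longrightarrow> conf_factor p > 0"
  using norm_less_1_sq[of p] by (simp add: conf_factor_def)

lemma matrix_inv_hyp: "norm p < 1 \<Longrightarrow> matrix_inv (hyp_metric p) $ i $ l = (if i = l then 1 / conf_factor p else 0)"
proof -
  assume p: "norm p < 1"
  have "hyp_metric p = conf_factor p *\<^sub>R mat 1" by (simp add: hyp_metric_def conf_factor_def)
  then have "matrix_inv (hyp_metric p) = (1 / conf_factor p) *\<^sub>R mat 1"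
    using conf_factor_pos[OF p] by (intro matrix_inv_eqI) (simp_all add: scalar_matrix_assoc[symmetric] matrix_scalar_ac)
  then show ?thesis by (simp add: mat_def)
qed

lemma norm_sq_DERIV: "((\<lambda>q::real^3. 1 - (norm q)\<^sup>2) has_derivative (\<lambda>h. - 2 * (p \<bullet> h))) (at p)"
  unfolding power2_norm_eq_inner
  by (auto intro!: derivative_eq_intros simp: inner_commute)

lemma conf_factor_DERIV: "norm p < 1 \<Longrightarrow> (conf_factor has_derivative (\<lambda>h. 16 * (p \<bullet> h) / (1 - (norm p)\<^sup>2) ^ 3)) (at p)"
proof -
  assume "norm p < 1"
  then have D: "1 - (norm p)\<^sup>2 \<noteq> 0" using norm_less_1_sq[of p] by simp
  have "((\<lambda>D. 4 / D\<^sup>2) has_real_derivative - 8 / D ^ 3) (at D)" if "D \<noteq> 0" for D :: real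
    using that by (auto intro!: derivative_eq_intros simp: field_simps eval_nat_numeral)
  note this[OF D]
  from has_derivative_chain1[of "\<lambda>D. 4 / D\<^sup>2" _ "\<lambda>q::real^3. 1 - (norm q)\<^sup>2", OF this norm_sq_DERIV]
  show ?thesis unfolding conf_factor_def[abs_def] by simp
qed

lemma pd_conf_factor: "norm p < 1 \<Longrightarrow> pd j conf_factor p = 2 * conf_factor p * tau j p"
proof -
  assume p: "norm p < 1"
  have "pd j conf_factor p = 16 * p $ j / (1 - (norm p)\<^sup>2) ^ 3"
    by (simp add: pd_eq[OF conf_factor_DERIV[OF p]] inner_axis)
  also have "\<dots> = 2 * conf_factor p * tau j p"
    by (simp add: conf_factor_def tau_def eval_nat_numeral)
  finally show ?thesis .
qed

lemma christoffel_hyp: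
  assumes p: "norm p < 1"
  shows "christoffel hyp_metric p i j k = (if k = i then tau j p else 0) + (if j = i then tau k p else 0) - (if j = k then tau i p else 0)"
proof -
  have d: "pd j (\<lambda>q. hyp_metric q $ k $ l) p = (if k = l then 2 * conf_factor p * tau j p else 0)" for j k l
  proof (cases "k = l")
    case True
    then show ?thesis using pd_conf_factor[OF p, of j] by (simp add: hyp_metric_nth)
  next
    case False
    then have "(\<lambda>q. hyp_metric q $ k $ l) = (\<lambda>q. 0)" by (auto simp: hyp_metric_nth)
    then show ?thesis using False by (simp add: pd_def)
  qed
  show ?thesis unfolding christoffel_def d matrix_inv_hyp[OF p]
    using conf_factor_pos[OF p]
    by (simp add: if_distrib[where f="\<lambda>x. x * _"] sum.delta cong: if_cong)
qed

lemma christoffel_contract: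
  assumes p: "norm p < 1"
  shows "(\<chi> k. \<Sum>l\<in>UNIV. \<Sum>m\<in>UNIV. christoffel hyp_metric p k l m * v $ l * w $ m)
    = (2 / (1 - (norm p)\<^sup>2)) *\<^sub>R ((p \<bullet> v) *\<^sub>R w + (p \<bullet> w) *\<^sub>R v - (v \<bullet> w) *\<^sub>R p)"
proof -
  have "(\<Sum>l\<in>UNIV. \<Sum>m\<in>UNIV. christoffel hyp_metric p k l m * v $ l * w $ m)
     = (2 / (1 - (norm p)\<^sup>2)) * ((p \<bullet> v) * w $ k + (p \<bullet> w) * v $ k - (v \<bullet> w) * p $ k)" for k
  proof -
    have "\<forall>k. (\<Sum>l\<in>UNIV. \<Sum>m\<in>UNIV. christoffel hyp_metric p k l m * v $ l * w $ m)
     = (2 / (1 - (norm p)\<^sup>2)) * ((p \<bullet> v) * w $ k + (p \<bullet> w) * v $ k - (v \<bullet> w) * p $ k)"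
      unfolding forall_3 sum_3 inner_vec_def christoffel_hyp[OF p] tau_def
      by (simp add: algebra_simps add_divide_distrib diff_divide_distrib)
    then show ?thesis by blast
  qed
  then show ?thesis by (simp add: vec_eq_iff)
qed

lemma tau_DERIV:
  assumes p: "norm p < 1"
  shows "(tau j has_derivative (\<lambda>h. 2 * h $ j / (1 - (norm p)\<^sup>2) + 4 * p $ j * (p \<bullet> h) / (1 - (norm p)\<^sup>2)\<^sup>2)) (at p)"
proof -
  have D: "1 - (norm p)\<^sup>2 \<noteq> 0" using norm_less_1_sq[OF p] by simp
  have "((\<lambda>q. 2 * q $ j / (1 - (norm q)\<^sup>2)) has_derivative
     (\<lambda>h. - (2 * p $ j) * (inverse (1 - (norm p)\<^sup>2) * (- 2 * (p \<bullet> h)) * inverse (1 - (norm p)\<^sup>2)) + 2 * h $ j / (1 - (norm p)\<^sup>2))) (at p)"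
    by (rule has_derivative_divide[OF has_derivative_mult_right[OF has_derivative_nth] norm_sq_DERIV D])
  then show ?thesis unfolding tau_def[abs_def]
    using D by (simp add: field_simps power2_eq_square)
qed

lemma pd_tau: "norm p < 1 \<Longrightarrow> pd m (tau j) p = (if m = j then 2 / (1 - (norm p)\<^sup>2) else 0) + 4 * p $ j * p $ m / (1 - (norm p)\<^sup>2)\<^sup>2"
  by (simp add: pd_eq[OF tau_DERIV] inner_axis) (simp add: axis_def)

lemma pd_christoffel_hyp:
  assumes p: "norm p < 1"
  shows "pd m (\<lambda>q. christoffel hyp_metric q i j k) p =
    (if k = i then pd m (tau j) p else 0) + (if j = i then pd m (tau k) p else 0) - (if j = k then pd m (tau i) p else 0)"
proof -
  have "pd m (\<lambda>q. christoffel hyp_metric q i j k) p =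
    pd m (\<lambda>q. (if k = i then tau j q else 0) + (if j = i then tau k q else 0) - (if j = k then tau i q else 0)) p"
    by (rule pd_cong_open[where U = "ball 0 1"]) (use p christoffel_hyp in auto)
  moreover have "((\<lambda>q. (if k = i then tau j q else 0) + (if j = i then tau k q else 0) - (if j = k then tau i q else 0)) has_derivative
     (\<lambda>h. (if k = i then 2 * h $ j / (1 - (norm p)\<^sup>2) + 4 * p $ j * (p \<bullet> h) / (1 - (norm p)\<^sup>2)\<^sup>2 else 0) +
        (if j = i then 2 * h $ k / (1 - (norm p)\<^sup>2) + 4 * p $ k * (p \<bullet> h) / (1 - (norm p)\<^sup>2)\<^sup>2 else 0) -
        (if j = k then 2 * h $ i / (1 - (norm p)\<^sup>2) + 4 * p $ i * (p \<bullet> h) / (1 - (norm p)\<^sup>2)\<^sup>2 else 0))) (at p)"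
  proof -
    have "((\<lambda>q. if b then tau j q else 0) has_derivative
      (\<lambda>h. if b then 2 * h $ j / (1 - (norm p)\<^sup>2) + 4 * p $ j * (p \<bullet> h) / (1 - (norm p)\<^sup>2)\<^sup>2 else 0)) (at p)" for b j
      using tau_DERIV[OF p, of j] by (cases b) auto
    then show ?thesis by (intro has_derivative_add has_derivative_diff)
  qed
  ultimately show ?thesis by (simp add: pd_eq pd_eq[OF tau_DERIV[OF p]])
qed

lemma ricci_hyp:
  assumes p: "norm p < 1"
  shows "ricci hyp_metric p = (- 2 * conf_factor p) *\<^sub>R mat 1"
proof -
  define D where "D = 1 - (norm p)\<^sup>2"
  have D: "D \<noteq> 0" using norm_less_1_sq[OF p] by (simp add: D_def)
  \<comment> \<open>Dividing the coordinates by \<open>D\<close> turns every entry into a polynomial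
    in x, y, z and d = 1/D, tied by the single relation \<open>rel\<close>.\<close>
  define x y z where xyz: "x = p $ 1 / D" "y = p $ 2 / D" "z = p $ 3 / D"
  have n: "(norm p)\<^sup>2 = (p $ 1)\<^sup>2 + (p $ 2)\<^sup>2 + (p $ 3)\<^sup>2"
    unfolding power2_norm_eq_inner inner_vec_def sum_3 by (simp add: power2_eq_square)
  define d where "d = 1 / D"
  have pe: "p $ 1 = x * D" "p $ 2 = y * D" "p $ 3 = z * D" using D by (simp_all add: xyz)
  have "D = 1 - (p $ 1)\<^sup>2 - (p $ 2)\<^sup>2 - (p $ 3)\<^sup>2" by (simp add: D_def n)
  then have "D = 1 - (x * D)\<^sup>2 - (y * D)\<^sup>2 - (z * D)\<^sup>2" by (simp only: pe)
  then have "d\<^sup>2 * D = d\<^sup>2 * (1 - (x * D)\<^sup>2 - (y * D)\<^sup>2 - (z * D)\<^sup>2)" by simp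
  then have rel: "d\<^sup>2 = d + x\<^sup>2 + y\<^sup>2 + z\<^sup>2" using D
    by (simp add: d_def field_simps power2_eq_square)
  have t: "tau 1 p = 2 * x" "tau 2 p = 2 * y" "tau 3 p = 2 * z"
    by (simp_all add: tau_def xyz D_def)
  define w where "w = (\<lambda>j. p $ j / D)"
  have pt: "pd m (tau j) p = (if m = j then 2 * d else 0) + 4 * w j * w m" for m j
    using pd_tau[OF p, of m j] by (simp add: D_def d_def w_def power2_eq_square)
  have w: "w 1 = x" "w 2 = y" "w 3 = z" by (simp_all add: w_def xyz)
  have c: "conf_factor p = 4 * d\<^sup>2" by (simp add: conf_factor_def d_def D_def power_divide)
  have "\<forall>j k. ricci hyp_metric p $ j $ k = ((- 2 * conf_factor p) *\<^sub>R mat 1) $ j $ k"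
    unfolding forall_3 ricci_def
    by (simp add: sum_3 pd_christoffel_hyp[OF p] christoffel_hyp[OF p] t pt w mat_def c rel)
       (simp add: power2_eq_square algebra_simps)
  then show ?thesis by (simp add: vec_eq_iff)
qed

section \<open>Fundamental forms in a conformal metric\<close>

lemma first_form_nth: "first_form hyp_metric X q $ i $ j = conf_factor (X q) * (pd i X q \<bullet> pd j X q)"
  by (simp add: first_form_def hyp_inner)

text \<open>Of the three terms of the contracted Christoffel symbol two are tangential and die
  against the normal; only the multiple of the position vector survives.\<close>

lemma second_form_hyp:
  assumes "norm (X q) < 1" and n: "\<And>i. unit_normal hyp_metric X q \<bullet> pd i X q = 0"
  shows "second_form hyp_metric X q $ i $ j = conf_factor (X q) * (pd i (pd j X) q \<bullet> unit_normal hyp_metric X q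
     - 2 / (1 - (norm (X q))\<^sup>2) * (X q \<bullet> unit_normal hyp_metric X q) * (pd i X q \<bullet> pd j X q))"
  unfolding second_form_def christoffel_contract[OF assms(1)] hyp_inner
  using n[of i] n[of j] by (simp add: inner_add_left inner_diff_left inner_commute algebra_simps)

section \<open>One-dimensional inequalities\<close>

lemma LBINT_from_zero_DERIV:
  fixes f :: "real \<Rightarrow> real"
  assumes "continuous_on UNIV f"
  shows "((\<lambda>s. LBINT t=ereal 0..ereal s. f t) has_real_derivative f s) (at s)"
proof -
  have "((\<lambda>s. LBINT t=ereal 0..ereal s. f t) has_vector_derivative f s)
      (at s within {- \<bar>s\<bar> - 1..\<bar>s\<bar> + 1})"
    by (rule interval_integral_FTC2) (use assms continuous_on_subset in auto)
  then have "((\<lambda>s. LBINT t=ereal 0..ereal s. f t) has_vector_derivative f s) (at s)"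
    by (subst (asm) at_within_Icc_at) auto
  then show ?thesis by (simp add: has_real_derivative_iff_has_vector_derivative)
qed

lemma continuous_on_if_DERIV: "(\<And>x. (f has_real_derivative f' x) (at x)) \<Longrightarrow> continuous_on A f"
  by (meson DERIV_continuous_on has_field_derivative_at_within)

text \<open>Completing the square in \<rho> (\<phi>' - P \<phi> / \<rho>)^2 \<ge> 0. If w is a
  positive solution or supersolution of (\<rho> w')' + r w = 0, then P = \<rho> w' / w satisfies the
  Riccati condition. Every lower bound for a one-dimensional form below is a choice of
  \<open>P\<close>.\<close>

lemma riccati_inequality:
  fixes \<rho> r P P' \<phi> \<phi>' :: "real \<Rightarrow> real"
  assumes "a \<le> b"
    and \<phi>: "\<And>s. s \<in> {a..b} \<Longrightarrow> (\<phi> has_real_derivative \<phi>' s) (at s)" "continuous_on {a..b} \<phi>'"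
    and P: "\<And>s. s \<in> {a..b} \<Longrightarrow> (P has_real_derivative P' s) (at s)"
    and pos: "\<And>s. s \<in> {a..b} \<Longrightarrow> 0 < \<rho> s" and \<rho>: "continuous_on {a..b} \<rho>" and r: "continuous_on {a..b} r"
    and ric: "\<And>s. s \<in> {a..b} \<Longrightarrow> P' s + (P s)\<^sup>2 / \<rho> s + r s \<le> 0"
  shows "P b * (\<phi> b)\<^sup>2 - P a * (\<phi> a)\<^sup>2 \<le> integral {a..b} (\<lambda>s. \<rho> s * (\<phi>' s)\<^sup>2 - r s * (\<phi> s)\<^sup>2)"
proof -
  have c: "continuous_on {a..b} \<phi>"
    using \<phi>(1) by (meson DERIV_continuous_on has_field_derivative_at_within)
  have "((\<lambda>s. P s * (\<phi> s)\<^sup>2) has_real_derivative P' s * (\<phi> s)\<^sup>2 + 2 * P s * \<phi> s * \<phi>' s) (at s within {a..b})"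
    if "s \<in> {a..b}" for s
    by (rule has_field_derivative_at_within) (auto intro!: derivative_eq_intros \<phi>(1) P that)
  then have 1: "((\<lambda>s. P' s * (\<phi> s)\<^sup>2 + 2 * P s * \<phi> s * \<phi>' s) has_integral P b * (\<phi> b)\<^sup>2 - P a * (\<phi> a)\<^sup>2) {a..b}"
    using assms(1) by (intro fundamental_theorem_of_calculus)
      (auto simp: has_real_derivative_iff_has_vector_derivative[symmetric])
  have 2: "(\<lambda>s. \<rho> s * (\<phi>' s)\<^sup>2 - r s * (\<phi> s)\<^sup>2) integrable_on {a..b}"
    by (intro integrable_continuous_interval continuous_intros \<rho> r c \<phi>)
  show ?thesis
  proof (rule has_integral_le[OF 1 integrable_integral[OF 2]])
    fix s assume s: "s \<in> {a..b}"
    have "0 \<le> \<rho> s * (\<phi>' s - P s * \<phi> s / \<rho> s)\<^sup>2" using pos[OF s] by simp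
    also have "\<dots> = \<rho> s * (\<phi>' s)\<^sup>2 - 2 * P s * \<phi> s * \<phi>' s + (P s)\<^sup>2 / \<rho> s * (\<phi> s)\<^sup>2"
      using pos[OF s] by (simp add: field_simps power2_eq_square)
    also have "\<dots> \<le> \<rho> s * (\<phi>' s)\<^sup>2 - 2 * P s * \<phi> s * \<phi>' s + (- P' s - r s) * (\<phi> s)\<^sup>2"
      using ric[OF s] by (intro add_left_mono mult_right_mono) auto
    finally show "P' s * (\<phi> s)\<^sup>2 + 2 * P s * \<phi> s * \<phi>' s \<le> \<rho> s * (\<phi>' s)\<^sup>2 - r s * (\<phi> s)\<^sup>2"
      by (simp add: algebra_simps)
  qed
qed

text \<open>The natural comparison function sin (t - t0) vanishes at both ends, where its Riccati
  function blows up. A slower sine of frequency k < 1, centred on the interval, stays positive and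
  gives the inequality with the factor k^2; then k is taken close to 1.\<close>

lemma wirtinger_dirichlet:
  fixes h h' :: "real \<Rightarrow> real"
  assumes h: "\<And>t. (h has_real_derivative h' t) (at t)" "continuous_on UNIV h'"
    and z: "h t0 = 0" "h (t0 + pi) = 0"
  shows "integral {t0..t0 + pi} (\<lambda>t. (h t)\<^sup>2) \<le> integral {t0..t0 + pi} (\<lambda>t. (h' t)\<^sup>2)"
proof -
  let ?A = "integral {t0..t0 + pi} (\<lambda>t. (h t)\<^sup>2)" and ?B = "integral {t0..t0 + pi} (\<lambda>t. (h' t)\<^sup>2)"
  have ch: "continuous_on A h" for A using h(1) by (rule continuous_on_if_DERIV)
  have ch': "continuous_on A h'" for A using h(2) continuous_on_subset by blast
  have k: "k\<^sup>2 * ?A \<le> ?B" if k: "0 < k" "k < 1" for k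
  proof -
    \<comment> \<open>The phase runs over an interval of length k pi centred at pi / 2.\<close>
    define \<alpha> where "\<alpha> = (\<lambda>t. k * (t - t0) + (1 - k) * pi / 2)"
    have sp: "sin (\<alpha> t) > 0" if t: "t \<in> {t0..t0 + pi}" for t
    proof (rule sin_gt_zero)
      have "0 \<le> k * (t - t0)" using k t by simp
      moreover have "k * (t - t0) \<le> k * pi" using k t by (intro mult_left_mono) auto
      moreover have "k * pi < 1 * pi" using k by (intro mult_strict_right_mono) auto
      moreover have "\<alpha> t = k * (t - t0) + pi / 2 - k * pi / 2" by (simp add: \<alpha>_def field_simps)
      ultimately show "0 < \<alpha> t" "\<alpha> t < pi" by linarith+
    qed
    have "k * cos (\<alpha> (t0 + pi)) / sin (\<alpha> (t0 + pi)) * (h (t0 + pi))\<^sup>2 - k * cos (\<alpha> t0) / sin (\<alpha> t0) * (h t0)\<^sup>2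
        \<le> integral {t0..t0 + pi} (\<lambda>s. 1 * (h' s)\<^sup>2 - k\<^sup>2 * (h s)\<^sup>2)"
    proof (rule riccati_inequality[where P = "\<lambda>t. k * cos (\<alpha> t) / sin (\<alpha> t)" and P' = "\<lambda>t. - (k\<^sup>2) / (sin (\<alpha> t))\<^sup>2"])
      fix t assume t: "t \<in> {t0..t0 + pi}"
      have "((\<lambda>t. k * cos (\<alpha> t) / sin (\<alpha> t)) has_real_derivative
          ((k * (- sin (\<alpha> t) * k)) * sin (\<alpha> t) - (k * cos (\<alpha> t)) * (cos (\<alpha> t) * k)) / (sin (\<alpha> t) * sin (\<alpha> t))) (at t)"
        using sp[OF t] unfolding \<alpha>_def by (auto intro!: derivative_eq_intros)
      moreover have "((k * (- sin (\<alpha> t) * k)) * sin (\<alpha> t) - (k * cos (\<alpha> t)) * (cos (\<alpha> t) * k)) / (sin (\<alpha> t) * sin (\<alpha> t))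
          = - (k\<^sup>2) * ((sin (\<alpha> t))\<^sup>2 + (cos (\<alpha> t))\<^sup>2) / (sin (\<alpha> t))\<^sup>2"
        unfolding power2_eq_square by (rule arg_cong2[where f="(/)"]) (algebra, rule refl)
      ultimately show "((\<lambda>t. k * cos (\<alpha> t) / sin (\<alpha> t)) has_real_derivative - (k\<^sup>2) / (sin (\<alpha> t))\<^sup>2) (at t)" by simp
      have "- (k\<^sup>2) / (sin (\<alpha> t))\<^sup>2 + (k * cos (\<alpha> t) / sin (\<alpha> t))\<^sup>2 / 1 + k\<^sup>2 = 0"
        using sp[OF t] by (simp add: power_divide power_mult_distrib cos_squared_eq field_simps)
      then show "- (k\<^sup>2) / (sin (\<alpha> t))\<^sup>2 + (k * cos (\<alpha> t) / sin (\<alpha> t))\<^sup>2 / 1 + k\<^sup>2 \<le> 0"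
        by simp
    qed (use h ch' in auto)
    also have "\<dots> = ?B - k\<^sup>2 * ?A"
      by (subst integral_diff) (auto intro!: integrable_continuous_interval continuous_intros ch ch')
    finally show ?thesis using z by simp
  qed
  have B0: "0 \<le> ?B" by (intro integral_nonneg integrable_continuous_interval continuous_intros ch') auto
  show ?thesis
  proof (rule ccontr)
    assume "\<not> ?thesis"
    then have AB: "?B < ?A" by simp
    \<comment> \<open>In place of a limit: this k^2 is the midpoint of \<open>?B / ?A\<close> and 1,
      which already contradicts the inequality for k.\<close>
    define k where "k = sqrt ((?A + ?B) / (2 * ?A))"
    have k2: "k\<^sup>2 = (?A + ?B) / (2 * ?A)" unfolding k_def using AB B0 by (intro real_sqrt_pow2) auto
    have "0 < k" "k < 1" unfolding k_def using AB B0 by (auto simp: field_simps)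
    from k[OF this] show False using AB B0 by (simp add: k2 field_simps)
  qed
qed

lemma integral_periodic:
  fixes f :: "real \<Rightarrow> real"
  assumes c: "continuous_on UNIV f" and per: "\<And>t. f (t + T) = f t" and "0 \<le> t0" "t0 \<le> T"
  shows "integral {t0..t0 + T} f = integral {0..T} f"
proof -
  have i: "f integrable_on {x..y}" for x y
    using c continuous_on_subset by (blast intro: integrable_continuous_interval)
  have "integral {T..t0 + T} f = integral {0..t0} (\<lambda>t. f (t + T))"
    using integral_shift_Icc_real[of 0 t0 f T] by (simp add: add.commute o_def)
  then have "integral {T..t0 + T} f = integral {0..t0} f" using per by simp
  moreover have "integral {t0..T} f + integral {T..t0 + T} f = integral {t0..t0 + T} f"
    using assms by (intro Henstock_Kurzweil_Integration.integral_combine i) auto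
  moreover have "integral {0..t0} f + integral {t0..T} f = integral {0..T} f"
    using assms by (intro Henstock_Kurzweil_Integration.integral_combine i) auto
  ultimately show ?thesis by simp
qed

text \<open>The difference h (t + pi) - h t takes opposite values at 0 and pi, so some t0 has h t0 =
  h (t0 + pi). Subtracting this common value gives Dirichlet data on two half periods, and for a
  function of mean zero the subtraction can only increase the square integral.\<close>

lemma wirtinger:
  fixes h h' :: "real \<Rightarrow> real"
  assumes h: "\<And>t. (h has_real_derivative h' t) (at t)" "continuous_on UNIV h'"
    and per: "\<And>t. h (t + 2 * pi) = h t" "\<And>t. h' (t + 2 * pi) = h' t"
    and mean: "integral {0..2 * pi} h = 0"
  shows "integral {0..2 * pi} (\<lambda>t. (h t)\<^sup>2) \<le> integral {0..2 * pi} (\<lambda>t. (h' t)\<^sup>2)"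
proof -
  have ch: "continuous_on A h" for A using h(1) by (rule continuous_on_if_DERIV)
  have ch': "continuous_on A h'" for A using h(2) continuous_on_subset by blast
  define d where "d = (\<lambda>t. h (t + pi) - h t)"
  have "d pi = - d 0" unfolding d_def using per(1)[of 0] by simp
  moreover have "continuous_on {0..pi} d" unfolding d_def
    by (intro continuous_intros ch continuous_on_compose2[OF ch[of UNIV]]) auto
  ultimately obtain t0 where t0: "0 \<le> t0" "t0 \<le> pi" "d t0 = 0"
    using IVT'[of d 0 0 pi] IVT2'[of d pi 0 0] by (cases "d 0 \<le> 0") auto
  define g where "g = (\<lambda>t. h t - h t0)"
  have g: "(g has_real_derivative h' t) (at t)" for t
    unfolding g_def by (auto intro!: derivative_eq_intros h)
  have cg: "continuous_on A g" for A using g by (rule continuous_on_if_DERIV)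
  have z: "g t0 = 0" "g (t0 + pi) = 0" "g (t0 + pi + pi) = 0"
    using t0(3) per(1)[of t0] by (auto simp: g_def d_def algebra_simps)
  have comb: "integral {t0..t0 + pi} f + integral {t0 + pi..t0 + pi + pi} f = integral {0..2 * pi} f"
    if "continuous_on UNIV f" "\<And>t. f (t + 2 * pi) = f t" for f :: "real \<Rightarrow> real"
  proof -
    have "integral {t0..t0 + pi} f + integral {t0 + pi..t0 + pi + pi} f = integral {t0..t0 + pi + pi} f"
      by (intro Henstock_Kurzweil_Integration.integral_combine integrable_continuous_interval continuous_on_subset[OF that(1)]) auto
    also have "\<dots> = integral {0..2 * pi} f"
      using integral_periodic[of f "2 * pi" t0] t0 that by (simp add: add.assoc)
    finally show ?thesis .
  qed
  have "integral {0..2 * pi} (\<lambda>t. (g t)\<^sup>2) \<le> integral {0..2 * pi} (\<lambda>t. (h' t)\<^sup>2)"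
    using wirtinger_dirichlet[OF g h(2) z(1,2)] wirtinger_dirichlet[OF g h(2) z(2,3)]
    by (subst (1 2) comb[symmetric]) (auto intro!: continuous_intros ch ch' simp: per g_def)
  moreover have "integral {0..2 * pi} (\<lambda>t. (g t)\<^sup>2)
      = integral {0..2 * pi} (\<lambda>t. (h t)\<^sup>2 - 2 * h t0 * h t + (h t0)\<^sup>2)"
    by (simp add: g_def power2_eq_square algebra_simps)
  moreover have "\<dots> = integral {0..2 * pi} (\<lambda>t. (h t)\<^sup>2) - 2 * h t0 * integral {0..2 * pi} h + 2 * pi * (h t0)\<^sup>2"
    by (subst integral_add integral_diff; (auto intro!: integrable_continuous_interval continuous_intros ch)?)+
  ultimately show ?thesis using mean by simp (smt (verit) mult_nonneg_nonneg pi_ge_zero zero_le_power2)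
qed

section \<open>The rotationally symmetric Jacobi equation\<close>

text \<open>For \<open>C = cosh (2 * a)\<close> the parallel at arc length \<open>s\<close> has the hyperbolic radius \<open>y\<close> with
  \<open>rho C s = sinh y\<close>, and \<open>pot C s\<close> is \<open>|A|\<^sup>2 + Ric\<close> there.  The derivative \<open>rho1\<close> of \<open>rho\<close> is the
  odd radial Jacobi field, induced by translation along the axis; reduction of order turns it into
  the even one, \<open>even_jacobi\<close>.\<close>

definition rho :: "real \<Rightarrow> real \<Rightarrow> real" where
  "rho C s = sqrt ((C * cosh (2 * s) - 1) / 2)"

definition rho1 :: "real \<Rightarrow> real \<Rightarrow> real" where
  "rho1 C s = C * sinh (2 * s) / (2 * rho C s)"

definition rho2 :: "real \<Rightarrow> real \<Rightarrow> real" where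
  "rho2 C s = rho C s + (C\<^sup>2 - 1) / (4 * rho C s ^ 3)"

definition pot :: "real \<Rightarrow> real \<Rightarrow> real" where
  "pot C s = (C\<^sup>2 - 1) / (2 * rho C s ^ 4) - 2"

text \<open>Reduction of order from \<open>rho1\<close> leads to an integral of 1 / (rho rho1^2),
  singular at 0. Up to a constant factor, integration by parts splits off the singular term
  \<open>cosh (2 * s) / rho1 C s\<close> and leaves this regular integral.\<close>

definition coshint :: "real \<Rightarrow> real \<Rightarrow> real" where
  "coshint C s = (LBINT t=ereal 0..ereal s. cosh (2 * t) / rho C t)"

text \<open>The part of \<open>coshint\<close> that stays bounded for s \<ge> 0: cosh is sinh plus
  the decaying exponential, and C sinh (2 t) / rho has the antiderivative 2 rho.\<close>

definition expint :: "real \<Rightarrow> real \<Rightarrow> real" where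
  "expint C s = (LBINT t=ereal 0..ereal s. exp (- (2 * t)) / rho C t)"

definition even_jacobi :: "real \<Rightarrow> real \<Rightarrow> real" where
  "even_jacobi C s = cosh (2 * s) - rho1 C s * coshint C s"

definition even_jacobi_deriv :: "real \<Rightarrow> real \<Rightarrow> real" where
  "even_jacobi_deriv C s = 2 * sinh (2 * s) - rho2 C s * coshint C s - rho1 C s * cosh (2 * s) / rho C s"

context
  fixes C :: real
  assumes C: "C > 1"
begin

lemma C_cosh_gt_1: "C * cosh x > 1"
  using C cosh_real_ge_1[of x] by (smt (verit) mult_le_cancel_left1)

lemma rho_pos: "rho C s > 0"
  using C_cosh_gt_1[of "2 * s"] by (simp add: rho_def)

lemma rho_nz [simp]: "rho C s \<noteq> 0"
  using rho_pos[of s] by simp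

lemma rho_sq: "(rho C s)\<^sup>2 = (C * cosh (2 * s) - 1) / 2"
  using C_cosh_gt_1[of "2 * s"] by (simp add: rho_def)

lemma C_cosh: "C * cosh (2 * s) = 2 * (rho C s)\<^sup>2 + 1"
  by (simp add: rho_sq field_simps)

lemma C_sinh: "C * sinh (2 * s) = 2 * rho C s * rho1 C s"
  by (simp add: rho1_def)

lemma rho_DERIV: "(rho C has_real_derivative rho1 C s) (at s)"
proof -
  have "((\<lambda>s. sqrt ((C * cosh (2 * s) - 1) / 2)) has_real_derivative
      inverse (rho C s) / 2 * (C * sinh (2 * s))) (at s)"
    using C_cosh_gt_1[of "2 * s"] by (auto intro!: derivative_eq_intros simp: rho_def)
  moreover have "inverse (rho C s) / 2 * (C * sinh (2 * s)) = rho1 C s"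
    by (simp add: rho1_def field_simps)
  ultimately show ?thesis unfolding rho_def[abs_def] by simp
qed

lemma rho1_sq: "(rho1 C s)\<^sup>2 = (rho C s)\<^sup>2 + 1 - (C\<^sup>2 - 1) / (4 * (rho C s)\<^sup>2)"
proof -
  have "(2 * rho C s * rho1 C s)\<^sup>2 = C\<^sup>2 * (sinh (2 * s))\<^sup>2"
    by (simp add: C_sinh[symmetric] power_mult_distrib)
  also have "\<dots> = (C * cosh (2 * s))\<^sup>2 - C\<^sup>2"
    by (simp add: sinh_square_eq algebra_simps power_mult_distrib)
  also have "\<dots> = (2 * (rho C s)\<^sup>2 + 1)\<^sup>2 - C\<^sup>2" by (simp add: C_cosh)
  finally show ?thesis by (simp add: field_simps power2_eq_square)
qed

lemma rho1_DERIV: "(rho1 C has_real_derivative rho2 C s) (at s)"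
proof -
  have "((\<lambda>s. C * sinh (2 * s) / (2 * rho C s)) has_real_derivative
      (C * (cosh (2 * s) * 2) * (2 * rho C s) - C * sinh (2 * s) * (2 * rho1 C s)) / (2 * rho C s * (2 * rho C s))) (at s)"
    by (auto intro!: derivative_eq_intros rho_DERIV)
  moreover have "(C * (cosh (2 * s) * 2) * (2 * rho C s) - C * sinh (2 * s) * (2 * rho1 C s)) / (2 * rho C s * (2 * rho C s))
      = (C * cosh (2 * s) - (rho1 C s)\<^sup>2) / rho C s"
    by (simp add: rho1_def field_simps power2_eq_square)
  moreover have "\<dots> = rho2 C s"
    unfolding C_cosh rho1_sq rho2_def by (simp add: field_simps eval_nat_numeral)
  ultimately show ?thesis unfolding rho1_def[abs_def] by simp
qed

lemma rho_cont: "continuous_on A (rho C)"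
  using rho_DERIV by (rule continuous_on_if_DERIV)
lemma rho1_cont: "continuous_on A (rho1 C)"
  using rho1_DERIV by (rule continuous_on_if_DERIV)
lemma pot_cont: "continuous_on A (pot C)"
  unfolding pot_def[abs_def] by (intro continuous_intros rho_cont) simp

lemma rho_even: "rho C (- s) = rho C s" by (simp add: rho_def)
lemma rho1_odd: "rho1 C (- s) = - rho1 C s" by (simp add: rho1_def rho_even)

lemma coshint_DERIV: "(coshint C has_real_derivative cosh (2 * s) / rho C s) (at s)"
  unfolding coshint_def[abs_def]
  by (rule LBINT_from_zero_DERIV) (intro continuous_intros rho_cont, simp)

lemma expint_DERIV: "(expint C has_real_derivative exp (- (2 * s)) / rho C s) (at s)"
  unfolding expint_def[abs_def]
  by (rule LBINT_from_zero_DERIV) (intro continuous_intros rho_cont, simp)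

lemma coshint_0 [simp]: "coshint C 0 = 0" by (simp add: coshint_def)
lemma expint_0 [simp]: "expint C 0 = 0" by (simp add: expint_def)

lemma coshint_odd: "coshint C (- s) = - coshint C s"
proof -
  have "((\<lambda>s. coshint C (- s) + coshint C s) has_real_derivative
      cosh (2 * - s) / rho C (- s) * (- 1) + cosh (2 * s) / rho C s) (at s)" for s
    by (intro derivative_intros DERIV_chain2[OF coshint_DERIV] coshint_DERIV)
  then have "((\<lambda>s. coshint C (- s) + coshint C s) has_real_derivative 0) (at s)" for s
    by (simp add: rho_even)
  then have "coshint C (- s) + coshint C s = coshint C (- 0) + coshint C 0"
    by (intro DERIV_isconst_all) blast
  then show ?thesis by simp
qed

lemma even_jacobi_even: "even_jacobi C (- s) = even_jacobi C s"
  by (simp add: even_jacobi_def coshint_odd rho1_odd)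

lemma even_jacobi_0 [simp]: "even_jacobi C 0 = 1" by (simp add: even_jacobi_def)

lemma even_jacobi_DERIV: "(even_jacobi C has_real_derivative even_jacobi_deriv C s) (at s)"
  unfolding even_jacobi_def[abs_def] even_jacobi_deriv_def
  by (auto intro!: derivative_eq_intros rho1_DERIV coshint_DERIV)

text \<open>With \<open>rho1\<close> and \<open>rho2\<close> eliminated, only \<open>rho\<close>,
  \<open>coshint\<close> and a hyperbolic sine remain, whose derivatives are at hand for the second
  differentiation.\<close>

lemma rho_even_jacobi_deriv: "rho C s * even_jacobi_deriv C s = sinh (2 * s) * (rho C s - 1 / (2 * rho C s))
    - ((rho C s)\<^sup>2 + (C\<^sup>2 - 1) / (4 * (rho C s)\<^sup>2)) * coshint C s"
proof -
  have "rho1 C s * cosh (2 * s) = sinh (2 * s) * (2 * (rho C s)\<^sup>2 + 1) / (2 * rho C s)"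
    unfolding C_cosh[symmetric] by (simp add: rho1_def)
  moreover have "rho C s * even_jacobi_deriv C s = 2 * rho C s * sinh (2 * s) - rho C s * rho2 C s * coshint C s - rho1 C s * cosh (2 * s)"
    by (simp add: even_jacobi_deriv_def field_simps)
  moreover have "rho C s * rho2 C s = (rho C s)\<^sup>2 + (C\<^sup>2 - 1) / (4 * (rho C s)\<^sup>2)"
    by (simp add: rho2_def field_simps eval_nat_numeral)
  moreover have "sinh (2 * s) * (2 * (rho C s)\<^sup>2 + 1) / (2 * rho C s) = sinh (2 * s) * (rho C s + 1 / (2 * rho C s))"
    by (simp add: field_simps power2_eq_square)
  ultimately show ?thesis by (simp add: algebra_simps)
qed

text \<open>Beyond field arithmetic one identity is needed: sinh times \<open>rho1\<close> is
  rewritten, by cosh^2 - sinh^2 = 1 and C cosh = 2 rho^2 + 1, so that all terms become multiples of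
  cosh or of \<open>coshint\<close>. The result is the Jacobi equation in the divergence form (rho
  w')' + rho pot w = 0.\<close>

lemma even_jacobi_deriv_DERIV: "((\<lambda>s. rho C s * even_jacobi_deriv C s) has_real_derivative - (rho C s * pot C s * even_jacobi C s)) (at s)"
proof -
  let ?r = "rho C s" and ?r1 = "rho1 C s" and ?c = "cosh (2 * s)" and ?h = "sinh (2 * s)" and ?K = "coshint C s"
  have D: "((\<lambda>s. sinh (2 * s) * (rho C s - 1 / (2 * rho C s))
    - ((rho C s)\<^sup>2 + (C\<^sup>2 - 1) / (4 * (rho C s)\<^sup>2)) * coshint C s) has_real_derivative
     (2 * ?c * (?r - 1 / (2 * ?r)) + ?h * (?r1 + ?r1 / (2 * ?r\<^sup>2))
      - (2 * ?r * ?r1 - (C\<^sup>2 - 1) * ?r1 / (2 * ?r ^ 3)) * ?K - (?r\<^sup>2 + (C\<^sup>2 - 1) / (4 * ?r\<^sup>2)) * (?c / ?r))) (at s)"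
    by (rule derivative_eq_intros rho_DERIV coshint_DERIV refl | simp)+
       (simp add: field_simps eval_nat_numeral)
  have "?h * ?r1 = C * (?c\<^sup>2 - 1) / (2 * ?r)"
    by (simp add: rho1_def power2_eq_square[of ?h, symmetric] sinh_square_eq)
  then have "?h * ?r1 = (?c * (2 * ?r\<^sup>2 + 1) - C) / (2 * ?r)"
    unfolding C_cosh[symmetric] by (simp add: power2_eq_square algebra_simps)
  moreover have "?h * (?r1 + ?r1 / (2 * ?r\<^sup>2)) = (?h * ?r1) * (1 + 1 / (2 * ?r\<^sup>2))"
    by (simp add: field_simps)
  ultimately have "?h * (?r1 + ?r1 / (2 * ?r\<^sup>2)) = (?c * (2 * ?r\<^sup>2 + 1) - C) / (2 * ?r) * (1 + 1 / (2 * ?r\<^sup>2))"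
    by simp
  also have "\<dots> = (?c * (2 * ?r\<^sup>2 + 1) - C) * (2 * ?r\<^sup>2 + 1) / (4 * ?r ^ 3)"
    by (simp add: divide_simps eval_nat_numeral)
  also have "\<dots> = ?c * ((2 * ?r\<^sup>2 + 1)\<^sup>2 - C\<^sup>2) / (4 * ?r ^ 3)"
  proof -
    have "C * (2 * ?r\<^sup>2 + 1) = C\<^sup>2 * ?c" by (simp only: C_cosh[symmetric]) (simp add: power2_eq_square)
    then show ?thesis by (simp add: algebra_simps power2_eq_square)
  qed
  finally have "?h * (?r1 + ?r1 / (2 * ?r\<^sup>2)) = ?c * ((2 * ?r\<^sup>2 + 1)\<^sup>2 - C\<^sup>2) / (4 * ?r ^ 3)" .
  then have "2 * ?c * (?r - 1 / (2 * ?r)) + ?h * (?r1 + ?r1 / (2 * ?r\<^sup>2))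
      - (2 * ?r * ?r1 - (C\<^sup>2 - 1) * ?r1 / (2 * ?r ^ 3)) * ?K - (?r\<^sup>2 + (C\<^sup>2 - 1) / (4 * ?r\<^sup>2)) * (?c / ?r)
      = 2 * ?c * (?r - 1 / (2 * ?r)) + ?c * ((2 * ?r\<^sup>2 + 1)\<^sup>2 - C\<^sup>2) / (4 * ?r ^ 3)
      - (2 * ?r * ?r1 - (C\<^sup>2 - 1) * ?r1 / (2 * ?r ^ 3)) * ?K - (?r\<^sup>2 + (C\<^sup>2 - 1) / (4 * ?r\<^sup>2)) * (?c / ?r)"
    by (simp only:)
  also have "\<dots> = - (?r * pot C s * even_jacobi C s)"
    unfolding pot_def even_jacobi_def by (simp add: field_simps eval_nat_numeral)
  finally have E: "2 * ?c * (?r - 1 / (2 * ?r)) + ?h * (?r1 + ?r1 / (2 * ?r\<^sup>2))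
      - (2 * ?r * ?r1 - (C\<^sup>2 - 1) * ?r1 / (2 * ?r ^ 3)) * ?K - (?r\<^sup>2 + (C\<^sup>2 - 1) / (4 * ?r\<^sup>2)) * (?c / ?r)
      = - (?r * pot C s * even_jacobi C s)" .
  show ?thesis using D unfolding rho_even_jacobi_deriv E .
qed

text \<open>As \<open>rho2\<close> is the derivative of \<open>rho1\<close>, this is the same Jacobi
  equation, now for the odd field.\<close>

lemma rho_rho2_DERIV: "((\<lambda>s. rho C s * rho2 C s) has_real_derivative - (rho C s * pot C s * rho1 C s)) (at s)"
proof -
  have e: "rho C s * rho2 C s = (rho C s)\<^sup>2 + (C\<^sup>2 - 1) / (4 * (rho C s)\<^sup>2)" for s
    by (simp add: rho2_def field_simps eval_nat_numeral)
  have "((\<lambda>s. (rho C s)\<^sup>2 + (C\<^sup>2 - 1) / (4 * (rho C s)\<^sup>2)) has_real_derivative - (rho C s * pot C s * rho1 C s)) (at s)"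
    by (rule derivative_eq_intros rho_DERIV refl | simp)+
       (simp add: pot_def field_simps eval_nat_numeral)
  then show ?thesis by (simp add: e)
qed

text \<open>Because cosh - sinh is a decaying exponential and C sinh (2 s) / rho is the derivative
  of 2 rho, the unbounded part of \<open>coshint\<close> can be absorbed. What remains is a decaying
  term plus the growing \<open>rho1\<close> times a bracket with a limit, which makes the sign at
  infinity visible.\<close>

lemma even_jacobi_eq: "C * even_jacobi C s = C * exp (- (2 * s)) + rho1 C s * (2 * rho C 0 - C * expint C s)"
proof -
  have "((\<lambda>s. 2 * rho C s + C * expint C s - C * coshint C s) has_real_derivative
     2 * rho1 C s + C * (exp (- (2 * s)) / rho C s) - C * (cosh (2 * s) / rho C s)) (at s)" for s
    by (intro derivative_intros DERIV_cmult rho_DERIV coshint_DERIV expint_DERIV)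
  moreover have "2 * rho1 C s + C * (exp (- (2 * s)) / rho C s) - C * (cosh (2 * s) / rho C s)
     = C * (sinh (2 * s) + exp (- (2 * s)) - cosh (2 * s)) / rho C s" for s
    by (simp add: rho1_def field_simps)
  moreover have "sinh (2 * s) + exp (- (2 * s)) - cosh (2 * s) = 0" for s :: real
    by (simp add: sinh_field_def cosh_field_def field_simps)
  ultimately have "((\<lambda>s. 2 * rho C s + C * expint C s - C * coshint C s) has_real_derivative 0) (at s)" for s
    by simp
  then have "2 * rho C s + C * expint C s - C * coshint C s = 2 * rho C 0 + C * expint C 0 - C * coshint C 0"
    by (intro DERIV_isconst_all) blast
  then have "C * coshint C s = 2 * rho C s + C * expint C s - 2 * rho C 0" by simp
  then have "C * even_jacobi C s = C * cosh (2 * s) - rho1 C s * (2 * rho C s + C * expint C s - 2 * rho C 0)"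
    unfolding even_jacobi_def by algebra
  also have "\<dots> = C * cosh (2 * s) - C * sinh (2 * s) + rho1 C s * (2 * rho C 0 - C * expint C s)"
    unfolding C_sinh by (simp add: algebra_simps)
  also have "C * cosh (2 * s) - C * sinh (2 * s) = C * exp (- (2 * s))"
    by (simp add: sinh_field_def cosh_field_def field_simps)
  finally show ?thesis .
qed

end

context
  fixes C :: real
  assumes C: "C > 1"
begin

section \<open>Radial quadratic forms by Riccati comparison\<close>

lemma C_sq: "C\<^sup>2 > 1" using C by (simp add: power2_eq_square less_1_mult)

lemma rho2_pos: "rho2 C s > 0"
  unfolding rho2_def using rho_pos[OF C, of s] C_sq by (intro add_pos_pos divide_pos_pos) auto

lemma rho1_strict_mono: "x < y \<Longrightarrow> rho1 C x < rho1 C y"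
  using DERIV_pos_imp_increasing[of x y "rho1 C"] rho1_DERIV[OF C] rho2_pos by blast

lemma rho1_0 [simp]: "rho1 C 0 = 0" by (simp add: rho1_def)

lemma rho1_pos: "0 < s \<Longrightarrow> 0 < rho1 C s" using rho1_strict_mono[of 0 s] by simp
lemma rho1_nonneg: "0 \<le> s \<Longrightarrow> 0 \<le> rho1 C s" using rho1_pos[of s] by (cases "s = 0") auto

lemma even_jacobi_cont: "continuous_on A (even_jacobi C)" using even_jacobi_DERIV[OF C] by (rule continuous_on_if_DERIV)

text \<open>The term 1 / rho is the angular energy of frequency one, the least among the nonzero
  frequencies. The Riccati function of w = 1 / rho is - \<open>rho1\<close>, and the left side of
  the Riccati condition is then exactly - 2 rho.\<close>

lemma mode1_nonneg:
  fixes \<phi> \<phi>' :: "real \<Rightarrow> real"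
  assumes "0 \<le> S" and \<phi>: "\<And>s. (\<phi> has_real_derivative \<phi>' s) (at s)" "continuous_on UNIV \<phi>'"
    and z: "\<phi> S = 0" "\<phi> (- S) = 0"
  shows "0 \<le> integral {- S..S} (\<lambda>s. rho C s * (\<phi>' s)\<^sup>2 - (rho C s * pot C s - 1 / rho C s) * (\<phi> s)\<^sup>2)"
proof -
  have ric: "- rho2 C s + (- rho1 C s)\<^sup>2 / rho C s + (rho C s * pot C s - 1 / rho C s) \<le> 0" for s
  proof -
    have "- rho2 C s + (- rho1 C s)\<^sup>2 / rho C s + (rho C s * pot C s - 1 / rho C s) = - 2 * rho C s"
      unfolding power2_minus rho1_sq[OF C] rho2_def pot_def
      using rho_nz[OF C, of s] by (simp add: field_simps eval_nat_numeral)
    then show ?thesis using rho_pos[OF C, of s] by simp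
  qed
  have "- rho1 C S * (\<phi> S)\<^sup>2 - (- rho1 C (- S)) * (\<phi> (- S))\<^sup>2 \<le>
      integral {- S..S} (\<lambda>s. rho C s * (\<phi>' s)\<^sup>2 - (rho C s * pot C s - 1 / rho C s) * (\<phi> s)\<^sup>2)"
    by (rule riccati_inequality[where P' = "\<lambda>s. - rho2 C s"])
      (use \<open>0 \<le> S\<close> ric in \<open>auto intro!: \<phi> continuous_on_subset[OF \<phi>(2)] DERIV_minus rho1_DERIV C rho_pos
         rho_cont pot_cont continuous_intros simp: rho_nz[OF C]\<close>)
  then show ?thesis using z by simp
qed

text \<open>For an exact solution the quotient rho w' / w satisfies the Riccati condition with
  equality, and its boundary terms drop out because \<open>\<phi>\<close> vanishes at both
  ends.\<close>

lemma mode0_nonneg_if_positive_solution: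
  fixes \<phi> \<phi>' w w1 :: "real \<Rightarrow> real"
  assumes "a \<le> b" and \<phi>: "\<And>s. (\<phi> has_real_derivative \<phi>' s) (at s)" "continuous_on UNIV \<phi>'"
    and z: "\<phi> a = 0" "\<phi> b = 0"
    and w: "\<And>s. (w has_real_derivative w1 s) (at s)"
      "\<And>s. ((\<lambda>s. rho C s * w1 s) has_real_derivative - (rho C s * pot C s * w s)) (at s)"
    and pos: "\<And>s. s \<in> {a..b} \<Longrightarrow> w s > 0"
  shows "0 \<le> integral {a..b} (\<lambda>s. rho C s * (\<phi>' s)\<^sup>2 - rho C s * pot C s * (\<phi> s)\<^sup>2)"
proof -
  define P' where "P' = (\<lambda>s. (- (rho C s * pot C s * w s) * w s - rho C s * w1 s * w1 s) / (w s * w s))"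
  have ric: "P' s + (rho C s * w1 s / w s)\<^sup>2 / rho C s + rho C s * pot C s \<le> 0" if "s \<in> {a..b}" for s
    using pos[OF that] rho_nz[OF C, of s] by (simp add: P'_def field_simps power2_eq_square)
  have D: "((\<lambda>s. rho C s * w1 s / w s) has_real_derivative P' s) (at s)" if "s \<in> {a..b}" for s
    unfolding P'_def using pos[OF that] by (intro DERIV_divide w) auto
  have "(rho C b * w1 b / w b) * (\<phi> b)\<^sup>2 - (rho C a * w1 a / w a) * (\<phi> a)\<^sup>2 \<le>
      integral {a..b} (\<lambda>s. rho C s * (\<phi>' s)\<^sup>2 - rho C s * pot C s * (\<phi> s)\<^sup>2)"
    by (rule riccati_inequality[where P = "\<lambda>s. rho C s * w1 s / w s" and P' = P'])
      (use \<open>a \<le> b\<close> ric in \<open>auto intro!: \<phi> continuous_on_subset[OF \<phi>(2)] D rho_pos C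
         rho_cont pot_cont continuous_intros\<close>)
  then show ?thesis using z by simp
qed

text \<open>\<open>rho1\<close> is positive for s > 0 but vanishes at 0, where its Riccati quotient
  is singular. A small multiple of the even field, which is 1 at 0, restores strict positivity on
  the closed interval.\<close>

lemma rho1_plus_even_jacobi_positive:
  "\<exists>\<delta>>0. \<forall>s\<in>{0..S}. rho1 C s + \<delta> * even_jacobi C s > 0"
proof -
  have "isCont (even_jacobi C) 0" using even_jacobi_DERIV[OF C] DERIV_isCont by blast
  then have "(even_jacobi C \<longlongrightarrow> 1) (at 0)" by (simp add: isCont_def even_jacobi_0[OF C])
  then have "eventually (\<lambda>s. even_jacobi C s > 0) (at 0)" by (rule order_tendstoD) simp
  then obtain \<eta> where \<eta>: "\<eta> > 0" "\<And>s. s \<noteq> 0 \<Longrightarrow> \<bar>s\<bar> < \<eta> \<Longrightarrow> even_jacobi C s > 0"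
    by (auto simp: eventually_at dist_real_def)
  have \<eta>': "even_jacobi C s > 0" if "\<bar>s\<bar> < \<eta>" for s using \<eta>(2)[of s] that even_jacobi_0[OF C] by (cases "s = 0") auto
  have "bounded (even_jacobi C ` {0..S})" by (intro compact_imp_bounded compact_continuous_image even_jacobi_cont) simp
  then obtain B where B: "B > 0" "\<And>s. s \<in> {0..S} \<Longrightarrow> \<bar>even_jacobi C s\<bar> \<le> B"
    unfolding bounded_pos by auto
  \<comment> \<open>The field is at most \<open>B\<close> in modulus, so the perturbation costs at
    most half of the value of \<open>rho1\<close> at \<eta> / 2, which bounds \<open>rho1\<close>
    from below away from 0.\<close>
  define \<delta> where "\<delta> = rho1 C (\<eta> / 2) / (2 * B)"
  have d: "\<delta> > 0" unfolding \<delta>_def using B \<eta>(1) rho1_pos[of "\<eta> / 2"] by simp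
  show ?thesis
  proof (intro exI[of _ \<delta>] conjI ballI d)
    fix s assume s: "s \<in> {0..S}"
    show "rho1 C s + \<delta> * even_jacobi C s > 0"
    proof (cases "s < \<eta>")
      case True
      then show ?thesis using \<eta>'[of s] rho1_nonneg[of s] d s by (intro add_nonneg_pos mult_pos_pos) auto
    next
      case False
      then have "rho1 C (\<eta> / 2) < rho1 C s" using \<eta>(1) by (intro rho1_strict_mono) auto
      moreover have "\<delta> * (- even_jacobi C s) \<le> \<delta> * B" using B(2)[OF s] d by (intro mult_left_mono) auto
      moreover have "\<delta> * B = rho1 C (\<eta> / 2) / 2" using B(1) by (simp add: \<delta>_def)
      ultimately show ?thesis using rho1_pos[of "\<eta> / 2"] \<eta>(1) by simp
    qed
  qed
qed

text \<open>Each half of the interval has its own positive solution: a perturbation of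
  \<open>rho1\<close> on the right, its reflection on the left. Their Riccati functions do not match
  at 0, and the condition \<open>\<phi> 0 = 0\<close> removes the jump.\<close>

lemma mode0_nonneg:
  fixes \<phi> \<phi>' :: "real \<Rightarrow> real"
  assumes "0 \<le> S" and \<phi>: "\<And>s. (\<phi> has_real_derivative \<phi>' s) (at s)" "continuous_on UNIV \<phi>'"
    and z: "\<phi> S = 0" "\<phi> (- S) = 0" "\<phi> 0 = 0"
  shows "0 \<le> integral {- S..S} (\<lambda>s. rho C s * (\<phi>' s)\<^sup>2 - rho C s * pot C s * (\<phi> s)\<^sup>2)"
proof -
  obtain \<delta> where \<delta>: "\<delta> > 0" "\<And>s. s \<in> {0..S} \<Longrightarrow> rho1 C s + \<delta> * even_jacobi C s > 0"
    using rho1_plus_even_jacobi_positive[of S] by blast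
  have sol: "((\<lambda>s. e * rho1 C s + \<delta> * even_jacobi C s) has_real_derivative e * rho2 C s + \<delta> * even_jacobi_deriv C s) (at s)"
    "((\<lambda>s. rho C s * (e * rho2 C s + \<delta> * even_jacobi_deriv C s)) has_real_derivative
       - (rho C s * pot C s * (e * rho1 C s + \<delta> * even_jacobi C s))) (at s)" for e s
  proof -
    show "((\<lambda>s. e * rho1 C s + \<delta> * even_jacobi C s) has_real_derivative e * rho2 C s + \<delta> * even_jacobi_deriv C s) (at s)"
      by (intro DERIV_add DERIV_cmult rho1_DERIV even_jacobi_DERIV C)
    have "((\<lambda>s. e * (rho C s * rho2 C s) + \<delta> * (rho C s * even_jacobi_deriv C s)) has_real_derivative
       e * (- (rho C s * pot C s * rho1 C s)) + \<delta> * (- (rho C s * pot C s * even_jacobi C s))) (at s)"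
      by (intro DERIV_add DERIV_cmult rho_rho2_DERIV even_jacobi_deriv_DERIV C)
    then show "((\<lambda>s. rho C s * (e * rho2 C s + \<delta> * even_jacobi_deriv C s)) has_real_derivative
       - (rho C s * pot C s * (e * rho1 C s + \<delta> * even_jacobi C s))) (at s)"
      by (simp add: algebra_simps)
  qed
  let ?f = "\<lambda>s. rho C s * (\<phi>' s)\<^sup>2 - rho C s * pot C s * (\<phi> s)\<^sup>2"
  have "0 \<le> integral {0..S} ?f"
    by (rule mode0_nonneg_if_positive_solution[OF assms(1) \<phi> z(3) z(1) sol[where e = 1]])
       (use \<delta>(2) in auto)
  moreover have "0 \<le> integral {- S..0} ?f"
  proof (rule mode0_nonneg_if_positive_solution[OF _ \<phi> z(2) z(3) sol[where e = "-1"]])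
    fix s assume "s \<in> {- S..0}"
    then show "- 1 * rho1 C s + \<delta> * even_jacobi C s > 0"
      using \<delta>(2)[of "- s"] by (simp add: rho1_odd[OF C] even_jacobi_even[OF C])
  qed (use assms(1) in auto)
  moreover have "continuous_on {- S..S} ?f"
    by (intro continuous_intros rho_cont pot_cont C continuous_on_subset[OF \<phi>(2)] continuous_on_if_DERIV[OF \<phi>(1)]) auto
  then have "integral {- S..0} ?f + integral {0..S} ?f = integral {- S..S} ?f"
    using assms(1) by (intro Henstock_Kurzweil_Integration.integral_combine integrable_continuous_interval) auto
  ultimately show ?thesis by linarith
qed

text \<open>The weighted mass of the even field between 0 and s, odd in s. It supplies a correction
  of the Riccati function that buys a positive gap.\<close>

definition "even_jacobi_mass s = (LBINT t=ereal 0..ereal s. rho C t * (even_jacobi C t)\<^sup>2)"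

lemma even_jacobi_mass_DERIV: "(even_jacobi_mass has_real_derivative rho C s * (even_jacobi C s)\<^sup>2) (at s)"
  unfolding even_jacobi_mass_def[abs_def] by (rule LBINT_from_zero_DERIV) (intro continuous_intros rho_cont even_jacobi_cont C)

lemma even_jacobi_mass_0 [simp]: "even_jacobi_mass 0 = 0" by (simp add: even_jacobi_mass_def)

lemma even_jacobi_mass_odd: "even_jacobi_mass (- s) = - even_jacobi_mass s"
proof -
  have "((\<lambda>s. even_jacobi_mass (- s) + even_jacobi_mass s) has_real_derivative
      rho C (- s) * (even_jacobi C (- s))\<^sup>2 * (- 1) + rho C s * (even_jacobi C s)\<^sup>2) (at s)" for s
    by (intro derivative_intros DERIV_chain2[OF even_jacobi_mass_DERIV] even_jacobi_mass_DERIV)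
  then have "((\<lambda>s. even_jacobi_mass (- s) + even_jacobi_mass s) has_real_derivative 0) (at s)" for s
    by (simp add: rho_even[OF C] even_jacobi_even[OF C])
  then have "even_jacobi_mass (- s) + even_jacobi_mass s = even_jacobi_mass (- 0) + even_jacobi_mass 0"
    by (intro DERIV_isconst_all) blast
  then show ?thesis by simp
qed

text \<open>The Riccati function of w = \<open>even_jacobi\<close> is corrected by - \<delta> m /
  w^2, with m the mass. The terms linear in m cancel, the derivative of m contributes - \<delta>
  rho, and the term quadratic in m is at most \<delta>^2 B^2 rho by the mass bound. The surplus
  \<delta> - \<delta>^2 B^2 is the gap.\<close>

lemma radial_spectral_gap:
  fixes \<phi> \<phi>' :: "real \<Rightarrow> real"
  assumes "0 \<le> S" and \<phi>: "\<And>s. (\<phi> has_real_derivative \<phi>' s) (at s)" "continuous_on UNIV \<phi>'"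
    and z: "\<phi> S = 0" "\<phi> (- S) = 0"
    and pos: "\<And>s. s \<in> {- S..S} \<Longrightarrow> even_jacobi C s > 0"
    and B: "B > 0" "\<And>s. s \<in> {- S..S} \<Longrightarrow> \<bar>even_jacobi_mass s\<bar> \<le> B * (rho C s * (even_jacobi C s)\<^sup>2)"
  shows "1 / (4 * B\<^sup>2) * integral {- S..S} (\<lambda>s. rho C s * (\<phi> s)\<^sup>2)
    \<le> integral {- S..S} (\<lambda>s. rho C s * (\<phi>' s)\<^sup>2 - rho C s * pot C s * (\<phi> s)\<^sup>2)"
proof -
  \<comment> \<open>This value maximizes \<delta> - \<delta>^2 B^2; the maximum is
    \<open>c\<close>.\<close>
  define \<delta> where "\<delta> = 1 / (2 * B\<^sup>2)"
  define c where "c = 1 / (4 * B\<^sup>2)"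
  have cont: "continuous_on {- S..S} \<phi>'" "continuous_on {- S..S} \<phi>"
    using continuous_on_subset[OF \<phi>(2)] continuous_on_if_DERIV[OF \<phi>(1)] by auto
  define P where "P = (\<lambda>s. rho C s * even_jacobi_deriv C s / even_jacobi C s - \<delta> * (even_jacobi_mass s / (even_jacobi C s)\<^sup>2))"
  define P' where "P' = (\<lambda>s. (- (rho C s * pot C s * even_jacobi C s) * even_jacobi C s - rho C s * even_jacobi_deriv C s * even_jacobi_deriv C s) / (even_jacobi C s * even_jacobi C s)
     - \<delta> * ((rho C s * (even_jacobi C s)\<^sup>2 * (even_jacobi C s)\<^sup>2 - even_jacobi_mass s * (2 * even_jacobi C s * even_jacobi_deriv C s)) / ((even_jacobi C s)\<^sup>2 * (even_jacobi C s)\<^sup>2)))"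
  have D: "(P has_real_derivative P' s) (at s)" if "s \<in> {- S..S}" for s
  proof -
    have "((\<lambda>s. (even_jacobi C s)\<^sup>2) has_real_derivative 2 * even_jacobi C s * even_jacobi_deriv C s) (at s)"
      by (auto intro!: derivative_eq_intros even_jacobi_DERIV C)
    then show ?thesis
      unfolding P_def P'_def using pos[OF that]
      by (intro DERIV_diff DERIV_divide DERIV_cmult even_jacobi_mass_DERIV even_jacobi_DERIV even_jacobi_deriv_DERIV C) auto
  qed
  have ric: "P' s + (P s)\<^sup>2 / rho C s + rho C s * (pot C s + c) \<le> 0" if s: "s \<in> {- S..S}" for s
  proof -
    let ?x = "even_jacobi C s" and ?r = "rho C s" and ?m = "even_jacobi_mass s"
    have nz: "?x \<noteq> 0" "?r \<noteq> 0" using pos[OF s] rho_pos[OF C, of s] by auto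
    have "P' s + (P s)\<^sup>2 / ?r + ?r * (pot C s + c) = ?r * c - \<delta> * ?r + \<delta>\<^sup>2 * ((?m)\<^sup>2 / (?r * ?x ^ 4))"
      unfolding P_def P'_def using nz by (simp add: field_simps eval_nat_numeral)
    also have "(?m)\<^sup>2 / (?r * ?x ^ 4) \<le> (B * (?r * ?x\<^sup>2))\<^sup>2 / (?r * ?x ^ 4)"
      using B(2)[OF s] rho_pos[OF C, of s] pos[OF s] B(1)
      by (intro divide_right_mono abs_le_square_iff[THEN iffD1]) auto
    also have "\<dots> = B\<^sup>2 * ?r" using nz by (simp add: field_simps eval_nat_numeral)
    also have "?r * c - \<delta> * ?r + \<delta>\<^sup>2 * (B\<^sup>2 * ?r) = 0"
      using B(1) by (simp add: c_def \<delta>_def field_simps eval_nat_numeral)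
    finally show ?thesis by (simp add: mult_left_mono)
  qed
  have "P S * (\<phi> S)\<^sup>2 - P (- S) * (\<phi> (- S))\<^sup>2 \<le>
      integral {- S..S} (\<lambda>s. rho C s * (\<phi>' s)\<^sup>2 - rho C s * (pot C s + c) * (\<phi> s)\<^sup>2)"
    by (rule riccati_inequality[where P' = P'])
      (use \<open>0 \<le> S\<close> ric in \<open>auto intro!: \<phi> cont D rho_pos C rho_cont pot_cont continuous_intros\<close>)
  also have "\<dots> = integral {- S..S} (\<lambda>s. (rho C s * (\<phi>' s)\<^sup>2 - rho C s * pot C s * (\<phi> s)\<^sup>2) - c * (rho C s * (\<phi> s)\<^sup>2))"
    by (simp add: algebra_simps)
  also have "\<dots> = integral {- S..S} (\<lambda>s. rho C s * (\<phi>' s)\<^sup>2 - rho C s * pot C s * (\<phi> s)\<^sup>2)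
     - c * integral {- S..S} (\<lambda>s. rho C s * (\<phi> s)\<^sup>2)"
    by (subst integral_diff)
       (auto intro!: integrable_continuous_interval continuous_intros cont rho_cont pot_cont C)
  finally show ?thesis using z by (simp add: c_def)
qed

text \<open>Up to the factor 2 this is the integrand of \<open>expint\<close> in the variable \<open>r = exp (- t)\<close>.\<close>

definition "crit_fun r = r\<^sup>2 / sqrt (C * r ^ 4 - 2 * r\<^sup>2 + C)"
definition "crit_int u = (LBINT r=ereal 0..ereal u. crit_fun r)"

section \<open>The critical integral and the sign of the even field\<close>

lemma quartic_pos: "C * r ^ 4 - 2 * r\<^sup>2 + C > 0"
proof -
  have "C * (C * r ^ 4 - 2 * r\<^sup>2 + C) = (C * r\<^sup>2 - 1)\<^sup>2 + (C\<^sup>2 - 1)"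
    by (simp add: power2_eq_square algebra_simps eval_nat_numeral)
  also have "\<dots> > 0" using C_sq by (intro add_nonneg_pos) auto
  finally show ?thesis using C by (simp add: zero_less_mult_iff)
qed

lemma crit_fun_cont: "continuous_on A crit_fun"
  unfolding crit_fun_def[abs_def] using quartic_pos by (intro continuous_intros) (auto simp: less_le)

lemma crit_int_DERIV: "(crit_int has_real_derivative crit_fun u) (at u)"
  unfolding crit_int_def[abs_def] by (rule LBINT_from_zero_DERIV) (rule crit_fun_cont)

lemma crit_int_0 [simp]: "crit_int 0 = 0" by (simp add: crit_int_def)

lemma crit_fun_nonneg: "crit_fun r \<ge> 0" unfolding crit_fun_def using quartic_pos[of r] by simp

lemma crit_int_nonneg: "0 \<le> u \<Longrightarrow> 0 \<le> crit_int u"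
  using DERIV_nonneg_imp_nondecreasing[of 0 u crit_int] crit_int_DERIV crit_fun_nonneg by (metis crit_int_0)

text \<open>With r = exp (- s) one has 2 rho r = sqrt (C r^4 - 2 r^2 + C), whence the factor 2; the
  limit r = 1 corresponds to s = 0.\<close>

lemma expint_eq: "expint C s = 2 * (crit_int 1 - crit_int (exp (- s)))"
proof -
  have e: "exp (- (2 * s)) / rho C s = 2 * (0 - crit_fun (exp (- s)) * (exp (- s) * (- 1)))" for s
  proof -
    let ?r = "exp (- s)"
    have c: "2 * cosh (2 * s) = exp s ^ 2 + ?r ^ 2"
      using exp_double[of s] exp_double[of "- s"] by (simp add: cosh_field_def)
    have "(2 * rho C s * ?r)\<^sup>2 = C * (2 * cosh (2 * s)) * ?r\<^sup>2 - 2 * ?r\<^sup>2"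
      by (simp add: power_mult_distrib rho_sq[OF C] field_simps)
    then have "(2 * rho C s * ?r)\<^sup>2 = C * (?r\<^sup>2 * exp s ^ 2 + ?r ^ 4) - 2 * ?r\<^sup>2"
      unfolding c by (simp add: algebra_simps eval_nat_numeral)
    also have "?r\<^sup>2 * exp s ^ 2 = 1" by (simp add: power_mult_distrib[symmetric] exp_minus)
    finally have "sqrt (C * ?r ^ 4 - 2 * ?r\<^sup>2 + C) = sqrt ((2 * rho C s * ?r)\<^sup>2)"
      by (simp add: algebra_simps)
    also have "\<dots> = 2 * rho C s * ?r" using rho_pos[OF C, of s] by simp
    finally have "crit_fun ?r * ?r = ?r\<^sup>2 / (2 * rho C s)" by (simp add: crit_fun_def)
    then show ?thesis using exp_double[of "- s"] by (simp add: field_simps)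
  qed
  have "((\<lambda>s. 2 * (crit_int 1 - crit_int (exp (- s))) - expint C s) has_real_derivative
      2 * (0 - crit_fun (exp (- s)) * (exp (- s) * (- 1))) - exp (- (2 * s)) / rho C s) (at s)" for s
    by (intro DERIV_diff DERIV_cmult DERIV_const DERIV_chain2[OF crit_int_DERIV] expint_DERIV C)
       (auto intro!: derivative_eq_intros)
  then have "((\<lambda>s. 2 * (crit_int 1 - crit_int (exp (- s))) - expint C s) has_real_derivative 0) (at s)" for s
    by (simp only: e) simp
  then have "2 * (crit_int 1 - crit_int (exp (- s))) - expint C s = 2 * (crit_int 1 - crit_int (exp (- 0))) - expint C 0"
    by (intro DERIV_isconst_all) blast
  then show ?thesis by (simp add: expint_0[OF C])
qed

lemma expint_le: "expint C s \<le> 2 * crit_int 1"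
  using expint_eq[of s] crit_int_nonneg[of "exp (- s)"] by simp

lemma expint_tendsto: "(expint C \<longlongrightarrow> 2 * crit_int 1) at_top"
proof -
  have "((\<lambda>s::real. exp (- s)) \<longlongrightarrow> 0) at_top"
    by (rule filterlim_compose[OF exp_at_bot filterlim_uminus_at_bot_at_top])
  moreover have "isCont crit_int 0" using crit_int_DERIV DERIV_isCont by blast
  ultimately have "((\<lambda>s. crit_int (exp (- s))) \<longlongrightarrow> crit_int 0) at_top"
    by (rule isCont_tendsto_compose[rotated])
  then have "((\<lambda>s. 2 * (crit_int 1 - crit_int (exp (- s)))) \<longlongrightarrow> 2 * (crit_int 1 - crit_int 0)) at_top"
    by (intro tendsto_intros)
  then show ?thesis by (simp add: expint_eq[abs_def])
qed

lemma even_jacobi_eq': "even_jacobi C s = exp (- (2 * s)) + rho1 C s * (2 * rho C 0 / C - expint C s)"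
proof -
  have "C * (exp (- (2 * s)) + rho1 C s * (2 * rho C 0 / C - expint C s))
     = C * exp (- (2 * s)) + rho1 C s * (2 * rho C 0 - C * expint C s)"
    using C by (simp add: field_simps)
  then show ?thesis using even_jacobi_eq[OF C, of s] C by (metis mult_left_cancel not_one_less_zero)
qed

lemma even_jacobi_lower:
  assumes "0 \<le> s" shows "even_jacobi C s \<ge> exp (- (2 * s)) + rho1 C s * (2 * rho C 0 / C - 2 * crit_int 1)"
  unfolding even_jacobi_eq' using expint_le[of s] rho1_nonneg[OF assms] by (simp add: mult_left_mono)

text \<open>The bracket multiplying \<open>rho1\<close> decreases to a nonnegative limit, and the
  term \<open>exp (- (2 * s))\<close> keeps positivity strict even when that limit is 0.\<close>

lemma even_jacobi_pos:
  assumes "crit_int 1 \<le> rho C 0 / C" shows "even_jacobi C s > 0"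
proof -
  have "even_jacobi C s > 0" if "0 \<le> s" for s
  proof -
    have "0 \<le> rho1 C s * (2 * rho C 0 / C - 2 * crit_int 1)"

    proof (intro mult_nonneg_nonneg rho1_nonneg that)
      have "2 * rho C 0 / C = 2 * (rho C 0 / C)" by simp
      then show "0 \<le> 2 * rho C 0 / C - 2 * crit_int 1" using assms by linarith
    qed
    then show ?thesis using even_jacobi_lower[OF that] exp_gt_zero[of "- (2 * s)"] by linarith
  qed
  from this[of s] this[of "- s"] show ?thesis using even_jacobi_even[OF C, of s] by (cases "0 \<le> s") auto
qed

lemma even_jacobi_negative:
  assumes "rho C 0 / C < crit_int 1" obtains s where "s > 0" "even_jacobi C s < 0"
proof -
  \<comment> \<open>The bracket tends to - 2 \<eta>, so it is eventually below - \<eta>, while the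
    exponential term falls below \<eta> times the fixed value \<open>rho1 C 1\<close>.\<close>
  define \<eta> where "\<eta> = crit_int 1 - rho C 0 / C"
  have \<eta>: "\<eta> > 0" using assms by (simp add: \<eta>_def)
  have r: "rho1 C 1 > 0" by (simp add: rho1_pos)
  have "eventually (\<lambda>s. expint C s > 2 * crit_int 1 - \<eta>) at_top"
    by (rule order_tendstoD[OF expint_tendsto]) (use \<eta> in simp)
  moreover have "((\<lambda>s::real. exp (- (2 * s))) \<longlongrightarrow> 0) at_top"
    by (rule filterlim_compose[OF exp_at_bot])
       (rule filterlim_compose[OF filterlim_uminus_at_bot_at_top], rule filterlim_tendsto_pos_mult_at_top[OF tendsto_const], auto intro: filterlim_ident)
  then have "eventually (\<lambda>s. exp (- (2 * s)) < \<eta> * rho1 C 1) at_top"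
    by (rule order_tendstoD) (use \<eta> r in simp)
  moreover have "eventually (\<lambda>s::real. s > 1) at_top" by (rule eventually_gt_at_top)
  ultimately have "eventually (\<lambda>s. expint C s > 2 * crit_int 1 - \<eta> \<and> exp (- (2 * s)) < \<eta> * rho1 C 1 \<and> s > 1) at_top"
    by eventually_elim simp
  then obtain s where s: "expint C s > 2 * crit_int 1 - \<eta>" "exp (- (2 * s)) < \<eta> * rho1 C 1" "s > 1"
    using eventually_happens'[OF trivial_limit_at_top_linorder] by blast
  have m: "rho1 C 1 < rho1 C s" using s by (intro rho1_strict_mono)
  have "2 * rho C 0 / C - expint C s < - \<eta>" using s(1) by (simp add: \<eta>_def)
  then have "rho1 C s * (2 * rho C 0 / C - expint C s) < rho1 C s * (- \<eta>)"
    using m r by (intro mult_strict_left_mono) auto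
  also have "\<dots> < rho1 C 1 * (- \<eta>)" using m \<eta> by simp
  finally have "even_jacobi C s < 0" unfolding even_jacobi_eq' using s(2) by (simp add: mult.commute)
  then show thesis using s(3) that[of s] by simp
qed

text \<open>Plain compactness, so the constant depends on \<open>S\<close>; this much survives in
  the case of equality.\<close>

lemma mass_bound_compact:
  assumes "crit_int 1 \<le> rho C 0 / C"
  obtains B where "B > 0" "\<And>s. s \<in> {- S..S} \<Longrightarrow> \<bar>even_jacobi_mass s\<bar> \<le> B * (rho C s * (even_jacobi C s)\<^sup>2)"
proof -
  let ?q = "\<lambda>s. even_jacobi_mass s / (rho C s * (even_jacobi C s)\<^sup>2)"
  have m: "rho C s * (even_jacobi C s)\<^sup>2 > 0" for s using rho_pos[OF C, of s] even_jacobi_pos[OF assms, of s] by simp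
  have "continuous_on {- S..S} ?q"
    using m by (intro continuous_intros rho_cont even_jacobi_cont C continuous_on_if_DERIV[OF even_jacobi_mass_DERIV]) (auto simp: less_le)
  then have "bounded (?q ` {- S..S})" by (intro compact_imp_bounded compact_continuous_image) auto
  then obtain B where B: "B > 0" "\<And>s. s \<in> {- S..S} \<Longrightarrow> \<bar>?q s\<bar> \<le> B" unfolding bounded_pos by auto
  show thesis
  proof (rule that[OF B(1)])
    fix s assume "s \<in> {- S..S}"
    from B(2)[OF this] show "\<bar>even_jacobi_mass s\<bar> \<le> B * (rho C s * (even_jacobi C s)\<^sup>2)"
      using m[of s] by (simp add: field_simps)
  qed
qed

text \<open>For s \<ge> 1 strict inequality makes the even field comparable to \<open>rho1\<close>
  from above and below. The density rho w^2 is then at most a multiple of the derivative of rho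
  rho1^2. Integration bounds the mass by a multiple of rho rho1^2, and the lower comparison turns
  this back into rho w^2.\<close>

lemma mass_bound_global:
  assumes st: "crit_int 1 < rho C 0 / C"
  obtains B where "B > 0" "\<And>s. \<bar>even_jacobi_mass s\<bar> \<le> B * (rho C s * (even_jacobi C s)\<^sup>2)"
proof -
  define d where "d = 2 * rho C 0 / C - 2 * crit_int 1"
  have d: "d > 0" using st by (simp add: d_def)
  have rho_mono: "rho C 0 \<le> rho C s" if "0 \<le> s" for s
    using DERIV_nonneg_imp_nondecreasing[OF that] rho_DERIV[OF C] rho1_nonneg by blast
  \<comment> \<open>The constant comes from C sinh \<le> C cosh = 2 rho^2 + 1 and from
    \<open>rho C 0 \<le> rho C s\<close>.\<close>
  define q where "q = 1 + 1 / (2 * (rho C 0)\<^sup>2)"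
  have q: "q > 0" unfolding q_def using rho_pos[OF C, of 0] by (intro add_pos_pos) auto
  have rho1_le: "rho1 C s \<le> q * rho C s" if s: "0 \<le> s" for s
  proof -
    have "2 * rho C s * rho1 C s \<le> 2 * (rho C s)\<^sup>2 + 1"
      unfolding C_sinh[OF C, symmetric] C_cosh[OF C, symmetric] using C by (simp add: sinh_less_cosh_real less_imp_le)
    also have "\<dots> \<le> 2 * (rho C s)\<^sup>2 + (rho C s)\<^sup>2 / (rho C 0)\<^sup>2"
      using rho_mono[OF s] rho_pos[OF C, of 0] by (simp add: power_mono)
    also have "\<dots> = 2 * rho C s * (q * rho C s)"
      using rho_pos[OF C, of 0] by (simp add: q_def field_simps power2_eq_square)
    finally show ?thesis using rho_pos[OF C, of s] by simp
  qed
  define c where "c = exp (-2) / rho1 C 1 + 2 * rho C 0 / C"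
  have c: "c > 0" unfolding c_def using rho_pos[OF C, of 0] rho1_pos[of 1] C by (intro add_pos_pos) auto
  have upper: "even_jacobi C s \<le> c * rho1 C s" if s: "1 \<le> s" for s
  proof -
    have m: "rho1 C 1 \<le> rho1 C s" using rho1_strict_mono[of 1 s] s by (cases "s = 1") auto
    have p: "rho1 C 1 > 0" by (simp add: rho1_pos)
    have E: "expint C s \<ge> 0"
      using DERIV_nonneg_imp_nondecreasing[of 0 s "expint C"] expint_DERIV[OF C] rho_pos[OF C] s
      by (force simp: expint_0[OF C] less_imp_le)
    have "exp (- (2 * s)) \<le> exp (-2)" using s by simp
    also have "\<dots> \<le> exp (-2) / rho1 C 1 * rho1 C s" using m p by (simp add: field_simps)
    finally have "exp (- (2 * s)) \<le> exp (-2) / rho1 C 1 * rho1 C s" .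
    moreover have "rho1 C s * (2 * rho C 0 / C - expint C s) \<le> rho1 C s * (2 * rho C 0 / C)"
      using E m p by (intro mult_left_mono) auto
    ultimately show ?thesis unfolding even_jacobi_eq' c_def by (simp add: algebra_simps)
  qed
  have lower: "d * rho1 C s \<le> even_jacobi C s" if s: "1 \<le> s" for s
  proof -
    have "even_jacobi C s \<ge> exp (- (2 * s)) + rho1 C s * d" using even_jacobi_lower[of s] s unfolding d_def by simp
    then show ?thesis using exp_gt_zero[of "- (2 * s)"] unfolding mult.commute[of d] by linarith
  qed
  obtain num_deriv2 where num_deriv2: "num_deriv2 > 0" "\<And>s. s \<in> {- 1..1} \<Longrightarrow> \<bar>even_jacobi_mass s\<bar> \<le> num_deriv2 * (rho C s * (even_jacobi C s)\<^sup>2)"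
    using mass_bound_compact[of 1] st by auto
  define R where "R = (\<lambda>s. rho C s * (rho1 C s)\<^sup>2)"
  \<comment> \<open>Three demands: the bound on [-1, 1], the comparison of derivatives for s \<ge>
    1, and the initial value at s = 1.\<close>
  define B where "B = max (max num_deriv2 (c\<^sup>2 * q / d\<^sup>2)) (even_jacobi_mass 1 / (d\<^sup>2 * R 1))"
  have B: "B \<ge> num_deriv2" "B \<ge> c\<^sup>2 * q / d\<^sup>2" "B \<ge> even_jacobi_mass 1 / (d\<^sup>2 * R 1)" by (auto simp: B_def)
  have R1: "R 1 > 0" unfolding R_def using rho_pos[OF C, of 1] rho1_pos[of 1] by simp
  have mass_le: "even_jacobi_mass s \<le> B * (rho C s * (even_jacobi C s)\<^sup>2)" if s: "1 \<le> s" for s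
  proof -
    let ?R' = "\<lambda>s. rho1 C s * (rho1 C s)\<^sup>2 + rho C s * (2 * rho1 C s * rho2 C s)"
    have "\<exists>y. ((\<lambda>s. B * (d\<^sup>2 * R s) - even_jacobi_mass s) has_real_derivative y) (at x) \<and> y \<ge> 0"
      if x: "1 \<le> x" "x \<le> s" for x
    proof (intro exI conjI)
      have "((\<lambda>s. rho C s * (rho1 C s)\<^sup>2) has_real_derivative ?R' x) (at x)"
        by (auto intro!: derivative_eq_intros rho_DERIV rho1_DERIV C)
      then show "((\<lambda>s. B * (d\<^sup>2 * R s) - even_jacobi_mass s) has_real_derivative B * (d\<^sup>2 * ?R' x) - rho C x * (even_jacobi C x)\<^sup>2) (at x)"
        unfolding R_def by (intro DERIV_diff DERIV_cmult even_jacobi_mass_DERIV)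
      have p: "rho1 C x > 0" "rho C x > 0" using rho1_pos[of x] rho_pos[OF C, of x] x by auto
      have "rho C x * (even_jacobi C x)\<^sup>2 \<le> rho C x * (c * rho1 C x)\<^sup>2"
        using p upper[OF x(1)] lower[OF x(1)] d by (intro mult_left_mono power_mono) (auto intro: order_trans[rotated])
      also have "\<dots> = c\<^sup>2 * (rho C x * rho1 C x * rho1 C x)" by (simp add: power2_eq_square)
      also have "\<dots> \<le> c\<^sup>2 * (rho C x * rho1 C x * (q * rho C x))"
        using p rho1_le[of x] x by (intro mult_left_mono) auto
      also have "\<dots> = (c\<^sup>2 * q / d\<^sup>2) * (d\<^sup>2 * (rho C x * rho1 C x * rho C x))" using d by simp
      also have "\<dots> \<le> B * (d\<^sup>2 * (rho C x * rho1 C x * rho C x))"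
        using B(2) p by (intro mult_right_mono) auto
      also have "\<dots> \<le> B * (d\<^sup>2 * ?R' x)"
      proof -
        have "rho C x \<le> rho2 C x" unfolding rho2_def using p C_sq by simp
        then have "rho C x * rho1 C x * rho C x \<le> rho C x * rho1 C x * rho2 C x" using p by (intro mult_left_mono) auto
        also have "\<dots> \<le> ?R' x" using p rho2_pos[of x] by (simp add: algebra_simps)
        finally show ?thesis using B(1) num_deriv2(1) by (intro mult_left_mono) auto
      qed
      finally show "B * (d\<^sup>2 * ?R' x) - rho C x * (even_jacobi C x)\<^sup>2 \<ge> 0" by simp
    qed
    then have "B * (d\<^sup>2 * R 1) - even_jacobi_mass 1 \<le> B * (d\<^sup>2 * R s) - even_jacobi_mass s"
      by (rule DERIV_nonneg_imp_nondecreasing[OF s])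
    moreover have "even_jacobi_mass 1 \<le> B * (d\<^sup>2 * R 1)" using B(3) R1 d by (simp add: field_simps)
    ultimately have "even_jacobi_mass s \<le> B * (d\<^sup>2 * R s)" by linarith
    also have "d\<^sup>2 * R s = rho C s * (d * rho1 C s)\<^sup>2" by (simp add: R_def power_mult_distrib)
    also have "B * \<dots> \<le> B * (rho C s * (even_jacobi C s)\<^sup>2)"
      using B(1) num_deriv2(1) rho_pos[OF C, of s] lower[OF s] d rho1_nonneg[of s] s
      by (intro mult_left_mono power_mono) auto
    finally show ?thesis .
  qed
  have mass_nonneg: "even_jacobi_mass s \<ge> 0" if "0 \<le> s" for s
    using DERIV_nonneg_imp_nondecreasing[OF that, of even_jacobi_mass] even_jacobi_mass_DERIV rho_pos[OF C]
    by (force simp: less_imp_le)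
  have pos: "\<bar>even_jacobi_mass s\<bar> \<le> B * (rho C s * (even_jacobi C s)\<^sup>2)" if s: "0 \<le> s" for s
  proof (cases "s \<le> 1")
    case True
    then have "\<bar>even_jacobi_mass s\<bar> \<le> num_deriv2 * (rho C s * (even_jacobi C s)\<^sup>2)" using s by (intro num_deriv2) auto
    also have "\<dots> \<le> B * (rho C s * (even_jacobi C s)\<^sup>2)" using B(1) rho_pos[OF C, of s] by (intro mult_right_mono) auto
    finally show ?thesis .
  next
    case False
    then show ?thesis using mass_le[of s] mass_nonneg[OF s] by simp
  qed
  show thesis
  proof (rule that[of B])
    show "B > 0" using B(1) num_deriv2(1) by simp
    show "\<bar>even_jacobi_mass s\<bar> \<le> B * (rho C s * (even_jacobi C s)\<^sup>2)" for s
      using pos[of s] pos[of "- s"] by (cases "0 \<le> s") (auto simp: even_jacobi_mass_odd rho_even[OF C] even_jacobi_even[OF C])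
  qed
qed

end

section \<open>The critical parameter\<close>

text \<open>On each of several pieces, \<open>1 / sqrt (quart g r)\<close> is compared with a polynomial \<open>P / N\<close> in the variable
  \<open>100 * r\<^sup>2\<close> that was found numerically.  The comparison amounts to the sign of a polynomial, which is
  decided by recentring it at \<open>X\<close> and bounding all but the constant term for arguments of modulus at
  most \<open>Y\<close>.\<close>

primrec list_poly :: "real list \<Rightarrow> real \<Rightarrow> real" where
  "list_poly [] x = 0"
| "list_poly (c # cs) x = c + x * list_poly cs x"

fun list_list_padd :: "real list \<Rightarrow> real list \<Rightarrow> real list" where
  "list_list_padd [] bs = bs"
| "list_list_padd as [] = as"
| "list_list_padd (a # as) (b # bs) = (a + b) # list_list_padd as bs"

primrec list_list_pmul :: "real list \<Rightarrow> real list \<Rightarrow> real list" where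
  "list_list_pmul [] bs = []"
| "list_list_pmul (a # as) bs = list_list_padd (map ((*) a) bs) (0 # list_list_pmul as bs)"

primrec list_list_pshift :: "real \<Rightarrow> real list \<Rightarrow> real list" where
  "list_list_pshift m [] = []"
| "list_list_pshift m (c # cs) = list_list_padd [c] (list_list_pmul [m, 1] (list_list_pshift m cs))"

primrec pos_check :: "real \<Rightarrow> real list \<Rightarrow> bool" where
  "pos_check y [] = True"
| "pos_check y (c # cs) = (y * list_poly (map abs cs) y \<le> c)"

text \<open>Antiderivative of r^2 p(100 r^2) for the polynomial p of a coefficient list; the index
  \<open>k\<close> records the power reached in the list.\<close>

primrec sq_antideriv :: "real list \<Rightarrow> nat \<Rightarrow> real \<Rightarrow> real" where
  "sq_antideriv [] k r = 0"
| "sq_antideriv (c # cs) k r = c * 100 ^ k * r ^ (2 * k + 3) / real (2 * k + 3) + sq_antideriv cs (Suc k) r"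

lemma list_poly_list_padd: "list_poly (list_list_padd as bs) x = list_poly as x + list_poly bs x"
  by (induction as bs rule: list_list_padd.induct) (auto simp: algebra_simps)

lemma list_poly_map_mult: "list_poly (map ((*) a) bs) x = a * list_poly bs x"
  by (induction bs) (auto simp: algebra_simps)

lemma list_poly_list_pmul: "list_poly (list_list_pmul as bs) x = list_poly as x * list_poly bs x"
  by (induction as) (auto simp: list_poly_list_padd list_poly_map_mult algebra_simps)

lemma list_poly_list_pshift: "list_poly (list_list_pshift m cs) x = list_poly cs (m + x)"
  by (induction cs) (auto simp: list_poly_list_padd list_poly_list_pmul list_poly_map_mult algebra_simps)

lemma abs_list_poly_le: "\<bar>x\<bar> \<le> y \<Longrightarrow> \<bar>list_poly cs x\<bar> \<le> list_poly (map abs cs) y"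
proof (induction cs)
  case (Cons c cs)
  have "\<bar>c + x * list_poly cs x\<bar> \<le> \<bar>c\<bar> + \<bar>x\<bar> * \<bar>list_poly cs x\<bar>" by (metis abs_mult abs_triangle_ineq)
  also have "\<dots> \<le> \<bar>c\<bar> + y * list_poly (map abs cs) y"
    using Cons by (intro add_left_mono mult_mono) auto
  finally show ?case by simp
qed simp

lemma pos_checkD:
  assumes "pos_check y cs" "\<bar>x\<bar> \<le> y" shows "0 \<le> list_poly cs x"
proof (cases cs)
  case (Cons c ds)
  have "\<bar>x * list_poly ds x\<bar> \<le> y * list_poly (map abs ds) y"
    unfolding abs_mult using abs_list_poly_le[OF assms(2), of ds] assms(2) by (intro mult_mono) auto
  then show ?thesis using assms(1) Cons by simp
qed simp

lemma sq_antideriv_DERIV: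
  "(sq_antideriv cs k has_real_derivative r\<^sup>2 * (100 * r\<^sup>2) ^ k * list_poly cs (100 * r\<^sup>2)) (at r within A)"
proof (induction cs arbitrary: k)
  case Nil
  then show ?case by simp
next
  case (Cons c cs)
  have "((\<lambda>r. c * 100 ^ k * r ^ (2 * k + 3) / real (2 * k + 3)) has_real_derivative
      c * 100 ^ k * (real (2 * k + 3) * r ^ (2 * k + 2)) / real (2 * k + 3)) (at r within A)"
    by (rule derivative_eq_intros refl | simp)+
  moreover have "c * 100 ^ k * (real (2 * k + 3) * r ^ (2 * k + 2)) / real (2 * k + 3) = c * (r\<^sup>2 * (100 * r\<^sup>2) ^ k)"
    by (simp add: power_mult_distrib power_mult power_add power2_eq_square)
  ultimately have "((\<lambda>r. c * 100 ^ k * r ^ (2 * k + 3) / real (2 * k + 3)) has_real_derivative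
      c * (r\<^sup>2 * (100 * r\<^sup>2) ^ k)) (at r within A)" by (simp only:)
  from DERIV_add[OF this Cons.IH[of "Suc k"]] show ?case by (simp add: algebra_simps)
qed

lemma sq_list_poly_integral:
  assumes "a \<le> b"
  shows "((\<lambda>r. r\<^sup>2 * list_poly cs (100 * r\<^sup>2)) has_integral sq_antideriv cs 0 b - sq_antideriv cs 0 a) {a..b}"
  using sq_antideriv_DERIV[of cs 0] assms
  by (intro fundamental_theorem_of_calculus)
     (auto simp: has_real_derivative_iff_has_vector_derivative[symmetric])

section \<open>Rational enclosures of the integral\<close>

definition quart :: "real \<Rightarrow> real \<Rightarrow> real" where
  "quart g r = r ^ 4 - 2 * g * r\<^sup>2 + 1"

definition Jfun :: "real \<Rightarrow> real \<Rightarrow> real" where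
  "Jfun g r = r\<^sup>2 / sqrt (quart g r)"

definition Jint :: "real \<Rightarrow> real" where
  "Jint g = integral {0..1} (Jfun g)"

lemma quart_pos: assumes "\<bar>g\<bar> < 1" shows "quart g r > 0"
proof -
  have "quart g r = (r\<^sup>2 - g)\<^sup>2 + (1 - g\<^sup>2)"
    by (simp add: quart_def power2_eq_square algebra_simps eval_nat_numeral)
  moreover have "g\<^sup>2 < 1" using assms by (simp add: abs_square_less_1)
  ultimately show ?thesis by (simp add: add_nonneg_pos)
qed

lemma Jfun_cont: "\<bar>g\<bar> < 1 \<Longrightarrow> continuous_on A (Jfun g)"
  unfolding Jfun_def[abs_def] using quart_pos[of g]
  by (intro continuous_intros) (auto simp: less_le quart_def intro!: continuous_intros)

lemma Jfun_integrable: "\<bar>g\<bar> < 1 \<Longrightarrow> Jfun g integrable_on {a..b}"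
  by (intro integrable_continuous_interval Jfun_cont)

text \<open>The factor \<open>M\<close> clears denominators: for the two values of g used below, the
  quartic becomes an integer polynomial in 100 r^2.\<close>

lemma quart_list_poly: "M * quart g r = list_poly [M, - 2 * g * M / 100, M / 10000] (100 * r\<^sup>2)"
  by (simp add: quart_def algebra_simps eval_nat_numeral)

lemma piece_range:
  assumes "0 \<le> a" "X - Y \<le> 100 * a\<^sup>2" "100 * b\<^sup>2 \<le> X + Y" "r \<in> {a..b}"
  shows "\<bar>100 * r\<^sup>2 - X\<bar> \<le> (Y::real)"
proof -
  have "a\<^sup>2 \<le> r\<^sup>2" "r\<^sup>2 \<le> b\<^sup>2" using assms by (auto intro!: power_mono)
  then show ?thesis using assms(2,3) by (auto simp: abs_le_iff)
qed

text \<open>Squaring removes the root: P / N lies above 1 / sqrt (quart g r) once P \<ge> 0 and P^2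
  quart - N^2 \<ge> 0. The certificates \<open>c1\<close> and \<open>c2\<close> establish these two
  signs, the second after multiplication by \<open>M\<close>, as long as 100 r^2 stays within
  \<open>Y\<close> of \<open>X\<close>.\<close>

lemma Jint_piece_le:
  assumes ab: "0 \<le> a" "a \<le> b" "X - Y \<le> 100 * a\<^sup>2" "100 * b\<^sup>2 \<le> X + Y" and g: "\<bar>g\<bar> < 1" and MN: "M > 0" "N > 0"
    and c1: "pos_check Y (list_list_pshift X P)"
    and c2: "pos_check Y (list_list_padd (list_list_pmul (list_list_pmul (list_list_pshift X P) (list_list_pshift X P)) (list_list_pshift X [M, - 2 * g * M / 100, M / 10000])) [- (N\<^sup>2 * M)])"
  shows "integral {a..b} (Jfun g) \<le> (sq_antideriv P 0 b - sq_antideriv P 0 a) / N"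
proof -
  have "integral {a..b} (Jfun g) \<le> integral {a..b} (\<lambda>r. r\<^sup>2 * list_poly P (100 * r\<^sup>2) / N)"
  proof (rule integral_le[OF Jfun_integrable[OF g]])
    show "(\<lambda>r. r\<^sup>2 * list_poly P (100 * r\<^sup>2) / N) integrable_on {a..b}"
      using sq_list_poly_integral[OF ab(2), of P] by (intro integrable_on_divide) blast
    fix r assume "r \<in> {a..b}"
    then have r: "\<bar>100 * r\<^sup>2 - X\<bar> \<le> Y" using piece_range ab by blast
    define p where "p = list_poly P (100 * r\<^sup>2)"
    have p: "0 \<le> p" using pos_checkD[OF c1 r] by (simp add: list_poly_list_pshift p_def)
    have "0 \<le> p * p * (M * quart g r) - N\<^sup>2 * M"
      using pos_checkD[OF c2 r] by (simp only: list_poly_list_padd list_poly_list_pmul list_poly_list_pshift quart_list_poly p_def) simp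
    then have "0 \<le> M * (p\<^sup>2 * quart g r - N\<^sup>2)" by (simp add: algebra_simps power2_eq_square)
    then have "N\<^sup>2 \<le> p\<^sup>2 * quart g r" using MN by (simp add: zero_le_mult_iff)
    then have "sqrt (N\<^sup>2) \<le> sqrt (p\<^sup>2 * quart g r)" by (rule real_sqrt_le_mono)
    then have "N \<le> p * sqrt (quart g r)" using p MN by (simp add: real_sqrt_mult)
    then have "1 / sqrt (quart g r) \<le> p / N" using quart_pos[OF g, of r] MN by (simp add: field_simps)
    then have "r\<^sup>2 * (1 / sqrt (quart g r)) \<le> r\<^sup>2 * (p / N)" by (rule mult_left_mono) simp
    then show "Jfun g r \<le> r\<^sup>2 * list_poly P (100 * r\<^sup>2) / N" by (simp add: Jfun_def p_def)
  qed
  also have "\<dots> = (sq_antideriv P 0 b - sq_antideriv P 0 a) / N"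
    using has_integral_divide[OF sq_list_poly_integral[OF ab(2), of P], of N] by (rule integral_unique)
  finally show ?thesis .
qed

text \<open>From P^2 quart \<le> N^2 follows a bound on the modulus of P, hence on P itself whatever
  its sign; one certificate decides.\<close>

lemma Jint_piece_ge:
  assumes ab: "0 \<le> a" "a \<le> b" "X - Y \<le> 100 * a\<^sup>2" "100 * b\<^sup>2 \<le> X + Y" and g: "\<bar>g\<bar> < 1" and MN: "M > 0" "N > 0"
    and c2: "pos_check Y (list_list_padd (map ((*) (-1)) (list_list_pmul (list_list_pmul (list_list_pshift X P) (list_list_pshift X P)) (list_list_pshift X [M, - 2 * g * M / 100, M / 10000]))) [N\<^sup>2 * M])"
  shows "(sq_antideriv P 0 b - sq_antideriv P 0 a) / N \<le> integral {a..b} (Jfun g)"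
proof -
  have "(sq_antideriv P 0 b - sq_antideriv P 0 a) / N = integral {a..b} (\<lambda>r. r\<^sup>2 * list_poly P (100 * r\<^sup>2) / N)"
    using has_integral_divide[OF sq_list_poly_integral[OF ab(2), of P], of N] by (rule integral_unique[symmetric])
  also have "\<dots> \<le> integral {a..b} (Jfun g)"
  proof (rule integral_le[OF _ Jfun_integrable[OF g]])
    show "(\<lambda>r. r\<^sup>2 * list_poly P (100 * r\<^sup>2) / N) integrable_on {a..b}"
      using sq_list_poly_integral[OF ab(2), of P] by (intro integrable_on_divide) blast
    fix r assume "r \<in> {a..b}"
    then have r: "\<bar>100 * r\<^sup>2 - X\<bar> \<le> Y" using piece_range ab by blast
    define p where "p = list_poly P (100 * r\<^sup>2)"
    have "0 \<le> N\<^sup>2 * M - p * p * (M * quart g r)"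
      using pos_checkD[OF c2 r] by (simp only: list_poly_list_padd list_poly_list_pmul list_poly_list_pshift list_poly_map_mult quart_list_poly p_def) simp
    then have "0 \<le> M * (N\<^sup>2 - p\<^sup>2 * quart g r)" by (simp add: algebra_simps power2_eq_square)
    then have "p\<^sup>2 * quart g r \<le> N\<^sup>2" using MN by (simp add: zero_le_mult_iff)
    then have "sqrt (p\<^sup>2 * quart g r) \<le> sqrt (N\<^sup>2)" by (rule real_sqrt_le_mono)
    then have "\<bar>p\<bar> * sqrt (quart g r) \<le> N" using MN by (simp add: real_sqrt_mult)
    moreover have "p * sqrt (quart g r) \<le> \<bar>p\<bar> * sqrt (quart g r)"
      using quart_pos[OF g, of r] by (intro mult_right_mono) auto
    ultimately have "p * sqrt (quart g r) \<le> N" by linarith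
    then have "p / N \<le> 1 / sqrt (quart g r)" using quart_pos[OF g, of r] MN by (simp add: field_simps)
    then have "r\<^sup>2 * (p / N) \<le> r\<^sup>2 * (1 / sqrt (quart g r))" by (rule mult_left_mono) simp
    then show "r\<^sup>2 * list_poly P (100 * r\<^sup>2) / N \<le> Jfun g r" by (simp add: Jfun_def p_def)
  qed
  finally show ?thesis .
qed

text \<open>The breakpoints cut the range of r^2 into pieces of length about 1/5, short enough for
  polynomials of degree six in 100 r^2.\<close>

lemma Jint_split:
  assumes "\<bar>g\<bar> < 1"
  shows "Jint g = integral {0..9/20} (Jfun g) + integral {9/20..63/100} (Jfun g) + integral {63/100..39/50} (Jfun g)
    + integral {39/50..9/10} (Jfun g) + integral {9/10..1} (Jfun g)"
  unfolding Jint_def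
  by (simp add: Henstock_Kurzweil_Integration.integral_combine Jfun_integrable[OF assms])

text \<open>The argument is a rational just below 1 / cosh (2 * 0.495765), and the right side is a
  rational just above the square root that the integral has to beat there. The coefficient lists are
  fits of 1 / sqrt (quart g r) from below, scaled by \<open>10 ^ 22\<close>.\<close>

lemma Jint_lower: "Jint (130447/200000) > 416994/1000000"
proof -
  have g: "\<bar>130447/200000 :: real\<bar> < 1" by simp
  have i0: "32825313/1000000000 \<le> integral {0..9/20} (Jfun (130447/200000))"
    by (rule order_trans[OF _ Jint_piece_ge[where X = "10" and Y = "11" and M = "10000000" and N = "10 ^ 22" and P = "[9999999332678262524987, 65223148843180582996, 138219705545236630, - 2863838263975292, - 41200947623939, - 369622241860, 3100862472]", OF _ _ _ _ g]])
      (simp_all add: power2_eq_square power_divide)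
  have i1: "634691/10000000 \<le> integral {9/20..63/100} (Jfun (130447/200000))"
    by (rule order_trans[OF _ Jint_piece_ge[where X = "30" and Y = "10" and M = "10000000" and N = "10 ^ 22" and P = "[10000900961779245205281, 65002748812347930515, 161374504502142317, - 4211745618717304, 5130155487940, - 1271999910005, 10976179353]", OF _ _ _ _ g]])
      (simp_all add: power2_eq_square power_divide)
  have i2: "3867179/40000000 \<le> integral {63/100..39/50} (Jfun (130447/200000))"
    by (rule order_trans[OF _ Jint_piece_ge[where X = "50" and Y = "11" and M = "10000000" and N = "10 ^ 22" and P = "[9869789758621570737875, 82249933895758893884, - 790087649299218607, 23979433193522259, - 468321065057718, 3003868807188, - 5257413468]", OF _ _ _ _ g]])
      (simp_all add: power2_eq_square power_divide)
  have i3: "55616273/500000000 \<le> integral {39/50..9/10} (Jfun (130447/200000))"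
    by (rule order_trans[OF _ Jint_piece_ge[where X = "71" and Y = "11" and M = "10000000" and N = "10 ^ 22" and P = "[9671371442981892396558, 109252384598641533422, - 2206670026084464734, 61907606230447847, - 1024192800421956, 7272749047107, - 18758357686]", OF _ _ _ _ g]])
      (simp_all add: power2_eq_square power_divide)
  have i4: "28197801/250000000 \<le> integral {9/10..1} (Jfun (130447/200000))"
    by (rule order_trans[OF _ Jint_piece_ge[where X = "90" and Y = "10" and M = "10000000" and N = "10 ^ 22" and P = "[17080068544484646477946, - 433740200109512506338, 14438517694247695087, - 211286133287885963, 1507974819917054, - 5294841921594, 7336474184]", OF _ _ _ _ g]])
      (simp_all add: power2_eq_square power_divide)
  show ?thesis unfolding Jint_split[OF g] using i0 i1 i2 i3 i4 by simp
qed

text \<open>The counterpart at 0.495775: the argument is just above 1 / cosh (2 * 0.495775), the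
  fits lie above 1 / sqrt (quart g r), and the right side is just below the square root.\<close>

lemma Jint_upper: "Jint (1304457/2000000) < 4169957/10000000"
proof -
  have g: "\<bar>1304457/2000000 :: real\<bar> < 1" by simp
  have i0: "integral {0..9/20} (Jfun (1304457/2000000)) \<le> 32825289/1000000000"
    by (rule order_trans[OF Jint_piece_le[where X = "10" and Y = "11" and M = "100000000" and N = "10 ^ 22" and P = "[10000001680494398419201, 65222498843540924207, 138206987028100624, - 2863948174411544, - 41200918190236, - 369608834887, 3101102369]", OF _ _ _ _ g]])
      (simp_all add: power2_eq_square power_divide)
  have i1: "integral {9/20..63/100} (Jfun (1304457/2000000)) \<le> 63468921/1000000000"
    by (rule order_trans[OF Jint_piece_le[where X = "30" and Y = "10" and M = "100000000" and N = "10 ^ 22" and P = "[10000901461798446370000, 65002139429814096757, 161357910902303302, - 4211654627949711, 5124184747258, - 1271887939869, 10975717115]", OF _ _ _ _ g]])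
      (simp_all add: power2_eq_square power_divide)
  have i2: "integral {63/100..39/50} (Jfun (1304457/2000000)) \<le> 19335803/200000000"
    by (rule order_trans[OF Jint_piece_le[where X = "50" and Y = "11" and M = "100000000" and N = "10 ^ 22" and P = "[9869800658103803635054, 82249228147020520501, - 790103558047531994, 23979667049010946, - 468332707620855, 3004067421068, - 5258366196]", OF _ _ _ _ g]])
      (simp_all add: power2_eq_square power_divide)
  have i3: "integral {39/50..9/10} (Jfun (1304457/2000000)) \<le> 55615863/500000000"
    by (rule order_trans[OF Jint_piece_le[where X = "71" and Y = "11" and M = "100000000" and N = "10 ^ 22" and P = "[9671508024068236417140, 109239274469872637793, - 2206182022583009982, 61896843077052512, - 1024068440211312, 7272043758998, - 18756787896]", OF _ _ _ _ g]])
      (simp_all add: power2_eq_square power_divide)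
  have i4: "integral {9/10..1} (Jfun (1304457/2000000)) \<le> 563951/5000000"
    by (rule order_trans[OF Jint_piece_le[where X = "90" and Y = "10" and M = "100000000" and N = "10 ^ 22" and P = "[17079675010648341709292, - 433715801077486749459, 14437888501191650831, - 211279110190183796, 1507939540263019, - 5294781278902, 7336509255]", OF _ _ _ _ g]])
      (simp_all add: power2_eq_square power_divide)
  show ?thesis unfolding Jint_split[OF g] using i0 i1 i2 i3 i4 by simp
qed

section \<open>Dependence on the parameter\<close>

lemma crit_int_eq_Jint:
  assumes C: "C > 1" shows "crit_int C 1 = Jint (1 / C) / sqrt C"
proof -
  have g: "\<bar>1 / C\<bar> < 1" using C by simp
  have "crit_fun C r = Jfun (1 / C) r / sqrt C" for r
  proof -
    have "C * r ^ 4 - 2 * r\<^sup>2 + C = C * quart (1 / C) r" using C by (simp add: quart_def algebra_simps)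
    then show ?thesis by (simp add: crit_fun_def[OF C] Jfun_def real_sqrt_mult)
  qed
  then have k: "crit_fun C = (\<lambda>r. Jfun (1 / C) r / sqrt C)" by blast
  have "crit_int C 1 = integral {0..1} (crit_fun C)"
    unfolding crit_int_def[OF C]
    by (rule interval_integral_eq_integral) (auto intro!: borel_integrable_atLeastAtMost' crit_fun_cont C)
  then show ?thesis by (simp add: k Jint_def)
qed

lemma rho_0_div: "C > 1 \<Longrightarrow> rho C 0 / C = sqrt ((1 - 1 / C) / 2) / sqrt C"
proof -
  assume C: "C > 1"
  have "sqrt ((1 - 1 / C) / 2) = sqrt ((C - 1) / 2 / C)" using C by (simp add: field_simps)
  also have "\<dots> = rho C 0 / sqrt C" by (simp add: rho_def real_sqrt_divide real_sqrt_mult)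
  finally show ?thesis using C by simp
qed

lemma Jint_mono:
  assumes "0 < g" "g \<le> g'" "g' < 1" shows "Jint g \<le> Jint g'"
  unfolding Jint_def
proof (rule integral_le)
  fix r :: real
  have "quart g' r \<le> quart g r" unfolding quart_def using assms(2) by (simp add: mult_right_mono)
  then show "Jfun g r \<le> Jfun g' r"
    unfolding Jfun_def using quart_pos[of g r] quart_pos[of g' r] assms by (intro divide_left_mono) auto
qed (use assms in \<open>auto intro!: Jfun_integrable\<close>)

lemma Jint_cont: "continuous_on {0<..<1} Jint"
proof -
  have c: "continuous_on ({0<..<1} \<times> cbox 0 1) (\<lambda>(g, r). Jfun g r)"
    unfolding Jfun_def case_prod_beta
    by (intro continuous_intros, simp_all add: quart_def)
       (use quart_pos in \<open>force simp: less_le quart_def intro!: continuous_intros\<close>)+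
  have "continuous_on {0<..<1} (\<lambda>g. integral (cbox 0 1) (Jfun g))"
    by (rule integral_continuous_on_param[OF c])
  then show ?thesis by (simp add: Jint_def[abs_def])
qed

text \<open>Difference of the two sides of the integral criterion for C = cosh (2 a), after removal
  of their common factor 1 / sqrt C.\<close>

definition defect :: "real \<Rightarrow> real" where
  "defect a = Jint (1 / cosh (2 * a)) - sqrt ((1 - 1 / cosh (2 * a)) / 2)"

lemma cosh_gt_1: "a > 0 \<Longrightarrow> cosh (2 * a) > (1::real)"
  using cosh_real_strict_mono[of 0 "2 * a"] by simp

lemma crit_int_less_iff: "a > 0 \<Longrightarrow> crit_int (cosh (2 * a)) 1 < rho (cosh (2 * a)) 0 / cosh (2 * a) \<longleftrightarrow> defect a < 0"
  using cosh_gt_1[of a] by (simp add: crit_int_eq_Jint rho_0_div defect_def divide_less_cancel)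

lemma crit_int_greater_iff: "a > 0 \<Longrightarrow> rho (cosh (2 * a)) 0 / cosh (2 * a) < crit_int (cosh (2 * a)) 1 \<longleftrightarrow> 0 < defect a"
  using cosh_gt_1[of a] by (simp add: crit_int_eq_Jint rho_0_div defect_def divide_less_cancel)

text \<open>Both terms work in the same direction: as a grows, 1 / cosh (2 a) falls, the integral
  falls with it, and the subtracted square root rises strictly.\<close>

lemma defect_strict_antimono:
  assumes "0 < a" "a < b" shows "defect b < defect a"
proof -
  have c: "1 < cosh (2 * a)" "cosh (2 * a) < cosh (2 * b)"
    using assms cosh_gt_1[of a] cosh_real_strict_mono[of "2 * a" "2 * b"] by auto
  then have g: "1 / cosh (2 * b) < 1 / cosh (2 * a)" "1 / cosh (2 * a) < 1"
    by (auto simp: field_simps)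
  have "Jint (1 / cosh (2 * b)) \<le> Jint (1 / cosh (2 * a))" using g by (intro Jint_mono) auto
  moreover have "sqrt ((1 - 1 / cosh (2 * a)) / 2) < sqrt ((1 - 1 / cosh (2 * b)) / 2)" using g(1) by simp
  ultimately show ?thesis unfolding defect_def by linarith
qed

lemma defect_cont: "continuous_on {0<..} defect"
  unfolding defect_def[abs_def]
  by (intro continuous_intros continuous_on_compose2[OF Jint_cont]) (auto simp: cosh_gt_1)

text \<open>Taylor polynomials of degree 11. The remainder has the even order 12 and is nonnegative,
  so the polynomial is a lower bound for arguments of either sign; the upper bound on the remainder
  uses exp 1 \<le> 3.\<close>

lemma cosh_bounds: "cosh (2 * 0.495765) < 1 / (130447 / 200000 :: real)" "cosh (2 * 0.495775) > 1 / (1304457 / 2000000 :: real)"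
proof -
  have E: "\<exists>t. \<bar>t\<bar> \<le> \<bar>x\<bar> \<and> exp x = (\<Sum>m<12. x ^ m / fact m) + exp t / fact 12 * x ^ 12" for x :: real
    by (rule Maclaurin_exp_le)
  have U: "exp x \<le> (\<Sum>m<12. x ^ m / fact m) + 3 / fact 12" if x: "\<bar>x\<bar> \<le> 1" for x :: real
  proof -
    obtain t where t: "\<bar>t\<bar> \<le> \<bar>x\<bar>" "exp x = (\<Sum>m<12. x ^ m / fact m) + exp t / fact 12 * x ^ 12" using E by blast
    have "exp t \<le> exp 1" using t x by simp
    then have "exp t \<le> 3" using exp_le by linarith
    moreover have "\<bar>x\<bar> ^ 12 \<le> 1" using x by (intro power_le_one) auto
    then have "x ^ 12 \<le> 1" by simp
    moreover have "0 \<le> x ^ 12" by simp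
    ultimately have "exp t * x ^ 12 \<le> 3 * 1" by (intro mult_mono) auto
    then have "exp t / fact 12 * x ^ 12 \<le> 3 / fact 12" by (simp add: field_simps)
    then show ?thesis using t by linarith
  qed
  have L: "(\<Sum>m<12. x ^ m / fact m) \<le> exp x" for x :: real
  proof -
    obtain t where t: "\<bar>t\<bar> \<le> \<bar>x\<bar>" "exp x = (\<Sum>m<12. x ^ m / fact m) + exp t / fact 12 * x ^ 12" using E by blast
    moreover have "0 \<le> exp t / fact 12 * x ^ 12" by simp
    ultimately show ?thesis by linarith
  qed
  show "cosh (2 * 0.495765) < 1 / (130447 / 200000 :: real)"
    using U[of "2 * 0.495765"] U[of "- (2 * 0.495765)"]
    by (simp add: cosh_field_def eval_nat_numeral fact_numeral)
  show "cosh (2 * 0.495775) > 1 / (1304457 / 2000000 :: real)"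
    using L[of "2 * 0.495775"] L[of "- (2 * 0.495775)"]
    by (simp add: cosh_field_def eval_nat_numeral fact_numeral)
qed

lemma defect_pos: "defect 0.495765 > 0"
proof -
  let ?g = "1 / cosh (2 * 0.495765) :: real"
  have c: "cosh (2 * 0.495765) > (1::real)" by (rule cosh_gt_1) simp
  have g: "130447 / 200000 \<le> ?g" "?g < 1" using cosh_bounds(1) c by (simp_all add: field_simps)
  have "416994/1000000 < Jint ?g"
    using Jint_lower Jint_mono[of "130447 / 200000" ?g] g by simp
  moreover have "sqrt ((1 - ?g) / 2) \<le> 416994/1000000"
    by (rule real_le_lsqrt) (use g in \<open>simp_all add: power2_eq_square\<close>)
  ultimately show ?thesis by (simp add: defect_def)
qed

lemma defect_neg: "defect 0.495775 < 0"
proof -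
  let ?g = "1 / cosh (2 * 0.495775) :: real"
  have c: "cosh (2 * 0.495775) > (1::real)" by (rule cosh_gt_1) simp
  have g: "?g \<le> 1304457 / 2000000" "0 < ?g" using cosh_bounds(2) c by (simp_all add: field_simps)
  have "Jint ?g < 4169957/10000000"
    using Jint_upper Jint_mono[of ?g "1304457 / 2000000"] g by simp
  moreover have "4169957/10000000 \<le> sqrt ((1 - ?g) / 2)"
    by (rule real_le_rsqrt) (use g in \<open>simp add: power2_eq_square\<close>)
  ultimately show ?thesis by (simp add: defect_def)
qed

lemma critical_parameter:
  "\<exists>a_c::real. \<bar>a_c - 0.49577\<bar> \<le> 0.000005 \<and> (\<forall>a. 0 < a \<and> a < a_c \<longrightarrow> 0 < defect a) \<and>
    (\<forall>a. a_c \<le> a \<longrightarrow> defect a \<le> 0) \<and> (\<forall>a. a_c < a \<longrightarrow> defect a < 0)"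
proof -
  have "continuous_on {0.495765..0.495775} defect" by (rule continuous_on_subset[OF defect_cont]) auto
  then obtain c where c: "0.495765 \<le> c" "c \<le> 0.495775" "defect c = 0"
    using IVT2'[of defect "0.495775" 0 "0.495765"] defect_pos defect_neg by auto
  show ?thesis
  proof (intro exI[of _ c] conjI allI impI)
    show "\<bar>c - 0.49577\<bar> \<le> 0.000005" using c by (auto simp: abs_if field_simps)
    show "0 < defect a" if "0 < a \<and> a < c" for a using defect_strict_antimono[of a c] that c by simp
    show "defect a < 0" if "c < a" for a using defect_strict_antimono[of c a] that c by simp
    show "defect a \<le> 0" if "c \<le> a" for a
      using defect_strict_antimono[of c a] that c by (cases "a = c") auto
  qed
qed

section \<open>Even eigenfunctions\<close>

definition int_from_0 :: "(real \<Rightarrow> real) \<Rightarrow> real \<Rightarrow> real" where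
  "int_from_0 f s = (LBINT t=ereal 0..ereal s. f t)"

lemma int_from_0_0 [simp]: "int_from_0 f 0 = 0" by (simp add: int_from_0_def)

lemma int_from_0_DERIV: "continuous_on UNIV f \<Longrightarrow> (int_from_0 f has_real_derivative f s) (at s)"
  unfolding int_from_0_def[abs_def] by (rule LBINT_from_zero_DERIV)

lemma int_from_0_unique:
  assumes "continuous_on UNIV f" "\<And>s. (F has_real_derivative f s) (at s)" "F 0 = 0"
  shows "int_from_0 f s = F s"
proof -
  have "((\<lambda>s. int_from_0 f s - F s) has_real_derivative f s - f s) (at s)" for s
    by (intro DERIV_diff int_from_0_DERIV assms)
  then have "((\<lambda>s. int_from_0 f s - F s) has_real_derivative 0) (at s)" for s by simp
  then have "int_from_0 f s - F s = int_from_0 f 0 - F 0" by (intro DERIV_isconst_all) blast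
  then show ?thesis using assms(3) by simp
qed

lemma int_from_0_add:
  "continuous_on UNIV f \<Longrightarrow> continuous_on UNIV g \<Longrightarrow> int_from_0 (\<lambda>t. f t + g t) s = int_from_0 f s + int_from_0 g s"
  by (rule int_from_0_unique) (auto intro!: continuous_intros DERIV_add int_from_0_DERIV)

lemma int_from_0_diff:
  "continuous_on UNIV f \<Longrightarrow> continuous_on UNIV g \<Longrightarrow> int_from_0 (\<lambda>t. f t - g t) s = int_from_0 f s - int_from_0 g s"
  by (rule int_from_0_unique) (auto intro!: continuous_intros DERIV_diff int_from_0_DERIV)

text \<open>The inductive step for iterated integrals, in which |t|^n / n! becomes |t|^(n+1) /
  (n+1)!. It follows from monotonicity of the bound minus F and of the bound plus F.\<close>

lemma antideriv_power_bound_pos: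
  fixes F f :: "real \<Rightarrow> real"
  assumes "F 0 = 0" "\<And>t. (F has_real_derivative f t) (at t)"
    and b: "\<And>t. \<bar>t\<bar> \<le> R \<Longrightarrow> \<bar>f t\<bar> \<le> c * \<bar>t\<bar> ^ n / fact n" and s: "0 \<le> s" "s \<le> R"
  shows "\<bar>F s\<bar> \<le> c * s ^ Suc n / fact (Suc n)"
proof -
  have G: "((\<lambda>t. c * t ^ Suc n / fact (Suc n)) has_real_derivative c * t ^ n / fact n) (at t)" for t
  proof -
    have "((\<lambda>t. c * t ^ Suc n / fact (Suc n)) has_real_derivative c * (real (Suc n) * t ^ n) / fact (Suc n)) (at t)"
      by (rule derivative_eq_intros refl | simp)+
    moreover have "c * (real (Suc n) * t ^ n) / fact (Suc n) = c * t ^ n / fact n"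
      by (simp add: field_simps del: of_nat_Suc)
    ultimately show ?thesis by (simp only:)
  qed
  have "c * 0 ^ Suc n / fact (Suc n) - e * F 0 \<le> c * s ^ Suc n / fact (Suc n) - e * F s"
    if "e = 1 \<or> e = - 1" for e
  proof (rule DERIV_nonneg_imp_nondecreasing[OF s(1)])
    fix t assume t: "0 \<le> t" "t \<le> s"
    have "((\<lambda>t. c * t ^ Suc n / fact (Suc n) - e * F t) has_real_derivative c * t ^ n / fact n - e * f t) (at t)"
      by (intro DERIV_diff G DERIV_cmult assms)
    moreover have "e * f t \<le> c * t ^ n / fact n" using b[of t] t s that by (auto simp: abs_le_iff)
    ultimately show "\<exists>y. ((\<lambda>t. c * t ^ Suc n / fact (Suc n) - e * F t) has_real_derivative y) (at t) \<and> 0 \<le> y"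
      by (intro exI conjI) auto
  qed
  from this[of 1] this[of "-1"] show ?thesis using assms(1) by (simp add: abs_le_iff)
qed

lemma antideriv_power_bound:
  fixes F f :: "real \<Rightarrow> real"
  assumes "F 0 = 0" "\<And>t. (F has_real_derivative f t) (at t)"
    and b: "\<And>t. \<bar>t\<bar> \<le> R \<Longrightarrow> \<bar>f t\<bar> \<le> c * \<bar>t\<bar> ^ n / fact n" and s: "\<bar>s\<bar> \<le> R"
  shows "\<bar>F s\<bar> \<le> c * \<bar>s\<bar> ^ Suc n / fact (Suc n)"
proof (cases "0 \<le> s")
  case True
  then show ?thesis using antideriv_power_bound_pos[OF assms(1-3), where s = s] s by simp
next
  case False
  have "((\<lambda>s. F (- s)) has_real_derivative - f (- t)) (at t)" for t
    using DERIV_chain2[OF assms(2)[of "- t"] DERIV_minus[OF DERIV_ident]] by simp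
  then have "\<bar>F (- (- s))\<bar> \<le> c * (- s) ^ Suc n / fact (Suc n)"
    using False s assms(1) b[of "- _"]
    by (intro antideriv_power_bound_pos[where F = "\<lambda>s. F (- s)" and f = "\<lambda>t. - f (- t)" and R = R]) auto
  then show ?thesis using False by simp
qed

text \<open>Neumann series for a kernel of rank two, the form that variation of constants produces.
  The terms are dominated by an exponential series, which gives convergence on bounded intervals and
  the explicit bound. The bound is part of the existence claim because it is used to place this very
  solution near \<open>f\<close>.\<close>

lemma volterra:
  fixes f p1 p2 q1 q2 :: "real \<Rightarrow> real"
  assumes c: "continuous_on UNIV f" "continuous_on UNIV p1" "continuous_on UNIV p2"
    "continuous_on UNIV q1" "continuous_on UNIV q2"
  shows "\<exists>\<phi>. continuous_on UNIV \<phi> \<and>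
     (\<forall>s. \<phi> s = f s + p1 s * int_from_0 (\<lambda>t. q1 t * \<phi> t) s + p2 s * int_from_0 (\<lambda>t. q2 t * \<phi> t) s) \<and>
     (\<forall>R M P Q. 0 \<le> P \<and> 0 \<le> Q \<and> 0 \<le> M \<and> (\<forall>s. \<bar>s\<bar> \<le> R \<longrightarrow> \<bar>f s\<bar> \<le> M \<and> \<bar>p1 s\<bar> \<le> P \<and> \<bar>p2 s\<bar> \<le> P \<and> \<bar>q1 s\<bar> \<le> Q \<and> \<bar>q2 s\<bar> \<le> Q) \<longrightarrow>
       (\<forall>s. \<bar>s\<bar> \<le> R \<longrightarrow> \<bar>\<phi> s - f s\<bar> \<le> M * (exp (2 * P * Q * R) - 1)))"
proof -
  define T where "T = (\<lambda>\<phi> s. p1 s * int_from_0 (\<lambda>t. q1 t * \<phi> t) s + p2 s * int_from_0 (\<lambda>t. q2 t * \<phi> t) s)"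
  define u where "u = (\<lambda>n. (T ^^ n) f)"
  have u0: "u 0 = f" and uS: "u (Suc n) = T (u n)" for n by (auto simp: u_def)
  have Tc: "continuous_on UNIV (T \<phi>)" if "continuous_on UNIV \<phi>" for \<phi>
    unfolding T_def by (intro continuous_intros c continuous_on_if_DERIV[OF int_from_0_DERIV] that)
  have uc: "continuous_on UNIV (u n)" for n by (induction n) (auto simp: u0 uS c Tc)
  have T_add: "T (\<lambda>t. \<phi> t + \<psi> t) s = T \<phi> s + T \<psi> s" if "continuous_on UNIV \<phi>" "continuous_on UNIV \<psi>" for \<phi> \<psi> s
    unfolding T_def by (simp add: algebra_simps int_from_0_add continuous_on_mult c that)
  have T_diff: "T (\<lambda>t. \<phi> t - \<psi> t) s = T \<phi> s - T \<psi> s" if "continuous_on UNIV \<phi>" "continuous_on UNIV \<psi>" for \<phi> \<psi> s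
    unfolding T_def by (simp add: algebra_simps int_from_0_diff continuous_on_mult c that)
  define Bd where "Bd = (\<lambda>R M P Q. 0 \<le> P \<and> 0 \<le> Q \<and> 0 \<le> M \<and> (\<forall>s. \<bar>s\<bar> \<le> R \<longrightarrow>
      \<bar>f s\<bar> \<le> M \<and> \<bar>p1 s\<bar> \<le> P \<and> \<bar>p2 s\<bar> \<le> P \<and> \<bar>q1 s\<bar> \<le> Q \<and> \<bar>q2 s\<bar> \<le> Q))"
  have T_bound: "\<bar>T \<phi> s\<bar> \<le> 2 * P * Q * b * \<bar>s\<bar> ^ Suc n / fact (Suc n)"
    if B: "Bd R M P Q" and s: "\<bar>s\<bar> \<le> R" and \<phi>: "continuous_on UNIV \<phi>"
      and b: "\<And>t. \<bar>t\<bar> \<le> R \<Longrightarrow> \<bar>\<phi> t\<bar> \<le> b * \<bar>t\<bar> ^ n / fact n" "0 \<le> b" for R M P Q s \<phi> b n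
  proof -
    have *: "\<bar>p * int_from_0 (\<lambda>t. q t * \<phi> t) s\<bar> \<le> P * (Q * b * \<bar>s\<bar> ^ Suc n / fact (Suc n))"
      if "continuous_on UNIV q" "\<And>t. \<bar>t\<bar> \<le> R \<Longrightarrow> \<bar>q t\<bar> \<le> Q" "\<bar>p\<bar> \<le> P" for p q
    proof -
      have "\<bar>q t * \<phi> t\<bar> \<le> Q * b * \<bar>t\<bar> ^ n / fact n" if "\<bar>t\<bar> \<le> R" for t
      proof -
        have "\<bar>q t * \<phi> t\<bar> \<le> Q * (b * \<bar>t\<bar> ^ n / fact n)"
          unfolding abs_mult using \<open>\<bar>t\<bar> \<le> R\<close> b B \<open>\<And>t. \<bar>t\<bar> \<le> R \<Longrightarrow> \<bar>q t\<bar> \<le> Q\<close>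
          by (intro mult_mono) (auto simp: Bd_def)
        then show ?thesis by (simp add: mult.assoc)
      qed
      then have "\<bar>int_from_0 (\<lambda>t. q t * \<phi> t) s\<bar> \<le> Q * b * \<bar>s\<bar> ^ Suc n / fact (Suc n)"
        by (intro antideriv_power_bound[where f = "\<lambda>t. q t * \<phi> t" and R = R] int_from_0_DERIV s)
           (auto intro!: continuous_intros that \<phi>)
      then show ?thesis unfolding abs_mult using that(3) B by (intro mult_mono) (auto simp: Bd_def)
    qed
    have "\<bar>T \<phi> s\<bar> \<le> P * (Q * b * \<bar>s\<bar> ^ Suc n / fact (Suc n)) + P * (Q * b * \<bar>s\<bar> ^ Suc n / fact (Suc n))"
      unfolding T_def using B s by (intro order_trans[OF abs_triangle_ineq] add_mono * c) (auto simp: Bd_def)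
    then show ?thesis by (simp add: field_simps)
  qed
  have u_bound: "\<bar>u n s\<bar> \<le> (M * (2 * P * Q) ^ n) * \<bar>s\<bar> ^ n / fact n" if B: "Bd R M P Q" and s: "\<bar>s\<bar> \<le> R" for R M P Q n s
    using s
  proof (induction n arbitrary: s)
    case 0
    then show ?case using B by (simp add: u0 Bd_def)
  next
    case (Suc n)
    have "\<bar>T (u n) s\<bar> \<le> 2 * P * Q * (M * (2 * P * Q) ^ n) * \<bar>s\<bar> ^ Suc n / fact (Suc n)"
      using B by (intro T_bound[OF B Suc.prems uc] Suc.IH) (auto simp: Bd_def)
    then show ?case by (simp only: uS) (simp add: algebra_simps)
  qed
  have u_bound': "\<bar>u n s\<bar> \<le> M * ((2 * P * Q * R) ^ n / fact n)" if B: "Bd R M P Q" and s: "\<bar>s\<bar> \<le> R" for R M P Q n s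
  proof -
    have "\<bar>s\<bar> ^ n \<le> R ^ n" using s by (intro power_mono) auto
    then have "(M * (2 * P * Q) ^ n) * \<bar>s\<bar> ^ n / fact n \<le> (M * (2 * P * Q) ^ n) * R ^ n / fact n"
      using B by (intro divide_right_mono mult_left_mono) (auto simp: Bd_def)
    then show ?thesis using u_bound[OF B s, of n] by (simp add: power_mult_distrib algebra_simps)
  qed
  have exS: "(\<lambda>n. M * (x ^ n / fact n)) sums (M * exp x)" for M x :: real
    using exp_converges[of x] by (intro sums_mult) (simp add: divide_inverse_commute scaleR_conv_of_real mult.commute)
  have ex: "\<exists>M P Q. Bd R M P Q" for R
  proof -
    have bd: "\<exists>B\<ge>0. \<forall>s. \<bar>s\<bar> \<le> R \<longrightarrow> \<bar>g s\<bar> \<le> B" if "continuous_on UNIV g" for g :: "real \<Rightarrow> real"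
    proof -
      have "bounded (g ` {- R..R})"
        by (intro compact_imp_bounded compact_continuous_image continuous_on_subset[OF that]) auto
      then obtain B where "B > 0" "\<forall>x\<in>g ` {- R..R}. norm x \<le> B" unfolding bounded_pos by auto
      then show ?thesis by (intro exI[of _ B]) (auto simp: abs_le_iff)
    qed
    obtain M P1 P2 Q1 Q2 where m: "M \<ge> 0" "\<forall>s. \<bar>s\<bar> \<le> R \<longrightarrow> \<bar>f s\<bar> \<le> M" "P1 \<ge> 0" "\<forall>s. \<bar>s\<bar> \<le> R \<longrightarrow> \<bar>p1 s\<bar> \<le> P1"
      "P2 \<ge> 0" "\<forall>s. \<bar>s\<bar> \<le> R \<longrightarrow> \<bar>p2 s\<bar> \<le> P2" "Q1 \<ge> 0" "\<forall>s. \<bar>s\<bar> \<le> R \<longrightarrow> \<bar>q1 s\<bar> \<le> Q1" "Q2 \<ge> 0" "\<forall>s. \<bar>s\<bar> \<le> R \<longrightarrow> \<bar>q2 s\<bar> \<le> Q2"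
      using bd[OF c(1)] bd[OF c(2)] bd[OF c(3)] bd[OF c(4)] bd[OF c(5)] by blast
    show ?thesis
      by (intro exI[of _ M] exI[of _ "max P1 P2"] exI[of _ "max Q1 Q2"]) (use m in \<open>auto simp: Bd_def le_max_iff_disj\<close>)
  qed
  define \<phi> where "\<phi> = (\<lambda>s. \<Sum>n. u n s)"
  have unif: "uniform_limit {- R..R} (\<lambda>n s. \<Sum>i<n. u i s) \<phi> sequentially" for R
  proof -
    obtain M P Q where B: "Bd R M P Q" using ex by blast
    show ?thesis unfolding \<phi>_def
      by (rule Weierstrass_m_test[where M = "\<lambda>n. M * ((2 * P * Q * R) ^ n / fact n)"])
         (use u_bound'[OF B] sums_summable[OF exS] in \<open>auto simp: abs_le_iff\<close>)
  qed
  have contR: "continuous_on {- R..R} \<phi>" for R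
    by (rule uniform_limit_theorem[OF _ unif])
       (auto intro!: always_eventually continuous_intros continuous_on_subset[OF uc])
  have \<phi>c: "continuous_on UNIV \<phi>"
  proof (rule continuous_at_imp_continuous_on, rule ballI)
    fix s :: real
    have "continuous_on {- (\<bar>s\<bar> + 1)<..<\<bar>s\<bar> + 1} \<phi>" by (rule continuous_on_subset[OF contR[of "\<bar>s\<bar> + 1"]]) auto
    then show "isCont \<phi> s" by (simp add: continuous_on_eq_continuous_at abs_real_def split: if_splits)
  qed
  have Sc: "continuous_on UNIV (\<lambda>s. \<Sum>i<n. u i s)" for n by (intro continuous_intros uc)
  \<comment> \<open>The partial sums satisfy the equation up to a shift of the index, so it passes
    to the limit once \<open>T\<close> is seen to respect the convergence.\<close>
  have Sn: "(\<Sum>i<Suc n. u i s) = f s + T (\<lambda>s. \<Sum>i<n. u i s) s" for n s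
  proof (induction n)
    case 0
    have "int_from_0 (\<lambda>t. 0) s = 0" for s by (rule int_from_0_unique) auto
    then show ?case by (simp add: u0 T_def)
  next
    case (Suc n)
    have "T (\<lambda>s. \<Sum>i<Suc n. u i s) s = T (\<lambda>s. \<Sum>i<n. u i s) s + T (u n) s"
      using T_add[OF Sc uc, of n n s] by simp
    then show ?case using Suc by (simp add: uS)
  qed
  have eq: "\<phi> s = f s + T \<phi> s" for s
  proof -
    define R where "R = \<bar>s\<bar>"
    obtain M P Q where B: "Bd R M P Q" using ex by blast
    have s: "s \<in> {- R..R}" "\<bar>s\<bar> \<le> R" by (auto simp: R_def)
    have "(\<lambda>n. T (\<lambda>s. \<Sum>i<n. u i s) s) \<longlonglongrightarrow> T \<phi> s"
    proof (rule LIMSEQ_I)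
      fix r :: real assume r: "r > 0"
      \<comment> \<open>Chosen so that \<open>T\<close> maps functions smaller than \<open>e\<close>
        to values smaller than \<open>r\<close>; the summand 1 covers a vanishing bound.\<close>
      define e where "e = r / (2 * P * Q * R + 1)"
      have K: "2 * P * Q * R \<ge> 0" using B by (simp add: Bd_def R_def)
      have e: "e > 0" using r K by (simp add: e_def)
      have "eventually (\<lambda>n. \<forall>t\<in>{- R..R}. dist (\<Sum>i<n. u i t) (\<phi> t) < e) sequentially"
        using unif[of R] e by (rule uniform_limitD)
      then obtain N where "\<forall>n\<ge>N. \<forall>t\<in>{- R..R}. dist (\<Sum>i<n. u i t) (\<phi> t) < e"
        unfolding eventually_sequentially by blast
      then have N: "\<bar>(\<Sum>i<n. u i t) - \<phi> t\<bar> < e" if "n \<ge> N" "\<bar>t\<bar> \<le> R" for n t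
        using that by (simp add: dist_real_def abs_le_iff)
      show "\<exists>no. \<forall>n\<ge>no. norm (T (\<lambda>s. \<Sum>i<n. u i s) s - T \<phi> s) < r"
      proof (intro exI[of _ N] allI impI)
        fix n assume n: "n \<ge> N"
        have "\<bar>T (\<lambda>t. (\<Sum>i<n. u i t) - \<phi> t) s\<bar> \<le> 2 * P * Q * e * \<bar>s\<bar> ^ Suc 0 / fact (Suc 0)"
          using N[OF n] e by (intro T_bound[OF B s(2)] continuous_intros Sc \<phi>c) (auto intro: less_imp_le)
        then have "\<bar>T (\<lambda>s. \<Sum>i<n. u i s) s - T \<phi> s\<bar> \<le> 2 * P * Q * R * e"
          using T_diff[OF Sc \<phi>c, of n s] by (simp add: R_def algebra_simps)
        also have "\<dots> < (2 * P * Q * R + 1) * e" using e by simp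
        also have "\<dots> = r" using K by (simp add: e_def)
        finally show "norm (T (\<lambda>s. \<Sum>i<n. u i s) s - T \<phi> s) < r" by simp
      qed
    qed
    then have "(\<lambda>n. f s + T (\<lambda>s. \<Sum>i<n. u i s) s) \<longlonglongrightarrow> f s + T \<phi> s" by (intro tendsto_intros)
    then have "(\<lambda>n. \<Sum>i<Suc n. u i s) \<longlonglongrightarrow> f s + T \<phi> s" by (simp only: Sn)
    moreover have "(\<lambda>n. \<Sum>i<n. u i s) \<longlonglongrightarrow> \<phi> s" using unif[of R] s(1) by (rule tendsto_uniform_limitI)
    then have "(\<lambda>n. \<Sum>i<Suc n. u i s) \<longlonglongrightarrow> \<phi> s" by (rule LIMSEQ_Suc)
    ultimately show ?thesis by (metis LIMSEQ_unique)
  qed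
  have est: "\<bar>\<phi> s - f s\<bar> \<le> M * (exp (2 * P * Q * R) - 1)" if B: "Bd R M P Q" and s: "\<bar>s\<bar> \<le> R" for R M P Q s
  proof -
    have sm: "summable (\<lambda>n. M * ((2 * P * Q * R) ^ n / fact n))" using exS sums_summable by blast
    have su: "summable (\<lambda>n. \<bar>u n s\<bar>)"
      by (rule summable_comparison_test'[OF sm, of 0]) (use u_bound'[OF B s] in auto)
    then have su': "summable (\<lambda>n. u n s)" by (rule summable_rabs_cancel)
    have "\<phi> s - f s = (\<Sum>n. u (Suc n) s)"
      using suminf_split_head[OF su'] by (simp add: \<phi>_def u0)
    also have "\<bar>\<dots>\<bar> \<le> (\<Sum>n. \<bar>u (Suc n) s\<bar>)"
      by (rule summable_rabs) (use su in \<open>simp add: summable_Suc_iff[of "\<lambda>n. \<bar>u n s\<bar>"]\<close>)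
    also have "\<dots> \<le> (\<Sum>n. M * ((2 * P * Q * R) ^ Suc n / fact (Suc n)))"
      by (intro suminf_le u_bound'[OF B s]) (use su sm in \<open>simp_all only: summable_Suc_iff[of "\<lambda>n. \<bar>u n s\<bar>"] summable_Suc_iff[of "\<lambda>n. M * ((2 * P * Q * R) ^ n / fact n)"]\<close>)
    also have "\<dots> = M * exp (2 * P * Q * R) - M"
      using suminf_split_head[OF sm] sums_unique[OF exS[of M "2 * P * Q * R"]] by simp
    finally show ?thesis by (simp add: algebra_simps)
  qed
  have "\<phi> s = f s + p1 s * int_from_0 (\<lambda>t. q1 t * \<phi> t) s + p2 s * int_from_0 (\<lambda>t. q2 t * \<phi> t) s" for s
    using eq[of s] by (simp only: T_def add.assoc)
  then show ?thesis
    by (intro exI[of _ \<phi>] conjI[OF \<phi>c] conjI allI impI) (assumption, rule est[unfolded Bd_def])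
qed

section \<open>Perturbing the even Jacobi field\<close>

lemma pot_even: "C > 1 \<Longrightarrow> pot C (- s) = pot C s"
  by (simp add: pot_def rho_even)

text \<open>Both functions solve the same equation in divergence form, so rho times their Wronskian
  is constant. It is evaluated at 0, where \<open>even_jacobi\<close> is 1 and \<open>rho1\<close>
  is 0.\<close>

lemma wronskian:
  assumes C: "C > 1"
  shows "rho C s * (even_jacobi C s * rho2 C s - even_jacobi_deriv C s * rho1 C s) = rho C 0 * rho2 C 0"
proof -
  have "((\<lambda>s. even_jacobi C s * (rho C s * rho2 C s) - rho1 C s * (rho C s * even_jacobi_deriv C s)) has_real_derivative
     (even_jacobi_deriv C s * (rho C s * rho2 C s) + - (rho C s * pot C s * rho1 C s) * even_jacobi C s)
     - (rho2 C s * (rho C s * even_jacobi_deriv C s) + - (rho C s * pot C s * even_jacobi C s) * rho1 C s)) (at s)" for s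
    by (intro DERIV_diff DERIV_mult even_jacobi_DERIV rho1_DERIV rho_rho2_DERIV even_jacobi_deriv_DERIV C)
  then have "((\<lambda>s. even_jacobi C s * (rho C s * rho2 C s) - rho1 C s * (rho C s * even_jacobi_deriv C s)) has_real_derivative 0) (at s)" for s
    by (simp add: algebra_simps)
  then have "even_jacobi C s * (rho C s * rho2 C s) - rho1 C s * (rho C s * even_jacobi_deriv C s)
     = even_jacobi C 0 * (rho C 0 * rho2 C 0) - rho1 C 0 * (rho C 0 * even_jacobi_deriv C 0)"
    by (intro DERIV_isconst_all) blast
  then show ?thesis by (simp add: even_jacobi_0[OF C] rho1_0[OF C] algebra_simps)
qed

text \<open>For l = - k the equation reads (rho w')' + rho pot w = k rho w. Variation of constants
  with the basis \<open>even_jacobi\<close>, \<open>rho1\<close> turns it into a Volterra equation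
  whose kernel carries the factor k, so for small k the solution stays near
  \<open>even_jacobi\<close> on the given interval.\<close>

lemma eigenfunction_near_even_jacobi:
  assumes C: "C > 1" and s0: "s0 \<ge> 0" and \<epsilon>: "\<epsilon> > 0"
  shows "\<exists>l<0. \<exists>\<phi> \<phi>1. (\<forall>s. (\<phi> has_real_derivative \<phi>1 s) (at s)) \<and>
    (\<forall>s. ((\<lambda>s. rho C s * \<phi>1 s) has_real_derivative - (rho C s * (pot C s + l) * \<phi> s)) (at s)) \<and>
    (\<forall>s. \<bar>s\<bar> \<le> s0 \<longrightarrow> \<bar>\<phi> s - even_jacobi C s\<bar> < \<epsilon>)"
proof -
  note cont = rho_cont[OF C] even_jacobi_cont[OF C] rho1_cont[OF C]
  define W where "W = rho C 0 * rho2 C 0"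
  have W: "W > 0" unfolding W_def using rho_pos[OF C] rho2_pos[OF C] by simp
  have "\<exists>B\<ge>0. \<forall>s. \<bar>s\<bar> \<le> s0 \<longrightarrow> \<bar>g s\<bar> \<le> B" if "continuous_on {- s0..s0} g" for g :: "real \<Rightarrow> real"
  proof -
    have "bounded (g ` {- s0..s0})" by (intro compact_imp_bounded compact_continuous_image that) auto
    then obtain B where "B > 0" "\<forall>x\<in>g ` {- s0..s0}. norm x \<le> B" unfolding bounded_pos by auto
    then show ?thesis by (intro exI[of _ B]) (auto simp: abs_le_iff)
  qed
  note bd = this
  obtain M where M: "M \<ge> 0" "\<forall>s. \<bar>s\<bar> \<le> s0 \<longrightarrow> \<bar>even_jacobi C s\<bar> \<le> M" using bd[OF cont(2)] by blast
  obtain P where P: "P \<ge> 0" "\<forall>s. \<bar>s\<bar> \<le> s0 \<longrightarrow> \<bar>rho1 C s\<bar> \<le> P" using bd[OF cont(3)] by blast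
  have cq: "continuous_on {- s0..s0} (\<lambda>s. even_jacobi C s * rho C s / W)" "continuous_on {- s0..s0} (\<lambda>s. rho1 C s * rho C s / W)"
    using W by (auto intro!: continuous_intros cont)
  obtain Q1 where Q1: "Q1 \<ge> 0" "\<forall>s. \<bar>s\<bar> \<le> s0 \<longrightarrow> \<bar>even_jacobi C s * rho C s / W\<bar> \<le> Q1"
    using bd[OF cq(1)] by blast
  obtain Q2 where Q2: "Q2 \<ge> 0" "\<forall>s. \<bar>s\<bar> \<le> s0 \<longrightarrow> \<bar>rho1 C s * rho C s / W\<bar> \<le> Q2"
    using bd[OF cq(2)] by blast
  define A where "A = max P M" define Q where "Q = max Q1 Q2"
  have AQ: "A \<ge> 0" "Q \<ge> 0" using P Q1 by (auto simp: A_def Q_def)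
  \<comment> \<open>The bound for the Volterra solution is continuous in the factor x and vanishes
    at x = 0, so some positive \<open>k\<close> brings it below \<epsilon>.\<close>
  have "((\<lambda>x. M * (exp (2 * A * (x * Q) * s0) - 1)) \<longlongrightarrow> M * (exp (2 * A * (0 * Q) * s0) - 1)) (at_right 0)"
    by (intro tendsto_intros)
  then have "eventually (\<lambda>x. M * (exp (2 * A * (x * Q) * s0) - 1) < \<epsilon>) (at_right 0)"
    by (intro order_tendstoD(2)[of _ _ "at_right 0"]) (use \<epsilon> in auto)
  moreover have "eventually (\<lambda>x::real. x > 0) (at_right 0)" by (simp add: eventually_at_right_less)
  ultimately have "eventually (\<lambda>x. M * (exp (2 * A * (x * Q) * s0) - 1) < \<epsilon> \<and> x > 0) (at_right 0)"
    by eventually_elim simp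
  then obtain k where k: "M * (exp (2 * A * (k * Q) * s0) - 1) < \<epsilon>" "k > 0"
    using eventually_happens'[OF trivial_limit_at_right_real] by blast
  define q1 where "q1 = (\<lambda>s. k * (even_jacobi C s * rho C s / W))"
  define q2 where "q2 = (\<lambda>s. - k * (rho1 C s * rho C s / W))"
  have qc: "continuous_on UNIV q1" "continuous_on UNIV q2"
    unfolding q1_def q2_def using W by (auto intro!: continuous_intros cont)
  obtain \<phi> where \<phi>: "continuous_on UNIV \<phi>"
    "\<And>s. \<phi> s = even_jacobi C s + rho1 C s * int_from_0 (\<lambda>t. q1 t * \<phi> t) s + even_jacobi C s * int_from_0 (\<lambda>t. q2 t * \<phi> t) s"
    and est: "\<And>R M P Q. 0 \<le> P \<and> 0 \<le> Q \<and> 0 \<le> M \<and> (\<forall>s. \<bar>s\<bar> \<le> R \<longrightarrow> \<bar>even_jacobi C s\<bar> \<le> M \<and> \<bar>rho1 C s\<bar> \<le> P \<and> \<bar>even_jacobi C s\<bar> \<le> P \<and> \<bar>q1 s\<bar> \<le> Q \<and> \<bar>q2 s\<bar> \<le> Q) \<Longrightarrow>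
       (\<forall>s. \<bar>s\<bar> \<le> R \<longrightarrow> \<bar>\<phi> s - even_jacobi C s\<bar> \<le> M * (exp (2 * P * Q * R) - 1))"
    using volterra[OF cont(2) cont(3) cont(2) qc] by blast
  define \<phi>1 where "\<phi>1 = (\<lambda>s. even_jacobi_deriv C s + rho2 C s * int_from_0 (\<lambda>t. q1 t * \<phi> t) s + even_jacobi_deriv C s * int_from_0 (\<lambda>t. q2 t * \<phi> t) s)"
  have I: "(int_from_0 (\<lambda>t. q1 t * \<phi> t) has_real_derivative q1 s * \<phi> s) (at s)"
    "(int_from_0 (\<lambda>t. q2 t * \<phi> t) has_real_derivative q2 s * \<phi> s) (at s)" for s
    by (intro int_from_0_DERIV continuous_intros qc \<phi>(1))+
  \<comment> \<open>The defining relation of variation of constants: differentiating the integrals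
    contributes nothing to the first derivative.\<close>
  have cancel: "rho1 C s * (q1 s * \<phi> s) + even_jacobi C s * (q2 s * \<phi> s) = 0" for s
    by (simp add: q1_def q2_def)
  have D: "(\<phi> has_real_derivative \<phi>1 s) (at s)" for s
  proof -
    have *: "((\<lambda>s. even_jacobi C s + rho1 C s * int_from_0 (\<lambda>t. q1 t * \<phi> t) s + even_jacobi C s * int_from_0 (\<lambda>t. q2 t * \<phi> t) s) has_real_derivative
       even_jacobi_deriv C s + (rho2 C s * int_from_0 (\<lambda>t. q1 t * \<phi> t) s + q1 s * \<phi> s * rho1 C s)
        + (even_jacobi_deriv C s * int_from_0 (\<lambda>t. q2 t * \<phi> t) s + q2 s * \<phi> s * even_jacobi C s)) (at s)"
      by (intro DERIV_add DERIV_mult I even_jacobi_DERIV rho1_DERIV C)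
    have "(\<lambda>s. even_jacobi C s + rho1 C s * int_from_0 (\<lambda>t. q1 t * \<phi> t) s + even_jacobi C s * int_from_0 (\<lambda>t. q2 t * \<phi> t) s) = \<phi>"
      by (rule ext) (rule \<phi>(2)[symmetric])
    moreover have "even_jacobi_deriv C s + (rho2 C s * int_from_0 (\<lambda>t. q1 t * \<phi> t) s + q1 s * \<phi> s * rho1 C s)
        + (even_jacobi_deriv C s * int_from_0 (\<lambda>t. q2 t * \<phi> t) s + q2 s * \<phi> s * even_jacobi C s) = \<phi>1 s"
      using cancel[of s] unfolding \<phi>1_def by (simp add: algebra_simps)
    ultimately show ?thesis using * by (simp only:)
  qed
  have D2: "((\<lambda>s. rho C s * \<phi>1 s) has_real_derivative - (rho C s * (pot C s + - k) * \<phi> s)) (at s)" for s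
  proof -
    let ?A = "int_from_0 (\<lambda>t. q1 t * \<phi> t)" and ?B = "int_from_0 (\<lambda>t. q2 t * \<phi> t)"
    have "((\<lambda>s. (rho C s * even_jacobi_deriv C s) + (rho C s * rho2 C s) * ?A s + (rho C s * even_jacobi_deriv C s) * ?B s) has_real_derivative
       - (rho C s * pot C s * even_jacobi C s) + (- (rho C s * pot C s * rho1 C s) * ?A s + q1 s * \<phi> s * (rho C s * rho2 C s))
        + (- (rho C s * pot C s * even_jacobi C s) * ?B s + q2 s * \<phi> s * (rho C s * even_jacobi_deriv C s))) (at s)"
      by (intro DERIV_add DERIV_mult I even_jacobi_deriv_DERIV rho_rho2_DERIV C)
    moreover have "- (rho C s * pot C s * even_jacobi C s) + (- (rho C s * pot C s * rho1 C s) * ?A s + q1 s * \<phi> s * (rho C s * rho2 C s))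
        + (- (rho C s * pot C s * even_jacobi C s) * ?B s + q2 s * \<phi> s * (rho C s * even_jacobi_deriv C s))
       = - (rho C s * pot C s) * (even_jacobi C s + rho1 C s * ?A s + even_jacobi C s * ?B s) + \<phi> s * (q1 s * (rho C s * rho2 C s) + q2 s * (rho C s * even_jacobi_deriv C s))"
      by (simp add: algebra_simps)
    moreover have "even_jacobi C s + rho1 C s * ?A s + even_jacobi C s * ?B s = \<phi> s" by (rule \<phi>(2)[symmetric])
    \<comment> \<open>In the second derivative the same contributions combine to the Wronskian and
      leave the source k rho.\<close>
    moreover have "q1 s * (rho C s * rho2 C s) + q2 s * (rho C s * even_jacobi_deriv C s)
       = k / W * rho C s * (rho C s * (even_jacobi C s * rho2 C s - even_jacobi_deriv C s * rho1 C s))"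
      unfolding q1_def q2_def divide_inverse by algebra
    moreover have "\<dots> = k * rho C s" unfolding wronskian[OF C] W_def[symmetric] using W by simp
    moreover have "(\<lambda>s. (rho C s * even_jacobi_deriv C s) + (rho C s * rho2 C s) * ?A s + (rho C s * even_jacobi_deriv C s) * ?B s) = (\<lambda>s. rho C s * \<phi>1 s)"
      by (rule ext) (simp add: \<phi>1_def algebra_simps)
    ultimately have "((\<lambda>s. rho C s * \<phi>1 s) has_real_derivative - (rho C s * pot C s) * \<phi> s + \<phi> s * (k * rho C s)) (at s)"
      by (simp only:)
    then show ?thesis by (simp add: algebra_simps)
  qed
  have "\<bar>\<phi> s - even_jacobi C s\<bar> < \<epsilon>" if "\<bar>s\<bar> \<le> s0" for s
  proof -
    have "\<bar>\<phi> s - even_jacobi C s\<bar> \<le> M * (exp (2 * A * (k * Q) * s0) - 1)"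
    proof (rule est[rule_format, OF _ that])
      have "\<bar>q1 s\<bar> \<le> k * Q \<and> \<bar>q2 s\<bar> \<le> k * Q" if "\<bar>s\<bar> \<le> s0" for s
      proof -
        have "\<bar>even_jacobi C s * rho C s / W\<bar> \<le> Q" "\<bar>rho1 C s * rho C s / W\<bar> \<le> Q"
          using Q1(2)[rule_format, OF that] Q2(2)[rule_format, OF that] unfolding Q_def by linarith+
        then have "k * \<bar>even_jacobi C s * rho C s / W\<bar> \<le> k * Q" "k * \<bar>rho1 C s * rho C s / W\<bar> \<le> k * Q"
          using k(2) by (intro mult_left_mono; simp)+
        then show ?thesis unfolding q1_def q2_def by (simp only: abs_mult abs_minus_cancel abs_of_pos[OF k(2)])
      qed
      then show "0 \<le> A \<and> 0 \<le> k * Q \<and> 0 \<le> M \<and> (\<forall>s. \<bar>s\<bar> \<le> s0 \<longrightarrow> \<bar>even_jacobi C s\<bar> \<le> M \<and> \<bar>rho1 C s\<bar> \<le> A \<and> \<bar>even_jacobi C s\<bar> \<le> A \<and> \<bar>q1 s\<bar> \<le> k * Q \<and> \<bar>q2 s\<bar> \<le> k * Q)"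
        using AQ k(2) M P unfolding A_def
        by (intro conjI allI impI) (simp_all add: le_max_iff_disj del: abs_le_iff)
    qed
    then show ?thesis using k(1) by linarith
  qed
  note E = this
  show ?thesis
  proof (rule exI[of _ "- k"], rule conjI, goal_cases)
    case 1 show ?case using k(2) by simp
    case 2 show ?case
      by (rule exI[of _ \<phi>], rule exI[of _ \<phi>1]) (intro conjI allI impI D D2 E; assumption)
  qed
qed

text \<open>Closeness to the even field forces opposite signs at 0 and \<open>s0\<close>, hence a
  zero \<open>S\<close> in between. Averaging with the reflection makes the solution even and keeps
  it close, since \<open>rho\<close>, \<open>pot\<close> and \<open>even_jacobi\<close> are
  even.\<close>

lemma even_eigenfunction:
  assumes C: "C > 1" and s0: "s0 > 0" "even_jacobi C s0 < 0"
  shows "\<exists>l<0. \<exists>S>0. \<exists>\<phi> \<phi>1. (\<forall>s. (\<phi> has_real_derivative \<phi>1 s) (at s)) \<and>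
    (\<forall>s. ((\<lambda>s. rho C s * \<phi>1 s) has_real_derivative - (rho C s * (pot C s + l) * \<phi> s)) (at s)) \<and>
    (\<forall>s. \<phi> (- s) = \<phi> s) \<and> \<phi> 0 \<noteq> 0 \<and> \<phi> S = 0"
proof -
  \<comment> \<open>Small enough to fix both signs: the field is 1 at 0 and negative at
    \<open>s0\<close>.\<close>
  define \<epsilon> where "\<epsilon> = min 1 (- even_jacobi C s0)"
  have \<epsilon>: "\<epsilon> > 0" using s0 by (simp add: \<epsilon>_def)
  obtain l f f1 where l: "l < 0" and f: "\<And>s. (f has_real_derivative f1 s) (at s)"
    and f1: "\<And>s. ((\<lambda>s. rho C s * f1 s) has_real_derivative - (rho C s * (pot C s + l) * f s)) (at s)"
    and est: "\<And>s. \<bar>s\<bar> \<le> s0 \<Longrightarrow> \<bar>f s - even_jacobi C s\<bar> < \<epsilon>"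
    using eigenfunction_near_even_jacobi[OF C less_imp_le[OF s0(1)] \<epsilon>] by blast
  define \<phi> where "\<phi> = (\<lambda>s. (f s + f (- s)) / 2)"
  define \<phi>1 where "\<phi>1 = (\<lambda>s. (f1 s - f1 (- s)) / 2)"
  have D: "(\<phi> has_real_derivative \<phi>1 s) (at s)" for s
  proof -
    have "((\<lambda>s. f (- s)) has_real_derivative f1 (- s) * - 1) (at s)"
      by (rule DERIV_chain2[OF f]) (rule DERIV_minus[OF DERIV_ident])
    from DERIV_cdivide[OF DERIV_add[OF f[of s] this], of 2] show ?thesis by (simp add: \<phi>_def \<phi>1_def)
  qed
  have D1: "((\<lambda>s. rho C s * \<phi>1 s) has_real_derivative - (rho C s * (pot C s + l) * \<phi> s)) (at s)" for s
  proof -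
    have "((\<lambda>s. rho C (- s) * f1 (- s)) has_real_derivative - (rho C (- s) * (pot C (- s) + l) * f (- s)) * - 1) (at s)"
      by (rule DERIV_chain2[OF f1]) (rule DERIV_minus[OF DERIV_ident])
    from DERIV_cdivide[OF DERIV_diff[OF f1[of s] this], of 2] show ?thesis
      by (simp add: \<phi>_def \<phi>1_def rho_even[OF C] pot_even[OF C] algebra_simps add_divide_distrib diff_divide_distrib)
  qed
  have e: "\<bar>\<phi> s - even_jacobi C s\<bar> < \<epsilon>" if "\<bar>s\<bar> \<le> s0" for s
  proof -
    have *: "\<bar>f s - even_jacobi C s\<bar> < \<epsilon>" "\<bar>f (- s) - even_jacobi C s\<bar> < \<epsilon>"
      using est[of s] est[of "- s"] that by (simp_all add: even_jacobi_even[OF C])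
    have "2 * (\<phi> s - even_jacobi C s) = (f s - even_jacobi C s) + (f (- s) - even_jacobi C s)" by (simp add: \<phi>_def)
    then have "2 * \<bar>\<phi> s - even_jacobi C s\<bar> = \<bar>(f s - even_jacobi C s) + (f (- s) - even_jacobi C s)\<bar>"
      by (metis abs_mult abs_numeral)
    also have "\<dots> \<le> \<bar>f s - even_jacobi C s\<bar> + \<bar>f (- s) - even_jacobi C s\<bar>" by (rule abs_triangle_ineq)
    also have "\<dots> < \<epsilon> + \<epsilon>" using * by (rule add_strict_mono)
    finally show ?thesis by simp
  qed
  have n: "\<phi> s0 < 0" using e[of s0] s0 by (simp add: \<epsilon>_def abs_less_iff)
  have p: "\<phi> 0 > 0" using e[of 0] s0 even_jacobi_0[OF C] by (simp add: \<epsilon>_def abs_less_iff)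
  obtain S where S: "0 \<le> S" "S \<le> s0" "\<phi> S = 0"
    using IVT2'[of \<phi> s0 0 0] n p s0(1) continuous_on_if_DERIV[OF D] by auto
  then have "S > 0" using p by (cases "S = 0") auto
  have "\<phi> (- s) = \<phi> s" for s by (simp add: \<phi>_def add.commute)
  note ev = this
  show ?thesis
  proof (rule exI[of _ l], rule conjI[OF l], rule exI[of _ S], rule conjI[OF \<open>S > 0\<close>])
    have "\<phi> 0 \<noteq> 0" using p by simp
    then show "\<exists>\<phi> \<phi>1. (\<forall>s. (\<phi> has_real_derivative \<phi>1 s) (at s)) \<and>
      (\<forall>s. ((\<lambda>s. rho C s * \<phi>1 s) has_real_derivative - (rho C s * (pot C s + l) * \<phi> s)) (at s)) \<and>
      (\<forall>s. \<phi> (- s) = \<phi> s) \<and> \<phi> 0 \<noteq> 0 \<and> \<phi> S = 0"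
      by (intro exI[of _ "\<phi>"] exI[of _ "\<phi>1"] conjI[OF allI[OF D] conjI[OF allI[OF D1]
            conjI[OF allI[OF ev] conjI[OF _ S(3)]]]])
  qed
qed

section \<open>Geometry of the catenoid\<close>

text \<open>Parametrization, partial derivatives and normal all have this shape, in each slot a
  function of s times a function of the angle. The class is closed under both partial derivatives
  and has a simple inner product.\<close>

definition rot_field :: "(real \<Rightarrow> real) \<Rightarrow> (real \<Rightarrow> real) \<Rightarrow> (real \<Rightarrow> real) \<Rightarrow> (real \<Rightarrow> real) \<Rightarrow> (real \<Rightarrow> real) \<Rightarrow> real^2 \<Rightarrow> real^3" where
  "rot_field \<alpha> \<beta> h f g q = vector [\<alpha> (q $ 1) * h (q $ 2), \<beta> (q $ 1) * f (q $ 2), \<beta> (q $ 1) * g (q $ 2)]"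

lemma prod_fun_of_nth:
  fixes q :: "real^2"
  assumes "(\<alpha> has_real_derivative \<alpha>') (at (q $ 1))" "(h has_real_derivative h') (at (q $ 2))"
  shows "(\<lambda>q::real^2. \<alpha> (q $ 1) * h (q $ 2)) differentiable (at q)"
    "pd 1 (\<lambda>q::real^2. \<alpha> (q $ 1) * h (q $ 2)) q = \<alpha>' * h (q $ 2)"
    "pd 2 (\<lambda>q::real^2. \<alpha> (q $ 1) * h (q $ 2)) q = \<alpha> (q $ 1) * h'"
proof -
  have d: "(\<lambda>q::real^2. \<alpha> (q $ 1)) differentiable (at q)" "(\<lambda>q::real^2. h (q $ 2)) differentiable (at q)"
    by (rule differentiable_chain[OF assms(1) differentiable_nth], rule differentiable_chain[OF assms(2) differentiable_nth])
  then show "(\<lambda>q::real^2. \<alpha> (q $ 1) * h (q $ 2)) differentiable (at q)" by (rule differentiable_mult)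
  show "pd 1 (\<lambda>q::real^2. \<alpha> (q $ 1) * h (q $ 2)) q = \<alpha>' * h (q $ 2)"
    "pd 2 (\<lambda>q::real^2. \<alpha> (q $ 1) * h (q $ 2)) q = \<alpha> (q $ 1) * h'"
    by (simp_all add: pd_mult[OF d] pd_fun_of_nth[OF assms(1)] pd_fun_of_nth[OF assms(2)])
qed

lemma rot_field_differentiable:
  assumes "(\<alpha> has_real_derivative \<alpha>') (at (q $ 1))" "(\<beta> has_real_derivative \<beta>') (at (q $ 1))"
    "(h has_real_derivative h') (at (q $ 2))" "(f has_real_derivative f') (at (q $ 2))" "(g has_real_derivative g') (at (q $ 2))"
  shows "rot_field \<alpha> \<beta> h f g differentiable (at q)"
proof -
  have "\<forall>j. (\<lambda>q. rot_field \<alpha> \<beta> h f g q $ j) differentiable (at q)"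
    unfolding forall_3 rot_field_def using assms prod_fun_of_nth(1) by auto
  then show ?thesis by (blast intro: differentiable_vecI)
qed

lemma pd_rot_field:
  assumes "(\<alpha> has_real_derivative \<alpha>' (q $ 1)) (at (q $ 1))" "(\<beta> has_real_derivative \<beta>' (q $ 1)) (at (q $ 1))"
    "(h has_real_derivative h' (q $ 2)) (at (q $ 2))" "(f has_real_derivative f' (q $ 2)) (at (q $ 2))"
    "(g has_real_derivative g' (q $ 2)) (at (q $ 2))"
  shows "pd 1 (rot_field \<alpha> \<beta> h f g) q = rot_field \<alpha>' \<beta>' h f g q" "pd 2 (rot_field \<alpha> \<beta> h f g) q = rot_field \<alpha> \<beta> h' f' g' q"
proof -
  note d = rot_field_differentiable[OF assms]
  note p = prod_fun_of_nth(2,3)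
  have "\<forall>j. pd 1 (rot_field \<alpha> \<beta> h f g) q $ j = rot_field \<alpha>' \<beta>' h f g q $ j"
    unfolding forall_3 pd_vec_nth[OF d] unfolding rot_field_def
    using p(1)[OF assms(1,3)] p(1)[OF assms(2,4)] p(1)[OF assms(2,5)] by simp
  then show "pd 1 (rot_field \<alpha> \<beta> h f g) q = rot_field \<alpha>' \<beta>' h f g q" by (simp add: vec_eq_iff)
  have "\<forall>j. pd 2 (rot_field \<alpha> \<beta> h f g) q $ j = rot_field \<alpha> \<beta> h' f' g' q $ j"
    unfolding forall_3 pd_vec_nth[OF d] unfolding rot_field_def
    using p(2)[OF assms(1,3)] p(2)[OF assms(2,4)] p(2)[OF assms(2,5)] by simp
  then show "pd 2 (rot_field \<alpha> \<beta> h f g) q = rot_field \<alpha> \<beta> h' f' g' q" by (simp add: vec_eq_iff)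
qed

lemma rot_field_inner: "rot_field \<alpha> \<beta> h f g q \<bullet> rot_field \<alpha>2 \<beta>2 h2 f2 g2 q = \<alpha> (q $ 1) * \<alpha>2 (q $ 1) * (h (q $ 2) * h2 (q $ 2))
    + \<beta> (q $ 1) * \<beta>2 (q $ 1) * (f (q $ 2) * f2 (q $ 2) + g (q $ 2) * g2 (q $ 2))"
  by (simp add: rot_field_def inner_vec_def sum_3 algebra_simps)

context
  fixes a :: real
  assumes a: "a > 0"
begin

definition "cC = cosh (2 * a)"
definition "cosh_y s = cosh (cat_y a s)"
definition "sinh_x s = sinh (cat_x a s)"
definition "cosh_x s = cosh (cat_x a s)"
text \<open>In the coordinates x, y the hyperbolic plane carries the metric cosh^2 y dx^2 + dy^2.
  Hence \<open>x_deriv\<close> is not the derivative of \<open>cat_x\<close> but cosh y times it,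
  the component of the tangent in an orthonormal frame.\<close>

definition "x_deriv s = sinh (2 * a) / (2 * rho cC s * cosh_y s)"
definition "y_deriv s = rho1 cC s / cosh_y s"
text \<open>Equal to (1 - r^2) / 2 along the curve, so the conformal factor is its inverse
  square.\<close>

definition "inv_denom s = 1 / (1 + cosh_x s * cosh_y s)"
definition "u_deriv s = (inv_denom s)\<^sup>2 * ((cosh_x s + cosh_y s) * x_deriv s + sinh_x s * rho cC s * y_deriv s)"
definition "v_deriv s = (inv_denom s)\<^sup>2 * ((cosh_x s + cosh_y s) * y_deriv s - sinh_x s * rho cC s * x_deriv s)"

section \<open>The catenary in the coordinates x and y\<close>

lemma cC_gt_1: "cC > 1" unfolding cC_def by (rule cosh_gt_1[OF a])

lemma S_sq: "(sinh (2 * a))\<^sup>2 = cC\<^sup>2 - 1" by (simp add: cC_def sinh_square_eq)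

lemma C_cosh_sq: "(cC * cosh (2 * s))\<^sup>2 - 1 = (2 * rho cC s * sqrt ((rho cC s)\<^sup>2 + 1))\<^sup>2"
  unfolding C_cosh[OF cC_gt_1] by (simp add: power_mult_distrib power2_eq_square algebra_simps)

lemma y_integrand: "cosh (2 * a) * sinh (2 * s) / sqrt ((cosh (2 * a))\<^sup>2 * (cosh (2 * s))\<^sup>2 - 1)
    = rho1 cC s / sqrt ((rho cC s)\<^sup>2 + 1)"
proof -
  have "sqrt ((cC * cosh (2 * s))\<^sup>2 - 1) = 2 * rho cC s * sqrt ((rho cC s)\<^sup>2 + 1)"
    unfolding C_cosh_sq using rho_pos[OF cC_gt_1, of s] by simp
  then show ?thesis by (simp add: cC_def[symmetric] power_mult_distrib[symmetric] rho1_def)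
qed

lemma x_integrand: "sqrt 2 * sinh (2 * a) * (sqrt (cosh (2 * a) * cosh (2 * s) - 1) / ((cosh (2 * a))\<^sup>2 * (cosh (2 * s))\<^sup>2 - 1))
    = sinh (2 * a) / (2 * rho cC s * ((rho cC s)\<^sup>2 + 1))"
proof -
  have "sqrt (cC * cosh (2 * s) - 1) = sqrt 2 * rho cC s"
    unfolding C_cosh[OF cC_gt_1] using rho_pos[OF cC_gt_1, of s] by (simp add: real_sqrt_mult)
  moreover have "(2 * rho cC s * sqrt ((rho cC s)\<^sup>2 + 1))\<^sup>2 = 4 * (rho cC s)\<^sup>2 * ((rho cC s)\<^sup>2 + 1)"
    by (simp add: power_mult_distrib)
  ultimately have "sqrt 2 * sinh (2 * a) * (sqrt (cC * cosh (2 * s) - 1) / ((cC * cosh (2 * s))\<^sup>2 - 1))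
     = sinh (2 * a) * ((sqrt 2 * sqrt 2) * rho cC s) / (4 * (rho cC s)\<^sup>2 * ((rho cC s)\<^sup>2 + 1))"
    unfolding C_cosh_sq by (simp add: algebra_simps)
  also have "\<dots> = sinh (2 * a) / (2 * rho cC s * ((rho cC s)\<^sup>2 + 1))"
    using rho_pos[OF cC_gt_1, of s] by (simp add: power2_eq_square)
  finally show ?thesis by (simp add: cC_def power_mult_distrib)
qed

lemma cosh_y_aux: "(rho cC s)\<^sup>2 + 1 > 0" by (rule add_nonneg_pos) auto

lemma cat_y_alt: "cat_y a s = a + int_from_0 (\<lambda>s. rho1 cC s / sqrt ((rho cC s)\<^sup>2 + 1)) s"
  unfolding cat_y_def int_from_0_def y_integrand zero_ereal_def ..

lemma cat_y_integrand_cont: "continuous_on A (\<lambda>s. rho1 cC s / sqrt ((rho cC s)\<^sup>2 + 1))"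
  using cosh_y_aux by (intro continuous_intros rho_cont rho1_cont cC_gt_1) (auto simp: less_le)

lemma cat_y_DERIV0: "(cat_y a has_real_derivative rho1 cC s / sqrt ((rho cC s)\<^sup>2 + 1)) (at s)"
  unfolding cat_y_alt[abs_def]
  using DERIV_add[OF DERIV_const int_from_0_DERIV[OF cat_y_integrand_cont, of s], of a] by simp

text \<open>The integral is elementary: the two sides have the same derivative and agree at s = 0.
  The closed form is the reason why \<open>rho\<close> is sinh y.\<close>

lemma two_y: "2 * cat_y a s = arcosh (cC * cosh (2 * s))"
proof -
  have g: "cC * cosh (2 * s) > 1" for s by (rule C_cosh_gt_1[OF cC_gt_1])
  have "((\<lambda>s. arcosh (cC * cosh (2 * s)) / 2 - a) has_real_derivative rho1 cC s / sqrt ((rho cC s)\<^sup>2 + 1)) (at s)" for s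
  proof -
    have "((\<lambda>s. cC * cosh (2 * s)) has_real_derivative cC * (sinh (2 * s) * 2)) (at s)"
      by (auto intro!: derivative_eq_intros)
    from DERIV_chain2[OF arcosh_real_has_field_derivative[OF g] this]
    have "((\<lambda>s. arcosh (cC * cosh (2 * s))) has_real_derivative 1 / sqrt ((cC * cosh (2 * s))\<^sup>2 - 1) * (cC * (sinh (2 * s) * 2))) (at s)" .
    from DERIV_diff[OF DERIV_cdivide[OF this, of 2] DERIV_const[of a]]
    have "((\<lambda>s. arcosh (cC * cosh (2 * s)) / 2 - a) has_real_derivative
        cosh (2 * a) * sinh (2 * s) / sqrt ((cosh (2 * a))\<^sup>2 * (cosh (2 * s))\<^sup>2 - 1)) (at s)"
      by (simp add: cC_def power_mult_distrib)
    then show ?thesis unfolding y_integrand .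
  qed
  then have "int_from_0 (\<lambda>s. rho1 cC s / sqrt ((rho cC s)\<^sup>2 + 1)) s = arcosh (cC * cosh (2 * s)) / 2 - a"
    using a arcosh_cosh_real[of "2 * a"] by (intro int_from_0_unique cat_y_integrand_cont) (auto simp: cC_def)
  then show ?thesis by (simp add: cat_y_alt)
qed

lemma cosh_2y: "cosh (2 * cat_y a s) = cC * cosh (2 * s)"
  unfolding two_y using C_cosh_gt_1[OF cC_gt_1, of "2 * s"] by (simp add: less_imp_le)

lemma sinh_y_sq: "(sinh (cat_y a s))\<^sup>2 = (rho cC s)\<^sup>2"
  using cosh_2y[of s] cosh_square_eq[of "cat_y a s"] C_cosh[OF cC_gt_1, of s] by (simp add: cosh_double)

lemma cosh_y_sq: "(cosh_y s)\<^sup>2 = (rho cC s)\<^sup>2 + 1"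
  using sinh_y_sq[of s] by (simp add: cosh_y_def cosh_square_eq)

lemma cosh_y_pos: "cosh_y s > 0" by (simp add: cosh_y_def)

lemma cosh_y_eq: "cosh_y s = sqrt ((rho cC s)\<^sup>2 + 1)"
  using cosh_y_sq[of s] cosh_y_pos[of s] by (metis real_sqrt_unique less_imp_le)

lemma cat_y_DERIV: "(cat_y a has_real_derivative y_deriv s) (at s)"
  using cat_y_DERIV0[of s] by (simp add: y_deriv_def cosh_y_eq)

lemma sinh_y: "sinh (cat_y a s) = rho cC s"
proof -
  have "2 * cat_y a s > 0"
    unfolding two_y using C_cosh_gt_1[OF cC_gt_1, of "2 * s"] by (simp add: less_imp_le)
  then have "sinh (cat_y a s) > 0" by simp
  then show ?thesis using rho_pos[OF cC_gt_1, of s] by (intro power2_eq_imp_eq[OF sinh_y_sq]) auto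
qed

lemma cosh_y_DERIV: "(cosh_y has_real_derivative rho cC s * y_deriv s) (at s)"
  unfolding cosh_y_def[abs_def] by (auto intro!: derivative_eq_intros cat_y_DERIV simp: sinh_y)

lemma rho_DERIV': "(rho cC has_real_derivative cosh_y s * y_deriv s) (at s)"
  using rho_DERIV[OF cC_gt_1, of s] cosh_y_pos[of s] by (simp add: y_deriv_def)

lemma cat_x_DERIV: "(cat_x a has_real_derivative x_deriv s / cosh_y s) (at s)"
proof -
  have c: "continuous_on UNIV (\<lambda>s. sqrt (cosh (2 * a) * cosh (2 * s) - 1) / ((cosh (2 * a))\<^sup>2 * (cosh (2 * s))\<^sup>2 - 1))"
  proof -
    have "(cosh (2 * a))\<^sup>2 * (cosh (2 * s))\<^sup>2 - 1 \<noteq> 0" for s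
      using C_cosh_sq[of s] rho_pos[OF cC_gt_1, of s] cosh_y_aux[of s] by (simp add: cC_def power_mult_distrib)
    then show ?thesis by (intro continuous_intros) auto
  qed
  have "(cat_x a has_real_derivative sqrt 2 * sinh (2 * a) *
    (sqrt (cosh (2 * a) * cosh (2 * s) - 1) / ((cosh (2 * a))\<^sup>2 * (cosh (2 * s))\<^sup>2 - 1))) (at s)"
    unfolding cat_x_def[abs_def] zero_ereal_def
    by (intro DERIV_cmult LBINT_from_zero_DERIV c)
  moreover have "sqrt 2 * sinh (2 * a) * (sqrt (cosh (2 * a) * cosh (2 * s) - 1) / ((cosh (2 * a))\<^sup>2 * (cosh (2 * s))\<^sup>2 - 1)) = x_deriv s / cosh_y s"
    unfolding x_integrand x_deriv_def cosh_y_sq[of s, symmetric] by (simp add: power2_eq_square)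
  ultimately show ?thesis by simp
qed

lemma sinh_x_DERIV: "(sinh_x has_real_derivative cosh_x s * (x_deriv s / cosh_y s)) (at s)"
  unfolding sinh_x_def[abs_def] cosh_x_def by (auto intro!: derivative_eq_intros cat_x_DERIV)
lemma cosh_x_DERIV: "(cosh_x has_real_derivative sinh_x s * (x_deriv s / cosh_y s)) (at s)"
  unfolding cosh_x_def[abs_def] sinh_x_def by (auto intro!: derivative_eq_intros cat_x_DERIV)

text \<open>Expresses that s is arc length, the components being taken in the orthonormal frame; it
  reduces to the first integral \<open>rho1_sq\<close>.\<close>

lemma mq: "(x_deriv s)\<^sup>2 + (y_deriv s)\<^sup>2 = 1"
proof -
  have "(x_deriv s)\<^sup>2 = (cC\<^sup>2 - 1) / (4 * (rho cC s)\<^sup>2) / (cosh_y s)\<^sup>2"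
    by (simp add: x_deriv_def power_divide power_mult_distrib S_sq)
  moreover have "(y_deriv s)\<^sup>2 = (rho1 cC s)\<^sup>2 / (cosh_y s)\<^sup>2" by (simp add: y_deriv_def power_divide)
  ultimately have "(x_deriv s)\<^sup>2 + (y_deriv s)\<^sup>2 = ((cC\<^sup>2 - 1) / (4 * (rho cC s)\<^sup>2) + (rho1 cC s)\<^sup>2) / (cosh_y s)\<^sup>2"
    by (simp add: add_divide_distrib)
  also have "\<dots> = 1" unfolding rho1_sq[OF cC_gt_1] cosh_y_sq using cosh_y_aux[of s] by simp
  finally show ?thesis .
qed

text \<open>Equal to coth (2 y). Twice this times \<open>x_deriv\<close> is the angular velocity of
  the unit vector with components \<open>x_deriv\<close> and \<open>y_deriv\<close>; the geodesic
  curvature of the curve is obtained from it by subtracting the rotation of the frame.\<close>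

definition "geod_curv s = ((cosh_y s)\<^sup>2 + (rho cC s)\<^sup>2) / (2 * rho cC s * cosh_y s)"

lemma x_deriv_DERIV: "(x_deriv has_real_derivative - 2 * geod_curv s * x_deriv s * y_deriv s) (at s)"
proof -
  have nz: "rho cC s \<noteq> 0" "cosh_y s \<noteq> 0" using rho_pos[OF cC_gt_1, of s] cosh_y_pos[of s] by auto
  have "((\<lambda>s. sinh (2 * a) / (2 * rho cC s * cosh_y s)) has_real_derivative
     (0 * (2 * rho cC s * cosh_y s) - sinh (2 * a) * (2 * (cosh_y s * y_deriv s) * cosh_y s + rho cC s * y_deriv s * (2 * rho cC s))) / ((2 * rho cC s * cosh_y s) * (2 * rho cC s * cosh_y s))) (at s)"
    using nz by (intro DERIV_divide DERIV_const DERIV_mult DERIV_cmult rho_DERIV' cosh_y_DERIV) auto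
  moreover have "(0 * (2 * rho cC s * cosh_y s) - sinh (2 * a) * (2 * (cosh_y s * y_deriv s) * cosh_y s + rho cC s * y_deriv s * (2 * rho cC s))) / ((2 * rho cC s * cosh_y s) * (2 * rho cC s * cosh_y s))
     = - 2 * geod_curv s * x_deriv s * y_deriv s"
    unfolding geod_curv_def x_deriv_def using nz by (simp add: field_simps power2_eq_square)
  ultimately show ?thesis unfolding x_deriv_def[abs_def] by simp
qed

lemma y_deriv_DERIV: "(y_deriv has_real_derivative 2 * geod_curv s * (x_deriv s)\<^sup>2) (at s)"
proof -
  have nz: "rho cC s \<noteq> 0" "cosh_y s \<noteq> 0" using rho_pos[OF cC_gt_1, of s] cosh_y_pos[of s] by auto
  have "((\<lambda>s. rho1 cC s / cosh_y s) has_real_derivative (rho2 cC s * cosh_y s - rho1 cC s * (rho cC s * y_deriv s)) / (cosh_y s * cosh_y s)) (at s)"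
    using nz by (intro DERIV_divide rho1_DERIV cC_gt_1 cosh_y_DERIV) auto
  moreover have "(rho2 cC s * cosh_y s - rho1 cC s * (rho cC s * y_deriv s)) / (cosh_y s * cosh_y s) = 2 * geod_curv s * (x_deriv s)\<^sup>2"
  proof -
    have r1: "rho1 cC s = y_deriv s * cosh_y s" using nz by (simp add: y_deriv_def)
    have "(cC\<^sup>2 - 1) = (2 * rho cC s * cosh_y s * x_deriv s)\<^sup>2" using nz by (simp add: x_deriv_def S_sq)
    then have r2: "rho2 cC s = rho cC s + (cosh_y s)\<^sup>2 * (x_deriv s)\<^sup>2 / rho cC s"
      unfolding rho2_def using nz by (simp add: field_simps eval_nat_numeral)
    have q2: "(y_deriv s)\<^sup>2 = 1 - (x_deriv s)\<^sup>2" using mq[of s] by simp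
    have "(rho2 cC s * cosh_y s - rho1 cC s * (rho cC s * y_deriv s)) / (cosh_y s * cosh_y s) = (rho2 cC s - (y_deriv s)\<^sup>2 * rho cC s) / cosh_y s"
      unfolding r1 using nz by (simp add: field_simps power2_eq_square)
    also have "\<dots> = 2 * geod_curv s * (x_deriv s)\<^sup>2"
      unfolding r2 q2 geod_curv_def using nz by (simp add: field_simps power2_eq_square)
    finally show ?thesis .
  qed
  ultimately show ?thesis unfolding y_deriv_def[abs_def] by simp
qed

section \<open>The catenary in the disk\<close>

lemma den_pos: "1 + cosh_x s * cosh_y s > 0" by (simp add: cosh_x_def cosh_y_def add_pos_pos)
lemma inv_denom_pos: "inv_denom s > 0" using den_pos[of s] by (simp add: inv_denom_def)
lemma inv_denom_eq: "inv_denom s * (1 + cosh_x s * cosh_y s) = 1" using den_pos[of s] by (simp add: inv_denom_def)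

lemma cosh_x_sq: "(cosh_x s)\<^sup>2 = (sinh_x s)\<^sup>2 + 1" by (simp add: cosh_x_def sinh_x_def cosh_square_eq)

lemma inv_denom_DERIV: "(inv_denom has_real_derivative - ((inv_denom s)\<^sup>2 * (sinh_x s * x_deriv s + cosh_x s * rho cC s * y_deriv s))) (at s)"
proof -
  have "((\<lambda>s. 1 / (1 + cosh_x s * cosh_y s)) has_real_derivative
     (0 * (1 + cosh_x s * cosh_y s) - 1 * (0 + (sinh_x s * (x_deriv s / cosh_y s) * cosh_y s + rho cC s * y_deriv s * cosh_x s))) / ((1 + cosh_x s * cosh_y s) * (1 + cosh_x s * cosh_y s))) (at s)"
    using den_pos[of s] by (intro DERIV_divide DERIV_add DERIV_const DERIV_mult cosh_x_DERIV cosh_y_DERIV) auto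
  moreover have "(0 * (1 + cosh_x s * cosh_y s) - 1 * (0 + (sinh_x s * (x_deriv s / cosh_y s) * cosh_y s + rho cC s * y_deriv s * cosh_x s))) / ((1 + cosh_x s * cosh_y s) * (1 + cosh_x s * cosh_y s))
     = - ((inv_denom s)\<^sup>2 * (sinh_x s * x_deriv s + cosh_x s * rho cC s * y_deriv s))"
    using cosh_y_pos[of s] by (simp add: inv_denom_def power2_eq_square algebra_simps add_divide_distrib diff_divide_distrib)
  ultimately show ?thesis unfolding inv_denom_def[abs_def] by simp
qed

lemma u_eq: "cat_u a s = sinh_x s * cosh_y s * inv_denom s" by (simp add: cat_u_def sinh_x_def cosh_x_def cosh_y_def inv_denom_def)
lemma v_eq: "cat_v a s = rho cC s * inv_denom s" by (simp add: cat_v_def sinh_y cosh_x_def cosh_y_def inv_denom_def)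

lemma u_DERIV: "(cat_u a has_real_derivative u_deriv s) (at s)"
proof -
  have "((\<lambda>s. sinh_x s * cosh_y s * inv_denom s) has_real_derivative
     (cosh_x s * (x_deriv s / cosh_y s) * cosh_y s + rho cC s * y_deriv s * sinh_x s) * inv_denom s + - ((inv_denom s)\<^sup>2 * (sinh_x s * x_deriv s + cosh_x s * rho cC s * y_deriv s)) * (sinh_x s * cosh_y s)) (at s)"
    by (intro DERIV_mult sinh_x_DERIV cosh_y_DERIV inv_denom_DERIV)
  \<comment> \<open>A factor equal to 1 by \<open>inv_denom_eq\<close> is inserted so that both
    summands carry the square of \<open>inv_denom\<close>.\<close>
  moreover have "(cosh_x s * (x_deriv s / cosh_y s) * cosh_y s + rho cC s * y_deriv s * sinh_x s) * inv_denom s + - ((inv_denom s)\<^sup>2 * (sinh_x s * x_deriv s + cosh_x s * rho cC s * y_deriv s)) * (sinh_x s * cosh_y s)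
      = (cosh_x s * x_deriv s + rho cC s * y_deriv s * sinh_x s) * (inv_denom s * (inv_denom s * (1 + cosh_x s * cosh_y s))) - ((inv_denom s)\<^sup>2 * (sinh_x s * x_deriv s + cosh_x s * rho cC s * y_deriv s)) * (sinh_x s * cosh_y s)"
    unfolding inv_denom_eq using cosh_y_pos[of s] by simp
  moreover have "\<dots> = (inv_denom s)\<^sup>2 * (x_deriv s * (cosh_x s + cosh_y s * ((cosh_x s)\<^sup>2 - (sinh_x s)\<^sup>2)) + y_deriv s * (sinh_x s * rho cC s))" by algebra
  moreover have "\<dots> = u_deriv s" unfolding u_deriv_def cosh_x_sq by (simp add: algebra_simps)
  moreover have "(\<lambda>s. sinh_x s * cosh_y s * inv_denom s) = cat_u a" by (rule ext) (rule u_eq[symmetric])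
  ultimately show ?thesis by (simp only:)
qed

lemma v_DERIV: "(cat_v a has_real_derivative v_deriv s) (at s)"
proof -
  have "((\<lambda>s. rho cC s * inv_denom s) has_real_derivative
     cosh_y s * y_deriv s * inv_denom s + - ((inv_denom s)\<^sup>2 * (sinh_x s * x_deriv s + cosh_x s * rho cC s * y_deriv s)) * rho cC s) (at s)"
    by (intro DERIV_mult rho_DERIV' inv_denom_DERIV)
  moreover have "cosh_y s * y_deriv s * inv_denom s + - ((inv_denom s)\<^sup>2 * (sinh_x s * x_deriv s + cosh_x s * rho cC s * y_deriv s)) * rho cC s
      = cosh_y s * y_deriv s * (inv_denom s * (inv_denom s * (1 + cosh_x s * cosh_y s))) - ((inv_denom s)\<^sup>2 * (sinh_x s * x_deriv s + cosh_x s * rho cC s * y_deriv s)) * rho cC s"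
    unfolding inv_denom_eq by simp
  moreover have "\<dots> = (inv_denom s)\<^sup>2 * (y_deriv s * (cosh_y s + cosh_x s * ((cosh_y s)\<^sup>2 - (rho cC s)\<^sup>2)) - sinh_x s * rho cC s * x_deriv s)" by algebra
  moreover have "\<dots> = v_deriv s" unfolding v_deriv_def cosh_y_sq by (simp add: algebra_simps)
  moreover have "(\<lambda>s. rho cC s * inv_denom s) = cat_v a" by (rule ext) (rule v_eq[symmetric])
  ultimately show ?thesis by (simp only:)
qed

text \<open>Derivative of 1 + cosh x cosh y. In the following lines \<open>u_num\<close> and
  \<open>v_num\<close> are the derivatives of u and v stripped of the squared
  \<open>inv_denom\<close>, and \<open>num_deriv1\<close>, \<open>num_deriv2\<close> are the
  derivatives of their coefficients cosh x + cosh y and sinh x rho.\<close>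

definition "denom_deriv s = sinh_x s * x_deriv s + cosh_x s * rho cC s * y_deriv s"
definition "u_num s = (cosh_x s + cosh_y s) * x_deriv s + sinh_x s * rho cC s * y_deriv s"
definition "v_num s = (cosh_x s + cosh_y s) * y_deriv s - sinh_x s * rho cC s * x_deriv s"
definition "num_deriv1 s = sinh_x s * (x_deriv s / cosh_y s) + rho cC s * y_deriv s"
definition "num_deriv2 s = cosh_x s * (x_deriv s / cosh_y s) * rho cC s + cosh_y s * y_deriv s * sinh_x s"
definition "u_num_deriv s = (num_deriv1 s * x_deriv s + (- 2 * geod_curv s * x_deriv s * y_deriv s) * (cosh_x s + cosh_y s)) + (num_deriv2 s * y_deriv s + (2 * geod_curv s * (x_deriv s)\<^sup>2) * (sinh_x s * rho cC s))"
definition "v_num_deriv s = (num_deriv1 s * y_deriv s + (2 * geod_curv s * (x_deriv s)\<^sup>2) * (cosh_x s + cosh_y s)) - (num_deriv2 s * x_deriv s + (- 2 * geod_curv s * x_deriv s * y_deriv s) * (sinh_x s * rho cC s))"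
definition "u_deriv2 s = - 2 * (inv_denom s)^3 * denom_deriv s * u_num s + (inv_denom s)\<^sup>2 * u_num_deriv s"
definition "v_deriv2 s = - 2 * (inv_denom s)^3 * denom_deriv s * v_num s + (inv_denom s)\<^sup>2 * v_num_deriv s"

lemma inv_denom_sq_DERIV: "((\<lambda>s. (inv_denom s)\<^sup>2) has_real_derivative - 2 * (inv_denom s)^3 * denom_deriv s) (at s)"
proof -
  have "((\<lambda>s. (inv_denom s)\<^sup>2) has_real_derivative real 2 * (inv_denom s ^ (2 - Suc 0) * - ((inv_denom s)\<^sup>2 * (sinh_x s * x_deriv s + cosh_x s * rho cC s * y_deriv s)))) (at s)"
    using DERIV_power[OF inv_denom_DERIV, of 2 s] by (simp add: mult.commute mult.left_commute)
  then show ?thesis by (simp add: denom_deriv_def eval_nat_numeral algebra_simps)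
qed

lemma u_deriv_DERIV: "(u_deriv has_real_derivative u_deriv2 s) (at s)"
proof -
  have "(u_num has_real_derivative u_num_deriv s) (at s)"
    unfolding u_num_def[abs_def] u_num_deriv_def num_deriv1_def num_deriv2_def
    by (intro DERIV_add DERIV_mult cosh_x_DERIV cosh_y_DERIV sinh_x_DERIV rho_DERIV' x_deriv_DERIV y_deriv_DERIV)
  from DERIV_mult[OF inv_denom_sq_DERIV this] have "((\<lambda>s. (inv_denom s)\<^sup>2 * u_num s) has_real_derivative u_deriv2 s) (at s)"
    by (simp add: u_deriv2_def mult.commute)
  then show ?thesis unfolding u_num_def u_deriv_def[abs_def] .
qed

lemma v_deriv_DERIV: "(v_deriv has_real_derivative v_deriv2 s) (at s)"
proof -
  have "(v_num has_real_derivative v_num_deriv s) (at s)"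
    unfolding v_num_def[abs_def] v_num_deriv_def num_deriv1_def num_deriv2_def
    by (intro DERIV_add DERIV_diff DERIV_mult cosh_x_DERIV cosh_y_DERIV sinh_x_DERIV rho_DERIV' x_deriv_DERIV y_deriv_DERIV)
  from DERIV_mult[OF inv_denom_sq_DERIV this] have "((\<lambda>s. (inv_denom s)\<^sup>2 * v_num s) has_real_derivative v_deriv2 s) (at s)"
    by (simp add: v_deriv2_def mult.commute)
  then show ?thesis unfolding v_num_def v_deriv_def[abs_def] .
qed

text \<open>Makes the linear map that takes (x_deriv, y_deriv) to (u_num, v_num) a rotation, up to
  orientation of the angle, times 1 + cosh x cosh y: passing from the orthonormal frame to the disk
  is conformal.\<close>

lemma AB_sq: "(cosh_x s + cosh_y s)\<^sup>2 + (sinh_x s * rho cC s)\<^sup>2 = (1 + cosh_x s * cosh_y s)\<^sup>2"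
proof -
  have "(sinh_x s * rho cC s)\<^sup>2 = ((cosh_x s)\<^sup>2 - 1) * ((cosh_y s)\<^sup>2 - 1)" by (simp add: power_mult_distrib cosh_x_sq cosh_y_sq)
  then show ?thesis by (simp add: power2_eq_square algebra_simps)
qed

text \<open>The Euclidean speed is \<open>inv_denom\<close> while the conformal factor is its
  inverse square, so s is hyperbolic arc length in the ball as well.\<close>

lemma UW_sq: "(u_deriv s)\<^sup>2 + (v_deriv s)\<^sup>2 = (inv_denom s)\<^sup>2"
proof -
  have "(u_deriv s)\<^sup>2 + (v_deriv s)\<^sup>2 = (inv_denom s)^4 * (((cosh_x s + cosh_y s)\<^sup>2 + (sinh_x s * rho cC s)\<^sup>2) * ((x_deriv s)\<^sup>2 + (y_deriv s)\<^sup>2))"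
    unfolding u_deriv_def v_deriv_def by algebra
  also have "\<dots> = (inv_denom s)\<^sup>2 * (inv_denom s * (1 + cosh_x s * cosh_y s))\<^sup>2" unfolding AB_sq mq by (simp add: power_mult_distrib eval_nat_numeral)
  finally show ?thesis unfolding inv_denom_eq by simp
qed

lemma uv_sq: "(cat_u a s)\<^sup>2 + (cat_v a s)\<^sup>2 = 1 - 2 * inv_denom s"
proof -
  have "(cat_u a s)\<^sup>2 + (cat_v a s)\<^sup>2 = (inv_denom s)\<^sup>2 * ((sinh_x s)\<^sup>2 * (cosh_y s)\<^sup>2 + (rho cC s)\<^sup>2)"
    unfolding u_eq v_eq by (simp add: power_mult_distrib algebra_simps)
  also have "(sinh_x s)\<^sup>2 * (cosh_y s)\<^sup>2 + (rho cC s)\<^sup>2 = (cosh_x s * cosh_y s)\<^sup>2 - 1"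
    by (simp add: power_mult_distrib cosh_x_sq cosh_y_sq algebra_simps)
  also have "(inv_denom s)\<^sup>2 * ((cosh_x s * cosh_y s)\<^sup>2 - 1) = (inv_denom s * (1 + cosh_x s * cosh_y s))\<^sup>2 - 2 * inv_denom s * (inv_denom s * (1 + cosh_x s * cosh_y s))"
    by (simp add: power2_eq_square algebra_simps)
  finally show ?thesis unfolding inv_denom_eq by simp
qed

text \<open>The left side is the Euclidean inner product of position and normal, through which the
  Christoffel term enters the second fundamental form.\<close>

lemma tangential_moment: "cat_v a s * u_deriv s - cat_u a s * v_deriv s = (inv_denom s)\<^sup>2 * (rho cC s * cosh_x s * x_deriv s - sinh_x s * y_deriv s)"
proof -
  have "cat_v a s * u_deriv s - cat_u a s * v_deriv s = (inv_denom s)^3 * (x_deriv s * (rho cC s * (cosh_x s + cosh_y s) + (sinh_x s)\<^sup>2 * cosh_y s * rho cC s)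
     + y_deriv s * (sinh_x s * (rho cC s)\<^sup>2 - sinh_x s * cosh_y s * (cosh_x s + cosh_y s)))"
    unfolding u_eq v_eq u_deriv_def v_deriv_def by algebra
  also have "(rho cC s * (cosh_x s + cosh_y s) + (sinh_x s)\<^sup>2 * cosh_y s * rho cC s) = rho cC s * cosh_x s * (1 + cosh_x s * cosh_y s)"
    using cosh_x_sq[of s] by algebra
  also have "sinh_x s * (rho cC s)\<^sup>2 - sinh_x s * cosh_y s * (cosh_x s + cosh_y s) = - sinh_x s * (1 + cosh_x s * cosh_y s)"
    using cosh_y_sq[of s] by algebra
  also have "(inv_denom s)^3 * (x_deriv s * (rho cC s * cosh_x s * (1 + cosh_x s * cosh_y s)) + y_deriv s * (- sinh_x s * (1 + cosh_x s * cosh_y s)))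
     = (inv_denom s)\<^sup>2 * (inv_denom s * (1 + cosh_x s * cosh_y s)) * (rho cC s * cosh_x s * x_deriv s - sinh_x s * y_deriv s)" by algebra
  finally show ?thesis unfolding inv_denom_eq by simp
qed

text \<open>The coefficient of the second fundamental form in the rotational direction, up to sign
  and scaling. It is independent of position apart from the scaling because rho cosh y
  \<open>x_deriv\<close> is the constant sinh (2 a) / 2, the conserved quantity of the
  catenary.\<close>

lemma A22_eq: "cat_v a s * u_deriv s + (cat_v a s)\<^sup>2 * (cat_v a s * u_deriv s - cat_u a s * v_deriv s) / inv_denom s = (inv_denom s)\<^sup>2 * (sinh (2 * a) / 2)"
proof -
  have "(cat_v a s)\<^sup>2 * (cat_v a s * u_deriv s - cat_u a s * v_deriv s) / inv_denom s = (rho cC s)\<^sup>2 * (inv_denom s)^3 * (rho cC s * cosh_x s * x_deriv s - sinh_x s * y_deriv s)"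
    unfolding tangential_moment unfolding v_eq using inv_denom_pos[of s] by (simp add: field_simps eval_nat_numeral)
  then have "cat_v a s * u_deriv s + (cat_v a s)\<^sup>2 * (cat_v a s * u_deriv s - cat_u a s * v_deriv s) / inv_denom s
     = (inv_denom s)^3 * (rho cC s * ((cosh_x s + cosh_y s) * x_deriv s + sinh_x s * rho cC s * y_deriv s) + (rho cC s)\<^sup>2 * (rho cC s * cosh_x s * x_deriv s - sinh_x s * y_deriv s))"
    unfolding v_eq u_deriv_def by (simp add: algebra_simps eval_nat_numeral)
  also have "\<dots> = (inv_denom s)\<^sup>2 * (inv_denom s * (1 + cosh_x s * cosh_y s)) * (rho cC s * cosh_y s * x_deriv s)"
    using cosh_y_sq[of s] by algebra
  also have "rho cC s * cosh_y s * x_deriv s = sinh (2 * a) / 2"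
    using rho_pos[OF cC_gt_1, of s] cosh_y_pos[of s] by (simp add: x_deriv_def)
  finally show ?thesis unfolding inv_denom_eq by simp
qed

text \<open>The coefficient in the profile direction. Terms from differentiating
  \<open>inv_denom\<close> cancel in the cross product, and what is left is the geodesic curvature,
  again expressed by the conserved quantity. It is the rotational coefficient divided by rho^2,
  which becomes minimality once the opposite signs are inserted.\<close>

lemma A11_eq: "u_deriv s * v_deriv2 s - v_deriv s * u_deriv2 s - inv_denom s * (cat_v a s * u_deriv s - cat_u a s * v_deriv s) = (inv_denom s)\<^sup>2 * (sinh (2 * a) / (2 * (rho cC s)\<^sup>2))"
proof -
  \<comment> \<open>The reciprocal of cosh y is named so that the remaining identities are
    polynomial and accessible to \<open>algebra\<close>.\<close>
  define i where "i = 1 / cosh_y s"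
  have i: "i * cosh_y s = 1" using cosh_y_pos[of s] by (simp add: i_def)
  have AB1: "num_deriv1 s = sinh_x s * x_deriv s * i + rho cC s * y_deriv s" "num_deriv2 s = cosh_x s * rho cC s * x_deriv s * i + cosh_y s * y_deriv s * sinh_x s"
    by (simp_all add: num_deriv1_def num_deriv2_def i_def)
  let ?A = "cosh_x s + cosh_y s" and ?B = "sinh_x s * rho cC s"
  have "u_deriv s * v_deriv2 s - v_deriv s * u_deriv2 s = (inv_denom s)^4 * (u_num s * v_num_deriv s - v_num s * u_num_deriv s)"
    unfolding u_deriv_def v_deriv_def u_deriv2_def v_deriv2_def u_num_def[symmetric] v_num_def[symmetric] by algebra
  also have "u_num s * v_num_deriv s - v_num s * u_num_deriv s = ((x_deriv s)\<^sup>2 + (y_deriv s)\<^sup>2) * ((?A\<^sup>2 + ?B\<^sup>2) * (2 * geod_curv s * x_deriv s) + (?B * num_deriv1 s - ?A * num_deriv2 s))"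
    unfolding u_num_def v_num_def u_num_deriv_def v_num_deriv_def by algebra
  also have "\<dots> = (1 + cosh_x s * cosh_y s)\<^sup>2 * (2 * geod_curv s * x_deriv s) + (?B * num_deriv1 s - ?A * num_deriv2 s)" unfolding AB_sq mq by simp
  also have "(inv_denom s)^4 * \<dots> = (inv_denom s)\<^sup>2 * ((inv_denom s * (1 + cosh_x s * cosh_y s))\<^sup>2 * (2 * geod_curv s * x_deriv s) + (inv_denom s)\<^sup>2 * (?B * num_deriv1 s - ?A * num_deriv2 s))"
    by algebra
  finally have 1: "u_deriv s * v_deriv2 s - v_deriv s * u_deriv2 s = (inv_denom s)\<^sup>2 * (2 * geod_curv s * x_deriv s + (inv_denom s)\<^sup>2 * (?B * num_deriv1 s - ?A * num_deriv2 s))"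
    unfolding inv_denom_eq by simp
  have 2: "?B * num_deriv1 s - ?A * num_deriv2 s = (1 + cosh_x s * cosh_y s) * (rho cC s * cosh_x s * x_deriv s - sinh_x s * y_deriv s) - x_deriv s * rho cC s * i * (1 + cosh_x s * cosh_y s)\<^sup>2"
    unfolding AB1 using i cosh_x_sq[of s] cosh_y_sq[of s] by algebra
  have "(inv_denom s)\<^sup>2 * (?B * num_deriv1 s - ?A * num_deriv2 s) = inv_denom s * (inv_denom s * (1 + cosh_x s * cosh_y s)) * (rho cC s * cosh_x s * x_deriv s - sinh_x s * y_deriv s) - x_deriv s * rho cC s * i * (inv_denom s * (1 + cosh_x s * cosh_y s))\<^sup>2"
    unfolding 2 by algebra
  then have 3: "(inv_denom s)\<^sup>2 * (?B * num_deriv1 s - ?A * num_deriv2 s) = inv_denom s * (rho cC s * cosh_x s * x_deriv s - sinh_x s * y_deriv s) - x_deriv s * rho cC s * i"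
    unfolding inv_denom_eq by simp
  have "u_deriv s * v_deriv2 s - v_deriv s * u_deriv2 s - inv_denom s * (cat_v a s * u_deriv s - cat_u a s * v_deriv s) = (inv_denom s)\<^sup>2 * (2 * geod_curv s * x_deriv s - x_deriv s * rho cC s * i)"
    unfolding 1 3 tangential_moment by algebra
  also have "2 * geod_curv s * x_deriv s - x_deriv s * rho cC s * i = sinh (2 * a) / (2 * (rho cC s)\<^sup>2)"
    unfolding geod_curv_def x_deriv_def i_def using rho_pos[OF cC_gt_1, of s] cosh_y_pos[of s] by (simp add: field_simps power2_eq_square)
  finally show ?thesis .
qed

section \<open>Fundamental forms and Jacobi operator of the surface\<close>

lemma cat_param_eq: "cat_param a = rot_field (cat_u a) (cat_v a) (\<lambda>t. 1) cos sin"
  by (rule ext) (simp add: cat_param_def rot_field_def)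

abbreviation (input) "catX \<equiv> cat_param a"

lemma pd_X: "pd 1 catX = rot_field u_deriv v_deriv (\<lambda>t. 1) cos sin" "pd 2 catX = rot_field (cat_u a) (cat_v a) (\<lambda>t. 0) (\<lambda>t. - sin t) cos"
  unfolding cat_param_eq
  by (intro ext pd_rot_field; auto intro!: derivative_eq_intros u_DERIV v_DERIV)+

lemma pd_pd_X: "pd 1 (pd 1 catX) = rot_field u_deriv2 v_deriv2 (\<lambda>t. 1) cos sin"
  "pd 1 (pd 2 catX) = rot_field u_deriv v_deriv (\<lambda>t. 0) (\<lambda>t. - sin t) cos"
  "pd 2 (pd 1 catX) = rot_field u_deriv v_deriv (\<lambda>t. 0) (\<lambda>t. - sin t) cos"
  "pd 2 (pd 2 catX) = rot_field (cat_u a) (cat_v a) (\<lambda>t. 0) (\<lambda>t. - cos t) (\<lambda>t. - sin t)"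
  unfolding pd_X
  by (intro ext pd_rot_field; auto intro!: derivative_eq_intros u_DERIV v_DERIV u_deriv_DERIV v_deriv_DERIV)+

lemma norm_X_sq: "(norm (catX q))\<^sup>2 = 1 - 2 * inv_denom (q $ 1)"
proof -
  have "(norm (catX q))\<^sup>2 = (cat_u a (q $ 1))\<^sup>2 + (cat_v a (q $ 1))\<^sup>2 * ((cos (q $ 2))\<^sup>2 + (sin (q $ 2))\<^sup>2)"
    unfolding power2_norm_eq_inner cat_param_eq rot_field_inner by (simp add: power2_eq_square)
  then show ?thesis by (simp add: uv_sq)
qed

lemma norm_X: "norm (catX q) < 1"
  using norm_X_sq[of q] inv_denom_pos[of "q $ 1"] abs_square_less_1[of "norm (catX q)"] by simp

lemma conf_factor_X: "conf_factor (catX q) = 1 / (inv_denom (q $ 1))\<^sup>2"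
  by (simp add: conf_factor_def norm_X_sq power_mult_distrib)

lemma first_form_X:
  "first_form hyp_metric catX q $ 1 $ 1 = 1" "first_form hyp_metric catX q $ 1 $ 2 = 0"
  "first_form hyp_metric catX q $ 2 $ 1 = 0" "first_form hyp_metric catX q $ 2 $ 2 = (rho cC (q $ 1))\<^sup>2"
proof -
  have "u_deriv s * u_deriv s + v_deriv s * v_deriv s = inv_denom s * inv_denom s" for s using UW_sq[of s] by (simp add: power2_eq_square)
  then show "first_form hyp_metric catX q $ 1 $ 1 = 1"
    unfolding first_form_nth conf_factor_X pd_X rot_field_inner
    using inv_denom_pos[of "q $ 1"] sin_cos_squared_add[of "q $ 2"] by (simp add: power2_eq_square add.commute)
  show "first_form hyp_metric catX q $ 1 $ 2 = 0" "first_form hyp_metric catX q $ 2 $ 1 = 0"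
    unfolding first_form_nth pd_X rot_field_inner by simp_all
  have "first_form hyp_metric catX q $ 2 $ 2 = (cat_v a (q $ 1))\<^sup>2 * ((cos (q $ 2))\<^sup>2 + (sin (q $ 2))\<^sup>2) / (inv_denom (q $ 1))\<^sup>2"
    unfolding first_form_nth conf_factor_X pd_X rot_field_inner by (simp add: power2_eq_square algebra_simps)
  then show "first_form hyp_metric catX q $ 2 $ 2 = (rho cC (q $ 1))\<^sup>2"
    using inv_denom_pos[of "q $ 1"] by (simp add: v_eq power_mult_distrib)
qed

lemma area_density_X: "area_density hyp_metric catX q = rho cC (q $ 1)"
  using rho_pos[OF cC_gt_1, of "q $ 1"] by (simp add: area_density_def det_2 first_form_X)

lemma matrix_inv_first_form:
  "matrix_inv (first_form hyp_metric catX q) $ 1 $ 1 = 1" "matrix_inv (first_form hyp_metric catX q) $ 1 $ 2 = 0"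
  "matrix_inv (first_form hyp_metric catX q) $ 2 $ 1 = 0" "matrix_inv (first_form hyp_metric catX q) $ 2 $ 2 = 1 / (rho cC (q $ 1))\<^sup>2"
proof -
  let ?B = "(\<chi> i j. if i = j then if i = 1 then 1 else 1 / (rho cC (q $ 1))\<^sup>2 else 0) :: real^2^2"
  have "matrix_inv (first_form hyp_metric catX q) = ?B"
    using rho_nz[OF cC_gt_1, of "q $ 1"]
    by (intro matrix_inv_eqI)
       (simp_all add: vec_eq_iff forall_2 matrix_matrix_mult_def sum_2 mat_def first_form_X)
  then show "matrix_inv (first_form hyp_metric catX q) $ 1 $ 1 = 1" "matrix_inv (first_form hyp_metric catX q) $ 1 $ 2 = 0"
    "matrix_inv (first_form hyp_metric catX q) $ 2 $ 1 = 0" "matrix_inv (first_form hyp_metric catX q) $ 2 $ 2 = 1 / (rho cC (q $ 1))\<^sup>2"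
    by simp_all
qed

text \<open>The profile tangent turned by a right angle and rotated about the axis. Its Euclidean
  length is \<open>inv_denom\<close>, so its hyperbolic length is 1.\<close>

definition "normal_field = rot_field (\<lambda>s. - v_deriv s) u_deriv (\<lambda>t. 1) cos sin"

lemma normal_field_inner_pd: "normal_field q \<bullet> pd i catX q = 0"
proof -
  have "\<forall>i. normal_field q \<bullet> pd i catX q = 0" unfolding forall_2 normal_field_def pd_X rot_field_inner by (simp add: power2_eq_square[symmetric])
  then show ?thesis by blast
qed

lemma normal_field_sq: "normal_field q \<bullet> normal_field q = (inv_denom (q $ 1))\<^sup>2"
  unfolding normal_field_def rot_field_inner using UW_sq[of "q $ 1"] by (simp add: power2_eq_square[symmetric])

text \<open>Orthogonality to two independent tangents and unit length leave only a sign. As the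
  normal is selected by a choice operator, \<sigma> may vary from point to point.\<close>

lemma unit_normal_X: "\<exists>\<sigma>. \<sigma>\<^sup>2 = 1 \<and> unit_normal hyp_metric catX q = \<sigma> *\<^sub>R normal_field q"
proof -
  let ?s = "q $ 1" and ?t = "q $ 2"
  define n where "n = unit_normal hyp_metric catX q"
  have e: "inv_denom ?s > 0" by (rule inv_denom_pos)
  have "riem_inner hyp_metric (catX q) n n = 1 \<and> (\<forall>i. riem_inner hyp_metric (catX q) n (pd i catX q) = 0)"
    unfolding n_def unit_normal_def
    by (rule someI[of _ "normal_field q"]) (use e in \<open>simp add: hyp_inner conf_factor_X normal_field_sq normal_field_inner_pd\<close>)
  then have n: "n \<bullet> n = (inv_denom ?s)\<^sup>2" "n \<bullet> pd 1 catX q = 0" "n \<bullet> pd 2 catX q = 0"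
    using e conf_factor_pos[OF norm_X, of q] by (auto simp: hyp_inner conf_factor_X)
  \<comment> \<open>Radial component of the normal; the angular component vanishes by orthogonality
    to the second tangent.\<close>
  define w where "w = n $ 2 * cos ?t + n $ 3 * sin ?t"
  have sc: "sin ?t * sin ?t + cos ?t * cos ?t = 1" using sin_cos_squared_add[of ?t] by (simp add: power2_eq_square)
  have v: "cat_v a ?s \<noteq> 0" using e rho_pos[OF cC_gt_1, of ?s] by (simp add: v_eq)
  have 1: "n $ 1 * u_deriv ?s + w * v_deriv ?s = 0"
    using n(2) unfolding pd_X rot_field_def w_def by (simp add: inner_vec_def sum_3 algebra_simps)
  have "cat_v a ?s * (n $ 3 * cos ?t - n $ 2 * sin ?t) = 0"
    using n(3) unfolding pd_X rot_field_def by (simp add: inner_vec_def sum_3 algebra_simps)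
  then have 2: "n $ 3 * cos ?t = n $ 2 * sin ?t" using v by simp
  have w2: "n $ 2 = w * cos ?t" unfolding w_def using sc 2 by algebra
  have w3: "n $ 3 = w * sin ?t" unfolding w_def using sc 2 by algebra
  define \<sigma> where "\<sigma> = (w * u_deriv ?s - n $ 1 * v_deriv ?s) / (inv_denom ?s)\<^sup>2"
  have U: "u_deriv ?s * u_deriv ?s + v_deriv ?s * v_deriv ?s = (inv_denom ?s)\<^sup>2" using UW_sq[of ?s] by (simp add: power2_eq_square)
  have s: "\<sigma> * (inv_denom ?s)\<^sup>2 = w * u_deriv ?s - n $ 1 * v_deriv ?s" using e by (simp add: \<sigma>_def)
  have ne: "(inv_denom ?s)\<^sup>2 \<noteq> 0" using e by simp
  have "(inv_denom ?s)\<^sup>2 * (\<sigma> * - v_deriv ?s) = (inv_denom ?s)\<^sup>2 * n $ 1" using s 1 U by algebra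
  then have c1: "n $ 1 = \<sigma> * - v_deriv ?s" unfolding mult_left_cancel[OF ne] by simp
  have "(inv_denom ?s)\<^sup>2 * (\<sigma> * u_deriv ?s) = (inv_denom ?s)\<^sup>2 * w" using s 1 U by algebra
  then have cw: "w = \<sigma> * u_deriv ?s" unfolding mult_left_cancel[OF ne] by simp
  have ns: "n = \<sigma> *\<^sub>R normal_field q"
    unfolding normal_field_def rot_field_def vec_eq_iff forall_3 using c1 w2 w3 by (simp add: cw)
  then have "\<sigma>\<^sup>2 * (inv_denom ?s)\<^sup>2 = (inv_denom ?s)\<^sup>2" using n(1) normal_field_sq[of q] by (simp add: power2_eq_square)
  then have "\<sigma>\<^sup>2 = 1" using e by simp
  then show ?thesis using ns unfolding n_def[symmetric] by blast
qed

lemma X_inner_normal_field: "catX q \<bullet> normal_field q = cat_v a (q $ 1) * u_deriv (q $ 1) - cat_u a (q $ 1) * v_deriv (q $ 1)"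
  unfolding cat_param_eq normal_field_def rot_field_inner by (simp add: power2_eq_square[symmetric])

text \<open>The sign \<sigma> is common to the two nonzero coefficients, so it disappears from the
  vanishing trace and from the squared norm.\<close>

lemma second_form_X:
  "\<exists>\<sigma>. \<sigma>\<^sup>2 = 1 \<and> unit_normal hyp_metric catX q = \<sigma> *\<^sub>R normal_field q \<and>
    second_form hyp_metric catX q $ 1 $ 1 = \<sigma> * (sinh (2 * a) / (2 * (rho cC (q $ 1))\<^sup>2)) \<and>
    second_form hyp_metric catX q $ 1 $ 2 = 0 \<and> second_form hyp_metric catX q $ 2 $ 1 = 0 \<and>
    second_form hyp_metric catX q $ 2 $ 2 = - \<sigma> * (sinh (2 * a) / 2)"
proof -
  let ?s = "q $ 1"
  obtain \<sigma> where \<sigma>: "\<sigma>\<^sup>2 = 1" "unit_normal hyp_metric catX q = \<sigma> *\<^sub>R normal_field q" using unit_normal_X by blast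
  have e: "inv_denom ?s > 0" by (rule inv_denom_pos)
  have n0: "unit_normal hyp_metric catX q \<bullet> pd i catX q = 0" for i by (simp add: \<sigma>(2) normal_field_inner_pd)
  have sf2: "second_form hyp_metric catX q $ i $ j = \<sigma> / (inv_denom ?s)\<^sup>2 * (pd i (pd j catX) q \<bullet> normal_field q
     - (cat_v a ?s * u_deriv ?s - cat_u a ?s * v_deriv ?s) / inv_denom ?s * (pd i catX q \<bullet> pd j catX q))" for i j
    unfolding second_form_hyp[OF norm_X n0] unfolding \<sigma>(2) conf_factor_X norm_X_sq
    using e by (simp add: X_inner_normal_field field_simps)
  have UW: "u_deriv ?s * u_deriv ?s + v_deriv ?s * v_deriv ?s = inv_denom ?s * inv_denom ?s" using UW_sq[of ?s] by (simp add: power2_eq_square)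
  let ?T = "cat_v a ?s * u_deriv ?s - cat_u a ?s * v_deriv ?s"
  have "second_form hyp_metric catX q $ 1 $ 1 = \<sigma> / (inv_denom ?s)\<^sup>2 * (u_deriv ?s * v_deriv2 ?s - v_deriv ?s * u_deriv2 ?s - ?T / inv_denom ?s * (u_deriv ?s * u_deriv ?s + v_deriv ?s * v_deriv ?s))"
    unfolding sf2 unfolding pd_pd_X unfolding pd_X normal_field_def rot_field_inner
    by (simp add: power2_eq_square[of "sin _", symmetric] power2_eq_square[of "cos _", symmetric] mult.commute)
  then have "second_form hyp_metric catX q $ 1 $ 1 = \<sigma> / (inv_denom ?s)\<^sup>2 * (u_deriv ?s * v_deriv2 ?s - v_deriv ?s * u_deriv2 ?s - inv_denom ?s * ?T)"
    unfolding UW using e by (simp add: mult.commute)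
  moreover have "second_form hyp_metric catX q $ 2 $ 2 = - \<sigma> / (inv_denom ?s)\<^sup>2 * (cat_v a ?s * u_deriv ?s + (cat_v a ?s)\<^sup>2 * (cat_v a ?s * u_deriv ?s - cat_u a ?s * v_deriv ?s) / inv_denom ?s)"
  proof -
    have c: "cos (q $ 2) * cos (q $ 2) = 1 - sin (q $ 2) * sin (q $ 2)"
      using cos_squared_eq[of "q $ 2"] by (simp only: power2_eq_square)
    have "second_form hyp_metric catX q $ 2 $ 2 = \<sigma> / (inv_denom ?s)\<^sup>2 * (- (cat_v a ?s * u_deriv ?s) - ?T / inv_denom ?s * (cat_v a ?s)\<^sup>2)"
      unfolding sf2 unfolding pd_pd_X unfolding pd_X normal_field_def rot_field_inner by (simp add: power2_eq_square c)
    then show ?thesis unfolding divide_inverse by algebra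
  qed
  moreover have "second_form hyp_metric catX q $ 1 $ 2 = 0" "second_form hyp_metric catX q $ 2 $ 1 = 0"
    unfolding sf2 unfolding pd_pd_X unfolding pd_X normal_field_def rot_field_inner by simp_all
  ultimately show ?thesis using \<sigma> e unfolding A11_eq A22_eq by (intro exI[of _ \<sigma>]) simp
qed

lemma mean_curvature_X: "mean_curvature hyp_metric catX q = 0"
proof -
  obtain \<sigma> where "second_form hyp_metric catX q $ 1 $ 1 = \<sigma> * (sinh (2 * a) / (2 * (rho cC (q $ 1))\<^sup>2))"
    "second_form hyp_metric catX q $ 1 $ 2 = 0" "second_form hyp_metric catX q $ 2 $ 1 = 0"
    "second_form hyp_metric catX q $ 2 $ 2 = - \<sigma> * (sinh (2 * a) / 2)" using second_form_X[of q] by blast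
  then show ?thesis by (simp add: mean_curvature_def sum_2 matrix_inv_first_form)
qed

lemma norm_second_form_X: "norm_second_form_sq hyp_metric catX q = (cC\<^sup>2 - 1) / (2 * rho cC (q $ 1) ^ 4)"
proof -
  obtain \<sigma> where s: "\<sigma>\<^sup>2 = 1" "second_form hyp_metric catX q $ 1 $ 1 = \<sigma> * (sinh (2 * a) / (2 * (rho cC (q $ 1))\<^sup>2))"
    "second_form hyp_metric catX q $ 1 $ 2 = 0" "second_form hyp_metric catX q $ 2 $ 1 = 0"
    "second_form hyp_metric catX q $ 2 $ 2 = - \<sigma> * (sinh (2 * a) / 2)" using second_form_X[of q] by blast
  let ?r = "rho cC (q $ 1)"
  have "norm_second_form_sq hyp_metric catX q = (\<sigma> * (sinh (2 * a) / (2 * ?r\<^sup>2)))\<^sup>2 + (\<sigma> * (sinh (2 * a) / 2))\<^sup>2 / ?r ^ 4"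
    by (simp add: norm_second_form_sq_def Let_def sum_2 matrix_inv_first_form s(2-5)) (simp add: eval_nat_numeral)
  also have "\<dots> = \<sigma>\<^sup>2 * (sinh (2 * a))\<^sup>2 / (2 * ?r ^ 4)"
    using rho_nz[OF cC_gt_1, of "q $ 1"] by (simp add: field_simps eval_nat_numeral)
  finally show ?thesis by (simp add: s(1) S_sq)
qed

lemma ricci_normal_X: "unit_normal hyp_metric catX q \<bullet> (ricci hyp_metric (catX q) *v unit_normal hyp_metric catX q) = - 2"
proof -
  obtain \<sigma> where s: "\<sigma>\<^sup>2 = 1" "unit_normal hyp_metric catX q = \<sigma> *\<^sub>R normal_field q" using second_form_X[of q] by blast
  have sm: "(c *\<^sub>R mat 1) *v x = c *\<^sub>R x" for c and x :: "real^3"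
    by (simp add: scaleR_matrix_vector_assoc[symmetric])
  have "unit_normal hyp_metric catX q \<bullet> (ricci hyp_metric (catX q) *v unit_normal hyp_metric catX q) = - 2 * conf_factor (catX q) * (\<sigma>\<^sup>2 * (normal_field q \<bullet> normal_field q))"
    unfolding ricci_hyp[OF norm_X] s(2) sm by (simp add: power2_eq_square)
  then show ?thesis using inv_denom_pos[of "q $ 1"] by (simp add: s(1) normal_field_sq conf_factor_X)
qed

lemma jacobi_op_X:
  "jacobi_op hyp_metric catX \<phi> q = (pd 1 (\<lambda>r. rho cC (r $ 1) * pd 1 \<phi> r) q + pd 2 (\<lambda>r. pd 2 \<phi> r / rho cC (r $ 1)) q) / rho cC (q $ 1)
     + pot cC (q $ 1) * \<phi> q"
proof -
  have "rho cC x * (pd 2 \<phi> r / (rho cC x)\<^sup>2) = pd 2 \<phi> r / rho cC x" for x r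
    using rho_nz[OF cC_gt_1, of x] by (simp add: power2_eq_square)
  then show ?thesis
    unfolding jacobi_op_def laplace_beltrami_def norm_second_form_X ricci_normal_X area_density_X sum_2 matrix_inv_first_form
    by (simp add: pot_def)
qed

lemma smooth_of_nth_1:
  shows "smooth (\<lambda>q::real^2. rho cC (q $ 1))" "smooth (\<lambda>q::real^2. cat_u a (q $ 1))" "smooth (\<lambda>q::real^2. cat_v a (q $ 1))"
    "smooth (\<lambda>q::real^2. pot cC (q $ 1))"
proof -
  have r: "smooth_on UNIV (\<lambda>q::real^2. rho cC (q $ 1))"
    unfolding rho_def using C_cosh_gt_1[OF cC_gt_1] by (intro smooth_intros) auto
  then show "smooth (\<lambda>q::real^2. rho cC (q $ 1))" by (simp add: smooth_on_UNIV)
  have p: "smooth_on UNIV (\<lambda>q::real^2. pot cC (q $ 1))"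
    unfolding pot_def using rho_nz[OF cC_gt_1] by (intro smooth_intros r) auto
  then show "smooth (\<lambda>q::real^2. pot cC (q $ 1))" by (simp add: smooth_on_UNIV)
  have h: "smooth_on UNIV (\<lambda>q::real^2. cosh_y (q $ 1))"
    unfolding cosh_y_eq using cosh_y_aux by (intro smooth_intros r) auto
  have hn: "cosh_y s \<noteq> 0" for s using cosh_y_pos[of s] by simp
  have "smooth_on UNIV (\<lambda>q::real^2. x_deriv (q $ 1) / cosh_y (q $ 1))"
    unfolding x_deriv_def using rho_nz[OF cC_gt_1] hn by (intro smooth_intros r h) auto
  then have x: "smooth_on UNIV (\<lambda>q::real^2. cat_x a (q $ 1))"
    unfolding smooth_on_UNIV by (intro smooth_fun_of_nth_if_deriv[OF cat_x_DERIV])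
  have e: "smooth_on UNIV (\<lambda>q::real^2. inv_denom (q $ 1))"
    unfolding inv_denom_def cosh_x_def using den_pos by (intro smooth_intros x h) (auto simp: cosh_x_def less_le)
  have "smooth_on UNIV (\<lambda>q::real^2. cat_u a (q $ 1))" "smooth_on UNIV (\<lambda>q::real^2. cat_v a (q $ 1))"
    unfolding u_eq v_eq sinh_x_def by (intro smooth_intros x h e r open_UNIV)+
  then show "smooth (\<lambda>q::real^2. cat_u a (q $ 1))" "smooth (\<lambda>q::real^2. cat_v a (q $ 1))" by (simp_all add: smooth_on_UNIV)
qed

lemma smooth_X: "smooth catX"
proof (rule smooth_vecI)
  note s = smooth_of_nth_1[unfolded smooth_on_UNIV[symmetric]]
  have "\<forall>j. smooth_on UNIV (\<lambda>q. catX q $ j)"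
    unfolding forall_3 cat_param_def vector_3 by (intro conjI smooth_intros s open_UNIV)
  then show "smooth (\<lambda>q. catX q $ j)" for j by (simp add: smooth_on_UNIV)
qed

lemma catenoid_minimal_X: "catenoid_minimal a"
  unfolding minimal_surface_def
proof (intro conjI allI)
  show "smooth catX" by (rule smooth_X)
  show "range catX \<subseteq> ball 0 1" using norm_X by auto
  show "mean_curvature hyp_metric catX q = 0" for q by (rule mean_curvature_X)
  fix q
  have o: "pd 1 catX q \<bullet> pd 2 catX q = 0" unfolding pd_X rot_field_inner by simp
  have o2: "pd 2 catX q \<bullet> pd 1 catX q = 0" unfolding pd_X rot_field_inner by simp
  have n1: "pd 1 catX q \<bullet> pd 1 catX q \<noteq> 0"
    using first_form_X(1)[of q] unfolding first_form_nth by auto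
  have n2: "pd 2 catX q \<bullet> pd 2 catX q \<noteq> 0"
    using first_form_X(4)[of q] rho_nz[OF cC_gt_1, of "q $ 1"] unfolding first_form_nth by auto
  show "inj (\<lambda>w::real^2. \<Sum>i\<in>UNIV. w $ i *\<^sub>R pd i catX q)"
  proof (rule injI)
    fix w z :: "real^2"
    assume "(\<Sum>i\<in>UNIV. w $ i *\<^sub>R pd i catX q) = (\<Sum>i\<in>UNIV. z $ i *\<^sub>R pd i catX q)"
    then have "(w $ 1 - z $ 1) *\<^sub>R pd 1 catX q + (w $ 2 - z $ 2) *\<^sub>R pd 2 catX q = 0"
      by (simp add: sum_2 algebra_simps)
    then have "((w $ 1 - z $ 1) *\<^sub>R pd 1 catX q + (w $ 2 - z $ 2) *\<^sub>R pd 2 catX q) \<bullet> pd 1 catX q = 0"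
      "((w $ 1 - z $ 1) *\<^sub>R pd 1 catX q + (w $ 2 - z $ 2) *\<^sub>R pd 2 catX q) \<bullet> pd 2 catX q = 0" by simp_all
    then have "w $ 1 = z $ 1" "w $ 2 = z $ 2"
      using o o2 n1 n2 by (simp_all add: inner_add_left)
    then show "w = z" by (simp add: vec_eq_iff forall_2)
  qed
qed

end

section \<open>The second variation in arc length and angle\<close>

abbreviation v2 :: "real \<Rightarrow> real \<Rightarrow> real^2" where "v2 s t \<equiv> vector [s, t]"

definition rect :: "real \<Rightarrow> (real^2) set" where "rect S = cbox (v2 (- S) 0) (v2 S (2 * pi))"

section \<open>Integrals over the parameter rectangle\<close>

lemma v2_eta: "v2 (q $ 1) (q $ 2) = q"
  by (simp add: vec_eq_iff forall_2)

lemma cbox_v2: "cbox (v2 a b) (v2 c d) = {q. a \<le> q $ 1 \<and> q $ 1 \<le> c \<and> b \<le> q $ 2 \<and> q $ 2 \<le> d}"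
  by (auto simp: mem_box_cart forall_2)

lemma mem_rect: "q \<in> rect S \<longleftrightarrow> \<bar>q $ 1\<bar> \<le> S \<and> 0 \<le> q $ 2 \<and> q $ 2 \<le> 2 * pi"
  by (auto simp: rect_def cbox_v2 abs_le_iff)

lemma continuous_on_v2 [continuous_intros]:
  "continuous_on A f \<Longrightarrow> continuous_on A g \<Longrightarrow> continuous_on A (\<lambda>x. v2 (f x) (g x))"
proof -
  assume fg: "continuous_on A f" "continuous_on A g"
  have e: "v2 x y = (\<chi> i. if i = 1 then x else y)" for x y by (simp add: vec_eq_iff forall_2)
  have "continuous_on A (\<lambda>x. if i = 1 then f x else g x)" for i :: 2 using fg by (cases "i = 1") auto
  then show ?thesis unfolding e by (rule continuous_on_vec_lambda)
qed

text \<open>Fubini is available for pairs, whereas the parameters live in \<open>real^2\<close>. The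
  coordinate bijections \<open>g\<close> and \<open>h\<close> map boxes to boxes, with equal
  content, and so transfer the integral.\<close>

lemma integral_rect_cont:
  fixes \<phi> :: "real^2 \<Rightarrow> real"
  assumes c: "continuous_on UNIV \<phi>" and S: "0 \<le> S"
  shows "integral (rect S) \<phi> = integral {- S..S} (\<lambda>s. integral {0..2 * pi} (\<lambda>t. \<phi> (v2 s t)))"
proof -
  define g where "g = (\<lambda>q::real^2. (q $ 1, q $ 2))"
  define h where "h = (\<lambda>(s, t). v2 s t)"
  have hg: "h (g q) = q" for q by (simp add: h_def g_def v2_eta)
  have gh: "g (h p) = p" for p by (cases p) (simp add: h_def g_def)
  have gi: "g ` cbox u v = cbox (g u) (g v)" for u v
  proof -
    have "g ` cbox u v = {p. h p \<in> cbox u v}"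
    proof (intro set_eqI iffI)
      fix p assume "p \<in> {p. h p \<in> cbox u v}"
      then show "p \<in> g ` cbox u v" by (intro image_eqI[of _ _ "h p"]) (simp_all add: gh)
    qed (auto simp: hg)
    also have "\<dots> = cbox (g u) (g v)"
      by (auto simp: h_def g_def cbox_Pair_eq mem_box_cart forall_2 split: prod.splits)
    finally show ?thesis .
  qed
  have hi: "h ` cbox u v = cbox (h u) (h v)" for u v
  proof -
    have "h ` cbox u v = h ` (g ` cbox (h u) (h v))" by (simp add: gi gh)
    also have "\<dots> = cbox (h u) (h v)" by (simp add: image_image hg)
    finally show ?thesis .
  qed
  have gc: "continuous (at x) g" for x
    unfolding g_def by (intro continuous_intros)
  have ct: "measure lborel (g ` cbox u v) = 1 * measure lborel (cbox u v)" for u v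
  proof (cases "cbox u v = {}")
    case True
    then show ?thesis by simp
  next
    case False
    then have "u $ 1 \<le> v $ 1" "u $ 2 \<le> v $ 2" by (auto simp: interval_ne_empty_cart forall_2)
    then show ?thesis
      unfolding gi using content_cbox_cart[OF False] by (simp add: g_def content_Pair UNIV_2)
  qed
  have cf: "continuous_on UNIV (\<lambda>p. \<phi> (h p))"
    unfolding h_def case_prod_beta by (intro continuous_on_compose2[OF c] continuous_intros) auto
  define I where "I = integral (cbox (- S, 0) (S, 2 * pi)) (\<lambda>p. \<phi> (h p))"
  have "((\<lambda>p. \<phi> (h p)) has_integral I) (cbox (- S, 0) (S, 2 * pi))"
    unfolding I_def by (intro integrable_integral integrable_continuous continuous_on_subset[OF cf]) auto
  moreover have "\<exists>w z. g ` cbox u v = cbox w z" for u v unfolding gi by blast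
  moreover have "\<exists>w z. h ` cbox u v = cbox w z" for u v unfolding hi by blast
  ultimately have "((\<lambda>q. \<phi> (h (g q))) has_integral (1 / 1) *\<^sub>R I) (h ` cbox (- S, 0) (S, 2 * pi))"
    by (intro has_integral_twiddle[OF zero_less_one hg gh gc _ _ ct])
  then have "((\<lambda>q. \<phi> (h (g q))) has_integral I) (h ` cbox (- S, 0) (S, 2 * pi))"
    by simp
  moreover have "h ` cbox (- S, 0) (S, 2 * pi) = rect S" unfolding hi by (simp add: h_def rect_def)
  ultimately have "(\<phi> has_integral I) (rect S)" by (simp add: hg)
  then have "integral (rect S) \<phi> = I" by (rule integral_unique)
  also have "I = integral {- S..S} (\<lambda>s. integral {0..2 * pi} (\<lambda>t. \<phi> (v2 s t)))"
    unfolding I_def using integral_prod_continuous[OF continuous_on_subset[OF cf], of "- S" 0 S "2 * pi"]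
    by (simp add: h_def)
  finally show ?thesis .
qed

lemma integral_rect_swap:
  fixes \<phi> :: "real^2 \<Rightarrow> real"
  assumes c: "continuous_on UNIV \<phi>" and S: "0 \<le> S"
  shows "integral (rect S) \<phi> = integral {0..2 * pi} (\<lambda>t. integral {- S..S} (\<lambda>s. \<phi> (v2 s t)))"
proof -
  have "continuous_on (cbox (- S, 0) (S, 2 * pi)) (\<lambda>(s, t). \<phi> (v2 s t))"
    unfolding case_prod_beta by (intro continuous_on_compose2[OF c] continuous_intros) auto
  from integral_swap_continuous[OF this] show ?thesis
    by (simp add: integral_rect_cont[OF assms])
qed

lemma integrable_rect: "continuous_on UNIV \<phi> \<Longrightarrow> (\<phi> :: real^2 \<Rightarrow> real) integrable_on rect S"
  unfolding rect_def by (intro integrable_continuous) (rule continuous_on_subset, auto)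

lemma integral_slice_cont:
  fixes \<phi> :: "real^2 \<Rightarrow> real"
  assumes c: "continuous_on UNIV \<phi>"
  shows "continuous_on A (\<lambda>s. integral {a..b} (\<lambda>t. \<phi> (v2 s t)))" "continuous_on A (\<lambda>t. integral {a..b} (\<lambda>s. \<phi> (v2 s t)))"
proof -
  have "continuous_on (A \<times> cbox a b) (\<lambda>(s, t). \<phi> (v2 s t))" "continuous_on (A \<times> cbox a b) (\<lambda>(t, s). \<phi> (v2 s t))"
    unfolding case_prod_beta by (intro continuous_on_compose2[OF c] continuous_intros; auto)+
  from integral_continuous_on_param[OF this(1)] integral_continuous_on_param[OF this(2)]
  show "continuous_on A (\<lambda>s. integral {a..b} (\<lambda>t. \<phi> (v2 s t)))" "continuous_on A (\<lambda>t. integral {a..b} (\<lambda>s. \<phi> (v2 s t)))"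
    by simp_all
qed

lemma integral_rect_nonneg_cols:
  fixes \<phi> :: "real^2 \<Rightarrow> real"
  assumes c: "continuous_on UNIV \<phi>" and S: "0 \<le> S" and "\<And>t. 0 \<le> integral {- S..S} (\<lambda>s. \<phi> (v2 s t))"
  shows "0 \<le> integral (rect S) \<phi>"
  unfolding integral_rect_swap[OF c S]
  by (intro integral_nonneg integrable_continuous_interval integral_slice_cont c assms)

lemma integral_rect_nonneg_rows:
  fixes \<phi> :: "real^2 \<Rightarrow> real"
  assumes c: "continuous_on UNIV \<phi>" and S: "0 \<le> S" and "\<And>s. 0 \<le> integral {0..2 * pi} (\<lambda>t. \<phi> (v2 s t))"
  shows "0 \<le> integral (rect S) \<phi>"
  unfolding integral_rect_cont[OF c S]
  by (intro integral_nonneg integrable_continuous_interval integral_slice_cont c assms)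

lemma slice_DERIV:
  fixes H :: "real^2 \<Rightarrow> real"
  assumes "H differentiable (at (v2 s t))"
  shows "((\<lambda>s. H (v2 s t)) has_real_derivative pd 1 H (v2 s t)) (at s)"
    "((\<lambda>t. H (v2 s t)) has_real_derivative pd 2 H (v2 s t)) (at t)"
proof -
  obtain H' where H': "(H has_derivative H') (at (v2 s t))" using assms unfolding differentiable_def by blast
  have l: "linear H'" using H' by (rule has_derivative_linear)
  have e1: "(\<lambda>s. v2 s t) = (\<lambda>s. v2 0 t + s *\<^sub>R axis 1 1)" by (rule ext) (simp add: vec_eq_iff forall_2 axis_def)
  have e2: "(\<lambda>t. v2 s t) = (\<lambda>t. v2 s 0 + t *\<^sub>R axis 2 1)" by (rule ext) (simp add: vec_eq_iff forall_2 axis_def)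
  have "((\<lambda>s. v2 s t) has_derivative (\<lambda>h. h *\<^sub>R axis 1 1)) (at s)"
    unfolding e1 by (auto intro!: derivative_eq_intros)
  from has_derivative_compose[OF this H'] have "((\<lambda>s. H (v2 s t)) has_derivative (\<lambda>h. h * H' (axis 1 1))) (at s)"
    by (simp add: linear_scale[OF l])
  then show "((\<lambda>s. H (v2 s t)) has_real_derivative pd 1 H (v2 s t)) (at s)"
    unfolding pd_eq[OF H'] has_field_derivative_def by (simp add: mult_commute_abs)
  have "((\<lambda>t. v2 s t) has_derivative (\<lambda>h. h *\<^sub>R axis 2 1)) (at t)"
    unfolding e2 by (auto intro!: derivative_eq_intros)
  from has_derivative_compose[OF this H'] have "((\<lambda>t. H (v2 s t)) has_derivative (\<lambda>h. h * H' (axis 2 1))) (at t)"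
    by (simp add: linear_scale[OF l])
  then show "((\<lambda>t. H (v2 s t)) has_real_derivative pd 2 H (v2 s t)) (at t)"
    unfolding pd_eq[OF H'] has_field_derivative_def by (simp add: mult_commute_abs)
qed

lemma smoothD:
  fixes f :: "real^2 \<Rightarrow> real"
  assumes "smooth f"
  shows "f differentiable (at x)" "continuous_on A f" "smooth (pd i f)"
proof -
  have s: "smooth_on UNIV f" using assms by (simp add: smooth_on_UNIV)
  show "f differentiable (at x)" by (rule smooth_on_differentiable[OF s]) auto
  show "continuous_on A f" using smooth_on_continuous[OF s] continuous_on_subset by blast
  show "smooth (pd i f)" using smooth_on_pd[OF s] by (simp add: smooth_on_UNIV)
qed

lemma smooth_mult: "smooth f \<Longrightarrow> smooth g \<Longrightarrow> smooth (\<lambda>x::real^2. f x * g x :: real)"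
  unfolding smooth_on_UNIV[symmetric] by (rule smooth_on_mult) auto
text \<open>The divergence theorem is used one direction at a time: Dirichlet data remove the
  boundary terms in s, and periodicity removes those in the angle.\<close>

lemma integral_pd1:
  fixes H :: "real^2 \<Rightarrow> real"
  assumes H: "smooth H" and S: "0 \<le> S" and z: "\<And>t. H (v2 S t) = 0" "\<And>t. H (v2 (- S) t) = 0"
  shows "integral (rect S) (pd 1 H) = 0"
proof -
  have "integral {- S..S} (\<lambda>s. pd 1 H (v2 s t)) = 0" for t
  proof (rule integral_unique)
    have "((\<lambda>s. pd 1 H (v2 s t)) has_integral H (v2 S t) - H (v2 (- S) t)) {- S..S}"
      using S slice_DERIV(1)[OF smoothD(1)[OF H]]
      by (intro fundamental_theorem_of_calculus)
         (auto simp: has_real_derivative_iff_has_vector_derivative intro: has_vector_derivative_at_within)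
    then show "((\<lambda>s. pd 1 H (v2 s t)) has_integral 0) {- S..S}" by (simp add: z)
  qed
  then show ?thesis using integral_rect_swap[OF smoothD(2)[OF smoothD(3)[OF H, of 1]] S] by simp
qed

lemma integral_pd2:
  fixes H :: "real^2 \<Rightarrow> real"
  assumes H: "smooth H" and S: "0 \<le> S" and z: "\<And>s. H (v2 s (2 * pi)) = H (v2 s 0)"
  shows "integral (rect S) (pd 2 H) = 0"
proof -
  have "integral {0..2 * pi} (\<lambda>t. pd 2 H (v2 s t)) = 0" for s
  proof (rule integral_unique)
    have "((\<lambda>t. pd 2 H (v2 s t)) has_integral H (v2 s (2 * pi)) - H (v2 s 0)) {0..2 * pi}"
      using slice_DERIV(2)[OF smoothD(1)[OF H]]
      by (intro fundamental_theorem_of_calculus)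
         (auto simp: has_real_derivative_iff_has_vector_derivative intro: has_vector_derivative_at_within)
    then show "((\<lambda>t. pd 2 H (v2 s t)) has_integral 0) {0..2 * pi}" by (simp add: z)
  qed
  then show ?thesis using integral_rect_cont[OF smoothD(2)[OF smoothD(3)[OF H, of 2]] S] by simp
qed

lemma pd_periodic:
  fixes f :: "real^2 \<Rightarrow> real"
  assumes "\<And>q. f (q + v2 0 (2 * pi)) = f q"
  shows "pd i f (q + v2 0 (2 * pi)) = pd i f q"
proof -
  have "f (q + v2 0 (2 * pi) + t *\<^sub>R axis i 1) = f (q + t *\<^sub>R axis i 1)" for t
    using assms[of "q + t *\<^sub>R axis i 1"] by (simp add: algebra_simps)
  then show ?thesis by (simp add: pd_def)
qed

lemma periodic_v2:
  assumes "\<And>q. f (q + v2 0 (2 * pi)) = f q"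
  shows "f (v2 s (t + 2 * pi)) = f (v2 s t)"
proof -
  have "v2 s (t + 2 * pi) = v2 s t + v2 0 (2 * pi)" by (simp add: vec_eq_iff forall_2)
  then show ?thesis using assms by simp
qed

text \<open>The second variation in coordinates: \<open>rho\<close> is the area density, and the
  inverse metric 1 / rho^2 in the angle leaves the weight 1 / rho there. It is polarized because
  orthogonality of eigenfunctions is also read off from it.\<close>

definition jacobi_form :: "real \<Rightarrow> real \<Rightarrow> (real^2 \<Rightarrow> real) \<Rightarrow> (real^2 \<Rightarrow> real) \<Rightarrow> real" where
  "jacobi_form C S G v = integral (rect S) (\<lambda>q. rho C (q $ 1) * (pd 1 G q * pd 1 v q) + pd 2 G q * pd 2 v q / rho C (q $ 1)
     - rho C (q $ 1) * pot C (q $ 1) * (G q * v q))"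

lemma jacobi_form_sym: "jacobi_form C S G v = jacobi_form C S v G"
  unfolding jacobi_form_def by (simp only: mult.commute[of "pd 1 v _"] mult.commute[of "pd 2 v _"] mult.commute[of "v _"])

text \<open>The coordinate expression of \<open>jacobi_op\<close>, with \<open>C\<close> as a free
  parameter and detached from the surface.\<close>

definition jacobi_strip :: "real \<Rightarrow> (real^2 \<Rightarrow> real) \<Rightarrow> real^2 \<Rightarrow> real" where
  "jacobi_strip C \<phi> q = (pd 1 (\<lambda>r. rho C (r $ 1) * pd 1 \<phi> r) q + pd 2 (\<lambda>r. pd 2 \<phi> r / rho C (r $ 1)) q) / rho C (q $ 1)
     + pot C (q $ 1) * \<phi> q"

section \<open>Estimates of the quadratic form\<close>

lemma cont_nth_1: "continuous_on UNIV f \<Longrightarrow> continuous_on A (\<lambda>q::real^2. f (q $ 1) :: real)"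
  by (rule continuous_on_compose2[of UNIV f]) (auto intro!: continuous_intros)

context
  fixes C :: real
  assumes C: "C > 1"
begin

lemma coeff_cont: "continuous_on A (\<lambda>q::real^2. rho C (q $ 1))" "continuous_on A (\<lambda>q::real^2. pot C (q $ 1))"
  by (intro cont_nth_1 rho_cont pot_cont C)+

lemma smooth_rho: "smooth (\<lambda>q::real^2. rho C (q $ 1))"
  unfolding smooth_on_UNIV[symmetric] rho_def using C_cosh_gt_1[OF C] by (intro smooth_intros) auto

lemma smooth_inv_rho: "smooth (\<lambda>q::real^2. 1 / rho C (q $ 1))"
  using smooth_rho unfolding smooth_on_UNIV[symmetric]
  by (intro smooth_on_divide smooth_on_const) (auto simp: rho_nz[OF C])

end

context
  fixes C S :: real
  assumes C: "C > 1" and S: "0 \<le> S"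
begin

text \<open>The vanishing of \<open>v\<close> at both ends removes all boundary terms in s. The
  asymmetry is exploited later, when \<open>G\<close> is an eigenfunction without cutoff and
  \<open>v\<close> a truncated one.\<close>

lemma integration_by_parts:
  assumes G: "smooth G" "\<And>q. G (q + v2 0 (2 * pi)) = G q" and v: "smooth v" "\<And>q. v (q + v2 0 (2 * pi)) = v q"
    and z: "\<And>t. v (v2 S t) = 0" "\<And>t. v (v2 (- S) t) = 0"
  shows "integral (rect S) (\<lambda>q. v q * jacobi_strip C G q * rho C (q $ 1)) = - jacobi_form C S G v"
proof -
  define P where "P = (\<lambda>q. rho C (q $ 1) * pd 1 G q)"
  define Q where "Q = (\<lambda>q. pd 2 G q / rho C (q $ 1))"
  have sP: "smooth P" unfolding P_def by (intro smooth_mult smooth_rho[OF C] smoothD(3) G)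
  have sQ: "smooth Q"
    using smooth_mult[OF smoothD(3)[OF G(1), of 2] smooth_inv_rho[OF C]] by (simp add: Q_def)
  have 1: "integral (rect S) (pd 1 (\<lambda>q. v q * P q)) = 0"
    by (rule integral_pd1[OF smooth_mult[OF v(1) sP] S]) (simp_all add: z)
  have 2: "integral (rect S) (pd 2 (\<lambda>q. v q * Q q)) = 0"
  proof (rule integral_pd2[OF smooth_mult[OF v(1) sQ] S])
    fix s
    have "v (v2 s (0 + 2 * pi)) = v (v2 s 0)" "pd 2 G (v2 s (0 + 2 * pi)) = pd 2 G (v2 s 0)"
      by (rule periodic_v2[of v, OF v(2)], rule periodic_v2[of "pd 2 G", OF pd_periodic[of G, OF G(2)]])
    then show "v (v2 s (2 * pi)) * Q (v2 s (2 * pi)) = v (v2 s 0) * Q (v2 s 0)" by (simp add: Q_def)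
  qed
  note c = smoothD(2)
  have i: "pd 1 (\<lambda>q. v q * P q) integrable_on rect S" "pd 2 (\<lambda>q. v q * Q q) integrable_on rect S"
    by (intro integrable_rect c smoothD(3) smooth_mult v sP sQ)+
  have denom_deriv: "continuous_on UNIV (\<lambda>q. rho C (q $ 1) * (pd 1 G q * pd 1 v q) + pd 2 G q * pd 2 v q / rho C (q $ 1)
     - rho C (q $ 1) * pot C (q $ 1) * (G q * v q))"
    by (intro continuous_intros coeff_cont[OF C] c smoothD(3) G v) (simp add: rho_nz[OF C])
  have e: "v q * jacobi_strip C G q * rho C (q $ 1) = pd 1 (\<lambda>q. v q * P q) q + pd 2 (\<lambda>q. v q * Q q) q
     - (rho C (q $ 1) * (pd 1 G q * pd 1 v q) + pd 2 G q * pd 2 v q / rho C (q $ 1) - rho C (q $ 1) * pot C (q $ 1) * (G q * v q))" for q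
  proof -
    have "pd i (\<lambda>q. v q * P q) q = pd i v q * P q + v q * pd i P q" "pd i (\<lambda>q. v q * Q q) q = pd i v q * Q q + v q * pd i Q q" for i
      by (intro pd_mult smoothD(1) v sP sQ)+
    then show ?thesis
      unfolding jacobi_strip_def P_def[symmetric] Q_def[symmetric] using rho_nz[OF C, of "q $ 1"] P_def[THEN fun_cong, of q] Q_def[THEN fun_cong, of q]
      by (simp add: field_simps)
  qed
  show ?thesis unfolding e jacobi_form_def
    using 1 2 i integrable_rect[OF denom_deriv, of S] by (simp add: integral_diff integral_add integrable_add)
qed

text \<open>The radial inequality is applied on each meridian separately and the angular energy,
  being nonnegative, is discarded; all frequencies are treated at once.\<close>

lemma jacobi_form_ge_gap:
  assumes F: "smooth F" and z: "\<And>t. F (v2 S t) = 0" "\<And>t. F (v2 (- S) t) = 0"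
    and radial_spectral_gap: "\<And>\<phi> \<phi>'. (\<And>s. (\<phi> has_real_derivative \<phi>' s) (at s)) \<Longrightarrow> continuous_on UNIV \<phi>' \<Longrightarrow> \<phi> S = 0 \<Longrightarrow> \<phi> (- S) = 0
      \<Longrightarrow> c * integral {- S..S} (\<lambda>s. rho C s * (\<phi> s)\<^sup>2)
       \<le> integral {- S..S} (\<lambda>s. rho C s * (\<phi>' s)\<^sup>2 - rho C s * pot C s * (\<phi> s)\<^sup>2)"
  shows "c * integral (rect S) (\<lambda>q. rho C (q $ 1) * (F q)\<^sup>2) \<le> jacobi_form C S F F"
proof -
  note cF = smoothD(2)[OF F] smoothD(2)[OF smoothD(3)[OF F]]
  let ?A = "\<lambda>q. rho C (q $ 1) * (pd 1 F q)\<^sup>2 - rho C (q $ 1) * pot C (q $ 1) * (F q)\<^sup>2 - c * (rho C (q $ 1) * (F q)\<^sup>2)"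
  let ?B = "\<lambda>q. (pd 2 F q)\<^sup>2 / rho C (q $ 1)"
  have cA: "continuous_on UNIV ?A" and cB: "continuous_on UNIV ?B" and cR: "continuous_on UNIV (\<lambda>q. c * (rho C (q $ 1) * (F q)\<^sup>2))"
    by (intro continuous_intros coeff_cont[OF C] cF; simp add: rho_nz[OF C])+
  have "0 \<le> integral (rect S) ?A"
  proof (rule integral_rect_nonneg_cols[OF cA S])
    fix t
    define \<phi> where "\<phi> = (\<lambda>s. F (v2 s t))"
    define \<phi>' where "\<phi>' = (\<lambda>s. pd 1 F (v2 s t))"
    have d: "(\<phi> has_real_derivative \<phi>' s) (at s)" for s unfolding \<phi>_def \<phi>'_def by (rule slice_DERIV(1)[OF smoothD(1)[OF F]])
    have c': "continuous_on A \<phi>'" for A unfolding \<phi>'_def by (intro continuous_on_compose2[OF cF(2)[of UNIV]] continuous_intros) auto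
    have c0: "continuous_on A \<phi>" for A by (rule continuous_on_if_DERIV[OF d])
    have "c * integral {- S..S} (\<lambda>s. rho C s * (\<phi> s)\<^sup>2) \<le> integral {- S..S} (\<lambda>s. rho C s * (\<phi>' s)\<^sup>2 - rho C s * pot C s * (\<phi> s)\<^sup>2)"
      by (rule radial_spectral_gap[OF d c']) (simp_all add: \<phi>_def z)
    moreover have "integral {- S..S} (\<lambda>s. (rho C s * (\<phi>' s)\<^sup>2 - rho C s * pot C s * (\<phi> s)\<^sup>2) - c * (rho C s * (\<phi> s)\<^sup>2))
       = integral {- S..S} (\<lambda>s. rho C s * (\<phi>' s)\<^sup>2 - rho C s * pot C s * (\<phi> s)\<^sup>2) - integral {- S..S} (\<lambda>s. c * (rho C s * (\<phi> s)\<^sup>2))"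
      by (intro integral_diff integrable_continuous_interval continuous_intros c0 c' rho_cont pot_cont C)
    then have "integral {- S..S} (\<lambda>s. ?A (v2 s t)) = integral {- S..S} (\<lambda>s. rho C s * (\<phi>' s)\<^sup>2 - rho C s * pot C s * (\<phi> s)\<^sup>2)
       - c * integral {- S..S} (\<lambda>s. rho C s * (\<phi> s)\<^sup>2)"
      by (simp add: \<phi>_def \<phi>'_def)
    ultimately show "0 \<le> integral {- S..S} (\<lambda>s. ?A (v2 s t))" by simp
  qed
  moreover have "0 \<le> integral (rect S) ?B"
    by (rule integral_nonneg[OF integrable_rect[OF cB]]) (use rho_pos[OF C] in \<open>simp add: less_imp_le\<close>)
  moreover have "jacobi_form C S F F = integral (rect S) (\<lambda>q. (?A q + ?B q) + c * (rho C (q $ 1) * (F q)\<^sup>2))"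
    unfolding jacobi_form_def by (simp add: power2_eq_square algebra_simps)
  moreover have "\<dots> = (integral (rect S) ?A + integral (rect S) ?B) + integral (rect S) (\<lambda>q. c * (rho C (q $ 1) * (F q)\<^sup>2))"
    using integrable_rect[OF cA] integrable_rect[OF cB] integrable_rect[OF cR]
    by (simp only: integral_add integrable_add)
  moreover have "integral (rect S) (\<lambda>q. c * (rho C (q $ 1) * (F q)\<^sup>2)) = c * integral (rect S) (\<lambda>q. rho C (q $ 1) * (F q)\<^sup>2)"
    by simp
  ultimately show ?thesis by linarith
qed

text \<open>\<open>F\<close> is split into its mean over parallels, a function of s that vanishes at
  0 and is covered by \<open>mode0_nonneg\<close>, and a remainder of mean zero on each parallel.
  For the remainder, Wirtinger's inequality provides the term 1 / rho that
  \<open>mode1_nonneg\<close> asks for.\<close>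

lemma jacobi_form_nonneg_if_mean_zero:
  assumes F: "smooth F" "\<And>q. F (q + v2 0 (2 * pi)) = F q" and z: "\<And>t. F (v2 S t) = 0" "\<And>t. F (v2 (- S) t) = 0"
    and mean: "integral {0..2 * pi} (\<lambda>t. F (v2 0 t)) = 0"
  shows "0 \<le> jacobi_form C S F F"
proof -
  note cF = smoothD(2)[OF F(1)] smoothD(2)[OF smoothD(3)[OF F(1)]]
  define M where "M = (\<lambda>s. integral {0..2 * pi} (\<lambda>t. F (v2 s t)) / (2 * pi))"
  define M1 where "M1 = (\<lambda>s. integral {0..2 * pi} (\<lambda>t. pd 1 F (v2 s t)) / (2 * pi))"
  have M: "(M has_real_derivative M1 s) (at s)" for s
  proof -
    have "((\<lambda>s. integral (cbox 0 (2 * pi)) (\<lambda>t. F (v2 s t))) has_vector_derivative integral (cbox 0 (2 * pi)) (\<lambda>t. pd 1 F (v2 s t))) (at s within UNIV)"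
    proof (rule leibniz_rule_vector_derivative)
      fix s t show "((\<lambda>s. F (v2 s t)) has_vector_derivative pd 1 F (v2 s t)) (at s within UNIV)"
        using slice_DERIV(1)[where s = s and t = t, OF smoothD(1)[OF F(1)]] by (simp add: has_real_derivative_iff_has_vector_derivative)
      show "(\<lambda>t. F (v2 s t)) integrable_on cbox 0 (2 * pi)"
        by (intro integrable_continuous continuous_on_compose2[OF cF(1)[of UNIV]] continuous_intros) auto
      show "continuous_on (UNIV \<times> cbox 0 (2 * pi)) (\<lambda>(s, t). pd 1 F (v2 s t))"
        unfolding case_prod_beta by (intro continuous_on_compose2[OF cF(2)[of UNIV]] continuous_intros) auto
    qed auto
    then have "((\<lambda>s. integral {0..2 * pi} (\<lambda>t. F (v2 s t))) has_real_derivative integral {0..2 * pi} (\<lambda>t. pd 1 F (v2 s t))) (at s)"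
      by (simp add: has_real_derivative_iff_has_vector_derivative)
    then show ?thesis unfolding M_def M1_def by (rule DERIV_cdivide)
  qed
  have cM1: "continuous_on A M1" for A unfolding M1_def by (intro continuous_intros integral_slice_cont cF) simp
  have cM: "continuous_on A M" for A by (rule continuous_on_if_DERIV[OF M])
  have Mz: "M S = 0" "M (- S) = 0" "M 0 = 0" by (simp_all add: M_def z mean)
  define m where "m = (\<lambda>q::real^2. M (q $ 1))"
  define m1 where "m1 = (\<lambda>q::real^2. M1 (q $ 1))"
  have cm: "continuous_on A m" "continuous_on A m1" for A unfolding m_def m1_def by (intro cont_nth_1 cM cM1)+
  let ?r = "\<lambda>q::real^2. rho C (q $ 1)" and ?p = "\<lambda>q::real^2. pot C (q $ 1)"
  \<comment> \<open>In order: the mean part, the remainder with angular energy of frequency one lent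
    to it, the loan covered by Wirtinger's inequality, and the cross terms, which integrate to
    zero.\<close>
  define I1 where "I1 = (\<lambda>q. ?r q * (m1 q)\<^sup>2 - ?r q * ?p q * (m q)\<^sup>2)"
  define I2 where "I2 = (\<lambda>q. ?r q * (pd 1 F q - m1 q)\<^sup>2 - (?r q * ?p q - 1 / ?r q) * (F q - m q)\<^sup>2)"
  define I3 where "I3 = (\<lambda>q. ((pd 2 F q)\<^sup>2 - (F q - m q)\<^sup>2) / ?r q)"
  define I4 where "I4 = (\<lambda>q. 2 * ?r q * m1 q * (pd 1 F q - m1 q) - 2 * ?r q * ?p q * m q * (F q - m q))"
  have c: "continuous_on UNIV I1" "continuous_on UNIV I2" "continuous_on UNIV I3" "continuous_on UNIV I4"
    unfolding I1_def I2_def I3_def I4_def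
    by (intro continuous_intros coeff_cont[OF C] cF cm; simp add: rho_nz[OF C])+
  have slc: "continuous_on A (\<lambda>t. f (v2 s t))" if "continuous_on UNIV f" for A f s and dummy :: "real"
    by (intro continuous_on_compose2[OF that] continuous_intros) auto
  have "0 \<le> integral (rect S) I1"
  proof (rule integral_rect_nonneg_cols[OF c(1) S])
    fix t
    show "0 \<le> integral {- S..S} (\<lambda>s. I1 (v2 s t))"
      using mode0_nonneg[OF C S M cM1 Mz] by (simp add: I1_def m_def m1_def)
  qed
  moreover have "0 \<le> integral (rect S) I2"
  proof (rule integral_rect_nonneg_cols[OF c(2) S])
    fix t
    have "((\<lambda>s. F (v2 s t) - M s) has_real_derivative pd 1 F (v2 s t) - M1 s) (at s)" for s
      by (intro DERIV_diff M slice_DERIV(1) smoothD(1) F)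
    moreover have "continuous_on UNIV (\<lambda>s. pd 1 F (v2 s t) - M1 s)"
      by (intro continuous_intros cM1 continuous_on_compose2[OF cF(2)[of UNIV]]) auto
    ultimately show "0 \<le> integral {- S..S} (\<lambda>s. I2 (v2 s t))"
      using mode1_nonneg[OF C S, of "\<lambda>s. F (v2 s t) - M s" "\<lambda>s. pd 1 F (v2 s t) - M1 s"]
      by (simp add: I2_def m_def m1_def z Mz)
  qed
  moreover have "0 \<le> integral (rect S) I3"
  proof (rule integral_rect_nonneg_rows[OF c(3) S])
    fix s
    let ?h = "\<lambda>t. F (v2 s t) - M s" and ?h' = "\<lambda>t. pd 2 F (v2 s t)"
    have "integral {0..2 * pi} (\<lambda>t. (?h t)\<^sup>2) \<le> integral {0..2 * pi} (\<lambda>t. (?h' t)\<^sup>2)"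
    proof (rule wirtinger)
      show "(?h has_real_derivative ?h' t) (at t)" for t
        using DERIV_diff[OF slice_DERIV(2)[where s = s and t = t, OF smoothD(1)[OF F(1)]] DERIV_const[of "M s"]] by simp
      show "continuous_on UNIV ?h'" by (rule slc[OF cF(2)])
      show "?h (t + 2 * pi) = ?h t" "?h' (t + 2 * pi) = ?h' t" for t
        by (simp only: periodic_v2[of F, OF F(2)], rule periodic_v2[of "pd 2 F", OF pd_periodic[of F, OF F(2)]])
      have "integral {0..2 * pi} ?h = integral {0..2 * pi} (\<lambda>t. F (v2 s t)) - integral {0..2 * pi} (\<lambda>t. M s)"
        by (intro integral_diff integrable_continuous_interval slc cF continuous_on_const)
      then show "integral {0..2 * pi} ?h = 0" by (simp add: M_def)
    qed
    then have "0 \<le> (integral {0..2 * pi} (\<lambda>t. (?h' t)\<^sup>2) - integral {0..2 * pi} (\<lambda>t. (?h t)\<^sup>2)) / rho C s"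
      using rho_pos[OF C, of s] by simp
    also have "\<dots> = integral {0..2 * pi} (\<lambda>t. ((?h' t)\<^sup>2 - (?h t)\<^sup>2) / rho C s)"
      by (subst integral_divide, subst integral_diff)
         (auto intro!: integrable_continuous_interval continuous_intros slc cF)
    finally show "0 \<le> integral {0..2 * pi} (\<lambda>t. I3 (v2 s t))" by (simp add: I3_def m_def)
  qed
  moreover have "integral (rect S) I4 = 0"
  proof -
    have "integral {0..2 * pi} (\<lambda>t. I4 (v2 s t)) = 0" for s
    proof -
      have *: "integral {0..2 * pi} (\<lambda>t. f (v2 s t) - integral {0..2 * pi} (\<lambda>t. f (v2 s t)) / (2 * pi)) = 0"
        if "continuous_on UNIV f" for f :: "real^2 \<Rightarrow> real"
      proof -
        have "integral {0..2 * pi} (\<lambda>t. f (v2 s t) - k) = integral {0..2 * pi} (\<lambda>t. f (v2 s t)) - integral {0..2 * pi} (\<lambda>t. k)" for k :: real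
          by (intro integral_diff integrable_continuous_interval slc that continuous_on_const)
        then show ?thesis by simp
      qed
      have "integral {0..2 * pi} (\<lambda>t. I4 (v2 s t)) = integral {0..2 * pi} (\<lambda>t. 2 * rho C s * M1 s * (pd 1 F (v2 s t) - M1 s))
          - integral {0..2 * pi} (\<lambda>t. 2 * rho C s * pot C s * M s * (F (v2 s t) - M s))"
        unfolding I4_def m_def m1_def by (subst integral_diff[symmetric])
          (auto intro!: integrable_continuous_interval continuous_intros slc cF)
      also have "\<dots> = 0"
      proof -
        have "continuous_on UNIV (pd 1 F)" "continuous_on UNIV F" by (rule cF)+
        from this[THEN *] show ?thesis unfolding integral_mult_right by (simp add: M1_def M_def)
      qed
      finally show ?thesis .
    qed
    then show ?thesis by (simp add: integral_rect_cont[OF c(4) S])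
  qed
  moreover have "jacobi_form C S F F = integral (rect S) (\<lambda>q. (I1 q + I2 q) + (I3 q + I4 q))"
  proof -
    have e: "?r q * (pd 1 F q * pd 1 F q) + pd 2 F q * pd 2 F q / ?r q - ?r q * ?p q * (F q * F q) = (I1 q + I2 q) + (I3 q + I4 q)" for q
      unfolding I1_def I2_def I3_def I4_def divide_inverse by algebra
    show ?thesis unfolding jacobi_form_def e ..
  qed
  then have "jacobi_form C S F F = (integral (rect S) I1 + integral (rect S) I2) + (integral (rect S) I3 + integral (rect S) I4)"
    using c[THEN integrable_rect] by (simp add: integral_add integrable_add)
  ultimately show ?thesis by linarith
qed

end

section \<open>Subdomains and stability\<close>

context
  fixes a :: real
  assumes a: "a > 0"
begin

abbreviation (input) "Sig \<equiv> cat_param a ` cat_strip"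
abbreviation (input) "CC \<equiv> cC a"

section \<open>Annuli and exhaustions\<close>

lemma X_periodic: "cat_param a (q + v2 0 (2 * pi)) = cat_param a q"
  by (simp add: cat_param_def)

lemma X_reduce: "\<exists>q'. q' $ 1 = q $ 1 \<and> 0 \<le> q' $ 2 \<and> q' $ 2 \<le> 2 * pi \<and> cat_param a q' = cat_param a q"
proof -
  define n where "n = \<lfloor>q $ 2 / (2 * pi)\<rfloor>"
  define t where "t = q $ 2 - of_int n * (2 * pi)"
  have "of_int n \<le> q $ 2 / (2 * pi)" "q $ 2 / (2 * pi) < of_int n + 1" unfolding n_def by linarith+
  then have t: "0 \<le> t" "t \<le> 2 * pi" by (simp_all add: t_def field_simps)
  have "q $ 2 = t + of_int n * (2 * pi)" by (simp add: t_def)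
  then have "cos (q $ 2) = cos t" "sin (q $ 2) = sin t"
    using cos.plus_of_int[of t n] sin.plus_of_int[of t n] by (simp_all add: mult.commute)
  then show ?thesis using t by (intro exI[of _ "v2 (q $ 1) t"]) (simp add: cat_param_def)
qed

lemma Sig_eq: "Sig = range (cat_param a)"
proof (intro equalityI subsetI)
  fix p assume "p \<in> range (cat_param a)"
  then obtain q where "p = cat_param a q" by blast
  moreover obtain q' where "0 \<le> q' $ 2" "q' $ 2 \<le> 2 * pi" "cat_param a q' = cat_param a q" using X_reduce[of q] by blast
  ultimately show "p \<in> Sig" by (intro image_eqI[of _ _ q']) (simp_all add: cat_strip_def)
qed auto

lemma X_in_Sig: "cat_param a q \<in> Sig" by (simp add: Sig_eq)

lemma X_cont: "continuous_on A (cat_param a)"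
  using smooth_X[OF a] smooth_on_continuous[of UNIV "cat_param a"] continuous_on_subset[of UNIV "cat_param a" A]
  by (simp add: smooth_on_UNIV)

lemma X_image_rect: "q \<in> {q. \<bar>q $ 1\<bar> \<le> S} \<Longrightarrow> cat_param a q \<in> cat_param a ` rect S"
proof -
  assume q: "q \<in> {q. \<bar>q $ 1\<bar> \<le> S}"
  obtain q' where "q' $ 1 = q $ 1" "0 \<le> q' $ 2" "q' $ 2 \<le> 2 * pi" "cat_param a q' = cat_param a q" using X_reduce[of q] by blast
  then show ?thesis using q by (intro image_eqI[of _ _ q']) (simp_all add: mem_rect)
qed

lemma rho_sq_less_iff: "(rho CC s)\<^sup>2 < (rho CC S)\<^sup>2 \<longleftrightarrow> \<bar>s\<bar> < \<bar>S\<bar>"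
proof -
  have "(rho CC s)\<^sup>2 < (rho CC S)\<^sup>2 \<longleftrightarrow> cosh (2 * \<bar>s\<bar>) < cosh (2 * \<bar>S\<bar>)"
  proof -
    have "cosh (2 * \<bar>x\<bar>) = cosh (2 * x)" for x :: real by (cases "x \<ge> 0") simp_all
    then show ?thesis using cC_gt_1[OF a] by (simp add: rho_sq[OF cC_gt_1[OF a]] divide_less_cancel)
  qed
  also have "\<dots> \<longleftrightarrow> \<bar>s\<bar> < \<bar>S\<bar>" by (subst cosh_real_nonneg_less_iff) auto
  finally show ?thesis .
qed

text \<open>Squared hyperbolic sine of the distance to the axis, in ball coordinates. On the surface
  it is an increasing function of |s|, so it serves as a continuous exhaustion function without an
  inverse of the parametrization.\<close>

definition "rot_radius_sq p = 4 * ((p $ 2)\<^sup>2 + (p $ 3)\<^sup>2) / (1 - (norm p)\<^sup>2)\<^sup>2" for p :: "real^3"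

lemma rot_radius_sq_X: "rot_radius_sq (cat_param a q) = (rho CC (q $ 1))\<^sup>2"
proof -
  have "(cat_param a q $ 2)\<^sup>2 + (cat_param a q $ 3)\<^sup>2 = (cat_v a (q $ 1))\<^sup>2 * ((cos (q $ 2))\<^sup>2 + (sin (q $ 2))\<^sup>2)"
    unfolding cat_param_def vector_3 power_mult_distrib distrib_left ..
  then show ?thesis
    unfolding rot_radius_sq_def norm_X_sq[OF a] using inv_denom_pos[OF a, of "q $ 1"]
    by (simp add: v_eq[OF a] power_mult_distrib)
qed

lemma rot_radius_sq_cont: "continuous_on Sig rot_radius_sq"
proof -
  have "(1 - (norm p)\<^sup>2)\<^sup>2 \<noteq> 0" if "p \<in> Sig" for p
    using that norm_less_1_sq[of p] norm_X[OF a] by auto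
  then show ?thesis unfolding rot_radius_sq_def[abs_def] by (intro continuous_intros) auto
qed

text \<open>The radius determines s up to sign, which suffices for everything symmetric under
  reflection in the neck.\<close>

lemma X_eq_imp_abs_eq: "cat_param a q = cat_param a q' \<Longrightarrow> \<bar>q $ 1\<bar> = \<bar>q' $ 1\<bar>"
  using rot_radius_sq_X[of q] rot_radius_sq_X[of q'] rho_sq_less_iff[of "q $ 1" "q' $ 1"] rho_sq_less_iff[of "q' $ 1" "q $ 1"]
  by (metis linorder_neqE_linordered_idom order_less_irrefl)

lemma openin_lt: "openin (top_of_set Sig) {p \<in> Sig. rot_radius_sq p < c}"
proof -
  have "openin (top_of_set Sig) (Sig \<inter> rot_radius_sq -` {..<c})"
    by (rule continuous_openin_preimage_gen[OF rot_radius_sq_cont]) auto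
  moreover have "Sig \<inter> rot_radius_sq -` {..<c} = {p \<in> Sig. rot_radius_sq p < c}" by auto
  ultimately show ?thesis by simp
qed

lemma annulus_interior:
  assumes "\<bar>q $ 1\<bar> < S"
  shows "cat_param a q \<in> top_of_set Sig interior_of (cat_param a ` rect S)"
proof -
  have "{p \<in> Sig. rot_radius_sq p < (rho CC S)\<^sup>2} \<subseteq> cat_param a ` rect S"
  proof
    fix p assume "p \<in> {p \<in> Sig. rot_radius_sq p < (rho CC S)\<^sup>2}"
    then obtain q where q: "p = cat_param a q" "rot_radius_sq p < (rho CC S)\<^sup>2" by auto
    then have "\<bar>q $ 1\<bar> < \<bar>S\<bar>" by (simp add: rot_radius_sq_X rho_sq_less_iff)
    then have "\<bar>q $ 1\<bar> \<le> S" using assms by linarith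
    then show "p \<in> cat_param a ` rect S" using X_image_rect q(1) by simp
  qed
  then have "{p \<in> Sig. rot_radius_sq p < (rho CC S)\<^sup>2} \<subseteq> top_of_set Sig interior_of (cat_param a ` rect S)"
    by (rule interior_of_maximal) (rule openin_lt)
  moreover have "cat_param a q \<in> {p \<in> Sig. rot_radius_sq p < (rho CC S)\<^sup>2}"
    using assms X_in_Sig by (simp add: rot_radius_sq_X rho_sq_less_iff)
  ultimately show ?thesis by blast
qed

lemma annulus_subdomain:
  assumes S: "S > 0"
  shows "compact_subdomain Sig (cat_param a ` rect S)"
  unfolding compact_subdomain_def
proof (intro conjI)
  show "cat_param a ` rect S \<subseteq> Sig" by (auto simp: Sig_eq)
  show "compact (cat_param a ` rect S)"
    by (intro compact_continuous_image X_cont) (simp add: rect_def)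
  show "connected (cat_param a ` rect S)"
    by (intro connected_continuous_image X_cont) (simp add: rect_def convex_connected)
  have "v2 0 0 \<in> rect S" using S by (simp add: mem_rect)
  then show "cat_param a ` rect S \<noteq> {}" by blast
  show "cat_param a ` rect S \<subseteq> closure (top_of_set Sig interior_of (cat_param a ` rect S))"
  proof
    fix p assume "p \<in> cat_param a ` rect S"
    then obtain q where q: "p = cat_param a q" "\<bar>q $ 1\<bar> \<le> S" by (auto simp: mem_rect)
    \<comment> \<open>Parameters shrunk towards the origin have arc length strictly below
      \<open>S\<close> in modulus, so every point is a limit of interior points.\<close>
    define r where "r = (\<lambda>n. (1 - 1 / real (Suc n)) *\<^sub>R q)"
    have "(\<lambda>n. 1 / real (Suc n)) \<longlonglongrightarrow> 0" using LIMSEQ_inverse_real_of_nat by (simp add: inverse_eq_divide)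
    then have "r \<longlonglongrightarrow> (1 - 0) *\<^sub>R q" unfolding r_def by (intro tendsto_intros)
    then have "r \<longlonglongrightarrow> q" by simp
    moreover have "isCont (cat_param a) q" using X_cont[of UNIV] by (simp add: continuous_on_eq_continuous_at)
    ultimately have l: "(\<lambda>n. cat_param a (r n)) \<longlonglongrightarrow> p" unfolding q(1) by (rule isCont_tendsto_compose[rotated])
    have "cat_param a (r n) \<in> top_of_set Sig interior_of (cat_param a ` rect S)" for n
    proof (rule annulus_interior)
      have k: "0 \<le> 1 - 1 / real (Suc n)" "1 - 1 / real (Suc n) < 1" by simp_all
      have "\<bar>r n $ 1\<bar> = (1 - 1 / real (Suc n)) * \<bar>q $ 1\<bar>" unfolding r_def vector_scaleR_component real_scaleR_def abs_mult using k(1) by simp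
      also have "\<dots> \<le> (1 - 1 / real (Suc n)) * S" using q(2) k(1) by (rule mult_left_mono)
      also have "\<dots> < 1 * S" using k(2) S by (rule mult_strict_right_mono)
      finally show "\<bar>r n $ 1\<bar> < S" by simp
    qed
    then show "p \<in> closure (top_of_set Sig interior_of (cat_param a ` rect S))"
      unfolding closure_sequential by (intro exI[of _ "\<lambda>n. cat_param a (r n)"] conjI allI l)
  qed
qed

lemma annulus_exhaustion: "exhaustion Sig (\<lambda>n. cat_param a ` rect (real n + 1))"
  unfolding exhaustion_def
proof (intro conjI allI)
  fix n
  show "compact_subdomain Sig (cat_param a ` rect (real n + 1))" by (rule annulus_subdomain) simp
  show "cat_param a ` rect (real n + 1) \<subseteq> top_of_set Sig interior_of (cat_param a ` rect (real (Suc n) + 1))"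
    using annulus_interior by (auto simp: mem_rect)
  show "(\<Union>n. cat_param a ` rect (real n + 1)) = Sig"
  proof (intro equalityI subsetI)
    fix p assume "p \<in> Sig"
    then obtain q where q: "p = cat_param a q" by blast
    obtain n where "\<bar>q $ 1\<bar> \<le> real n" using real_arch_simple by blast
    then have "p \<in> cat_param a ` rect (real n + 1)" unfolding q by (intro X_image_rect) simp
    then show "p \<in> (\<Union>n. cat_param a ` rect (real n + 1))" by blast
  qed (auto simp: Sig_eq)
qed

lemma compact_openin_subcover:
  assumes "compact K" "K \<subseteq> T" "\<forall>U\<in>A. openin (top_of_set T) U" "K \<subseteq> \<Union>A"
  shows "\<exists>F. finite F \<and> F \<subseteq> A \<and> K \<subseteq> \<Union>F"
proof -
  have "compactin (top_of_set T) K" using assms(1,2) by (simp add: compactin_subtopology)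
  then show ?thesis using assms(3,4) unfolding compactin_def by blast
qed

text \<open>The sublevel sets of \<open>rot_radius_sq\<close> form an open cover of the surface, and
  finitely many of them contain a compact set.\<close>

lemma compact_bounded_arc_length:
  assumes "compact \<Omega>" "\<Omega> \<subseteq> Sig"
  shows "\<exists>S>0. \<forall>q. cat_param a q \<in> \<Omega> \<longrightarrow> \<bar>q $ 1\<bar> < S"
proof -
  define D where "D = (\<lambda>n::nat. {p \<in> Sig. rot_radius_sq p < (rho CC (real n))\<^sup>2})"
  have 1: "\<forall>U\<in>range D. openin (top_of_set Sig) U" unfolding D_def using openin_lt by blast
  have 2: "\<Omega> \<subseteq> \<Union>(range D)"
  proof
    fix p assume "p \<in> \<Omega>"
    then obtain q where q: "p = cat_param a q" "p \<in> Sig" using assms(2) by blast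
    obtain n where "\<bar>q $ 1\<bar> < real n" using reals_Archimedean2 by blast
    then have "p \<in> D n" using q by (simp add: D_def rot_radius_sq_X rho_sq_less_iff)
    then show "p \<in> \<Union>(range D)" by blast
  qed
  obtain F where F: "finite F" "F \<subseteq> range D" "\<Omega> \<subseteq> \<Union>F"
    using compact_openin_subcover[OF assms 1 2] by blast
  obtain N where N: "finite N" "F = D ` N" using finite_subset_image[OF F(1,2)] by blast
  define S where "S = real (Max (insert 0 N)) + 1"
  have "\<bar>q $ 1\<bar> < S" if inO: "cat_param a q \<in> \<Omega>" for q
  proof -
    obtain n where n: "n \<in> N" "cat_param a q \<in> D n" using F(3) N(2) inO by blast
    then have "\<bar>q $ 1\<bar> < real n" by (simp add: D_def rot_radius_sq_X rho_sq_less_iff)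
    moreover have "n \<le> Max (insert 0 N)" using n(1) N(1) by simp
    ultimately show ?thesis unfolding S_def by linarith
  qed
  moreover have "S > 0" by (simp add: S_def)
  ultimately show ?thesis by blast
qed

text \<open>The relative interiors of the members cover the surface; this is where the nesting into
  interiors enters.\<close>

lemma compact_in_exhaustion:
  assumes "exhaustion Sig \<Omega>" "compact K" "K \<subseteq> Sig"
  shows "\<exists>n. \<forall>m\<ge>n. K \<subseteq> \<Omega> m"
proof -
  have ex1: "\<Omega> n \<subseteq> top_of_set Sig interior_of \<Omega> (Suc n)" for n
    using assms(1) unfolding exhaustion_def by simp
  have ex2: "(\<Union>n. \<Omega> n) = Sig" using assms(1) unfolding exhaustion_def by simp
  have st: "\<Omega> n \<subseteq> \<Omega> (Suc n)" for n
    by (rule subset_trans[OF ex1 interior_of_subset])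
  have mono: "\<Omega> n \<subseteq> \<Omega> m" if "n \<le> m" for n m using that by (rule lift_Suc_mono_le[of \<Omega>, OF st])
  define J where "J = (\<lambda>n. top_of_set Sig interior_of \<Omega> n)"
  have 1: "\<forall>U\<in>range J. openin (top_of_set Sig) U" unfolding J_def by auto
  have 2: "K \<subseteq> \<Union>(range J)"
  proof
    fix p assume "p \<in> K"
    then have "p \<in> (\<Union>n. \<Omega> n)" unfolding ex2 using assms(3) by blast
    then obtain n where "p \<in> \<Omega> n" by blast
    then have "p \<in> J (Suc n)" unfolding J_def using ex1 by blast
    then show "p \<in> \<Union>(range J)" by blast
  qed
  obtain F where F: "finite F" "F \<subseteq> range J" "K \<subseteq> \<Union>F"
    using compact_openin_subcover[OF assms(2,3) 1 2] by blast
  obtain N where N: "finite N" "F = J ` N" using finite_subset_image[OF F(1,2)] by blast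
  have J: "J n \<subseteq> \<Omega> n" for n unfolding J_def by (rule interior_of_subset)
  have "K \<subseteq> \<Omega> m" if m: "m \<ge> Max (insert 0 N)" for m
  proof
    fix p assume "p \<in> K"
    then obtain n where n: "n \<in> N" "p \<in> \<Omega> n" using F(3) N(2) J by blast
    then have "n \<le> m" using m N(1) by (meson Max_ge finite_insert insertI2 order_trans)
    then show "p \<in> \<Omega> m" using mono n(2) by blast
  qed
  then show ?thesis by blast
qed

text \<open>Once \<open>lambda1\<close> decreases under inclusion, its limit along an exhaustion is
  the infimum over all compact subdomains, because each of these is eventually contained in the
  members. This makes the limit independent of the exhaustion.\<close>

lemma has_lambda1I:
  assumes mono: "\<And>\<Omega> \<Omega>'. compact_subdomain Sig \<Omega> \<Longrightarrow> compact_subdomain Sig \<Omega>' \<Longrightarrow> \<Omega> \<subseteq> \<Omega>'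
     \<Longrightarrow> lambda1 hyp_metric (cat_param a) cat_strip \<Omega>' \<le> lambda1 hyp_metric (cat_param a) cat_strip \<Omega>"
  shows "has_lambda1 hyp_metric (cat_param a) cat_strip
     (INF \<Omega>\<in>{\<Omega>. compact_subdomain Sig \<Omega>}. lambda1 hyp_metric (cat_param a) cat_strip \<Omega>)"
  unfolding has_lambda1_def
proof (intro conjI allI impI)
  show "\<exists>\<Omega>. exhaustion Sig \<Omega>" using annulus_exhaustion by blast
  fix \<Omega> assume ex: "exhaustion Sig \<Omega>"
  let ?l = "lambda1 hyp_metric (cat_param a) cat_strip"
  let ?L = "INF \<Omega>\<in>{\<Omega>. compact_subdomain Sig \<Omega>}. ?l \<Omega>"
  have cs: "compact_subdomain Sig (\<Omega> n)" for n using ex unfolding exhaustion_def by simp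
  show "(\<lambda>n. ?l (\<Omega> n)) \<longlonglongrightarrow> ?L"
  proof (rule order_tendstoI)
    fix x assume "x < ?L"
    moreover have "?L \<le> ?l (\<Omega> n)" for n by (rule INF_lower) (simp add: cs)
    ultimately show "eventually (\<lambda>n. x < ?l (\<Omega> n)) sequentially" by (simp add: less_le_trans)
  next
    fix x assume "?L < x"
    then obtain K where K: "compact_subdomain Sig K" "?l K < x" unfolding INF_less_iff by blast
    then obtain n where "\<forall>m\<ge>n. K \<subseteq> \<Omega> m"
      using compact_in_exhaustion[OF ex, of K] unfolding compact_subdomain_def by blast
    then have "\<forall>m\<ge>n. ?l (\<Omega> m) < x" using mono[OF K(1) cs] K(2) le_less_trans by blast
    then show "eventually (\<lambda>n. ?l (\<Omega> n) < x) sequentially" unfolding eventually_sequentially by blast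
  qed
qed

text \<open>As \<open>\<phi>\<close> vanishes off \<Omega>, a possibly irregular set of integration
  can be replaced by a rectangle, on which the Lebesgue and gauge integrals of a continuous function
  agree.\<close>

lemma surface_integral_eq:
  assumes c: "continuous_on UNIV \<phi>" and z: "\<And>q. cat_param a q \<notin> \<Omega> \<Longrightarrow> \<phi> q = 0"
    and S: "\<And>q. cat_param a q \<in> \<Omega> \<Longrightarrow> \<bar>q $ 1\<bar> \<le> S"
  shows "surface_integral hyp_metric (cat_param a) cat_strip \<Omega> \<phi> = integral (rect S) (\<lambda>q. \<phi> q * rho CC (q $ 1))"
proof -
  let ?f = "\<lambda>q. \<phi> q * rho CC (q $ 1)"
  have cf: "continuous_on A ?f" for A
    by (intro continuous_intros coeff_cont cC_gt_1 a continuous_on_subset[OF c]) auto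
  have e: "(\<lambda>q. indicator {q \<in> cat_strip. cat_param a q \<in> \<Omega>} q *\<^sub>R ?f q) = (\<lambda>q. indicator (rect S) q *\<^sub>R ?f q)"
  proof
    fix q show "indicator {q \<in> cat_strip. cat_param a q \<in> \<Omega>} q *\<^sub>R ?f q = indicator (rect S) q *\<^sub>R ?f q"
      using z[of q] S[of q] by (auto simp: indicator_def mem_rect cat_strip_def)
  qed
  have "surface_integral hyp_metric (cat_param a) cat_strip \<Omega> \<phi> = (LINT q:rect S|lborel. ?f q)"
    unfolding surface_integral_def area_density_X[OF a] set_lebesgue_integral_def e ..
  also have "\<dots> = integral (rect S) ?f"
  proof (rule set_borel_integral_eq_integral(2))
    show "set_integrable lborel (rect S) ?f"
      unfolding set_integrable_def by (rule borel_integrable_compact[OF _ cf]) (simp add: rect_def)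
  qed
  finally show ?thesis .
qed

section \<open>Test functions and the first eigenvalue\<close>

lemma jacobi_op_jacobi_strip: "jacobi_op hyp_metric (cat_param a) \<phi> q = jacobi_strip CC \<phi> q"
  by (simp add: jacobi_op_X[OF a] jacobi_strip_def)

lemma jacobi_strip_cont: "smooth G \<Longrightarrow> continuous_on A (jacobi_strip CC G)"
proof -
  note C = cC_gt_1[OF a]
  assume G: "smooth G"
  have "smooth (\<lambda>r. rho CC (r $ 1) * pd 1 G r)" by (intro smooth_mult smooth_rho[OF C] smoothD(3) G)
  moreover have "smooth (\<lambda>r. pd 2 G r * (1 / rho CC (r $ 1)))" by (intro smooth_mult smooth_inv_rho[OF C] smoothD(3) G)
  ultimately show ?thesis
    unfolding jacobi_strip_def[abs_def]
    by (intro continuous_intros coeff_cont[OF C] smoothD(2)[OF G] smoothD(2)[OF smoothD(3)]) (simp_all add: rho_nz[OF C])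
qed

text \<open>All data of a test function are carried to one rectangle that contains \<Omega> strictly
  between its ends, so the pulled back function vanishes there and integration by parts
  applies.\<close>

lemma test_function_props:
  assumes f: "f \<in> test_functions (cat_param a) cat_strip \<Omega>"
    and S: "\<And>q. cat_param a q \<in> \<Omega> \<Longrightarrow> \<bar>q $ 1\<bar> < S"
  defines "F \<equiv> \<lambda>q. f (cat_param a q)"
  shows "smooth F" "F (q + v2 0 (2 * pi)) = F q" "F (v2 S t) = 0" "F (v2 (- S) t) = 0"
    "surface_integral hyp_metric (cat_param a) cat_strip \<Omega> (\<lambda>q. (f (cat_param a q))\<^sup>2) = integral (rect S) (\<lambda>q. rho CC (q $ 1) * (F q)\<^sup>2)"
    "- surface_integral hyp_metric (cat_param a) cat_strip \<Omega> (\<lambda>q. f (cat_param a q) * jacobi_op hyp_metric (cat_param a) (f \<circ> cat_param a) q) = jacobi_form CC S F F"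
proof -
  have sm: "smooth (f \<circ> cat_param a)" using f by (simp add: test_functions_def)
  then show s: "smooth F" by (simp add: F_def comp_def)
  have cl: "closure {p \<in> Sig. f p \<noteq> 0} \<subseteq> top_of_set Sig interior_of \<Omega>"
    using f by (simp add: test_functions_def)
  have zero: "F q = 0" if "cat_param a q \<notin> \<Omega>" for q
  proof (rule ccontr)
    assume "F q \<noteq> 0"
    then have "cat_param a q \<in> {p \<in> Sig. f p \<noteq> 0}" using X_in_Sig by (simp add: F_def)
    then have "cat_param a q \<in> closure {p \<in> Sig. f p \<noteq> 0}" by (rule closure_subset[THEN subsetD])
    then have "cat_param a q \<in> top_of_set Sig interior_of \<Omega>" by (rule subsetD[OF cl])
    then have "cat_param a q \<in> \<Omega>" by (rule interior_of_subset[THEN subsetD])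
    then show False using that by simp
  qed
  have z: "F (v2 s t) = 0" if "\<bar>s\<bar> \<ge> S" for s t
    using S[of "v2 s t"] that by (intro zero) auto
  show per: "F (q + v2 0 (2 * pi)) = F q" for q by (simp add: F_def X_periodic)
  show zS: "F (v2 S t) = 0" "F (v2 (- S) t) = 0" for t by (rule z, simp)+
  have S': "\<And>q. cat_param a q \<in> \<Omega> \<Longrightarrow> \<bar>q $ 1\<bar> \<le> S" using S by (simp add: less_imp_le)
  have cF: "continuous_on A F" for A by (rule smoothD(2)[OF s])
  have "surface_integral hyp_metric (cat_param a) cat_strip \<Omega> (\<lambda>q. (F q)\<^sup>2) = integral (rect S) (\<lambda>q. (F q)\<^sup>2 * rho CC (q $ 1))"
    by (rule surface_integral_eq) (use zero S' in \<open>auto intro!: continuous_intros cF\<close>)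
  then show "surface_integral hyp_metric (cat_param a) cat_strip \<Omega> (\<lambda>q. (f (cat_param a q))\<^sup>2) = integral (rect S) (\<lambda>q. rho CC (q $ 1) * (F q)\<^sup>2)"
    by (simp add: F_def mult.commute)
  show "- surface_integral hyp_metric (cat_param a) cat_strip \<Omega> (\<lambda>q. f (cat_param a q) * jacobi_op hyp_metric (cat_param a) (f \<circ> cat_param a) q) = jacobi_form CC S F F"
  proof (cases "0 \<le> S")
    case True
    have e: "f \<circ> cat_param a = F" by (auto simp: F_def)
    have "surface_integral hyp_metric (cat_param a) cat_strip \<Omega> (\<lambda>q. F q * jacobi_strip CC F q) = integral (rect S) (\<lambda>q. F q * jacobi_strip CC F q * rho CC (q $ 1))"
      by (rule surface_integral_eq) (use zero S' in \<open>auto intro!: continuous_intros cF jacobi_strip_cont s\<close>)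
    also have "\<dots> = - jacobi_form CC S F F"
      by (rule integration_by_parts[OF cC_gt_1[OF a] True s per s per zS])
    finally show ?thesis unfolding e jacobi_op_jacobi_strip unfolding F_def by simp
  next
    \<comment> \<open>For negative \<open>S\<close> no parameter is mapped into \<Omega>, and both
      sides are 0.\<close>
    case False
    then have "rect S = {}" by (auto simp: mem_rect)
    moreover have "F q = 0" for q using zero[of q] S[of q] False by force
    then have "f (cat_param a q) = 0" for q by (simp add: F_def)
    ultimately show ?thesis by (simp add: surface_integral_def jacobi_form_def set_lebesgue_integral_def)
  qed
qed

text \<open>A test function of the smaller set is one of the larger set. Computed on a common
  rectangle, its norm and energy do not depend on the set it is attached to.\<close>

lemma lambda1_mono:
  assumes "compact_subdomain Sig \<Omega>" "compact_subdomain Sig \<Omega>'" "\<Omega> \<subseteq> \<Omega>'"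
  shows "lambda1 hyp_metric (cat_param a) cat_strip \<Omega>' \<le> lambda1 hyp_metric (cat_param a) cat_strip \<Omega>"
proof -
  obtain S where S: "\<And>q. cat_param a q \<in> \<Omega>' \<Longrightarrow> \<bar>q $ 1\<bar> < S"
    using compact_bounded_arc_length[of \<Omega>'] assms(2) unfolding compact_subdomain_def by blast
  then have S0: "\<And>q. cat_param a q \<in> \<Omega> \<Longrightarrow> \<bar>q $ 1\<bar> < S" using assms(3) by blast
  have t: "f \<in> test_functions (cat_param a) cat_strip \<Omega>'" if "f \<in> test_functions (cat_param a) cat_strip \<Omega>" for f
    using that subset_trans[OF _ interior_of_mono[OF assms(3), of "top_of_set Sig"]] by (simp add: test_functions_def)
  show ?thesis
    unfolding lambda1_def
  proof (rule INF_superset_mono)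
    show "{f \<in> test_functions (cat_param a) cat_strip \<Omega>. surface_integral hyp_metric (cat_param a) cat_strip \<Omega> (\<lambda>q. (f (cat_param a q))\<^sup>2) = 1}
       \<subseteq> {f \<in> test_functions (cat_param a) cat_strip \<Omega>'. surface_integral hyp_metric (cat_param a) cat_strip \<Omega>' (\<lambda>q. (f (cat_param a q))\<^sup>2) = 1}"
      using t test_function_props(5)[OF _ S0] test_function_props(5)[OF _ S] by auto
  next
    fix f assume "f \<in> {f \<in> test_functions (cat_param a) cat_strip \<Omega>. surface_integral hyp_metric (cat_param a) cat_strip \<Omega> (\<lambda>q. (f (cat_param a q))\<^sup>2) = 1}"
    then have f: "f \<in> test_functions (cat_param a) cat_strip \<Omega>" by simp
    show "ereal (- surface_integral hyp_metric (cat_param a) cat_strip \<Omega>' (\<lambda>q. f (cat_param a q) * jacobi_op hyp_metric (cat_param a) (f \<circ> cat_param a) q))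
      \<le> ereal (- surface_integral hyp_metric (cat_param a) cat_strip \<Omega> (\<lambda>q. f (cat_param a q) * jacobi_op hyp_metric (cat_param a) (f \<circ> cat_param a) q))"
      using test_function_props(6)[OF f S0] test_function_props(6)[OF t[OF f] S] by simp
  qed
qed

lemma lambda1_ge_gap:
  assumes "compact_subdomain Sig \<Omega>" and S: "0 < S" "\<And>q. cat_param a q \<in> \<Omega> \<Longrightarrow> \<bar>q $ 1\<bar> < S"
    and radial_spectral_gap: "\<And>\<phi> \<phi>'. (\<And>s. (\<phi> has_real_derivative \<phi>' s) (at s)) \<Longrightarrow> continuous_on UNIV \<phi>' \<Longrightarrow> \<phi> S = 0 \<Longrightarrow> \<phi> (- S) = 0
      \<Longrightarrow> c * integral {- S..S} (\<lambda>s. rho CC s * (\<phi> s)\<^sup>2)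
       \<le> integral {- S..S} (\<lambda>s. rho CC s * (\<phi>' s)\<^sup>2 - rho CC s * pot CC s * (\<phi> s)\<^sup>2)"
  shows "ereal c \<le> lambda1 hyp_metric (cat_param a) cat_strip \<Omega>"
  unfolding lambda1_def
proof (rule INF_greatest)
  fix f assume "f \<in> {f \<in> test_functions (cat_param a) cat_strip \<Omega>. surface_integral hyp_metric (cat_param a) cat_strip \<Omega> (\<lambda>q. (f (cat_param a q))\<^sup>2) = 1}"
  then have f: "f \<in> test_functions (cat_param a) cat_strip \<Omega>" and n: "surface_integral hyp_metric (cat_param a) cat_strip \<Omega> (\<lambda>q. (f (cat_param a q))\<^sup>2) = 1" by auto
  note p = test_function_props[OF f S(2)]
  have "c * integral (rect S) (\<lambda>q. rho CC (q $ 1) * (f (cat_param a q))\<^sup>2) \<le> jacobi_form CC S (\<lambda>q. f (cat_param a q)) (\<lambda>q. f (cat_param a q))"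
    by (rule jacobi_form_ge_gap[OF cC_gt_1[OF a] _ p(1) p(3) p(4) radial_spectral_gap]) (use S(1) in auto)
  then have "c \<le> jacobi_form CC S (\<lambda>q. f (cat_param a q)) (\<lambda>q. f (cat_param a q))" using n p(5) by simp
  then show "ereal c \<le> ereal (- surface_integral hyp_metric (cat_param a) cat_strip \<Omega> (\<lambda>q. f (cat_param a q) * jacobi_op hyp_metric (cat_param a) (f \<circ> cat_param a) q))"
    using p(6) by simp
qed

text \<open>The mass bound depends on \<open>S\<close> here, so each compact subdomain has its own
  positive gap, and the infimum is only shown to be nonnegative.\<close>

lemma catenoid_stable_on_compactsI:
  assumes st: "crit_int CC 1 \<le> rho CC 0 / CC"
  shows "catenoid_stable_on_compacts a"
proof -
  note C = cC_gt_1[OF a]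
  have pos: "0 < lambda1 hyp_metric (cat_param a) cat_strip \<Omega>" if O: "compact_subdomain Sig \<Omega>" for \<Omega>
  proof -
    obtain S where S: "S > 0" "\<And>q. cat_param a q \<in> \<Omega> \<Longrightarrow> \<bar>q $ 1\<bar> < S"
      using compact_bounded_arc_length[of \<Omega>] O unfolding compact_subdomain_def by blast
    obtain B where B: "B > 0" "\<And>s. s \<in> {- S..S} \<Longrightarrow> \<bar>even_jacobi_mass CC s\<bar> \<le> B * (rho CC s * (even_jacobi CC s)\<^sup>2)"
      using mass_bound_compact[OF C st, of S] by auto
    have "ereal (1 / (4 * B\<^sup>2)) \<le> lambda1 hyp_metric (cat_param a) cat_strip \<Omega>"
      by (rule lambda1_ge_gap[OF O S radial_spectral_gap[OF C]]) (use S(1) even_jacobi_pos[OF C st] B in auto)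
    moreover have "0 < ereal (1 / (4 * B\<^sup>2))" using B(1) by simp
    ultimately show ?thesis by (rule less_le_trans[rotated])
  qed
  then have "0 \<le> (INF \<Omega>\<in>{\<Omega>. compact_subdomain Sig \<Omega>}. lambda1 hyp_metric (cat_param a) cat_strip \<Omega>)"
    by (intro INF_greatest) (auto intro: less_imp_le)
  then show ?thesis unfolding stable_on_compacts_def using pos has_lambda1I[OF lambda1_mono] by blast
qed

text \<open>The mass bound is uniform in s, so one gap serves all compact subdomains and survives
  the infimum.\<close>

lemma catenoid_globally_stableI:
  assumes st: "crit_int CC 1 < rho CC 0 / CC"
  shows "catenoid_globally_stable a"
proof -
  note C = cC_gt_1[OF a]
  obtain B where B: "B > 0" "\<And>s. \<bar>even_jacobi_mass CC s\<bar> \<le> B * (rho CC s * (even_jacobi CC s)\<^sup>2)"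
    using mass_bound_global[OF C st] by auto
  have "ereal (1 / (4 * B\<^sup>2)) \<le> lambda1 hyp_metric (cat_param a) cat_strip \<Omega>" if O: "compact_subdomain Sig \<Omega>" for \<Omega>
  proof -
    obtain S where S: "S > 0" "\<And>q. cat_param a q \<in> \<Omega> \<Longrightarrow> \<bar>q $ 1\<bar> < S"
      using compact_bounded_arc_length[of \<Omega>] O unfolding compact_subdomain_def by blast
    show ?thesis
      by (rule lambda1_ge_gap[OF O S radial_spectral_gap[OF C]]) (use S(1) even_jacobi_pos[OF C less_imp_le[OF st]] B in auto)
  qed
  then have "ereal (1 / (4 * B\<^sup>2)) \<le> (INF \<Omega>\<in>{\<Omega>. compact_subdomain Sig \<Omega>}. lambda1 hyp_metric (cat_param a) cat_strip \<Omega>)"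
    by (intro INF_greatest) simp
  moreover have "0 < ereal (1 / (4 * B\<^sup>2))" using B(1) by simp
  ultimately show ?thesis unfolding globally_stable_def using has_lambda1I[OF lambda1_mono] less_le_trans by blast
qed

end

section \<open>Truncation of eigenfunctions\<close>

lemma flat_fun_1_DERIV: "(flat_fun 1 has_real_derivative flat_fun [:0, 0, 1:] t) (at t)"
  using DERIV_flat_fun[of 1 t] by simp

lemma flat_fun_1_bounds: "0 \<le> flat_fun 1 t" "flat_fun 1 t \<le> 1"
  by (auto simp: flat_fun_def)

lemma flat_fun_1_pos: "0 < t \<Longrightarrow> 0 < flat_fun 1 t"
  by (simp add: flat_fun_def)

lemma flat_fun_1_tendsto: "(flat_fun 1 \<longlongrightarrow> 1) at_top"
proof -
  have "((\<lambda>t::real. 1 / t) \<longlongrightarrow> 0) at_top"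
    by (rule tendsto_divide_0[OF tendsto_const]) (simp add: filterlim_at_top_imp_at_infinity filterlim_ident)
  then have "((\<lambda>t::real. exp (- (1 / t))) \<longlongrightarrow> exp (- 0)) at_top" by (intro tendsto_intros)
  then have "((\<lambda>t::real. exp (- (1 / t))) \<longlongrightarrow> 1) at_top" by simp
  then show ?thesis
    by (rule Lim_transform_eventually)
       (auto simp: flat_fun_def intro!: eventually_mono[OF eventually_gt_at_top[of 0]])
qed

text \<open>With \<tau> = t + 1 this is \<tau> times the derivative of the cutoff profile: the
  scale-invariant size of the gradient when the cutoff depends on the square of a function.\<close>

definition flat_beta :: "real \<Rightarrow> real" where
  "flat_beta t = (t + 1) * flat_fun [:0, 0, 1:] t"

lemma flat_beta_eq: "0 < t \<Longrightarrow> flat_beta t = (1 / t + (1 / t)\<^sup>2) * exp (- (1 / t))"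
  by (simp add: flat_beta_def flat_fun_def field_simps power2_eq_square)

lemma flat_beta_bounds: "0 \<le> flat_beta t" "flat_beta t \<le> 2"
proof -
  have "0 \<le> flat_beta t \<and> flat_beta t \<le> 2"
  proof (cases "0 < t")
    case True
    define x where "x = 1 / t"
    have x: "x > 0" using True by (simp add: x_def)
    \<comment> \<open>Twice the quadratic Taylor polynomial of exp dominates x + x^2, the factor in
      front of the decaying exponential.\<close>
    have "1 + x + x\<^sup>2 / 2 \<le> exp x" using exp_lower_Taylor_quadratic[of x] x by simp
    then have "x + x\<^sup>2 \<le> 2 * exp x" using x by simp
    then have "(x + x\<^sup>2) * exp (- x) \<le> 2 * exp x * exp (- x)" by (rule mult_right_mono) simp
    also have "\<dots> = 2" by (simp add: exp_minus)
    finally show ?thesis using flat_beta_eq[OF True] x by (simp add: x_def)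
  qed (simp add: flat_beta_def flat_fun_def)
  then show "0 \<le> flat_beta t" "flat_beta t \<le> 2" by auto
qed

lemma flat_beta_tendsto: "(flat_beta \<longlongrightarrow> 0) at_top"
proof (rule tendsto_sandwich[of "\<lambda>t. 0" _ _ "\<lambda>t. 1 / t + (1 / t)\<^sup>2"])
  show "eventually (\<lambda>t. flat_beta t \<le> 1 / t + (1 / t)\<^sup>2) at_top"
  proof (rule eventually_mono[OF eventually_gt_at_top[of 0]])
    fix t :: real assume t: "0 < t"
    have "(1 / t + (1 / t)\<^sup>2) * exp (- (1 / t)) \<le> (1 / t + (1 / t)\<^sup>2) * 1"
      using t by (intro mult_left_mono) auto
    then show "flat_beta t \<le> 1 / t + (1 / t)\<^sup>2" using flat_beta_eq[OF t] by simp
  qed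
  have "((\<lambda>t::real. 1 / t) \<longlongrightarrow> 0) at_top"
    by (rule tendsto_divide_0[OF tendsto_const]) (simp add: filterlim_at_top_imp_at_infinity filterlim_ident)
  then have "((\<lambda>t::real. 1 / t + (1 / t)\<^sup>2) \<longlongrightarrow> 0 + 0\<^sup>2) at_top" by (intro tendsto_intros)
  then show "((\<lambda>t::real. 1 / t + (1 / t)\<^sup>2) \<longlongrightarrow> 0) at_top" by simp
qed (auto intro: always_eventually flat_beta_bounds)

lemma jacobi_form_linear:
  assumes C: "C > 1" and s: "smooth G" "smooth H" "smooth v"
  shows "jacobi_form C S (\<lambda>q. c * G q + d * H q) v = c * jacobi_form C S G v + d * jacobi_form C S H v"
proof -
  let ?f = "\<lambda>G q. rho C (q $ 1) * (pd 1 G q * pd 1 v q) + pd 2 G q * pd 2 v q / rho C (q $ 1)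
     - rho C (q $ 1) * pot C (q $ 1) * (G q * v q)"
  have denom_deriv: "continuous_on UNIV (?f G)" if "smooth G" for G
    by (intro continuous_intros coeff_cont[OF C] smoothD(2) smoothD(3) that s) (simp add: rho_nz[OF C])
  have p: "pd i (\<lambda>q. c * G q + d * H q) q = c * pd i G q + d * pd i H q" for i q
  proof -
    have dc: "(\<lambda>q::real^2. e) differentiable (at q)" "pd i (\<lambda>q::real^2. e) q = 0" for e :: real by (simp_all add: pd_def)
    show ?thesis
      by (subst pd_add) (auto intro!: differentiable_mult dc smoothD(1) s simp: pd_mult dc smoothD(1) s)
  qed
  have "?f (\<lambda>q. c * G q + d * H q) = (\<lambda>q. c * ?f G q + d * ?f H q)"
    unfolding p by (rule ext) (simp add: divide_inverse algebra_simps)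
  then have "jacobi_form C S (\<lambda>q. c * G q + d * H q) v = integral (rect S) (\<lambda>q. c * ?f G q + d * ?f H q)"
    unfolding jacobi_form_def by (rule arg_cong)
  also have "\<dots> = integral (rect S) (\<lambda>q. c * ?f G q) + integral (rect S) (\<lambda>q. d * ?f H q)"
    by (intro integral_add integrable_rect continuous_on_mult continuous_on_const denom_deriv s)
  finally show ?thesis by (simp add: jacobi_form_def)
qed

lemma jacobi_form_square:
  assumes C: "C > 1" and s: "smooth G" "smooth H"
  shows "jacobi_form C S (\<lambda>q. c * G q + d * H q) (\<lambda>q. c * G q + d * H q)
    = c\<^sup>2 * jacobi_form C S G G + 2 * c * d * jacobi_form C S G H + d\<^sup>2 * jacobi_form C S H H"
proof -
  have sF: "smooth (\<lambda>q. c * G q + d * H q)"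
    using s unfolding smooth_on_UNIV[symmetric] by (intro smooth_intros open_UNIV)
  have "jacobi_form C S G (\<lambda>q. c * G q + d * H q) = c * jacobi_form C S G G + d * jacobi_form C S G H"
    "jacobi_form C S H (\<lambda>q. c * G q + d * H q) = c * jacobi_form C S G H + d * jacobi_form C S H H"
    unfolding jacobi_form_sym[of C S G "\<lambda>q. c * G q + d * H q"] jacobi_form_sym[of C S H "\<lambda>q. c * G q + d * H q"]
      jacobi_form_linear[OF C s s(1)] jacobi_form_linear[OF C s s(2)] by (simp_all add: jacobi_form_sym[of C S H G])
  then show ?thesis unfolding jacobi_form_linear[OF C s sF] by (simp add: power2_eq_square algebra_simps)
qed

context
  fixes a S :: real and \<Omega> :: "(real^3) set" and g :: "bool \<Rightarrow> real^3 \<Rightarrow> real" and l :: "bool \<Rightarrow> real"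
  assumes a: "a > 0" and S: "S > 0"
    and \<Omega>: "compact \<Omega>" "\<Omega> \<subseteq> cat_param a ` cat_strip"
    and inS: "\<And>q. cat_param a q \<in> \<Omega> \<Longrightarrow> \<bar>q $ 1\<bar> < S"
    and gs: "\<And>i. smooth (\<lambda>q. g i (cat_param a q))"
    and fr: "\<And>i p. p \<in> \<Omega> \<Longrightarrow> p \<notin> top_of_set (cat_param a ` cat_strip) interior_of \<Omega> \<Longrightarrow> g i p = 0"
    and eig: "\<And>i q. cat_param a q \<in> top_of_set (cat_param a ` cat_strip) interior_of \<Omega> \<Longrightarrow>
       jacobi_strip (cC a) (\<lambda>q. g i (cat_param a q)) q = - l i * g i (cat_param a q)"
begin

abbreviation (input) "interior\<Omega> \<equiv> top_of_set (cat_param a ` cat_strip) interior_of \<Omega>"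

text \<open>The boundary of \<open>\<Omega>\<close> may be irregular, and all that is known of the eigenfunctions there is that
  they vanish.  The cutoff is therefore a function of their values: it is zero wherever both are small,
  so the truncations are smooth with support in the interior, and the error terms it produces in the
  quadratic form are bounded and tend to zero pointwise.\<close>

definition "pulled i q = g i (cat_param a q)"
text \<open>One cutoff has to serve both eigenfunctions, so it depends on the sum of their squares.
  The index type \<open>bool\<close> supplies two labels, and a single eigenfunction is covered by
  using it twice.\<close>

definition "pulled_sq q = (pulled True q)\<^sup>2 + (pulled False q)\<^sup>2"
text \<open>Since \<open>flat_fun\<close> vanishes for nonpositive arguments, the cutoff is 0
  wherever the sum of squares is at most 1 / (n + 1)^2.\<close>

definition "cut_scale n = (real n + 1)\<^sup>2"
definition "cutoff n q = flat_fun 1 (cut_scale n * pulled_sq q - 1)"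
definition "truncate n P q = (if cat_param a q \<in> \<Omega> then cutoff n q * P q else 0)"

section \<open>Smooth truncation inside the subdomain\<close>

lemma pulled_smooth: "smooth (pulled i)" using gs[of i] by (simp add: pulled_def[abs_def])
lemma pulled_periodic: "pulled i (q + v2 0 (2 * pi)) = pulled i q" by (simp add: pulled_def X_periodic[OF a])
lemma pulled_sq_smooth: "smooth pulled_sq"
  using pulled_smooth[THEN smooth_on_UNIV[THEN iffD2]] unfolding pulled_sq_def[abs_def] smooth_on_UNIV[symmetric] by (intro smooth_intros open_UNIV)
lemma cutoff_smooth: "smooth (cutoff n)"
  using pulled_sq_smooth[THEN smooth_on_UNIV[THEN iffD2]] unfolding cutoff_def[abs_def] smooth_on_UNIV[symmetric] by (intro smooth_intros open_UNIV)
lemma cutoff_periodic: "cutoff n (q + v2 0 (2 * pi)) = cutoff n q" by (simp add: cutoff_def pulled_sq_def pulled_periodic)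
lemma cutoff_bounds: "0 \<le> cutoff n q" "cutoff n q \<le> 1" by (simp_all add: cutoff_def flat_fun_1_bounds)
lemma cut_scale_pos: "cut_scale n > 0" by (simp add: cut_scale_def add_nonneg_pos)
lemma pulled_sq_nonneg: "0 \<le> pulled_sq q" by (simp add: pulled_sq_def)
lemma pulled_le: "\<bar>pulled i q\<bar> \<le> sqrt (pulled_sq q)"
  by (cases i) (auto simp: pulled_sq_def intro!: real_le_rsqrt)

definition "int_preimage = {q. cat_param a q \<in> interior\<Omega>}"
definition "cutoff_support n = {q. cat_param a q \<in> \<Omega> \<and> 1 \<le> cut_scale n * pulled_sq q}"

lemma int_preimage_open: "open int_preimage"
proof -
  obtain V where V: "open V" "interior\<Omega> = cat_param a ` cat_strip \<inter> V"
    using openin_interior_of[of "top_of_set (cat_param a ` cat_strip)" \<Omega>] unfolding openin_open by auto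
  have "int_preimage = cat_param a -` V" unfolding int_preimage_def V(2) using X_in_Sig[OF a] by auto
  then show ?thesis using V(1) X_cont[OF a, of UNIV] by (simp add: open_vimage)
qed

lemma cutoff_support_closed: "closed (cutoff_support n)"
proof -
  have "closed (cat_param a -` \<Omega>)" by (rule closed_vimage[OF compact_imp_closed[OF \<Omega>(1)] X_cont[OF a]])
  moreover have "closed {q. 1 \<le> cut_scale n * pulled_sq q}" by (intro closed_Collect_le continuous_intros smoothD(2) pulled_sq_smooth)
  ultimately have "closed (cat_param a -` \<Omega> \<inter> {q. 1 \<le> cut_scale n * pulled_sq q})" by (rule closed_Int)
  moreover have "cat_param a -` \<Omega> \<inter> {q. 1 \<le> cut_scale n * pulled_sq q} = cutoff_support n" by (auto simp: cutoff_support_def)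
  ultimately show ?thesis by simp
qed

text \<open>At points of \<Omega> outside its interior both functions vanish, whereas here the sum
  of their squares has a positive lower bound. This takes the place of regularity of the
  boundary.\<close>

lemma cutoff_support_subset: "cutoff_support n \<subseteq> int_preimage"
proof
  fix q assume q: "q \<in> cutoff_support n"
  show "q \<in> int_preimage"
  proof (rule ccontr)
    assume "q \<notin> int_preimage"
    then have "pulled i q = 0" for i using fr[of "cat_param a q" i] q by (simp add: int_preimage_def cutoff_support_def pulled_def)
    then show False using q by (simp add: cutoff_support_def pulled_sq_def)
  qed
qed

lemma int_preimage_subset: "q \<in> int_preimage \<Longrightarrow> cat_param a q \<in> \<Omega>"
  unfolding int_preimage_def using interior_of_subset[of "top_of_set (cat_param a ` cat_strip)" \<Omega>] by auto

lemma truncate_interior: "q \<in> int_preimage \<Longrightarrow> truncate n P q = cutoff n q * P q" by (simp add: truncate_def int_preimage_subset)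
lemma truncate_exterior: "q \<in> - cutoff_support n \<Longrightarrow> truncate n P q = 0"
  by (auto simp: truncate_def cutoff_support_def cutoff_def flat_fun_def)

text \<open>Two open sets cover the plane: the preimage of the interior, where the truncation is a
  product of smooth functions, and the complement of the closed set \<open>cutoff_support n\<close>,
  where it is zero.\<close>

lemma truncate_smooth: assumes P: "smooth P" shows "smooth (truncate n P)"
proof -
  have 1: "smooth_on int_preimage (\<lambda>q. cutoff n q * P q)"
    using smooth_mult[OF cutoff_smooth P] by (auto simp: smooth_on_UNIV[symmetric] intro: smooth_on_subset)
  have "smooth_on int_preimage (truncate n P)" by (rule smooth_on_cong[OF int_preimage_open _ 1]) (simp add: truncate_interior)
  moreover have "smooth_on (- cutoff_support n) (truncate n P)"
    using cutoff_support_closed by (intro smooth_on_cong[OF _ _ smooth_on_const[of _ 0]]) (auto simp: truncate_exterior)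
  ultimately have "smooth_on (int_preimage \<union> - cutoff_support n) (truncate n P)"
    using cutoff_support_closed by (intro smooth_on_Un int_preimage_open) auto
  moreover have "int_preimage \<union> - cutoff_support n = UNIV" using cutoff_support_subset by blast
  ultimately show ?thesis by (simp add: smooth_on_UNIV)
qed

lemma truncate_periodic: "(\<And>q. P (q + v2 0 (2 * pi)) = P q) \<Longrightarrow> truncate n P (q + v2 0 (2 * pi)) = truncate n P q"
  by (simp add: truncate_def X_periodic[OF a] cutoff_periodic)

lemma truncate_zero: "truncate n P (v2 S t) = 0" "truncate n P (v2 (- S) t) = 0"
  using inS[of "v2 S t"] inS[of "v2 (- S) t"] S by (auto simp: truncate_def)

lemma pd_truncate_interior: "q \<in> int_preimage \<Longrightarrow> smooth P \<Longrightarrow> pd k (truncate n P) q = pd k (cutoff n) q * P q + cutoff n q * pd k P q"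
  using pd_cong_open[OF int_preimage_open, of q "truncate n P" "\<lambda>q. cutoff n q * P q" k]
  by (simp add: truncate_interior pd_mult smoothD(1) cutoff_smooth)

lemma pd_truncate_exterior: "q \<notin> int_preimage \<Longrightarrow> pd k (truncate n P) q = 0"
proof -
  assume "q \<notin> int_preimage"
  then have "q \<in> - cutoff_support n" using cutoff_support_subset by blast
  then have "pd k (truncate n P) q = pd k (\<lambda>q. 0) q"
    using cutoff_support_closed[of n] by (intro pd_cong_open[of "- cutoff_support n"]) (auto simp: truncate_exterior)
  then show ?thesis by (simp add: pd_def)
qed

text \<open>With \<eta> the cutoff and g an eigenfunction, \<open>trunc_once\<close> and
  \<open>trunc_twice\<close> stand for \<eta> g and \<eta>^2 g. The form is wanted on \<eta> g,
  while the eigenvalue equation for the uncut g is tested with \<eta>^2 g.\<close>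

definition "trunc_once n i = truncate n (pulled i)"
definition "trunc_twice n i = truncate n (\<lambda>q. cutoff n q * pulled i q)"

lemma trunc_once_smooth: "smooth (trunc_once n i)" "smooth (trunc_twice n i)"
  unfolding trunc_once_def trunc_twice_def by (intro truncate_smooth pulled_smooth smooth_mult cutoff_smooth)+
lemma trunc_once_periodic: "trunc_once n i (q + v2 0 (2 * pi)) = trunc_once n i q" "trunc_twice n i (q + v2 0 (2 * pi)) = trunc_twice n i q"
  unfolding trunc_once_def trunc_twice_def by (intro truncate_periodic; simp add: pulled_periodic cutoff_periodic)+
lemma trunc_once_zero: "trunc_once n i (v2 S t) = 0" "trunc_once n i (v2 (- S) t) = 0" "trunc_twice n i (v2 S t) = 0" "trunc_twice n i (v2 (- S) t) = 0"
  unfolding trunc_once_def trunc_twice_def by (rule truncate_zero)+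

definition "grad_error n i j k q = pd k (trunc_once n i) q * pd k (trunc_once n j) q - pd k (pulled i) q * pd k (trunc_twice n j) q"

text \<open>In the product rule the terms with \<eta>^2 cancel, and in what remains each derivative
  of \<eta> is accompanied by a factor g. This keeps the error bounded although the gradient of
  \<eta> is not bounded in n.\<close>

lemma grad_error_interior: "q \<in> int_preimage \<Longrightarrow> grad_error n i j k q = cutoff n q * pd k (cutoff n) q * (pulled i q * pd k (pulled j) q - pulled j q * pd k (pulled i) q)
   + pulled i q * pulled j q * (pd k (cutoff n) q)\<^sup>2"
  unfolding grad_error_def trunc_once_def trunc_twice_def
  by (simp add: pd_truncate_interior pulled_smooth smooth_mult cutoff_smooth pd_mult smoothD(1)) (simp add: power2_eq_square algebra_simps)

lemma grad_error_exterior: "q \<notin> int_preimage \<Longrightarrow> grad_error n i j k q = 0"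
  unfolding grad_error_def trunc_once_def trunc_twice_def by (simp add: pd_truncate_exterior)

lemma pd_cutoff: "pd k (cutoff n) q = flat_fun [:0, 0, 1:] (cut_scale n * pulled_sq q - 1) * (cut_scale n * (2 * (pulled True q * pd k (pulled True) q + pulled False q * pd k (pulled False) q)))"
proof -
  have sq: "(\<lambda>q. (pulled i q)\<^sup>2) = (\<lambda>q. pulled i q * pulled i q)" for i by (simp add: power2_eq_square)
  have d: "(\<lambda>q. pulled i q * pulled i q) differentiable (at q)" for i by (intro differentiable_mult smoothD(1) pulled_smooth)
  have r: "pd k pulled_sq q = 2 * (pulled True q * pd k (pulled True) q + pulled False q * pd k (pulled False) q)"
    unfolding pulled_sq_def[abs_def] power2_eq_square
    by (simp add: pd_add d pd_mult smoothD(1) pulled_smooth algebra_simps)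
  have "((\<lambda>x. flat_fun 1 (cut_scale n * x - 1)) has_real_derivative flat_fun [:0, 0, 1:] (cut_scale n * pulled_sq q - 1) * cut_scale n) (at (pulled_sq q))"
    by (rule DERIV_chain2[OF flat_fun_1_DERIV]) (auto intro!: derivative_eq_intros)
  from pd_chain[OF this smoothD(1)[OF pulled_sq_smooth], of k] show ?thesis by (simp add: cutoff_def[abs_def] r)
qed

text \<open>With r the root of the sum of squares, the derivative of r^2 is at most 4 r L. Hence r
  times the derivative of the cutoff is at most 4 L times \<open>cut_scale n\<close> r^2 times the
  derivative of the profile, and the last two factors are \<open>flat_beta\<close>.\<close>

lemma cutoff_gradient_bound:
  assumes L: "\<And>i. \<bar>pd k (pulled i) q\<bar> \<le> L"
  shows "sqrt (pulled_sq q) * \<bar>pd k (cutoff n) q\<bar> \<le> 4 * L * flat_beta (cut_scale n * pulled_sq q - 1)"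
proof -
  let ?r = "sqrt (pulled_sq q)" and ?h = "flat_fun [:0, 0, 1:] (cut_scale n * pulled_sq q - 1)"
  have h: "0 \<le> ?h" by (simp add: flat_fun_def)
  have r: "0 \<le> ?r" using pulled_sq_nonneg by simp
  have "\<bar>pulled i q * pd k (pulled i) q\<bar> \<le> ?r * L" for i
    unfolding abs_mult using pulled_le L r by (intro mult_mono) auto
  from add_mono[OF this[of True] this[of False]]
  have "\<bar>pulled True q * pd k (pulled True) q\<bar> + \<bar>pulled False q * pd k (pulled False) q\<bar> \<le> ?r * L + ?r * L" .
  from order_trans[OF abs_triangle_ineq this] have s: "\<bar>pulled True q * pd k (pulled True) q + pulled False q * pd k (pulled False) q\<bar> \<le> 2 * ?r * L"
    by (simp only: mult_2 distrib_right)
  have "\<bar>pd k (cutoff n) q\<bar> = ?h * (cut_scale n * (2 * \<bar>pulled True q * pd k (pulled True) q + pulled False q * pd k (pulled False) q\<bar>))"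
    unfolding pd_cutoff abs_mult abs_of_nonneg[OF h] abs_of_pos[OF cut_scale_pos] by (simp only: abs_numeral)
  also have "\<dots> \<le> ?h * (cut_scale n * (2 * (2 * ?r * L)))"
    using h cut_scale_pos[of n] s by (intro mult_left_mono) auto
  finally have "?r * \<bar>pd k (cutoff n) q\<bar> \<le> ?r * (?h * (cut_scale n * (2 * (2 * ?r * L))))" using r by (rule mult_left_mono)
  also have "\<dots> = 4 * L * ((cut_scale n * (?r * ?r)) * ?h)" by simp
  also have "?r * ?r = pulled_sq q" using pulled_sq_nonneg by simp
  finally show ?thesis by (simp add: flat_beta_def)
qed

lemma grad_error_bound:
  assumes L: "\<And>i. \<bar>pd k (pulled i) q\<bar> \<le> L"
  shows "\<bar>grad_error n i j k q\<bar> \<le> 8 * L\<^sup>2 * flat_beta (cut_scale n * pulled_sq q - 1) + 16 * L\<^sup>2 * (flat_beta (cut_scale n * pulled_sq q - 1))\<^sup>2"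
proof (cases "q \<in> int_preimage")
  case False
  then show ?thesis using grad_error_exterior flat_beta_bounds(1) by simp
next
  case True
  let ?r = "sqrt (pulled_sq q)" and ?c = "\<bar>pd k (cutoff n) q\<bar>" and ?b = "flat_beta (cut_scale n * pulled_sq q - 1)"
  have r: "0 \<le> ?r" using pulled_sq_nonneg by simp
  have L0: "0 \<le> L" using L[of True] by linarith
  have rc: "?r * ?c \<le> 4 * L * ?b" by (rule cutoff_gradient_bound[OF L])
  have rc0: "0 \<le> ?r * ?c" using r by simp
  have m: "\<bar>pulled i q * pd k (pulled j) q\<bar> \<le> ?r * L" for i j
    unfolding abs_mult using pulled_le L r by (intro mult_mono) auto
  have "\<bar>pulled i q * pd k (pulled j) q - pulled j q * pd k (pulled i) q\<bar> \<le> 2 * ?r * L"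
    using m[of i j] m[of j i] abs_triangle_ineq4[of "pulled i q * pd k (pulled j) q" "pulled j q * pd k (pulled i) q"] by linarith
  then have "cutoff n q * ?c * \<bar>pulled i q * pd k (pulled j) q - pulled j q * pd k (pulled i) q\<bar> \<le> 1 * ?c * (2 * ?r * L)"
    using cutoff_bounds[of n q] by (intro mult_mono) auto
  also have "\<dots> = 2 * L * (?r * ?c)" by simp
  also have "\<dots> \<le> 2 * L * (4 * L * ?b)" using rc L0 by (intro mult_left_mono) auto
  finally have A: "\<bar>cutoff n q * pd k (cutoff n) q * (pulled i q * pd k (pulled j) q - pulled j q * pd k (pulled i) q)\<bar> \<le> 8 * L\<^sup>2 * ?b"
    unfolding abs_mult[of "cutoff n q * pd k (cutoff n) q"] abs_mult[of "cutoff n q"] using cutoff_bounds(1)[of n q]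
    by (simp add: power2_eq_square)
  have "\<bar>pulled i q\<bar> * \<bar>pulled j q\<bar> \<le> ?r * ?r" using pulled_le r by (intro mult_mono) auto
  then have "\<bar>pulled i q\<bar> * \<bar>pulled j q\<bar> * ?c\<^sup>2 \<le> ?r * ?r * ?c\<^sup>2" by (rule mult_right_mono) simp
  also have "\<dots> = (?r * ?c)\<^sup>2" by (simp only: power2_eq_square mult.assoc mult.commute mult.left_commute)
  also have "\<dots> \<le> (4 * L * ?b)\<^sup>2" using rc rc0 by (intro power_mono)
  finally have B: "\<bar>pulled i q * pulled j q * (pd k (cutoff n) q)\<^sup>2\<bar> \<le> 16 * L\<^sup>2 * ?b\<^sup>2"
    by (simp add: abs_mult power_mult_distrib)
  show ?thesis unfolding grad_error_interior[OF True] by (rule order_trans[OF abs_triangle_ineq add_mono[OF A B]])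
qed

section \<open>Limits of the truncated forms\<close>

lemma cut_scale_tendsto: "0 < x \<Longrightarrow> filterlim (\<lambda>n. cut_scale n * x - 1) at_top sequentially"
  unfolding filterlim_at_top
proof
  fix Z :: real
  assume x: "0 < x"
  obtain m :: nat where m: "(Z + 1) / x \<le> real m" using real_arch_simple by blast
  show "eventually (\<lambda>n. Z \<le> cut_scale n * x - 1) sequentially"
  proof (rule eventually_sequentiallyI[of m])
    fix n assume n: "m \<le> n"
    have "Z + 1 \<le> real m * x" using m x by (simp add: field_simps)
    also have "\<dots> \<le> (real n + 1)\<^sup>2 * x"
    proof (rule mult_right_mono)
      have "real m \<le> (real n + 1) * 1" using n by simp
      also have "\<dots> \<le> (real n + 1) * (real n + 1)" by (intro mult_left_mono) auto
      finally show "real m \<le> (real n + 1)\<^sup>2" by (simp add: power2_eq_square)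
    qed (use x in simp)
    finally show "Z \<le> cut_scale n * x - 1" by (simp add: cut_scale_def)
  qed
qed

text \<open>Where both functions vanish the argument is - 1 and the value is 0; elsewhere the
  argument tends to infinity.\<close>

lemma flat_beta_pointwise: "(\<lambda>n. flat_beta (cut_scale n * pulled_sq q - 1)) \<longlonglongrightarrow> 0"
proof (cases "pulled_sq q = 0")
  case True
  then show ?thesis by (simp add: flat_beta_def)
next
  case False
  then have "0 < pulled_sq q" using pulled_sq_nonneg[of q] by simp
  from filterlim_compose[OF flat_beta_tendsto cut_scale_tendsto[OF this]] show ?thesis .
qed

definition "energy_error n i j q = rho (cC a) (q $ 1) * grad_error n i j 1 q + grad_error n i j 2 q / rho (cC a) (q $ 1)"

lemma rect_bounded:
  assumes "continuous_on UNIV (f :: real^2 \<Rightarrow> real)"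
  shows "\<exists>B\<ge>0. \<forall>q\<in>rect S. \<bar>f q\<bar> \<le> B"
proof -
  have "bounded (f ` rect S)"
    unfolding rect_def by (intro compact_imp_bounded compact_continuous_image continuous_on_subset[OF assms]) auto
  then obtain B where "B > 0" "\<forall>x\<in>f ` rect S. norm x \<le> B" unfolding bounded_pos by auto
  then show ?thesis by (intro exI[of _ B]) auto
qed

lemma grad_error_cont: "continuous_on A (grad_error n i j k)"
  unfolding grad_error_def[abs_def] by (intro continuous_intros smoothD(2) smoothD(3) trunc_once_smooth pulled_smooth)

lemma energy_error_cont: "continuous_on A (energy_error n i j)"
  unfolding energy_error_def[abs_def] by (intro continuous_intros coeff_cont[OF cC_gt_1[OF a]] grad_error_cont) (simp add: rho_nz[OF cC_gt_1[OF a]])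

text \<open>Dominated convergence: the derivatives of the eigenfunctions are bounded by
  \<open>L\<close> on the rectangle and \<open>flat_beta\<close> is at most 2. The constant 80 in
  the majorant is 8 times 2 plus 16 times 4.\<close>

lemma energy_error_integral_tendsto: "(\<lambda>n. integral (rect S) (energy_error n i j)) \<longlonglongrightarrow> 0"
proof -
  note C = cC_gt_1[OF a]
  have "\<exists>L\<ge>0. \<forall>q\<in>rect S. \<forall>i k. \<bar>pd k (pulled i) q\<bar> \<le> L"
  proof -
    have "\<exists>B\<ge>0. \<forall>q\<in>rect S. \<bar>pd k (pulled i) q\<bar> \<le> B" for k i
      by (rule rect_bounded) (intro smoothD(2) smoothD(3) pulled_smooth)
    then obtain B where B: "\<And>k i. B k i \<ge> 0" "\<And>k i q. q \<in> rect S \<Longrightarrow> \<bar>pd k (pulled i) q\<bar> \<le> B k i" by metis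
    have "\<bar>pd k (pulled i) q\<bar> \<le> B 1 True + B 1 False + B 2 True + B 2 False" if "q \<in> rect S" for k i q
    proof -
      have "B k i \<le> B 1 True + B 1 False + B 2 True + B 2 False"
        using B(1)[of 1 True] B(1)[of 1 False] B(1)[of 2 True] B(1)[of 2 False] exhaust_2[of k] by (cases i) auto
      then show ?thesis using B(2)[OF that, of k i] by linarith
    qed
    then show ?thesis using B(1) by (intro exI[of _ "B 1 True + B 1 False + B 2 True + B 2 False"]) (auto intro!: add_nonneg_nonneg)
  qed
  then obtain L where L: "L \<ge> 0" "\<And>q i k. q \<in> rect S \<Longrightarrow> \<bar>pd k (pulled i) q\<bar> \<le> L" by blast
  obtain K1 where K1: "K1 \<ge> 0" "\<And>q. q \<in> rect S \<Longrightarrow> \<bar>rho (cC a) (q $ 1)\<bar> \<le> K1"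
    using rect_bounded[OF coeff_cont(1)[OF C]] by blast
  have "continuous_on UNIV (\<lambda>q::real^2. 1 / rho (cC a) (q $ 1))" by (intro smoothD(2) smooth_inv_rho[OF C])
  then obtain K2 where K2: "K2 \<ge> 0" "\<And>q. q \<in> rect S \<Longrightarrow> \<bar>1 / rho (cC a) (q $ 1)\<bar> \<le> K2"
    using rect_bounded by blast
  define b where "b = (\<lambda>n q. flat_beta (cut_scale n * pulled_sq q - 1))"
  have b: "0 \<le> b n q" "b n q \<le> 2" for n q by (simp_all add: b_def flat_beta_bounds)
  have E: "\<bar>energy_error n i j q\<bar> \<le> (K1 + K2) * (8 * L\<^sup>2 * b n q + 16 * L\<^sup>2 * (b n q)\<^sup>2)" if q: "q \<in> rect S" for n q
  proof -
    let ?M = "8 * L\<^sup>2 * b n q + 16 * L\<^sup>2 * (b n q)\<^sup>2"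
    have D: "\<bar>grad_error n i j k q\<bar> \<le> ?M" for k unfolding b_def by (rule grad_error_bound[OF L(2)[OF q]])
    have M: "0 \<le> ?M" using b by simp
    have "\<bar>energy_error n i j q\<bar> \<le> \<bar>rho (cC a) (q $ 1)\<bar> * \<bar>grad_error n i j 1 q\<bar> + \<bar>1 / rho (cC a) (q $ 1)\<bar> * \<bar>grad_error n i j 2 q\<bar>"
      unfolding energy_error_def abs_mult[symmetric] by (rule order_trans[OF abs_triangle_ineq]) simp
    also have "\<dots> \<le> K1 * ?M + K2 * ?M"
      using K1 K2 D M q by (intro add_mono mult_mono) auto
    finally show ?thesis by (simp add: algebra_simps)
  qed
  have "(\<lambda>n. integral (rect S) (energy_error n i j)) \<longlonglongrightarrow> integral (rect S) (\<lambda>q. 0)"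
  proof (rule dominated_convergence(2)[where h = "\<lambda>q. (K1 + K2) * (80 * L\<^sup>2)"])
    show "energy_error n i j integrable_on rect S" for n by (rule integrable_rect[OF energy_error_cont])
    show "(\<lambda>q. (K1 + K2) * (80 * L\<^sup>2)) integrable_on rect S" by (rule integrable_rect) simp
    fix q assume q: "q \<in> rect S"
    show "norm (energy_error n i j q) \<le> (K1 + K2) * (80 * L\<^sup>2)" for n
    proof -
      have "(b n q)\<^sup>2 \<le> 2\<^sup>2" using b[of n q] by (intro power_mono) auto
      then have "8 * L\<^sup>2 * b n q + 16 * L\<^sup>2 * (b n q)\<^sup>2 \<le> 8 * L\<^sup>2 * 2 + 16 * L\<^sup>2 * 2\<^sup>2"
        using b(2)[of n q] by (intro add_mono mult_left_mono) auto
      also have "\<dots> = 80 * L\<^sup>2" by simp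
      finally have "(K1 + K2) * (8 * L\<^sup>2 * b n q + 16 * L\<^sup>2 * (b n q)\<^sup>2) \<le> (K1 + K2) * (80 * L\<^sup>2)"
        using K1(1) K2(1) by (intro mult_left_mono) auto
      then show ?thesis using E[OF q, of n] by simp
    qed
    have "(\<lambda>n. (K1 + K2) * (8 * L\<^sup>2 * b n q + 16 * L\<^sup>2 * (b n q)\<^sup>2)) \<longlonglongrightarrow> (K1 + K2) * (8 * L\<^sup>2 * 0 + 16 * L\<^sup>2 * 0\<^sup>2)"
      unfolding b_def by (intro tendsto_intros flat_beta_pointwise)
    then have "(\<lambda>n. (K1 + K2) * (8 * L\<^sup>2 * b n q + 16 * L\<^sup>2 * (b n q)\<^sup>2)) \<longlonglongrightarrow> 0" by simp
    then show "(\<lambda>n. energy_error n i j q) \<longlonglongrightarrow> 0"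
      by (rule Lim_null_comparison[rotated]) (use E[OF q] in \<open>auto intro!: always_eventually\<close>)
  qed
  then show ?thesis by simp
qed

definition "ext_pulled i q = (if cat_param a q \<in> \<Omega> then pulled i q else 0)"
definition "gram i j = integral (rect S) (\<lambda>q. rho (cC a) (q $ 1) * (ext_pulled i q * ext_pulled j q))"

lemma gram_sym: "gram i j = gram j i" by (simp add: gram_def mult.commute)

lemma cutoff_pointwise: "(\<lambda>n. (cutoff n q)\<^sup>2 * (ext_pulled i q * ext_pulled j q)) \<longlonglongrightarrow> ext_pulled i q * ext_pulled j q"
proof (cases "pulled_sq q = 0")
  case True
  then have "pulled i q = 0" using pulled_le[of i q] by simp
  then show ?thesis by (simp add: ext_pulled_def)
next
  case False
  then have "0 < pulled_sq q" using pulled_sq_nonneg[of q] by simp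
  from filterlim_compose[OF flat_fun_1_tendsto cut_scale_tendsto[OF this]]
  have "(\<lambda>n. cutoff n q) \<longlonglongrightarrow> 1" by (simp add: cutoff_def)
  then have "(\<lambda>n. (cutoff n q)\<^sup>2 * (ext_pulled i q * ext_pulled j q)) \<longlonglongrightarrow> 1\<^sup>2 * (ext_pulled i q * ext_pulled j q)" by (intro tendsto_intros)
  then show ?thesis by simp
qed

lemma trunc_once_products: "trunc_once n i q * trunc_once n j q = (cutoff n q)\<^sup>2 * (ext_pulled i q * ext_pulled j q)" "trunc_twice n j q * pulled i q = (cutoff n q)\<^sup>2 * (ext_pulled i q * ext_pulled j q)"
  by (simp_all add: trunc_once_def trunc_twice_def truncate_def ext_pulled_def power2_eq_square)

text \<open>The products of truncations are continuous and converge pointwise under a common bound,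
  which yields integrability of the limit together with convergence of the integrals.\<close>

lemma gram_limit:
  "(\<lambda>q. rho (cC a) (q $ 1) * (ext_pulled i q * ext_pulled j q)) integrable_on rect S"
  "(\<lambda>n. integral (rect S) (\<lambda>q. rho (cC a) (q $ 1) * (trunc_once n i q * trunc_once n j q))) \<longlonglongrightarrow> gram i j"
proof -
  note C = cC_gt_1[OF a]
  have c: "continuous_on UNIV (\<lambda>q. rho (cC a) (q $ 1) * (pulled i q * pulled j q))"
    by (intro continuous_intros coeff_cont[OF C] smoothD(2) pulled_smooth)
  obtain K where K: "K \<ge> 0" "\<And>q. q \<in> rect S \<Longrightarrow> \<bar>rho (cC a) (q $ 1) * (pulled i q * pulled j q)\<bar> \<le> K"
    using rect_bounded[OF c] by blast
  have i: "(\<lambda>q. rho (cC a) (q $ 1) * (trunc_once n i q * trunc_once n j q)) integrable_on rect S" for n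
    by (intro integrable_rect continuous_intros coeff_cont[OF C] smoothD(2) trunc_once_smooth)
  have h: "(\<lambda>q. K) integrable_on rect S" by (rule integrable_rect) simp
  have le: "norm (rho (cC a) (q $ 1) * (trunc_once n i q * trunc_once n j q)) \<le> K" if q: "q \<in> rect S" for n q
  proof -
    have "\<bar>rho (cC a) (q $ 1) * (trunc_once n i q * trunc_once n j q)\<bar> = (cutoff n q)\<^sup>2 * \<bar>rho (cC a) (q $ 1) * (ext_pulled i q * ext_pulled j q)\<bar>"
      unfolding trunc_once_products by (simp add: abs_mult mult.left_commute)
    also have "\<dots> \<le> 1 * K"
      using K(1) K(2)[OF q] cutoff_bounds[of n q] by (intro mult_mono) (auto simp: ext_pulled_def power_le_one)
    finally show ?thesis by simp
  qed
  have lim: "(\<lambda>n. rho (cC a) (q $ 1) * (trunc_once n i q * trunc_once n j q)) \<longlonglongrightarrow> rho (cC a) (q $ 1) * (ext_pulled i q * ext_pulled j q)" for q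
    unfolding trunc_once_products by (intro tendsto_intros cutoff_pointwise)
  show "(\<lambda>q. rho (cC a) (q $ 1) * (ext_pulled i q * ext_pulled j q)) integrable_on rect S"
    by (rule dominated_convergence(1)[OF i h le lim])
  show "(\<lambda>n. integral (rect S) (\<lambda>q. rho (cC a) (q $ 1) * (trunc_once n i q * trunc_once n j q))) \<longlonglongrightarrow> gram i j"
    unfolding gram_def by (rule dominated_convergence(2)[OF i h le lim])
qed

text \<open>The function \<eta>^2 g_j has its support inside the interior, so the eigenvalue
  equation for g_i can be integrated by parts against it. Replacing the pair g_i, \<eta>^2 g_j by
  \<eta> g_i, \<eta> g_j costs precisely the energy error.\<close>

lemma jacobi_form_trunc: "jacobi_form (cC a) S (trunc_once n i) (trunc_once n j) = l i * integral (rect S) (\<lambda>q. rho (cC a) (q $ 1) * (trunc_once n i q * trunc_once n j q)) + integral (rect S) (energy_error n i j)"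
proof -
  note C = cC_gt_1[OF a]
  have S0: "0 \<le> S" using S by simp
  let ?r = "\<lambda>q::real^2. rho (cC a) (q $ 1)"
  have "trunc_twice n j q * jacobi_strip (cC a) (pulled i) q * ?r q = - l i * (?r q * (trunc_once n i q * trunc_once n j q))" for q
  proof (cases "q \<in> int_preimage")
    case True
    then have "jacobi_strip (cC a) (pulled i) q = - l i * pulled i q" using eig[of q i] by (simp add: int_preimage_def pulled_def[abs_def])
    then have "trunc_twice n j q * jacobi_strip (cC a) (pulled i) q = - l i * (trunc_twice n j q * pulled i q)" by simp
    then show ?thesis unfolding trunc_once_products by simp
  next
    case False
    then have "q \<in> - cutoff_support n" using cutoff_support_subset by blast
    then show ?thesis by (simp add: trunc_once_def trunc_twice_def truncate_exterior)
  qed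
  then have "integral (rect S) (\<lambda>q. trunc_twice n j q * jacobi_strip (cC a) (pulled i) q * ?r q) = - l i * integral (rect S) (\<lambda>q. ?r q * (trunc_once n i q * trunc_once n j q))"
    by simp
  then have G: "jacobi_form (cC a) S (pulled i) (trunc_twice n j) = l i * integral (rect S) (\<lambda>q. ?r q * (trunc_once n i q * trunc_once n j q))"
    using integration_by_parts[OF C S0 pulled_smooth[of i] pulled_periodic[of i] trunc_once_smooth(2)[where n=n and i=j] trunc_once_periodic(2)[where n=n and i=j] trunc_once_zero(3,4)[where n=n and i=j]] by simp
  let ?f = "\<lambda>G v q. ?r q * (pd 1 G q * pd 1 v q) + pd 2 G q * pd 2 v q / ?r q - ?r q * pot (cC a) (q $ 1) * (G q * v q)"
  have e: "?f (trunc_once n i) (trunc_once n j) q = ?f (pulled i) (trunc_twice n j) q + energy_error n i j q" for q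
  proof -
    have "trunc_once n i q * trunc_once n j q = pulled i q * trunc_twice n j q" using trunc_once_products(1)[of n i q j] trunc_once_products(2)[of n j q i] by (simp add: mult.commute)
    then show ?thesis unfolding energy_error_def grad_error_def by (simp add: algebra_simps diff_divide_distrib)
  qed
  have "continuous_on UNIV (?f (pulled i) (trunc_twice n j))"
    by (intro continuous_intros coeff_cont[OF C] smoothD(2) smoothD(3) pulled_smooth trunc_once_smooth) (simp add: rho_nz[OF C])
  then have "jacobi_form (cC a) S (trunc_once n i) (trunc_once n j) = jacobi_form (cC a) S (pulled i) (trunc_twice n j) + integral (rect S) (energy_error n i j)"
    unfolding jacobi_form_def e by (intro integral_add integrable_rect energy_error_cont)
  then show ?thesis unfolding G .
qed

lemma jacobi_form_trunc_tendsto: "(\<lambda>n. jacobi_form (cC a) S (trunc_once n i) (trunc_once n j)) \<longlonglongrightarrow> l i * gram i j"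
proof -
  have "(\<lambda>n. jacobi_form (cC a) S (trunc_once n i) (trunc_once n j)) \<longlonglongrightarrow> l i * gram i j + 0"
    unfolding jacobi_form_trunc by (intro tendsto_intros gram_limit(2) energy_error_integral_tendsto)
  then show ?thesis by simp
qed

text \<open>The limit of the symmetric form can be computed with either eigenvalue. This is the
  usual argument for a self-adjoint operator, with the boundary integrals replaced by vanishing
  error terms.\<close>

lemma gram_orthogonal: "l i \<noteq> l j \<Longrightarrow> gram i j = 0"
proof -
  assume ne: "l i \<noteq> l j"
  have "(\<lambda>n. jacobi_form (cC a) S (trunc_once n i) (trunc_once n j)) \<longlonglongrightarrow> l j * gram j i"
    unfolding jacobi_form_sym[of _ _ "trunc_once _ i"] by (rule jacobi_form_trunc_tendsto)
  then have "l i * gram i j = l j * gram j i" using jacobi_form_trunc_tendsto LIMSEQ_unique by blast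
  then show ?thesis using ne gram_sym[of i j] by simp
qed

lemma trunc_once_norm_le: "integral (rect S) (\<lambda>q. rho (cC a) (q $ 1) * (trunc_once n i q * trunc_once n i q)) \<le> gram i i"
  unfolding gram_def
proof (rule integral_le[OF _ gram_limit(1)])
  show "(\<lambda>q. rho (cC a) (q $ 1) * (trunc_once n i q * trunc_once n i q)) integrable_on rect S"
    by (intro integrable_rect continuous_intros coeff_cont[OF cC_gt_1[OF a]] smoothD(2) trunc_once_smooth)
  fix q
  have "(cutoff n q)\<^sup>2 * (ext_pulled i q * ext_pulled i q) \<le> 1 * (ext_pulled i q * ext_pulled i q)"
    using cutoff_bounds[of n q] by (intro mult_right_mono) (auto simp: power_le_one)
  then show "rho (cC a) (q $ 1) * (trunc_once n i q * trunc_once n i q) \<le> rho (cC a) (q $ 1) * (ext_pulled i q * ext_pulled i q)"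
    unfolding trunc_once_products using rho_pos[OF cC_gt_1[OF a], of "q $ 1"] by (intro mult_left_mono) auto
qed

lemma trunc_once_norm_pos:
  assumes "trunc_once n i q \<noteq> 0" shows "0 < integral (rect S) (\<lambda>q. rho (cC a) (q $ 1) * (trunc_once n i q * trunc_once n i q))"
proof -
  let ?f = "\<lambda>q. rho (cC a) (q $ 1) * (trunc_once n i q * trunc_once n i q)"
  have q: "cat_param a q \<in> \<Omega>" using assms by (auto simp: trunc_once_def truncate_def split: if_splits)
  \<comment> \<open>The point is moved into the fundamental rectangle, over which the integral is
    taken.\<close>
  obtain q' where q': "q' $ 1 = q $ 1" "0 \<le> q' $ 2" "q' $ 2 \<le> 2 * pi" "cat_param a q' = cat_param a q" using X_reduce[OF a, of q] by blast
  have r: "q' \<in> rect S" using q' inS[OF q] by (simp add: mem_rect)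
  have "pulled j q' = pulled j q" for j by (simp add: pulled_def q'(4))
  then have "trunc_once n i q' = trunc_once n i q" by (simp add: trunc_once_def truncate_def cutoff_def pulled_sq_def q'(4))
  then have nz: "?f q' \<noteq> 0" using assms rho_nz[OF cC_gt_1[OF a]] by simp
  have c: "continuous_on UNIV ?f" by (intro continuous_intros coeff_cont[OF cC_gt_1[OF a]] smoothD(2) trunc_once_smooth)
  have nn: "0 \<le> ?f q" for q using rho_pos[OF cC_gt_1[OF a], of "q $ 1"] by simp
  have "box (v2 (- S) 0) (v2 S (2 * pi)) \<noteq> {}" using S by (simp add: interval_ne_empty_cart forall_2)
  then have "integral (rect S) ?f \<noteq> 0"
    using integral_cbox_eq_0_iff[of "v2 (- S) 0" "v2 S (2 * pi)" ?f] continuous_on_subset[OF c] nn r nz unfolding rect_def by blast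
  moreover have "0 \<le> integral (rect S) ?f" using nn by (intro integral_nonneg integrable_rect[OF c])
  ultimately show ?thesis by simp
qed

lemma trunc_once_nonzero:
  assumes "ext_pulled i q \<noteq> 0" shows "\<exists>n. trunc_once n i q \<noteq> 0"
proof -
  have "pulled i q \<noteq> 0" "cat_param a q \<in> \<Omega>" using assms by (auto simp: ext_pulled_def split: if_splits)
  then have "pulled_sq q \<noteq> 0" using pulled_le[of i q] by auto
  then have "0 < pulled_sq q" using pulled_sq_nonneg[of q] by simp
  from filterlim_at_top_dense[THEN iffD1, OF cut_scale_tendsto[OF this]]
  obtain n where "0 < cut_scale n * pulled_sq q - 1" unfolding eventually_sequentially by blast
  then have "0 < cutoff n q" unfolding cutoff_def by (rule flat_fun_1_pos)
  then show ?thesis using \<open>pulled i q \<noteq> 0\<close> \<open>cat_param a q \<in> \<Omega>\<close> by (intro exI[of _ n]) (simp add: trunc_once_def truncate_def)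
qed

lemma gram_pos: "ext_pulled i q \<noteq> 0 \<Longrightarrow> 0 < gram i i"
  using trunc_once_nonzero[of i q] trunc_once_norm_pos trunc_once_norm_le less_le_trans by blast

text \<open>For large n the form is negative definite on the span of the two truncations. In this
  plane the single linear condition of vanishing mean over the neck has a nontrivial solution, and
  there the form is nonnegative.\<close>

lemma no_orthogonal_negative_pair:
  assumes l: "l True < 0" "l False < 0" and p: "0 < gram True True" "0 < gram False False" and o: "gram True False = 0"
  shows False
proof -
  note C = cC_gt_1[OF a]
  have S0: "0 \<le> S" using S by simp
  let ?b = "\<lambda>n i j. jacobi_form (cC a) S (trunc_once n i) (trunc_once n j)"
  \<comment> \<open>Half of the smaller modulus of the two diagonal limits. Eventually the diagonal
    entries lie below - \<kappa> and the mixed entry is smaller than \<kappa> in modulus, so the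
    form is negative definite in the two coefficients.\<close>
  define \<kappa> where "\<kappa> = min (- (l True * gram True True)) (- (l False * gram False False)) / 2"
  have \<kappa>: "\<kappa> > 0" "l True * gram True True < - \<kappa>" "l False * gram False False < - \<kappa>"
  proof -
    have "l True * gram True True < 0" "l False * gram False False < 0" using l p by (simp_all add: mult_neg_pos)
    then show "\<kappa> > 0" "l True * gram True True < - \<kappa>" "l False * gram False False < - \<kappa>"
      unfolding \<kappa>_def min_def by (simp_all split: if_splits)
  qed
  have "eventually (\<lambda>n. ?b n True True < - \<kappa>) sequentially" "eventually (\<lambda>n. ?b n False False < - \<kappa>) sequentially"
    by (rule order_tendstoD(2)[OF jacobi_form_trunc_tendsto]; use \<kappa> in simp)+
  moreover have "(\<lambda>n. \<bar>?b n True False\<bar>) \<longlonglongrightarrow> \<bar>0\<bar>" using jacobi_form_trunc_tendsto[of True False] o by (intro tendsto_rabs) simp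
  then have "eventually (\<lambda>n. \<bar>?b n True False\<bar> < \<kappa>) sequentially" by (rule order_tendstoD(2)) (use \<kappa> in simp)
  ultimately have "eventually (\<lambda>n. ?b n True True < - \<kappa> \<and> ?b n False False < - \<kappa> \<and> \<bar>?b n True False\<bar> < \<kappa>) sequentially"
    by eventually_elim simp
  then obtain n where n: "?b n True True < - \<kappa>" "?b n False False < - \<kappa>" "\<bar>?b n True False\<bar> < \<kappa>"
    unfolding eventually_sequentially by blast
  define m where "m = (\<lambda>i. integral {0..2 * pi} (\<lambda>t. trunc_once n i (v2 0 t)))"
  obtain c d where cd: "c * m True + d * m False = 0" "c \<noteq> 0 \<or> d \<noteq> 0"
  proof (cases "m True = 0")
    case True
    then show ?thesis using that[of 1 0] by simp
  next
    case False
    then show ?thesis using that[of "- m False" "m True"] by simp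
  qed
  let ?F = "\<lambda>q. c * trunc_once n True q + d * trunc_once n False q"
  have sF: "smooth ?F"
    using trunc_once_smooth(1)[THEN smooth_on_UNIV[THEN iffD2]] unfolding smooth_on_UNIV[symmetric] by (intro smooth_intros open_UNIV)
  have "0 \<le> jacobi_form (cC a) S ?F ?F"
  proof (rule jacobi_form_nonneg_if_mean_zero[OF C S0 sF])
    show "?F (q + v2 0 (2 * pi)) = ?F q" for q by (simp add: trunc_once_periodic)
    show "?F (v2 S t) = 0" "?F (v2 (- S) t) = 0" for t by (simp_all add: trunc_once_zero)
    have ii: "(\<lambda>t. e * trunc_once n i (v2 0 t)) integrable_on {0..2 * pi}" for e i
      by (intro integrable_continuous_interval continuous_intros continuous_on_compose2[OF smoothD(2)[OF trunc_once_smooth(1)]]) auto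
    show "integral {0..2 * pi} (\<lambda>t. ?F (v2 0 t)) = 0"
      using cd(1) by (simp add: integral_add[OF ii ii] m_def)
  qed
  also have "jacobi_form (cC a) S ?F ?F = c\<^sup>2 * ?b n True True + 2 * c * d * ?b n True False + d\<^sup>2 * ?b n False False"
    by (rule jacobi_form_square[OF C trunc_once_smooth(1) trunc_once_smooth(1)])
  also have "\<dots> < 0"
  proof -
    have 1: "2 * c * d * ?b n True False \<le> (c\<^sup>2 + d\<^sup>2) * \<kappa>"
    proof -
      have "2 * c * d * ?b n True False \<le> \<bar>2 * c * d\<bar> * \<bar>?b n True False\<bar>" by (metis abs_ge_self abs_mult)
      also have "\<dots> \<le> (c\<^sup>2 + d\<^sup>2) * \<kappa>"
      proof (rule mult_mono)
        have "0 \<le> (\<bar>c\<bar> - \<bar>d\<bar>)\<^sup>2" by simp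
        then show "\<bar>2 * c * d\<bar> \<le> c\<^sup>2 + d\<^sup>2" by (simp add: power2_diff abs_mult)
      qed (use n in auto)
      finally show ?thesis .
    qed
    have 2: "c\<^sup>2 * ?b n True True \<le> c\<^sup>2 * (- \<kappa>)" "d\<^sup>2 * ?b n False False \<le> d\<^sup>2 * (- \<kappa>)"
      by (rule mult_left_mono; use n in simp)+
    have 3: "c\<^sup>2 * ?b n True True < c\<^sup>2 * (- \<kappa>) \<or> d\<^sup>2 * ?b n False False < d\<^sup>2 * (- \<kappa>)"
      using n cd(2) by (metis mult_strict_left_mono zero_less_power2)
    have 4: "(c\<^sup>2 + d\<^sup>2) * \<kappa> = - (c\<^sup>2 * (- \<kappa>)) - (d\<^sup>2 * (- \<kappa>))" by (simp add: algebra_simps)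
    show ?thesis using 1 2 3 unfolding 4 by linarith
  qed
  finally show False by simp
qed

text \<open>For large n the truncation has negative energy and compact support in the interior, so
  after normalization it is an admissible competitor.\<close>

lemma negative_test_function:
  assumes l: "l True < 0" and f: "ext_pulled True q \<noteq> 0" and cs: "compact_subdomain (cat_param a ` cat_strip) \<Omega>"
  shows "lambda1 hyp_metric (cat_param a) cat_strip \<Omega> < 0"
proof -
  note C = cC_gt_1[OF a]
  have "l True * gram True True < 0" using l gram_pos[OF f] by (simp add: mult_neg_pos)
  then have "eventually (\<lambda>n. jacobi_form (cC a) S (trunc_once n True) (trunc_once n True) < 0) sequentially"
    by (rule order_tendstoD(2)[OF jacobi_form_trunc_tendsto])
  then obtain n where n: "jacobi_form (cC a) S (trunc_once n True) (trunc_once n True) < 0" unfolding eventually_sequentially by blast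
  \<comment> \<open>Test functions live on the ambient space, so the truncation is rewritten there
    in terms of \<open>g\<close> instead of the parameters.\<close>
  define h where "h = (\<lambda>p. if p \<in> \<Omega> then flat_fun 1 (cut_scale n * ((g True p)\<^sup>2 + (g False p)\<^sup>2) - 1) * g True p else 0)"
  have hX: "h (cat_param a q) = trunc_once n True q" for q
    by (simp add: h_def trunc_once_def truncate_def cutoff_def pulled_sq_def pulled_def)
  define c where "c = integral (rect S) (\<lambda>q. rho (cC a) (q $ 1) * (trunc_once n True q)\<^sup>2)"
  have c: "c > 0"
  proof -
    have "\<exists>q. trunc_once n True q \<noteq> 0"
    proof (rule ccontr)
      assume "\<not> ?thesis"
      then have "trunc_once n True = (\<lambda>q. 0)" by auto
      then have "jacobi_form (cC a) S (trunc_once n True) (trunc_once n True) = 0" by (simp add: jacobi_form_def pd_def)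
      then show False using n by simp
    qed
    then show ?thesis using trunc_once_norm_pos[of n True] by (auto simp: c_def power2_eq_square)
  qed
  define f where "f = (\<lambda>p. 1 / sqrt c * h p)"
  have fX: "f (cat_param a q) = 1 / sqrt c * trunc_once n True q" for q by (simp add: f_def hX)
  have tf: "f \<in> test_functions (cat_param a) cat_strip \<Omega>"
  proof -
    have "smooth (\<lambda>q. 1 / sqrt c * trunc_once n True q)"
      using trunc_once_smooth(1)[THEN smooth_on_UNIV[THEN iffD2]] unfolding smooth_on_UNIV[symmetric] by (intro smooth_intros open_UNIV)
    then have 1: "smooth (f \<circ> cat_param a)" by (simp add: comp_def fX)
    have "cutoff_support n \<inter> rect S \<subseteq> rect S" by blast
    then have "compact (cutoff_support n \<inter> rect S)" using cutoff_support_closed by (simp add: rect_def closed_Int_compact)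
    then have cl: "closed (cat_param a ` (cutoff_support n \<inter> rect S))" by (intro compact_imp_closed compact_continuous_image X_cont a)
    have "{p \<in> cat_param a ` cat_strip. f p \<noteq> 0} \<subseteq> cat_param a ` (cutoff_support n \<inter> rect S)"
    proof
      fix p assume "p \<in> {p \<in> cat_param a ` cat_strip. f p \<noteq> 0}"
      then obtain q where q: "q \<in> cat_strip" "p = cat_param a q" "trunc_once n True q \<noteq> 0" by (auto simp: fX)
      have "q \<in> cutoff_support n" using q(3) truncate_exterior[of q n] unfolding trunc_once_def by auto
      moreover have "q \<in> rect S" using q(1) inS[of q] \<open>q \<in> cutoff_support n\<close> by (simp add: mem_rect cat_strip_def cutoff_support_def)
      ultimately show "p \<in> cat_param a ` (cutoff_support n \<inter> rect S)" using q(2) by blast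
    qed
    then have "closure {p \<in> cat_param a ` cat_strip. f p \<noteq> 0} \<subseteq> cat_param a ` (cutoff_support n \<inter> rect S)" using cl by (rule closure_minimal)
    also have "\<dots> \<subseteq> interior\<Omega>" using cutoff_support_subset by (auto simp: int_preimage_def)
    finally show ?thesis using 1 by (simp add: test_functions_def)
  qed
  note P = test_function_props[OF a tf inS]
  have "integral (rect S) (\<lambda>q. rho (cC a) (q $ 1) * (f (cat_param a q))\<^sup>2) = integral (rect S) (\<lambda>q. (1 / c) * (rho (cC a) (q $ 1) * (trunc_once n True q)\<^sup>2))"
    unfolding fX using c by (simp add: power_mult_distrib power_divide)
  also have "\<dots> = 1" unfolding integral_mult_right using c by (simp add: c_def)
  finally have one: "surface_integral hyp_metric (cat_param a) cat_strip \<Omega> (\<lambda>q. (f (cat_param a q))\<^sup>2) = 1" using P(5) by simp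
  have "jacobi_form (cC a) S (\<lambda>q. f (cat_param a q)) (\<lambda>q. f (cat_param a q)) = (1 / sqrt c)\<^sup>2 * jacobi_form (cC a) S (trunc_once n True) (trunc_once n True)"
    unfolding fX using jacobi_form_square[OF C trunc_once_smooth(1) trunc_once_smooth(1), of S "1 / sqrt c" n True 0 n True] by simp
  also have "\<dots> < 0" using n c by (intro mult_pos_neg) auto
  finally have "ereal (- surface_integral hyp_metric (cat_param a) cat_strip \<Omega> (\<lambda>q. f (cat_param a q) * jacobi_op hyp_metric (cat_param a) (f \<circ> cat_param a) q)) < 0"
    using P(6) by simp
  moreover have "lambda1 hyp_metric (cat_param a) cat_strip \<Omega> \<le> ereal (- surface_integral hyp_metric (cat_param a) cat_strip \<Omega> (\<lambda>q. f (cat_param a q) * jacobi_op hyp_metric (cat_param a) (f \<circ> cat_param a) q))"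
    unfolding lambda1_def by (rule INF_lower) (use tf one in simp)
  ultimately show ?thesis by (rule le_less_trans[rotated])
qed

end

section \<open>Instability and the Morse index\<close>

text \<open>Derivatives see only germs. This allows an eigenfunction extended by zero to be
  exchanged, in the interior, for a smooth representative that agrees with it on \<Omega>.\<close>

lemma jacobi_op_cong_open:
  assumes U: "open U" "q \<in> U" and eq: "\<And>x. x \<in> U \<Longrightarrow> \<phi> x = \<psi> x"
  shows "jacobi_op G X \<phi> q = jacobi_op G X \<psi> q"
proof -
  have "pd j \<phi> x = pd j \<psi> x" if "x \<in> U" for j x by (rule pd_cong_open[OF U(1) that eq])
  then have "pd i (\<lambda>r. area_density G X r * (\<Sum>j\<in>UNIV. matrix_inv (first_form G X r) $ i $ j * pd j \<phi> r)) q
      = pd i (\<lambda>r. area_density G X r * (\<Sum>j\<in>UNIV. matrix_inv (first_form G X r) $ i $ j * pd j \<psi> r)) q" for i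
    by (intro pd_cong_open[OF U]) simp
  then show ?thesis by (simp add: jacobi_op_def laplace_beltrami_def eq[OF U(2)])
qed

lemma jacobi_strip_add_scale:
  assumes C: "C > 1" and s: "smooth G" "smooth H"
  shows "jacobi_strip C (\<lambda>q. G q + c * H q) q = jacobi_strip C G q + c * jacobi_strip C H q"
proof -
  have dc: "(\<lambda>q::real^2. c) differentiable (at q)" "pd i (\<lambda>q::real^2. c) q = 0" for i q by (simp_all add: pd_def)
  have p: "pd i (\<lambda>q. G q + c * H q) q = pd i G q + c * pd i H q" if "smooth G" "smooth H" for G H :: "real^2 \<Rightarrow> real" and i q
    by (subst pd_add) (auto intro!: differentiable_mult dc smoothD(1) that simp: pd_mult dc smoothD(1) that)
  have 1: "(\<lambda>r. rho C (r $ 1) * pd 1 (\<lambda>q. G q + c * H q) r)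
     = (\<lambda>r. rho C (r $ 1) * pd 1 G r + c * (rho C (r $ 1) * pd 1 H r))"
    unfolding p[OF s] by (simp add: algebra_simps)
  have 2: "(\<lambda>r. pd 2 (\<lambda>q. G q + c * H q) r / rho C (r $ 1))
     = (\<lambda>r. pd 2 G r / rho C (r $ 1) + c * (pd 2 H r / rho C (r $ 1)))"
    unfolding p[OF s] by (simp add: add_divide_distrib)
  have s1: "smooth (\<lambda>r. rho C (r $ 1) * pd 1 G r)" if "smooth G" for G :: "real^2 \<Rightarrow> real"
    by (intro smooth_mult smooth_rho[OF C] smoothD(3) that)
  have s2: "smooth (\<lambda>r. pd 2 G r / rho C (r $ 1))" if "smooth G" for G :: "real^2 \<Rightarrow> real"
    using smooth_mult[OF smoothD(3)[OF that, of 2] smooth_inv_rho[OF C]] by simp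
  show ?thesis
    unfolding jacobi_strip_def 1 2 p[OF s1[OF s(1)] s1[OF s(2)]] p[OF s2[OF s(1)] s2[OF s(2)]]
    by (simp add: add_divide_distrib algebra_simps)
qed

lemma Ck_on_fun_of_nth_if_deriv:
  assumes d: "\<And>x. (h has_real_derivative h' x) (at x)" and "Ck_on UNIV k (\<lambda>q::real^'n::finite. h' (q $ i))"
  shows "Ck_on UNIV (Suc k) (\<lambda>q::real^'n::finite. h (q $ i))"
proof -
  have "(\<lambda>q::real^'n. h (q $ i)) differentiable_on UNIV"
    by (auto simp: differentiable_on_def intro: differentiable_chain[OF d] differentiable_nth differentiable_at_withinI)
  moreover have "Ck_on UNIV k (pd j (\<lambda>q::real^'n. h (q $ i)))" for j
  proof -
    have "pd j (\<lambda>q::real^'n. h (q $ i)) = (\<lambda>q. if i = j then h' (q $ i) else 0)"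
      by (rule ext) (simp add: pd_fun_of_nth[OF d])
    then show ?thesis using assms(2) Ck_on_const by (cases "i = j") simp_all
  qed
  ultimately show ?thesis by simp
qed

text \<open>Bootstrapping on the first-order system for \<phi> and rho \<phi>1: the derivative of
  each is a smooth coefficient times the other, so both gain an order at each step.\<close>

lemma smooth_ode_solution:
  assumes C: "C > 1" and d: "\<And>s. (\<phi> has_real_derivative \<phi>1 s) (at s)"
    and d1: "\<And>s. ((\<lambda>s. rho C s * \<phi>1 s) has_real_derivative - (rho C s * (pot C s + l) * \<phi> s)) (at s)"
  shows "smooth (\<lambda>q::real^2. \<phi> (q $ 1))"
proof -
  let ?r = "\<lambda>q::real^2. rho C (q $ 1)" and ?i = "\<lambda>q::real^2. 1 / rho C (q $ 1)"
  have i: "smooth_on UNIV ?i" "smooth_on UNIV ?r" using smooth_inv_rho[OF C] smooth_rho[OF C] by (simp_all add: smooth_on_UNIV)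
  have "smooth_on UNIV (\<lambda>q. - (?r q * (pot C (q $ 1) + l)))"
    unfolding pot_def using i(2) by (intro smooth_intros open_UNIV) (simp_all add: rho_nz[OF C])
  then have K: "Ck_on UNIV k (\<lambda>q. - (?r q * (pot C (q $ 1) + l)))" for k by (simp add: smooth_on_def)
  have R: "Ck_on UNIV k ?i" for k using i by (simp add: smooth_on_def)
  have "Ck_on UNIV k (\<lambda>q::real^2. \<phi> (q $ 1)) \<and> Ck_on UNIV k (\<lambda>q::real^2. ?r q * \<phi>1 (q $ 1))" for k
  proof (induction k)
    case 0
    have "continuous_on UNIV \<phi>" by (rule DERIV_continuous_on[OF has_field_derivative_at_within[OF d]])
    moreover have "continuous_on UNIV (\<lambda>s. rho C s * \<phi>1 s)"
      by (rule DERIV_continuous_on[OF has_field_derivative_at_within[OF d1]])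
    ultimately show ?case using cont_nth_1[of \<phi> UNIV] cont_nth_1[of "\<lambda>s. rho C s * \<phi>1 s" UNIV] by simp
  next
    case (Suc k)
    have "Ck_on UNIV k (\<lambda>q. ?i q * (?r q * \<phi>1 (q $ 1)))" by (rule Ck_on_mult[OF open_UNIV R conjunct2[OF Suc]])
    then have "Ck_on UNIV k (\<lambda>q::real^2. \<phi>1 (q $ 1))" by (simp add: rho_nz[OF C])
    then have 1: "Ck_on UNIV (Suc k) (\<lambda>q::real^2. \<phi> (q $ 1))" by (rule Ck_on_fun_of_nth_if_deriv[OF d])
    have "Ck_on UNIV k (\<lambda>q. - (?r q * (pot C (q $ 1) + l)) * \<phi> (q $ 1))" by (rule Ck_on_mult[OF open_UNIV K conjunct1[OF Suc]])
    then have "Ck_on UNIV k (\<lambda>q::real^2. - (?r q * (pot C (q $ 1) + l) * \<phi> (q $ 1)))" by simp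
    then have 2: "Ck_on UNIV (Suc k) (\<lambda>q::real^2. ?r q * \<phi>1 (q $ 1))" by (rule Ck_on_fun_of_nth_if_deriv[OF d1])
    show ?case using 1 2 by blast
  qed
  then show ?thesis by (simp add: smooth_on_UNIV[symmetric] smooth_on_def)
qed

lemma sum_two_indices:
  fixes h :: "nat \<Rightarrow> real"
  assumes "2 \<le> k"
  shows "(\<Sum>i<k. (if i = 0 then \<alpha> else if i = 1 then \<beta> else 0) * h i) = \<alpha> * h 0 + \<beta> * h 1"
proof -
  have "(\<Sum>i<k. (if i = 0 then \<alpha> else if i = 1 then \<beta> else 0) * h i)
      = (\<Sum>i\<in>{0, 1}. (if i = 0 then \<alpha> else if i = 1 then \<beta> else 0) * h i)"
    using assms by (intro sum.mono_neutral_right) auto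
  then show ?thesis by simp
qed

context
  fixes a :: real
  assumes a: "a > 0"
begin

abbreviation (input) "cat_image \<equiv> cat_param a ` cat_strip"

text \<open>The eigenvalue problem for a representative that is smooth on the whole surface, with
  nothing prescribed outside \<Omega>. These are the conditions under which truncation
  works.\<close>

definition dirichlet_eigen :: "(real^3) set \<Rightarrow> real \<Rightarrow> (real^3 \<Rightarrow> real) \<Rightarrow> bool" where
  "dirichlet_eigen \<Omega> l g \<longleftrightarrow> smooth (\<lambda>q. g (cat_param a q)) \<and>
     (\<forall>p\<in>\<Omega>. p \<notin> top_of_set cat_image interior_of \<Omega> \<longrightarrow> g p = 0) \<and>
     (\<forall>q. cat_param a q \<in> top_of_set cat_image interior_of \<Omega> \<longrightarrow>
        jacobi_strip (cC a) (\<lambda>q. g (cat_param a q)) q = - l * g (cat_param a q))"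

section \<open>Negative eigenfunctions of one subdomain\<close>

lemma open_preimage_interior: "open {q. cat_param a q \<in> top_of_set cat_image interior_of \<Omega>}"
proof -
  obtain V where V: "open V" "top_of_set cat_image interior_of \<Omega> = cat_image \<inter> V"
    using openin_interior_of[of "top_of_set cat_image" \<Omega>] unfolding openin_open by auto
  have "{q. cat_param a q \<in> top_of_set cat_image interior_of \<Omega>} = cat_param a -` V"
    unfolding V(2) using X_in_Sig[OF a] by auto
  then show ?thesis using V(1) X_cont[OF a, of UNIV] by (simp add: open_vimage)
qed

lemma eigenspace_dirichlet_eigen:
  assumes "\<Omega> \<subseteq> cat_image" and f: "f \<in> eigenspace hyp_metric (cat_param a) cat_strip \<Omega> l"
  shows "\<exists>g. dirichlet_eigen \<Omega> l g \<and> (\<forall>p\<in>\<Omega>. f p = g p)"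
proof -
  let ?I = "top_of_set cat_image interior_of \<Omega>"
  have IO: "?I \<subseteq> \<Omega>" by (rule interior_of_subset)
  from f obtain g where g: "smooth (g \<circ> cat_param a)" "\<forall>p\<in>\<Omega>. f p = g p"
    unfolding eigenspace_def dirichlet_functions_def by auto
  have z: "f p = 0" if "p \<in> \<Omega>" "p \<notin> ?I" for p
  proof -
    \<comment> \<open>Points of \<Omega> lie in its closure, so those outside the interior belong to
      the frontier, where \<open>f\<close> vanishes.\<close>
    have "p \<in> top_of_set cat_image closure_of \<Omega>" using closure_of_subset[of \<Omega> "top_of_set cat_image"] assms(1) that(1) by auto
    then have "p \<in> top_of_set cat_image frontier_of \<Omega>" using that(2) by (simp add: frontier_of_def)
    then show ?thesis using f unfolding eigenspace_def dirichlet_functions_def by blast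
  qed
  have "jacobi_strip (cC a) (\<lambda>q. g (cat_param a q)) q = - l * g (cat_param a q)" if q: "cat_param a q \<in> ?I" for q
  proof -
    have "jacobi_op hyp_metric (cat_param a) (f \<circ> cat_param a) q = jacobi_op hyp_metric (cat_param a) (g \<circ> cat_param a) q"
      by (rule jacobi_op_cong_open[OF open_preimage_interior[of \<Omega>]]) (use q g(2) IO in auto)
    moreover have "jacobi_op hyp_metric (cat_param a) (f \<circ> cat_param a) q = - l * f (cat_param a q)"
      using f q unfolding eigenspace_def by blast
    moreover have "f (cat_param a q) = g (cat_param a q)" using g(2) IO q by blast
    ultimately show ?thesis by (simp add: jacobi_op_jacobi_strip[OF a] comp_def)
  qed
  then have "dirichlet_eigen \<Omega> l g" using g z by (auto simp: dirichlet_eigen_def comp_def)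
  then show ?thesis using g(2) by blast
qed

lemma dirichlet_eigen_add_scale:
  assumes "dirichlet_eigen \<Omega> l g" "dirichlet_eigen \<Omega> l h"
  shows "dirichlet_eigen \<Omega> l (\<lambda>p. g p + c * h p)"
proof -
  have s: "smooth (\<lambda>q. g (cat_param a q))" "smooth (\<lambda>q. h (cat_param a q))" using assms by (simp_all add: dirichlet_eigen_def)
  have "smooth (\<lambda>q. g (cat_param a q) + c * h (cat_param a q))"
    using s unfolding smooth_on_UNIV[symmetric] by (intro smooth_intros open_UNIV)
  moreover have "jacobi_strip (cC a) (\<lambda>q. g (cat_param a q) + c * h (cat_param a q)) q
      = jacobi_strip (cC a) (\<lambda>q. g (cat_param a q)) q + c * jacobi_strip (cC a) (\<lambda>q. h (cat_param a q)) q" for q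
    by (rule jacobi_strip_add_scale[OF cC_gt_1[OF a] s])
  ultimately show ?thesis using assms by (simp add: dirichlet_eigen_def algebra_simps)
qed

definition eigen_inner :: "real \<Rightarrow> (real^3) set \<Rightarrow> (real^3 \<Rightarrow> real) \<Rightarrow> (real^3 \<Rightarrow> real) \<Rightarrow> real" where
  "eigen_inner S \<Omega> g h = integral (rect S) (\<lambda>q. rho (cC a) (q $ 1) *
     ((if cat_param a q \<in> \<Omega> then g (cat_param a q) else 0) * (if cat_param a q \<in> \<Omega> then h (cat_param a q) else 0)))"

text \<open>Transfers the results on labelled pairs to two given functions, with the inner product
  written out, so that they can be reused for one function with itself or with a linear
  combination.\<close>

lemma eigen_pair:
  assumes S: "S > 0" "\<forall>q. cat_param a q \<in> \<Omega> \<longrightarrow> \<bar>q $ 1\<bar> < S"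
    and \<Omega>: "compact \<Omega>" "\<Omega> \<subseteq> cat_image" and e: "dirichlet_eigen \<Omega> l1 g1" "dirichlet_eigen \<Omega> l2 g2"
  shows "(\<lambda>q. rho (cC a) (q $ 1) * ((if cat_param a q \<in> \<Omega> then g1 (cat_param a q) else 0) *
      (if cat_param a q \<in> \<Omega> then g2 (cat_param a q) else 0))) integrable_on rect S"
    and "l1 \<noteq> l2 \<Longrightarrow> eigen_inner S \<Omega> g1 g2 = 0"
    and "p \<in> \<Omega> \<Longrightarrow> g1 p \<noteq> 0 \<Longrightarrow> 0 < eigen_inner S \<Omega> g1 g1"
    and "l1 < 0 \<Longrightarrow> l2 < 0 \<Longrightarrow> eigen_inner S \<Omega> g1 g2 = 0 \<Longrightarrow> p1 \<in> \<Omega> \<Longrightarrow> g1 p1 \<noteq> 0 \<Longrightarrow> p2 \<in> \<Omega> \<Longrightarrow> g2 p2 \<noteq> 0 \<Longrightarrow> False"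
    and "l1 < 0 \<Longrightarrow> p \<in> \<Omega> \<Longrightarrow> g1 p \<noteq> 0 \<Longrightarrow> compact_subdomain cat_image \<Omega> \<Longrightarrow> lambda1 hyp_metric (cat_param a) cat_strip \<Omega> < 0"
proof -
  have gp: "smooth (\<lambda>q. (if i then g1 else g2) (cat_param a q))"
    "p \<in> \<Omega> \<Longrightarrow> p \<notin> top_of_set cat_image interior_of \<Omega> \<Longrightarrow> (if i then g1 else g2) p = 0"
    "cat_param a q \<in> top_of_set cat_image interior_of \<Omega> \<Longrightarrow>
       jacobi_strip (cC a) (\<lambda>q. (if i then g1 else g2) (cat_param a q)) q = - (if i then l1 else l2) * (if i then g1 else g2) (cat_param a q)"
     for i p q
    using e unfolding dirichlet_eigen_def by (cases i; force)+
  let ?g = "\<lambda>i. if i then g1 else g2" and ?l = "\<lambda>i. if i then l1 else l2"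
  note facts = gram_pos gram_orthogonal no_orthogonal_negative_pair gram_limit(1) gram_def ext_pulled_def pulled_def negative_test_function
  note inst = facts[where g = ?g and l = ?l, OF a S(1) \<Omega> S(2)[rule_format] gp]
  have pos': "ext_pulled a \<Omega> ?g i q \<noteq> 0 \<Longrightarrow> 0 < gram a S \<Omega> ?g i i" for i q by (rule inst(1))
  have orth': "?l i \<noteq> ?l j \<Longrightarrow> gram a S \<Omega> ?g i j = 0" for i j by (rule inst(2))
  have pair': "?l True < 0 \<Longrightarrow> ?l False < 0 \<Longrightarrow> 0 < gram a S \<Omega> ?g True True \<Longrightarrow> 0 < gram a S \<Omega> ?g False False
    \<Longrightarrow> gram a S \<Omega> ?g True False = 0 \<Longrightarrow> False" by (rule inst(3))
  have int': "(\<lambda>q. rho (cC a) (q $ 1) * (ext_pulled a \<Omega> ?g i q * ext_pulled a \<Omega> ?g j q)) integrable_on rect S" for i j by (rule inst(4))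
  have gram': "gram a S \<Omega> ?g i j = integral (rect S) (\<lambda>q. rho (cC a) (q $ 1) * (ext_pulled a \<Omega> ?g i q * ext_pulled a \<Omega> ?g j q))" for i j
    by (rule inst(5))
  have ff': "ext_pulled a \<Omega> ?g i q = (if cat_param a q \<in> \<Omega> then pulled a ?g i q else 0)" for i q by (rule inst(6))
  have GG': "pulled a ?g i q = ?g i (cat_param a q)" for i q by (rule inst(7))
  have test': "?l True < 0 \<Longrightarrow> ext_pulled a \<Omega> ?g True q \<noteq> 0 \<Longrightarrow> compact_subdomain cat_image \<Omega> \<Longrightarrow>
    lambda1 hyp_metric (cat_param a) cat_strip \<Omega> < 0" for q by (rule inst(8))
  have ext_pulled: "ext_pulled a \<Omega> (\<lambda>i. if i then g1 else g2) i = (\<lambda>q. if cat_param a q \<in> \<Omega> then (if i then g1 else g2) (cat_param a q) else 0)" for i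
    by (rule ext) (simp only: ff' GG')
  have gr: "gram a S \<Omega> (\<lambda>i. if i then g1 else g2) i j = eigen_inner S \<Omega> (if i then g1 else g2) (if j then g1 else g2)" for i j
    unfolding gram' eigen_inner_def ext_pulled ..
  show "(\<lambda>q. rho (cC a) (q $ 1) * ((if cat_param a q \<in> \<Omega> then g1 (cat_param a q) else 0) *
      (if cat_param a q \<in> \<Omega> then g2 (cat_param a q) else 0))) integrable_on rect S"
    using int'[of True False] by (simp only: ext_pulled if_True if_False)
  show "l1 \<noteq> l2 \<Longrightarrow> eigen_inner S \<Omega> g1 g2 = 0"
    using orth'[of True False] by (simp only: gr if_True if_False simp_thms)
  have pos: "0 < eigen_inner S \<Omega> (if i then g1 else g2) (if i then g1 else g2)" if "p \<in> \<Omega>" "(if i then g1 else g2) p \<noteq> 0" for p i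
  proof -
    obtain q where "cat_param a q = p" using \<open>p \<in> \<Omega>\<close> \<Omega>(2) by blast
    then show ?thesis using pos'[of i q] that unfolding gr ext_pulled by simp
  qed
  show "p \<in> \<Omega> \<Longrightarrow> g1 p \<noteq> 0 \<Longrightarrow> 0 < eigen_inner S \<Omega> g1 g1" using pos[of p True] by simp
  show False if "l1 < 0" "l2 < 0" and o: "eigen_inner S \<Omega> g1 g2 = 0" and p: "p1 \<in> \<Omega>" "g1 p1 \<noteq> 0" "p2 \<in> \<Omega>" "g2 p2 \<noteq> 0"
  proof -
    have "0 < eigen_inner S \<Omega> g1 g1" "0 < eigen_inner S \<Omega> g2 g2" using pos[of p1 True] pos[of p2 False] p by simp_all
    then show False using pair' that(1,2) o by (simp add: gr)
  qed
  show "lambda1 hyp_metric (cat_param a) cat_strip \<Omega> < 0" if "l1 < 0" "p \<in> \<Omega>" "g1 p \<noteq> 0" "compact_subdomain cat_image \<Omega>"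
  proof -
    obtain q where "cat_param a q = p" using \<open>p \<in> \<Omega>\<close> \<Omega>(2) by blast
    then show ?thesis using test'[of q] that unfolding ext_pulled by simp
  qed
qed

text \<open>For different eigenvalues the functions are orthogonal and cannot both be nonzero. For
  equal ones the projection onto \<open>g1\<close> is subtracted from \<open>g2\<close>; the
  difference is again an eigenfunction, orthogonal to \<open>g1\<close>, and must vanish on
  \<Omega>.\<close>

lemma negative_eigenfunctions_dependent:
  assumes \<Omega>: "compact \<Omega>" "\<Omega> \<subseteq> cat_image" and e: "dirichlet_eigen \<Omega> l1 g1" "dirichlet_eigen \<Omega> l2 g2"
    and l: "l1 < 0" "l2 < 0" and p1: "p1 \<in> \<Omega>" "g1 p1 \<noteq> 0"
  shows "l1 \<noteq> l2 \<Longrightarrow> \<forall>p\<in>\<Omega>. g2 p = 0"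
    and "l1 = l2 \<Longrightarrow> \<exists>c. \<forall>p\<in>\<Omega>. g2 p = c * g1 p"
proof -
  obtain S where S: "S > 0" "\<forall>q. cat_param a q \<in> \<Omega> \<longrightarrow> \<bar>q $ 1\<bar> < S" using compact_bounded_arc_length[OF a \<Omega>] by blast
  note P = eigen_pair[OF S \<Omega>]
  show "\<forall>p\<in>\<Omega>. g2 p = 0" if "l1 \<noteq> l2"
    using P(4)[OF e l P(2)[OF e that] p1] by blast
  show "\<exists>c. \<forall>p\<in>\<Omega>. g2 p = c * g1 p" if "l1 = l2"
  proof -
    have pos: "0 < eigen_inner S \<Omega> g1 g1" by (rule P(3)[OF e p1])
    define c where "c = eigen_inner S \<Omega> g1 g2 / eigen_inner S \<Omega> g1 g1"
    have e': "dirichlet_eigen \<Omega> l2 (\<lambda>p. g2 p + (- c) * g1 p)"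
      using e that by (intro dirichlet_eigen_add_scale) auto
    let ?z = "\<lambda>g q. if cat_param a q \<in> \<Omega> then g (cat_param a q) else (0::real)"
    let ?h = "\<lambda>g q. rho (cC a) (q $ 1) * (?z g1 q * ?z g q)"
    have "eigen_inner S \<Omega> g1 (\<lambda>p. g2 p + (- c) * g1 p) = integral (rect S) (\<lambda>q. ?h g2 q + (- c) * ?h g1 q)"
      unfolding eigen_inner_def by (rule arg_cong[where f = "integral (rect S)"]) (auto simp: algebra_simps)
    also have "\<dots> = integral (rect S) (?h g2) + integral (rect S) (\<lambda>q. (- c) * ?h g1 q)"
      by (rule integral_add[OF P(1)[OF e] integrable_on_mult_right[OF P(1)[OF e(1) e(1)]]])
    also have "\<dots> = eigen_inner S \<Omega> g1 g2 - c * eigen_inner S \<Omega> g1 g1"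
      unfolding integral_mult_right by (simp add: eigen_inner_def)
    also have "\<dots> = 0" using pos by (simp add: c_def)
    finally have "\<forall>p\<in>\<Omega>. g2 p + (- c) * g1 p = 0" using P(4)[OF e(1) e' l _ p1] by blast
    then show ?thesis by (intro exI[of _ c]) auto
  qed
qed

section \<open>Counting negative eigenvalues\<close>

lemma eigenspace_zero_outside: "f \<in> eigenspace hyp_metric (cat_param a) cat_strip \<Omega> l \<Longrightarrow> p \<notin> \<Omega> \<Longrightarrow> f p = 0"
  by (auto simp: eigenspace_def dirichlet_functions_def)

lemma negative_eigenspaces_dependent:
  assumes \<Omega>: "compact \<Omega>" "\<Omega> \<subseteq> cat_image"
    and f: "f1 \<in> eigenspace hyp_metric (cat_param a) cat_strip \<Omega> l1" "f2 \<in> eigenspace hyp_metric (cat_param a) cat_strip \<Omega> l2"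
    and l: "l1 < 0" "l2 < 0" and p1: "f1 p1 \<noteq> 0"
  shows "l1 \<noteq> l2 \<Longrightarrow> f2 p = 0" and "l1 = l2 \<Longrightarrow> \<exists>c. \<forall>p. f2 p = c * f1 p"
proof -
  obtain g1 where g1: "dirichlet_eigen \<Omega> l1 g1" "\<And>p. p \<in> \<Omega> \<Longrightarrow> f1 p = g1 p"
    using eigenspace_dirichlet_eigen[OF \<Omega>(2) f(1)] by blast
  obtain g2 where g2: "dirichlet_eigen \<Omega> l2 g2" "\<And>p. p \<in> \<Omega> \<Longrightarrow> f2 p = g2 p"
    using eigenspace_dirichlet_eigen[OF \<Omega>(2) f(2)] by blast
  have z: "f1 p = 0" "f2 p = 0" if "p \<notin> \<Omega>" for p using that f by (simp_all add: eigenspace_zero_outside)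
  have p: "p1 \<in> \<Omega>" using p1 z(1)[of p1] by blast
  have p': "g1 p1 \<noteq> 0" using p1 g1(2)[OF p] by simp
  note D = negative_eigenfunctions_dependent[OF \<Omega> g1(1) g2(1) l p p']
  show "f2 p = 0" if "l1 \<noteq> l2" using D(1)[OF that] z(2)[of p] g2(2)[of p] by (cases "p \<in> \<Omega>") auto
  show "\<exists>c. \<forall>p. f2 p = c * f1 p" if eq: "l1 = l2"
  proof -
    obtain c where "\<And>p. p \<in> \<Omega> \<Longrightarrow> g2 p = c * g1 p" using D(2)[OF eq] by blast
    then have "f2 p = c * f1 p" for p using z[of p] g1(2)[of p] g2(2)[of p] by (cases "p \<in> \<Omega>") auto
    then show ?thesis by blast
  qed
qed

abbreviation (input) "cat_mult \<equiv> multiplicity hyp_metric (cat_param a) cat_strip"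

lemma multiplicity_le_1:
  assumes \<Omega>: "compact \<Omega>" "\<Omega> \<subseteq> cat_image" and l: "l < 0"
  shows "cat_mult \<Omega> l \<le> 1"
  unfolding multiplicity_def
proof (rule SUP_least)
  fix k
  assume "k \<in> {k. \<exists>f :: nat \<Rightarrow> real^3 \<Rightarrow> real. (\<forall>i<k. f i \<in> eigenspace hyp_metric (cat_param a) cat_strip \<Omega> l) \<and>
     (\<forall>c. (\<forall>p. (\<Sum>i<k. c i * f i p) = 0) \<longrightarrow> (\<forall>i<k. c i = 0))}"
  then obtain f where f: "\<And>i. i < k \<Longrightarrow> f i \<in> eigenspace hyp_metric (cat_param a) cat_strip \<Omega> l"
    and ind: "\<And>c i. (\<And>p. (\<Sum>i<k. c i * f i p) = 0) \<Longrightarrow> i < k \<Longrightarrow> c i = 0" by blast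
  have "k \<le> 1"
  proof (rule ccontr)
    assume "\<not> k \<le> 1"
    then have k: "2 \<le> k" by simp
    \<comment> \<open>Coefficients supported on the first two indices reduce independence of the
      family to that of two functions.\<close>
    have two: "\<alpha> = 0 \<and> \<beta> = 0" if "\<And>p. \<alpha> * f 0 p + \<beta> * f 1 p = 0" for \<alpha> \<beta>
      using ind[of "\<lambda>i. if i = 0 then \<alpha> else if i = 1 then \<beta> else 0" 0]
        ind[of "\<lambda>i. if i = 0 then \<alpha> else if i = 1 then \<beta> else 0" 1] that k
      unfolding sum_two_indices[OF k] by auto
    obtain p where p: "f 0 p \<noteq> 0" using two[of 1 0] by auto
    have "\<exists>c. \<forall>p. f 1 p = c * f 0 p"
      using negative_eigenspaces_dependent(2)[OF \<Omega> f[of 0] f[of 1] l l p] k by simp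
    then obtain c where "\<And>p. f 1 p = c * f 0 p" by blast
    then show False using two[of "- c" 1] by simp
  qed
  then show "enat k \<le> 1" by (simp add: one_enat_def)
qed

lemma multiplicity_nonzero:
  assumes "cat_mult \<Omega> l \<noteq> 0"
  shows "\<exists>f \<in> eigenspace hyp_metric (cat_param a) cat_strip \<Omega> l. \<exists>p. f p \<noteq> 0"
proof (rule ccontr)
  assume n: "\<not> ?thesis"
  have "cat_mult \<Omega> l \<le> 0"
    unfolding multiplicity_def
  proof (rule SUP_least)
    fix k
    assume "k \<in> {k. \<exists>f :: nat \<Rightarrow> real^3 \<Rightarrow> real. (\<forall>i<k. f i \<in> eigenspace hyp_metric (cat_param a) cat_strip \<Omega> l) \<and>
       (\<forall>c. (\<forall>p. (\<Sum>i<k. c i * f i p) = 0) \<longrightarrow> (\<forall>i<k. c i = 0))}"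
    then obtain f where f: "\<And>i. i < k \<Longrightarrow> f i \<in> eigenspace hyp_metric (cat_param a) cat_strip \<Omega> l"
      and ind: "\<And>c i. (\<And>p. (\<Sum>i<k. c i * f i p) = 0) \<Longrightarrow> i < k \<Longrightarrow> c i = 0" by blast
    have "f i p = 0" if "i < k" for i p using n f[OF that] by blast
    then have "(1::real) = 0" if "0 < k" using ind[of "\<lambda>i. 1" 0] that by simp
    then show "enat k \<le> 0" by (auto simp: zero_enat_def)
  qed
  then show False using assms by simp
qed

text \<open>A nonzero eigenfunction for one negative eigenvalue excludes nonzero ones for all
  others, so a finite sum of multiplicities has at most one nonzero term.\<close>

lemma subdomain_index_le_1:
  assumes \<Omega>: "compact \<Omega>" "\<Omega> \<subseteq> cat_image"
  shows "subdomain_index hyp_metric (cat_param a) cat_strip \<Omega> \<le> 1"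
  unfolding subdomain_index_def
proof (rule SUP_least)
  fix S :: "real set" assume "S \<in> {S. finite S \<and> S \<subseteq> {..<0}}"
  then have S: "finite S" "\<And>l. l \<in> S \<Longrightarrow> l < 0" by auto
  show "(\<Sum>l\<in>S. cat_mult \<Omega> l) \<le> 1"
  proof (cases "\<forall>l\<in>S. cat_mult \<Omega> l = 0")
    case True
    then show ?thesis by simp
  next
    case False
    then obtain l0 where l0: "l0 \<in> S" "cat_mult \<Omega> l0 \<noteq> 0" by blast
    obtain f p where f: "f \<in> eigenspace hyp_metric (cat_param a) cat_strip \<Omega> l0" "f p \<noteq> 0" using multiplicity_nonzero[OF l0(2)] by blast
    have "cat_mult \<Omega> l = 0" if "l \<in> S" "l \<noteq> l0" for l
    proof (rule ccontr)
      assume "cat_mult \<Omega> l \<noteq> 0"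
      then obtain h p' where h: "h \<in> eigenspace hyp_metric (cat_param a) cat_strip \<Omega> l" "h p' \<noteq> 0" using multiplicity_nonzero by blast
      show False using negative_eigenspaces_dependent(1)[OF \<Omega> f(1) h(1) S(2)[OF l0(1)] S(2)[OF that(1)] f(2), of p'] that(2) h(2) by simp
    qed
    then have "(\<Sum>l\<in>S. cat_mult \<Omega> l) = cat_mult \<Omega> l0"
      using S(1) l0(1) by (subst sum.remove[of S l0]) (auto intro!: sum.neutral)
    then show ?thesis using multiplicity_le_1[OF \<Omega> S(2)[OF l0(1)]] by simp
  qed
qed

lemma catenoid_index_le_1: "catenoid_index a \<le> 1"
  unfolding morse_index_def by (rule SUP_least) (use subdomain_index_le_1 in \<open>auto simp: compact_subdomain_def\<close>)

lemma catenoid_index_ge_1: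
  assumes cs: "compact_subdomain cat_image \<Omega>" and f: "f \<in> eigenspace hyp_metric (cat_param a) cat_strip \<Omega> l" "f p \<noteq> 0" and l: "l < 0"
  shows "1 \<le> catenoid_index a"
proof -
  have "enat 1 \<le> cat_mult \<Omega> l"
    unfolding multiplicity_def
  proof (rule SUP_upper, rule CollectI, intro exI conjI allI impI)
    show "(\<lambda>i::nat. f) i \<in> eigenspace hyp_metric (cat_param a) cat_strip \<Omega> l" for i by (rule f)
    show "c i = 0" if "\<forall>p. (\<Sum>i<1. c i * (\<lambda>i::nat. f) i p) = 0" "i < 1" for c :: "nat \<Rightarrow> real" and i
      using that(1)[rule_format, of p] that(2) f(2) by simp
  qed
  also have "\<dots> = (\<Sum>l\<in>{l}. cat_mult \<Omega> l)" by simp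
  also have "\<dots> \<le> subdomain_index hyp_metric (cat_param a) cat_strip \<Omega>"
    unfolding subdomain_index_def by (rule SUP_upper) (use l in simp)
  also have "\<dots> \<le> catenoid_index a"
    unfolding morse_index_def by (rule SUP_upper) (use cs in simp)
  finally show ?thesis by (simp add: one_enat_def)
qed

text \<open>The even solution with negative eigenvalue vanishes at S and - S, so it is a Dirichlet
  eigenfunction of the annulus between these parallels. It contributes to the index and, once
  truncated, shows that \<open>lambda1\<close> of the annulus is negative.\<close>

lemma catenoid_unstable_index:
  assumes s0: "s0 > 0" "even_jacobi (cC a) s0 < 0"
  shows "catenoid_unstable a" "catenoid_index a = 1"
proof -
  note C = cC_gt_1[OF a]
  obtain l S \<phi> \<phi>1 where l: "l < 0" and S: "S > 0" and d: "\<And>s. (\<phi> has_real_derivative \<phi>1 s) (at s)"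
    and d1: "\<And>s. ((\<lambda>s. rho (cC a) s * \<phi>1 s) has_real_derivative - (rho (cC a) s * (pot (cC a) s + l) * \<phi> s)) (at s)"
    and ev: "\<And>s. \<phi> (- s) = \<phi> s" and nz: "\<phi> 0 \<noteq> 0" and bd: "\<phi> S = 0"
    using even_eigenfunction[OF C s0] by blast
  let ?\<Omega> = "cat_param a ` rect S"
  let ?I = "top_of_set cat_image interior_of ?\<Omega>"
  have cs: "compact_subdomain cat_image ?\<Omega>" by (rule annulus_subdomain[OF a S])
  then have \<Omega>: "compact ?\<Omega>" "?\<Omega> \<subseteq> cat_image" by (simp_all add: compact_subdomain_def)
  have IO: "?I \<subseteq> ?\<Omega>" by (rule interior_of_subset)
  have ab: "\<phi> \<bar>x\<bar> = \<phi> x" for x using ev[of x] by (simp add: abs_if)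
  \<comment> \<open>A point of the surface is known to determine s only up to sign, which is
    harmless for the even function \<open>\<phi>\<close>.\<close>
  define g where "g = (\<lambda>p. \<phi> ((SOME q. cat_param a q = p) $ 1))"
  have gX: "g (cat_param a q) = \<phi> (q $ 1)" for q
  proof -
    have "cat_param a (SOME q'. cat_param a q' = cat_param a q) = cat_param a q" by (rule someI[of _ q]) simp
    from X_eq_imp_abs_eq[OF a this] show ?thesis unfolding g_def by (metis ab)
  qed
  have le: "\<bar>q $ 1\<bar> \<le> S" if q: "cat_param a q \<in> ?\<Omega>" for q
  proof -
    obtain q' where "q' \<in> rect S" "cat_param a q = cat_param a q'" using q by blast
    then show ?thesis using X_eq_imp_abs_eq[OF a, of q q'] by (auto simp: mem_rect)
  qed
  have z: "g p = 0" if p: "p \<in> ?\<Omega>" "p \<notin> ?I" for p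
  proof -
    obtain q where q: "p = cat_param a q" using p(1) by blast
    have "\<bar>q $ 1\<bar> = S" using annulus_interior[OF a, of q S] le[of q] p unfolding q by force
    then show ?thesis using ab[of "q $ 1"] bd by (simp add: q gX)
  qed
  have p1: "pd i (\<lambda>q. \<phi> (q $ 1)) = (\<lambda>q::real^2. if 1 = i then \<phi>1 (q $ 1) else 0)" for i
    by (rule ext) (rule pd_fun_of_nth[OF d])
  have "pd 2 (\<lambda>r::real^2. 0::real) q = 0" for q by (simp add: pd_def)
  then have L: "jacobi_strip (cC a) (\<lambda>q. \<phi> (q $ 1)) q = - l * \<phi> (q $ 1)" for q
    using rho_nz[OF C, of "q $ 1"]
    unfolding jacobi_strip_def p1 by (simp add: pd_fun_of_nth[OF d1]) (simp add: field_simps)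
  have e: "dirichlet_eigen ?\<Omega> l g"
    unfolding dirichlet_eigen_def gX using smooth_ode_solution[OF C d d1] L z by blast
  define f where "f = (\<lambda>p. if p \<in> ?\<Omega> then g p else 0)"
  have f: "f \<in> eigenspace hyp_metric (cat_param a) cat_strip ?\<Omega> l"
    unfolding eigenspace_def dirichlet_functions_def
  proof (intro CollectI conjI allI impI ballI)
    show "f p = 0" if "p \<notin> ?\<Omega>" for p using that by (simp add: f_def)
    show "f p = 0" if "p \<in> top_of_set cat_image frontier_of ?\<Omega>" for p
      using that z[of p] by (auto simp: f_def frontier_of_def)
    have "smooth (g \<circ> cat_param a)" using e by (simp add: dirichlet_eigen_def comp_def)
    then show "\<exists>g. smooth (g \<circ> cat_param a) \<and> (\<forall>p\<in>?\<Omega>. f p = g p)" by (intro exI[of _ g]) (simp add: f_def)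
    show "jacobi_op hyp_metric (cat_param a) (f \<circ> cat_param a) q = - l * f (cat_param a q)" if q: "cat_param a q \<in> ?I" for q
    proof -
      have "jacobi_op hyp_metric (cat_param a) (f \<circ> cat_param a) q = jacobi_op hyp_metric (cat_param a) (g \<circ> cat_param a) q"
        by (rule jacobi_op_cong_open[OF open_preimage_interior[of ?\<Omega>]]) (use q IO in \<open>auto simp: f_def\<close>)
      also have "\<dots> = - l * g (cat_param a q)" using e q by (simp add: jacobi_op_jacobi_strip[OF a] comp_def dirichlet_eigen_def)
      also have "g (cat_param a q) = f (cat_param a q)" using q IO by (auto simp: f_def)
      finally show ?thesis .
    qed
  qed
  have O: "cat_param a (vector [0, 0]) \<in> ?\<Omega>" using S by (intro imageI) (simp add: mem_rect)
  have nz': "g (cat_param a (vector [0, 0])) \<noteq> 0" using nz by (simp add: gX)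
  then have "f (cat_param a (vector [0, 0])) \<noteq> 0" using O by (simp add: f_def)
  from catenoid_index_ge_1[OF cs f this l] show "catenoid_index a = 1"
    using catenoid_index_le_1 by (rule antisym[rotated])
  \<comment> \<open>The truncation results ask for |s| strictly below the bound, and the closed
    annulus reaches s = S; hence the bound S + 1.\<close>
  have "\<forall>q. cat_param a q \<in> ?\<Omega> \<longrightarrow> \<bar>q $ 1\<bar> < S + 1" using le by force
  then have neg: "lambda1 hyp_metric (cat_param a) cat_strip ?\<Omega> < 0"
    using eigen_pair(5)[of "S + 1", OF _ _ \<Omega> e e l O nz' cs] S by simp
  have "(INF \<Omega>\<in>{\<Omega>. compact_subdomain cat_image \<Omega>}. lambda1 hyp_metric (cat_param a) cat_strip \<Omega>)
      \<le> lambda1 hyp_metric (cat_param a) cat_strip ?\<Omega>" by (rule INF_lower) (use cs in simp)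
  then have "(INF \<Omega>\<in>{\<Omega>. compact_subdomain cat_image \<Omega>}. lambda1 hyp_metric (cat_param a) cat_strip \<Omega>) < 0"
    using neg by (rule le_less_trans)
  moreover have "has_lambda1 hyp_metric (cat_param a) cat_strip
      (INF \<Omega>\<in>{\<Omega>. compact_subdomain cat_image \<Omega>}. lambda1 hyp_metric (cat_param a) cat_strip \<Omega>)"
    by (rule has_lambda1I[OF a lambda1_mono[OF a]])
  ultimately show "catenoid_unstable a" unfolding unstable_def by blast
qed

end

theorem theorem1p2:
  shows "\<exists>a_c::real. \<bar>a_c - 0.49577\<bar> \<le> 0.000005 \<and>
    (\<forall>a. 0 < a \<and> a < a_c \<longrightarrow>
        catenoid_minimal a \<and> catenoid_unstable a \<and> catenoid_index a = 1) \<and>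
    (\<forall>a. a_c \<le> a \<longrightarrow> catenoid_minimal a \<and> catenoid_stable_on_compacts a) \<and>
    (\<forall>a. a_c < a \<longrightarrow> catenoid_globally_stable a)"
proof -
  obtain a_c where c: "\<bar>a_c - 0.49577\<bar> \<le> 0.000005" and pos: "\<And>a. 0 < a \<Longrightarrow> a < a_c \<Longrightarrow> 0 < defect a"
    and nonpos: "\<And>a. a_c \<le> a \<Longrightarrow> defect a \<le> 0" and neg: "\<And>a. a_c < a \<Longrightarrow> defect a < 0"
    using critical_parameter by blast
  have c0: "0 < a_c" using c by (simp add: abs_if split: if_splits)
  have "catenoid_minimal a \<and> catenoid_unstable a \<and> catenoid_index a = 1" if a: "0 < a" "a < a_c" for a
  proof -
    have "rho (cC a) 0 / cC a < crit_int (cC a) 1" using crit_int_greater_iff[OF a(1)] pos[OF a] by (simp add: cC_def[OF a(1)])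
    then obtain s where "s > 0" "even_jacobi (cC a) s < 0" using even_jacobi_negative[OF cC_gt_1[OF a(1)]] by blast
    then show ?thesis using catenoid_unstable_index[OF a(1)] catenoid_minimal_X[OF a(1)] by blast
  qed
  moreover have "catenoid_minimal a \<and> catenoid_stable_on_compacts a" if a: "a_c \<le> a" for a
  proof -
    have a0: "0 < a" using a c0 by linarith
    have "crit_int (cC a) 1 \<le> rho (cC a) 0 / cC a" using crit_int_greater_iff[OF a0] nonpos[OF a] unfolding cC_def[OF a0] by linarith
    then show ?thesis using catenoid_stable_on_compactsI[OF a0] catenoid_minimal_X[OF a0] by blast
  qed
  moreover have "catenoid_globally_stable a" if a: "a_c < a" for a
  proof -
    have a0: "0 < a" using a c0 by linarith
    have "crit_int (cC a) 1 < rho (cC a) 0 / cC a" using crit_int_less_iff[OF a0] neg[OF a] unfolding cC_def[OF a0] by blast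
    then show ?thesis by (rule catenoid_globally_stableI[OF a0])
  qed
  ultimately show ?thesis using c by blast
qed

end
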